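(* Let $d\ge1$ be an integer, and let $a_d$, $\Phi_1$, $\Phi_2$, $\tilde\Phi_1$, $\tilde\Phi_2$, $R_d$, $K_d$ be as defined in the context. (a) For all $z\in\mathbb C$, $$z^{d+1}\bigl(\Phi_1'(z)\Phi_2(z)-\Phi_1(z)\Phi_2'(z)\bigr)-2R_d(z)\Phi_1(z)\Phi_2(z)=-2a_d.$$ (b) The functions $\tilde\Phi_1,\tilde\Phi_2$ are linearly independent solutions of the equation $$y''+\frac{d+1}{z}\,y'+\Bigl(\frac{K_d(z)}{z^{d+1}}-\frac{R_d(z)^2}{z^{2d+2}}\Bigr)y=0$$ in the domain $\mathbb C\setminus(-\infty,0]$, and their Wronskian is $$W(\tilde\Phi_1,\tilde\Phi_2)=\tilde\Phi_1\tilde\Phi_2'-\tilde\Phi_1'\tilde\Phi_2=\frac{2a_d}{z^{d+1}}.$$ Equivalently, the functions $\Phi_1,\Phi_2$ satisfy the system $$\begin{cases} z^{d+1}\Phi_1''+\bigl((d+1)z^d-2R_d\bigr)\Phi_1'+\bigl(K_d-R_d'\bigr)\Phi_1=0,\\ z^{d+1}\Phi_2''+\bigl((d+1)z^d+2R_d\bigr)\Phi_2'+\bigl(K_d+R_d'\bigr)\Phi_2=0.\end{cases}$$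
   Context: Extremal function. Let $\mathrm{PW}_r^p(\mathbb R^d)$ be the Paley--Wiener class of functions of spherical exponential type at most $r$ belonging to $L^p(\mathbb R^d)$. The sharp Nikolskii constant $\mathcal C_d$ is defined by $\mathcal C_d^{-1}=\inf\{\|f\|_1: f\in \mathrm{PW}_1^1(\mathbb R^d),\ f(0)=1\}$. It is known that this problem has a unique radial extremal function $x\mapsto\varphi(|x|)$, where $\varphi=\varphi_d$ is an even entire function of exact exponential type $1$, bounded in modulus by one on $\mathbb R$; its positive zeros are $0<\tau_1<\tau_2<\dots$ ($\tau_k=\tau_{k,d}$), $\tau_k\sim\pi k$ as $k\to\infty$, and $\varphi(z)=\prod_{k\ge1}(1-z^2/\tau_k^2)$. It is also known that the extremality condition $g(0)=\frac{\mathcal C_d\omega_{d-1}}2\int_{\mathbb R}\sigma(x)g(x)|x|^{d-1}\,dx$ holds for every even entire function $g$ of exponential type at most $1$ with $|x|^{d-1}g(x)\in L^1(\mathbb R)$, where $\sigma(x)=\operatorname{sign}\varphi(x)$, $v_d$ is the volume of the unit ball of $\mathbb R^d$ and $\omega_{d-1}=dv_d$. Put $a_d=\frac1{2v_d\mathcal C_d}$. Parity notation. $\epsilon=0$ if $d$ is odd, $\epsilon=1$ if $d$ is even; $N=\frac{d-1-\epsilon}2$. Signature and the polynomial $P_d$. $\tilde\sigma(x)=\sigma(x)$ if $d$ is odd, $\tilde\sigma(x)=\operatorname{sign}(x)\sigma(x)$ if $d$ is even. The Fourier transform is $\widehat f(t)=\int_{\mathbb R}f(x)e^{-itx}\,dx$,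 extended to tempered distributions by duality. The restriction of the distribution $2^{1-\epsilon}i^\epsilon\,\widehat{\tilde\sigma}$ to $(-1,1)$ coincides with a real polynomial $P_d(t)=\sum_{n=0}^Np_nt^{2n+\epsilon}$, with $p_N=(-1)^N2^{1-\epsilon}\frac{4a_d}{d!}$; this defines the $p_n$. Polynomials $R_d$, $K_d$. $$R_d(z)=\frac\epsilon2 z^{2(N+\epsilon)}+2^{\epsilon-3}\sum_{n=0}^N(-1)^n(2n+\epsilon+1)!\,p_nz^{2(N-n)}=\sum_{j=0}^{N+\epsilon}r_jz^{2j},$$ which defines the $r_j$; $r_0=a_d$. For $q\ge0$, $\lambda_q=\sum_{k\ge1}(-1)^k\tau_k^{-(2q+\epsilon+1)}$ (conditionally convergent if $\epsilon=q=0$, otherwise absolutely convergent). Then $$K_d(z)=\frac14 z^{d+1}+2\sum_{n=0}^N\Bigl(\sum_{j=0}^nr_j\lambda_{n-j}\Bigr)z^{2n+\epsilon}.$$ Factors. For odd $d$: $\Phi_1(z)=\prod_{k\ge1}\bigl(1+(-1)^k\frac z{\tau_k}\bigr)$, with consecutive factors ($k=2m-1$ and $k=2m$) grouped in pairs, and $\Phi_2(z)=\Phi_1(-z)$. For even $d$: $\Phi_1(z)=\prod_{k\ge1}\bigl(1-\frac{z^2}{\tau_{2k-1}^2}\bigr)$, $\Phi_2(z)=\prod_{k\ge1}\bigl(1-\frac{z^2}{\tau_{2k}^2}\bigr)$. In both cases $\varphi=\Phi_1\Phi_2$. In $\mathbb C\setminus(-\infty,0]$, with $\log$ the principal branch,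 $$h_d(z)=\frac\epsilon2\log z-\sum_{j=0}^N\frac{r_j}{d-2j}z^{-(d-2j)},\qquad h_d'(z)=\frac{R_d(z)}{z^{d+1}},$$ and $\tilde\Phi_1(z)=e^{-h_d(z)}\Phi_1(z)$, $\tilde\Phi_2(z)=e^{h_d(z)}\Phi_2(z)$. *)

theory Defs
  imports "HOL-Analysis.Analysis" "HOL-Library.Landau_Symbols"
    "HOL-Computational_Algebra.Polynomial" "HOL-Complex_Analysis.Complex_Analysis"
begin

definition entire_Cn :: "(complex ^ 'n \<Rightarrow> complex) \<Rightarrow> bool" where
  "entire_Cn F \<longleftrightarrow>
     (\<forall>z. \<exists>D. (F has_derivative D) (at z) \<and> (\<forall>c v. D (c *s v) = c * D v))"

text \<open>The norm on \<open>complex ^ 'n\<close> is the Hermitian one, so on that type this is the spherical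
  exponential type; on \<open>complex\<close> it is the usual exponential type.\<close>
definition exp_type_at_most :: "real \<Rightarrow> ('a::real_normed_vector \<Rightarrow> complex) \<Rightarrow> bool" where
  "exp_type_at_most r F \<longleftrightarrow> (\<forall>e>0. \<exists>A. \<forall>z. norm (F z) \<le> A * exp ((r + e) * norm z))"

definition exact_exp_type :: "real \<Rightarrow> (complex \<Rightarrow> complex) \<Rightarrow> bool" where
  "exact_exp_type r F \<longleftrightarrow> exp_type_at_most r F \<and> (\<forall>s<r. \<not> exp_type_at_most s F)"

definition paley_wiener :: "real \<Rightarrow> real \<Rightarrow> (real ^ 'n \<Rightarrow> complex) set" where
  "paley_wiener r p =
     {f. (\<exists>F. entire_Cn F \<and> exp_type_at_most r F \<and>
              (\<forall>x. f x = F (\<chi> i. complex_of_real (x $ i)))) \<and>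
         integrable lborel (\<lambda>x. norm (f x) powr p)}"

definition nikolskii_const :: "'n::finite itself \<Rightarrow> real" where
  "nikolskii_const _ =
     inverse (Inf {LINT x|lborel. norm (f x) |f :: real ^ 'n \<Rightarrow> complex.
                     f \<in> paley_wiener 1 1 \<and> f 0 = 1})"

definition ball_vol :: "'n::finite itself \<Rightarrow> real" where
  "ball_vol _ = measure lborel (ball (0 :: real ^ 'n) 1)"

definition sphere_area :: "'n::finite itself \<Rightarrow> real" where
  "sphere_area T = real CARD('n) * ball_vol T"

definition a_const :: "'n::finite itself \<Rightarrow> real" where
  "a_const T = 1 / (2 * ball_vol T * nikolskii_const T)"

text \<open>\<open>x \<mapsto> \<phi> \<bar>x\<bar>\<close> is a radial extremal function for the Nikolskii problem in dimension
  \<open>CARD('n)\<close>; \<open>\<phi>\<close> is taken as an entire function of one complex variable.\<close>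
definition radial_extremal :: "'n::finite itself \<Rightarrow> (complex \<Rightarrow> complex) \<Rightarrow> bool" where
  "radial_extremal T \<phi> \<longleftrightarrow>
     \<phi> holomorphic_on UNIV \<and>
     (\<lambda>x :: real ^ 'n. \<phi> (of_real (norm x))) \<in> paley_wiener 1 1 \<and>
     \<phi> 0 = 1 \<and>
     (LINT x :: real ^ 'n|lborel. norm (\<phi> (of_real (norm x)))) = inverse (nikolskii_const T)"

text \<open>\<open>\<phi>\<close> is real on the real axis in all uses.\<close>
definition signature :: "(complex \<Rightarrow> complex) \<Rightarrow> real \<Rightarrow> real" where
  "signature \<phi> x = sgn (Re (\<phi> (of_real x)))"

definition extremality_condition :: "'n::finite itself \<Rightarrow> (complex \<Rightarrow> complex) \<Rightarrow> bool" where
  "extremality_condition T \<phi> \<longleftrightarrow>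
     (\<forall>g. g holomorphic_on UNIV \<and> (\<forall>z. g (- z) = g z) \<and> exp_type_at_most 1 g \<and>
          integrable lborel (\<lambda>x :: real. of_real (\<bar>x\<bar> ^ (CARD('n) - 1)) * g (of_real x)) \<longrightarrow>
        g 0 = of_real (nikolskii_const T * sphere_area T / 2) *
          (LINT x :: real|lborel.
             of_real (signature \<phi> x) * g (of_real x) * of_real (\<bar>x\<bar> ^ (CARD('n) - 1))))"

definition par :: "nat \<Rightarrow> nat" where
  "par d = (if odd d then 0 else 1)"

definition half_deg :: "nat \<Rightarrow> nat" where
  "half_deg d = (d - 1 - par d) div 2"

definition signature_tilde :: "nat \<Rightarrow> (complex \<Rightarrow> complex) \<Rightarrow> real \<Rightarrow> real" where
  "signature_tilde d \<phi> x = (if odd d then signature \<phi> x else sgn x * signature \<phi> x)"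

definition test_function_on :: "real set \<Rightarrow> (real \<Rightarrow> complex) \<Rightarrow> bool" where
  "test_function_on U \<psi> \<longleftrightarrow>
     (\<exists>D :: nat \<Rightarrow> real \<Rightarrow> complex. D 0 = \<psi> \<and>
        (\<forall>k t. (D k has_vector_derivative D (Suc k) t) (at t))) \<and>
     compact (closure {t. \<psi> t \<noteq> 0}) \<and> closure {t. \<psi> t \<noteq> 0} \<subseteq> U"

definition fourier :: "(real \<Rightarrow> complex) \<Rightarrow> real \<Rightarrow> complex" where
  "fourier f t = (LINT x|lborel. f x * exp (- \<i> * of_real x * of_real t))"

text \<open>The Fourier transform, as a functional on test functions, of the tempered distribution
  given by a bounded measurable function \<open>f\<close>.\<close>
definition fourier_distr :: "(real \<Rightarrow> complex) \<Rightarrow> (real \<Rightarrow> complex) \<Rightarrow> complex" where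
  "fourier_distr f \<psi> = (LINT x|lborel. f x * fourier \<psi> x)"

definition distr_eq_on ::
  "real set \<Rightarrow> ((real \<Rightarrow> complex) \<Rightarrow> complex) \<Rightarrow> (real \<Rightarrow> complex) \<Rightarrow> bool" where
  "distr_eq_on U u P \<longleftrightarrow> (\<forall>\<psi>. test_function_on U \<psi> \<longrightarrow> u \<psi> = (LINT t|lborel. P t * \<psi> t))"

definition P_fun :: "nat \<Rightarrow> (nat \<Rightarrow> real) \<Rightarrow> real \<Rightarrow> real" where
  "P_fun d p t = (\<Sum>n\<le>half_deg d. p n * t ^ (2 * n + par d))"

text \<open>\<open>2 / 2 ^ par d\<close> is $2^{1-\epsilon}$.\<close>
definition signature_coeffs ::
  "'n::finite itself \<Rightarrow> (complex \<Rightarrow> complex) \<Rightarrow> (nat \<Rightarrow> real) \<Rightarrow> bool" where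
  "signature_coeffs T \<phi> p \<longleftrightarrow> (let d = CARD('n) in
     distr_eq_on {-1<..<1}
       (\<lambda>\<psi>. 2 / 2 ^ par d * \<i> ^ par d *
             fourier_distr (\<lambda>x. of_real (signature_tilde d \<phi> x)) \<psi>)
       (\<lambda>t. of_real (P_fun d p t)) \<and>
     p (half_deg d) = (-1) ^ half_deg d * (2 / 2 ^ par d) * (4 * a_const T / fact d))"

text \<open>The factor \<open>2 ^ par d / 8\<close> is $2^{\epsilon-3}$.\<close>
definition R_poly :: "nat \<Rightarrow> (nat \<Rightarrow> real) \<Rightarrow> complex poly" where
  "R_poly d p =
     monom (of_nat (par d) / 2) (2 * (half_deg d + par d)) +
     smult (2 ^ par d / 8)
       (\<Sum>n\<le>half_deg d.
          monom ((-1) ^ n * fact (2 * n + par d + 1) * of_real (p n)) (2 * (half_deg d - n)))"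

definition r_coeff :: "nat \<Rightarrow> (nat \<Rightarrow> real) \<Rightarrow> nat \<Rightarrow> complex" where
  "r_coeff d p j = coeff (R_poly d p) (2 * j)"

text \<open>The zeros are \<open>\<tau> 1 < \<tau> 2 < \<dots>\<close>; the value \<open>\<tau> 0\<close> is irrelevant. The sum may be
  only conditionally convergent, hence \<open>suminf\<close>.\<close>
definition lambda_sum :: "nat \<Rightarrow> (nat \<Rightarrow> real) \<Rightarrow> nat \<Rightarrow> real" where
  "lambda_sum d \<tau> q = (\<Sum>k. (-1) ^ Suc k / \<tau> (Suc k) ^ (2 * q + par d + 1))"

definition K_poly :: "nat \<Rightarrow> (nat \<Rightarrow> real) \<Rightarrow> (nat \<Rightarrow> real) \<Rightarrow> complex poly" where
  "K_poly d \<tau> p =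
     monom (1 / 4) (d + 1) +
     smult 2 (\<Sum>n\<le>half_deg d.
       monom (\<Sum>j\<le>n. r_coeff d p j * of_real (lambda_sum d \<tau> (n - j))) (2 * n + par d))"

text \<open>The index \<open>m\<close> starts at 0, so the \<open>m\<close>-th factor involves \<open>\<tau> (2 * m + 1)\<close>,
  \<open>\<tau> (2 * m + 2)\<close>, or both.\<close>
definition Phi1 :: "nat \<Rightarrow> (nat \<Rightarrow> real) \<Rightarrow> complex \<Rightarrow> complex" where
  "Phi1 d \<tau> z =
     (if odd d
      then (\<Prod>m. (1 - z / of_real (\<tau> (2 * m + 1))) * (1 + z / of_real (\<tau> (2 * m + 2))))
      else (\<Prod>m. 1 - z\<^sup>2 / of_real (\<tau> (2 * m + 1)) ^ 2))"

definition Phi2 :: "nat \<Rightarrow> (nat \<Rightarrow> real) \<Rightarrow> complex \<Rightarrow> complex" where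
  "Phi2 d \<tau> z =
     (if odd d then Phi1 d \<tau> (- z)
      else (\<Prod>m. 1 - z\<^sup>2 / of_real (\<tau> (2 * m + 2)) ^ 2))"

definition h_fun :: "nat \<Rightarrow> (nat \<Rightarrow> real) \<Rightarrow> complex \<Rightarrow> complex" where
  "h_fun d p z =
     of_nat (par d) / 2 * Ln z -
     (\<Sum>j\<le>half_deg d. r_coeff d p j / of_nat (d - 2 * j) * (1 / z ^ (d - 2 * j)))"

definition Phi1_tilde :: "nat \<Rightarrow> (nat \<Rightarrow> real) \<Rightarrow> (nat \<Rightarrow> real) \<Rightarrow> complex \<Rightarrow> complex" where
  "Phi1_tilde d \<tau> p z = exp (- h_fun d p z) * Phi1 d \<tau> z"

definition Phi2_tilde :: "nat \<Rightarrow> (nat \<Rightarrow> real) \<Rightarrow> (nat \<Rightarrow> real) \<Rightarrow> complex \<Rightarrow> complex" where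
  "Phi2_tilde d \<tau> p z = exp (h_fun d p z) * Phi2 d \<tau> z"

definition solves_ode2_on ::
  "complex set \<Rightarrow> (complex \<Rightarrow> complex) \<Rightarrow> (complex \<Rightarrow> complex) \<Rightarrow> (complex \<Rightarrow> complex) \<Rightarrow> bool"
  where
  "solves_ode2_on D A B y \<longleftrightarrow>
     y holomorphic_on D \<and> (\<forall>z\<in>D. deriv (deriv y) z + A z * deriv y z + B z * y z = 0)"

definition lin_indep2_on ::
  "complex set \<Rightarrow> (complex \<Rightarrow> complex) \<Rightarrow> (complex \<Rightarrow> complex) \<Rightarrow> bool" where
  "lin_indep2_on D f g \<longleftrightarrow>
     (\<forall>a b :: complex. (\<forall>z\<in>D. a * f z + b * g z = 0) \<longrightarrow> a = 0 \<and> b = 0)"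

definition wronskian :: "(complex \<Rightarrow> complex) \<Rightarrow> (complex \<Rightarrow> complex) \<Rightarrow> complex \<Rightarrow> complex" where
  "wronskian f g z = f z * deriv g z - deriv f z * g z"

end

theory Submission
  imports Defs "HOL-Probability.Sinc_Integral"
    "HOL-Computational_Algebra.Fundamental_Theorem_Algebra" "HOL-Real_Asymp.Real_Asymp"
begin

text \<open>
Let \<open>F = \<Phi>\<^sub>1' / \<Phi>\<^sub>1 - \<Phi>\<^sub>2' / \<Phi>\<^sub>2\<close> be the gap of the logarithmic derivatives of the two factors of \<open>\<phi>\<close>, and
\<open>L = \<phi>' / \<phi>\<close> their sum. Both parts of the theorem are statements about \<open>F\<close>.

Divided by \<open>\<phi>\<close>, part (a) reads \<open>z ^ (d + 1) F = 2 R - 2 a / \<phi>\<close>. The partial fraction expansion of \<open>F\<close> is an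
alternating sum over the zeros \<open>\<tau>\<^sub>k\<close> of a kernel, \<open>t / (t\<^sup>2 - z\<^sup>2)\<close> or \<open>z / (t\<^sup>2 - z\<^sup>2)\<close> according to the parity
of \<open>d\<close>. As \<open>\<phi>\<close> changes sign exactly at its zeros, an alternating sum of the values of \<open>G\<close> at the zeros is an
integral of \<open>G'\<close> against the signature \<open>\<sigma>\<close> (\<open>alternating_FTC\<close>). The same mechanism gives two evaluations of
the alternating sum of \<open>\<tau>\<^sub>k ^ d S(\<tau>\<^sub>k) / (\<tau>\<^sub>k\<^sup>2 - w\<^sup>2)\<close>, where \<open>S\<close> is the transform of a bump of small support. The
extremality condition, applied to the interpolation-type function of \<open>extremal_sum\<close>, gives a multiple of
\<open>1 - S(w) / \<phi>(w)\<close>. The knowledge that the transform of the signature is a polynomial on \<open>(-1, 1)\<close>, tested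
against a function whose own transform is the derivative of a quotient \<open>A(x) / (x - w)\<close> with \<open>A(w) = 0\<close>
(\<open>squeezed_identity\<close> and its limit), expresses the same sum through \<open>F(w)\<close> and the coefficients of the
polynomial. Comparison proves (a) on the imaginary axis (\<open>logderiv_gap_imaginary\<close>), and analytic
continuation proves it everywhere.

For part (b), let \<open>E\<^sub>1\<close> and \<open>E\<^sub>2\<close> be the left-hand sides of the system. Differentiation of (a) gives
\<open>\<Phi>\<^sub>2 E\<^sub>1 = \<Phi>\<^sub>1 E\<^sub>2\<close>. Since \<open>a \<noteq> 0\<close>, (a) also shows that the factors have no common zero, so that
\<open>E\<^sub>1 = Q \<Phi>\<^sub>1\<close> and \<open>E\<^sub>2 = Q \<Phi>\<^sub>2\<close> with one entire function \<open>Q\<close>, namely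
\<open>Q = z ^ (d + 1) (\<phi>'' / (2 \<phi>) - (L\<^sup>2 - F\<^sup>2) / 4) + (d + 1) z ^ d L / 2 + K - R F\<close>. Bounds for \<open>L\<close>, \<open>L'\<close> and \<open>F\<close> by
powers of \<open>\<bar>z\<bar> / \<bar>Im z\<bar>\<close> make \<open>Q\<close> a polynomial of degree at most \<open>d + 1\<close>. The polynomial \<open>K\<close> is the expansion of
\<open>R F\<close> at the origin up to terms of order \<open>z ^ (d + 1)\<close>, so \<open>Q\<close> is a constant multiple of \<open>z ^ (d + 1)\<close>. Finally
\<open>L(\<i> y) \<rightarrow> - \<i>\<close> as \<open>y \<rightarrow> \<infinity>\<close>, by the asymptotics of the zeros, and together with the leading coefficient \<open>1/4\<close>
of \<open>K\<close> this makes the constant zero (\<open>ode_quotient_eq_0\<close>). The equation for the modified factors is the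
system after the substitution \<open>y = exp (\<plusminus> h) \<Phi>\<close>, and their Wronskian is (a) again.
\<close>

section \<open>Infinite products of quadratic polynomials\<close>

text \<open>The functions \<open>\<phi>\<close>, \<open>\<Phi>\<^sub>1\<close> and \<open>\<Phi>\<^sub>2\<close> are all infinite products of quadratic polynomials with summable
coefficients, once the factors of \<open>\<Phi>\<^sub>1\<close> and \<open>\<Phi>\<^sub>2\<close> are grouped in pairs for odd \<open>d\<close>. Holomorphy and
logarithmic derivatives of all three come from the locally uniform convergence of such products.\<close>

lemma uniform_limit_quadratic_prod:
  fixes a b :: "nat \<Rightarrow> complex"
  assumes a: "summable (\<lambda>m. norm (a m))" and b: "summable (\<lambda>m. norm (b m))"
  shows "uniform_limit (cball 0 r) (\<lambda>n z. \<Prod>m<n. 1 + a m * z + b m * z\<^sup>2)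
           (\<lambda>z. \<Prod>m. 1 + a m * z + b m * z\<^sup>2) sequentially"
proof -
  let ?g = "\<lambda>m z. a m * z + b m * z\<^sup>2"
  have bound: "norm (?g m z) \<le> norm (a m) * norm r + norm (b m) * norm r ^ 2" if "z \<in> cball 0 r" for m z
  proof -
    have le: "norm z \<le> norm r" using that by auto
    have "norm (?g m z) \<le> norm (a m) * norm z + norm (b m) * norm z ^ 2"
      using norm_triangle_ineq[of "a m * z" "b m * z\<^sup>2"] by (simp add: norm_mult norm_power)
    also have "\<dots> \<le> norm (a m) * norm r + norm (b m) * norm r ^ 2"
      by (intro add_mono mult_left_mono power_mono le) auto
    finally show ?thesis .
  qed
  have sm: "summable (\<lambda>m. norm (a m) * norm r + norm (b m) * norm r ^ 2)"
    by (intro summable_add summable_mult2 a b)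
  have uc: "uniformly_convergent_on (cball 0 r) (\<lambda>n z. \<Prod>m<n. 1 + ?g m z)"
  proof (rule uniformly_convergent_on_prod)
    show "uniformly_convergent_on (cball 0 r) (\<lambda>N x. \<Sum>n<N. norm (?g n x))"
      by (rule Weierstrass_m_test'[OF _ sm]) (use bound in auto)
  qed (auto intro!: continuous_intros)
  then have ul: "uniform_limit (cball 0 r) (\<lambda>n z. \<Prod>m<n. 1 + ?g m z) (\<lambda>z. lim (\<lambda>n. \<Prod>m<n. 1 + ?g m z)) sequentially"
    using uniformly_convergent_uniform_limit_iff by blast
  have eq: "lim (\<lambda>n. \<Prod>m<n. 1 + ?g m z) = (\<Prod>m. 1 + ?g m z)" if z: "z \<in> cball 0 r" for z
  proof -
    have "summable (\<lambda>m. norm (?g m z))"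
      by (rule summable_comparison_test'[OF sm, of 0]) (use bound[OF z] in auto)
    then have "abs_convergent_prod (\<lambda>m. 1 + ?g m z)"
      by (simp add: abs_convergent_prod_conv_summable)
    then have "convergent_prod (\<lambda>m. 1 + ?g m z)"
      by (rule abs_convergent_prod_imp_convergent_prod)
    then have "(\<lambda>m. 1 + ?g m z) has_prod (\<Prod>m. 1 + ?g m z)"
      by (rule convergent_prod_has_prod)
    then have "(\<lambda>n. \<Prod>m\<le>n. 1 + ?g m z) \<longlonglongrightarrow> (\<Prod>m. 1 + ?g m z)"
      by (rule has_prod_imp_tendsto)
    then show ?thesis
      using LIMSEQ_lessThan_iff_atMost limI by blast
  qed
  have "uniform_limit (cball 0 r) (\<lambda>n z. \<Prod>m<n. 1 + ?g m z) (\<lambda>z. lim (\<lambda>n. \<Prod>m<n. 1 + ?g m z)) sequentially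
      \<longleftrightarrow> uniform_limit (cball 0 r) (\<lambda>n z. \<Prod>m<n. 1 + ?g m z) (\<lambda>z. \<Prod>m. 1 + ?g m z) sequentially"
    by (rule uniform_limit_cong') (simp_all only: eq)
  then have "uniform_limit (cball 0 r) (\<lambda>n z. \<Prod>m<n. 1 + ?g m z) (\<lambda>z. \<Prod>m. 1 + ?g m z) sequentially"
    using ul by blast
  then show ?thesis by (simp add: add.assoc)
qed

lemma holomorphic_quadratic_prod:
  fixes a b :: "nat \<Rightarrow> complex"
  assumes a: "summable (\<lambda>m. norm (a m))" and b: "summable (\<lambda>m. norm (b m))"
  shows "(\<lambda>z. \<Prod>m. 1 + a m * z + b m * z\<^sup>2) holomorphic_on UNIV"
proof (rule holomorphic_uniform_sequence)
  show "(\<lambda>z. \<Prod>m<n. 1 + a m * z + b m * z\<^sup>2) holomorphic_on UNIV" for n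
    by (intro holomorphic_intros)
  fix x :: complex
  have "uniform_limit (cball x 1) (\<lambda>n z. \<Prod>m<n. 1 + a m * z + b m * z\<^sup>2)
           (\<lambda>z. \<Prod>m. 1 + a m * z + b m * z\<^sup>2) sequentially"
  proof (rule uniform_limit_on_subset[OF uniform_limit_quadratic_prod[OF a b]])
    show "cball x 1 \<subseteq> cball 0 (norm x + 1)"
    proof
      fix y assume "y \<in> cball x 1"
      then show "y \<in> cball 0 (norm x + 1)"
        using norm_triangle_sub[of y x] by (simp add: dist_norm norm_minus_commute)
    qed
  qed
  then show "\<exists>d>0. cball x d \<subseteq> UNIV \<and> uniform_limit (cball x d) (\<lambda>n z. \<Prod>m<n. 1 + a m * z + b m * z\<^sup>2)
           (\<lambda>z. \<Prod>m. 1 + a m * z + b m * z\<^sup>2) sequentially"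
    by (intro exI[of _ 1]) auto
qed auto

lemma tendsto_quadratic_prod:
  fixes a b :: "nat \<Rightarrow> complex"
  assumes a: "summable (\<lambda>m. norm (a m))" and b: "summable (\<lambda>m. norm (b m))"
  shows "(\<lambda>n. \<Prod>m<n. 1 + a m * z + b m * z\<^sup>2) \<longlonglongrightarrow> (\<Prod>m. 1 + a m * z + b m * z\<^sup>2)"
  by (rule tendsto_uniform_limitI[OF uniform_limit_quadratic_prod[OF a b, of "norm z"]]) auto

lemma logderiv_quadratic_prod:
  fixes a b :: "nat \<Rightarrow> complex"
  assumes a: "summable (\<lambda>m. norm (a m))" and b: "summable (\<lambda>m. norm (b m))"
  defines "P \<equiv> \<lambda>z. \<Prod>m. 1 + a m * z + b m * z\<^sup>2"
  assumes nz: "P z \<noteq> 0"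
  shows "(\<lambda>m. (a m + 2 * b m * z) / (1 + a m * z + b m * z\<^sup>2)) sums (deriv P z / P z)"
proof -
  have "(\<lambda>k. deriv (\<lambda>z. 1 + a k * z + b k * z\<^sup>2) z / (1 + a k * z + b k * z\<^sup>2)) sums (deriv P z / P z)"
  proof (rule logderiv_prodinf_complex_uniform_limit)
    show "uniform_limit (ball 0 (norm z + 1)) (\<lambda>n x. \<Prod>k<n. 1 + a k * x + b k * x\<^sup>2) P sequentially"
      unfolding P_def
      by (rule uniform_limit_on_subset[OF uniform_limit_quadratic_prod[OF a b, of "norm z + 1"]]) auto
  qed (use nz in \<open>auto intro!: holomorphic_intros\<close>)
  moreover have "deriv (\<lambda>z. 1 + a k * z + b k * z\<^sup>2) z = a k + 2 * b k * z" for k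
    by (rule DERIV_imp_deriv) (auto intro!: derivative_eq_intros)
  ultimately show ?thesis by simp
qed

section \<open>Alternating sums as integrals against a sign function\<close>

text \<open>The sign is constant between consecutive nodes, so the integral up to \<open>s n\<close> is an alternating sum of
differences of \<open>G\<close>. Summation by parts counts every inner node twice, \<open>G 0\<close> once, and leaves one
boundary term that vanishes because \<open>G\<close> tends to \<open>0\<close> along the nodes. This turns sums over the zeros of
\<open>\<phi>\<close> into integrals against its signature.\<close>

lemma alternating_FTC:
  fixes G G' :: "real \<Rightarrow> complex" and s :: "nat \<Rightarrow> real"
  assumes s: "strict_mono s" "s 0 = 0" and s_inf: "filterlim s at_top sequentially"
    and sg: "\<And>k x. s k < x \<Longrightarrow> x < s (Suc k) \<Longrightarrow> sg x = (-1 :: real) ^ k"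
    and sg_meas: "sg \<in> borel_measurable borel" and sg_bound: "\<And>x. \<bar>sg x\<bar> \<le> 1"
    and G: "\<And>x. x \<ge> 0 \<Longrightarrow> (G has_vector_derivative G' x) (at x)"
    and cont: "continuous_on {0..} G'"
    and int: "set_integrable lborel {0..} G'"
    and lim: "(\<lambda>k. G (s k)) \<longlonglongrightarrow> 0"
  shows "(\<lambda>k. (-1) ^ Suc k * G (s (Suc k))) sums
           (- (G 0 + (LINT x:{0..}|lborel. of_real (sg x) * G' x)) / 2)"
proof -
  let ?h = "\<lambda>x. of_real (sg x) * G' x :: complex"
  have sg_meas': "(\<lambda>x. complex_of_real (sg x)) \<in> borel_measurable lborel"
    using sg_meas by measurable
  have int_h: "set_integrable lborel {0..} ?h"
    unfolding set_integrable_def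
  proof (rule Bochner_Integration.integrable_bound)
    show "integrable lborel (\<lambda>x. indicat_real {0..} x *\<^sub>R G' x)"
      using int unfolding set_integrable_def .
    have "(\<lambda>x. of_real (sg x) * (indicat_real {0..} x *\<^sub>R G' x)) \<in> borel_measurable lborel"
      by (intro borel_measurable_times sg_meas' borel_measurable_integrable[OF int[unfolded set_integrable_def]])
    then show "(\<lambda>x. indicat_real {0..} x *\<^sub>R ?h x) \<in> borel_measurable lborel"
      by (simp add: scaleR_conv_of_real mult_ac)
    show "AE x in lborel. norm (indicat_real {0..} x *\<^sub>R ?h x) \<le> norm (indicat_real {0..} x *\<^sub>R G' x)"
      using sg_bound by (auto simp: norm_mult intro!: AE_I2 mult_left_le_one_le mult_left_mono)
  qed
  have s_ge: "s k \<ge> 0" for k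
    using s by (metis le0 strict_mono_less_eq)
  have sub: "set_integrable lborel A ?h" if "A \<in> sets lborel" "A \<subseteq> {0..}" for A
    using set_integrable_subset[OF int_h] that by auto
  have piece: "(LINT x:{s n..s (Suc n)}|lborel. ?h x) = (-1) ^ n * (G (s (Suc n)) - G (s n))" for n
  proof -
    have le: "s n \<le> s (Suc n)" using s(1) by (simp add: strict_mono_less_eq)
    have "(LINT x:{s n..s (Suc n)}|lborel. ?h x) = (LINT x:{s n..s (Suc n)}|lborel. (-1) ^ n * G' x)"
      unfolding set_lebesgue_integral_def
    proof (rule integral_cong_AE)
      have "AE x in lborel. x \<noteq> s n" by (rule AE_lborel_singleton)
      moreover have "AE x in lborel. x \<noteq> s (Suc n)" by (rule AE_lborel_singleton)
      ultimately show "AE x in lborel. indicat_real {s n..s (Suc n)} x *\<^sub>R ?h x = indicat_real {s n..s (Suc n)} x *\<^sub>R ((-1) ^ n * G' x)"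
      proof eventually_elim
        case (elim x)
        show ?case
        proof (cases "x \<in> {s n..s (Suc n)}")
          case True
          then have "sg x = (-1) ^ n" using elim by (intro sg) auto
          then show ?thesis by simp
        qed simp
      qed
      show "(\<lambda>x. indicat_real {s n..s (Suc n)} x *\<^sub>R ?h x) \<in> borel_measurable lborel"
      proof -
        have "set_integrable lborel {s n..s (Suc n)} ?h"
          by (rule sub) (use s_ge[of n] in auto)
        then show ?thesis unfolding set_integrable_def by (rule borel_measurable_integrable)
      qed
      have "set_integrable lborel {s n..s (Suc n)} G'"
        by (rule set_integrable_subset[OF int]) (use s_ge[of n] in auto)
      then have "set_integrable lborel {s n..s (Suc n)} (\<lambda>x. (-1) ^ n * G' x)"
        by (rule set_integrable_mult_right)
      then show "(\<lambda>x. indicat_real {s n..s (Suc n)} x *\<^sub>R ((-1) ^ n * G' x)) \<in> borel_measurable lborel"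
        unfolding set_integrable_def by (rule borel_measurable_integrable)
    qed
    also have "\<dots> = (-1) ^ n * (LINT x:{s n..s (Suc n)}|lborel. G' x)"
      by (rule set_integral_mult_right)
    also have "(LINT x:{s n..s (Suc n)}|lborel. G' x) = G (s (Suc n)) - G (s n)"
      unfolding set_lebesgue_integral_def
    proof (rule integral_FTC_Icc[OF le])
      show "(G has_vector_derivative G' x) (at x within {s n..s (Suc n)})"
        if "s n \<le> x" "x \<le> s (Suc n)" for x
      proof -
        have "0 \<le> x" using that s_ge[of n] by linarith
        from G[OF this] show ?thesis by (rule has_vector_derivative_at_within)
      qed
      show "continuous_on {s n..s (Suc n)} G'"
        by (rule continuous_on_subset[OF cont]) (use s_ge[of n] in auto)
    qed
    finally show ?thesis .
  qed
  have partial: "(LINT x:{0..s n}|lborel. ?h x) = (\<Sum>k<n. (-1) ^ k * (G (s (Suc k)) - G (s k)))" for n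
  proof (induction n)
    case 0
    have "AE x in lborel. indicat_real {0..s 0} x *\<^sub>R ?h x = 0"
      using AE_lborel_singleton[of 0] by eventually_elim (simp add: s(2))
    then have "(LINT x:{0..s 0}|lborel. ?h x) = 0"
      unfolding set_lebesgue_integral_def by (rule integral_eq_zero_AE)
    then show ?case by simp
  next
    case (Suc n)
    have le: "s n \<le> s (Suc n)" using s(1) by (simp add: strict_mono_less_eq)
    have "{0..s (Suc n)} = {0..s n} \<union> {s n..s (Suc n)}" using le s_ge[of n] by auto
    moreover have "(LINT x:{0..s n} \<union> {s n..s (Suc n)}|lborel. ?h x) =
        (LINT x:{0..s n}|lborel. ?h x) + (LINT x:{s n..s (Suc n)}|lborel. ?h x)"
    proof (rule set_integral_Un_AE)
      show "AE x in lborel. \<not> (x \<in> {0..s n} \<and> x \<in> {s n..s (Suc n)})"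
        using AE_lborel_singleton[of "s n"] by eventually_elim auto
    qed (use s_ge[of n] in \<open>auto intro!: sub\<close>)
    ultimately show ?case using Suc piece[of n] by simp
  qed
  have conv: "(\<lambda>n. LINT x:{0..s n}|lborel. ?h x) \<longlonglongrightarrow> (LINT x:{0..}|lborel. ?h x)"
    unfolding set_lebesgue_integral_def
  proof (rule integral_dominated_convergence)
    show "integrable lborel (\<lambda>x. norm (indicat_real {0..} x *\<^sub>R ?h x))"
      using int_h unfolding set_integrable_def by (rule integrable_norm)
    show "(\<lambda>x. indicat_real {0..} x *\<^sub>R ?h x) \<in> borel_measurable lborel"
      using int_h unfolding set_integrable_def by (rule borel_measurable_integrable)
    show "(\<lambda>x. indicat_real {0..s n} x *\<^sub>R ?h x) \<in> borel_measurable lborel" for n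
    proof -
      have "set_integrable lborel {0..s n} ?h" by (rule sub) auto
      then show ?thesis unfolding set_integrable_def by (rule borel_measurable_integrable)
    qed
    show "AE x in lborel. norm (indicat_real {0..s n} x *\<^sub>R ?h x) \<le> norm (indicat_real {0..} x *\<^sub>R ?h x)" for n
      by (auto simp: indicator_def)
    show "AE x in lborel. (\<lambda>n. indicat_real {0..s n} x *\<^sub>R ?h x) \<longlonglongrightarrow> indicat_real {0..} x *\<^sub>R ?h x"
    proof (rule AE_I2)
      fix x :: real
      have "eventually (\<lambda>n. x \<le> s n) sequentially"
        using s_inf by (auto simp: filterlim_at_top)
      then have "eventually (\<lambda>n. indicat_real {0..s n} x *\<^sub>R ?h x = indicat_real {0..} x *\<^sub>R ?h x) sequentially"
        by eventually_elim (auto simp: indicator_def)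
      then show "(\<lambda>n. indicat_real {0..s n} x *\<^sub>R ?h x) \<longlonglongrightarrow> indicat_real {0..} x *\<^sub>R ?h x"
        by (rule tendsto_eventually)
    qed
  qed
  have "2 * (\<Sum>k<n. (-1) ^ Suc k * G (s (Suc k))) =
      - (G 0 + (LINT x:{0..s n}|lborel. ?h x)) + (-1) ^ n * G (s n)" for n
    unfolding partial by (induction n) (auto simp: s(2) algebra_simps)
  then have abel: "(\<Sum>k<n. (-1) ^ Suc k * G (s (Suc k))) =
      (- (G 0 + (LINT x:{0..s n}|lborel. ?h x)) + (-1) ^ n * G (s n)) / 2" for n
    by (rule eq_divide_imp[rotated, OF trans[OF mult.commute]]) simp
  have "(\<lambda>n. (-1) ^ n * G (s n)) \<longlonglongrightarrow> 0"
    by (rule tendsto_norm_zero_cancel) (use tendsto_norm_zero[OF lim] in \<open>simp add: norm_mult norm_power\<close>)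
  then have "(\<lambda>n. (- (G 0 + (LINT x:{0..s n}|lborel. ?h x)) + (-1) ^ n * G (s n)) / 2)
      \<longlonglongrightarrow> (- (G 0 + (LINT x:{0..}|lborel. ?h x)) + 0) / 2"
    by (intro tendsto_divide tendsto_add tendsto_minus conv tendsto_const) simp_all
  then show ?thesis
    unfolding sums_def abel by (simp only: add_0_right)
qed

section \<open>Phragmen--Lindelof bounds\<close>

text \<open>Let \<open>c\<close> be the square root of \<open>(1 - \<i>) z + 1\<close>. The factor \<open>1 - \<i>\<close> turns the quadrant into a sector around
the positive axis, and the shift by \<open>1\<close> keeps the branch point away. Hence \<open>c\<close> stays in a sector of
half-angle less than \<open>\<pi>/6\<close>, so that \<open>Re (c ^ 3)\<close> is positive and grows like \<open>norm z powr (3/2)\<close>, faster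
than the exponent in the growth condition. The maximum principle on large quarter discs applies to
\<open>g exp (- \<delta> c ^ 3)\<close>, and \<open>\<delta>\<close> tends to \<open>0\<close>.\<close>

lemma phragmen_lindelof_quadrant:
  assumes hol: "g holomorphic_on UNIV" and A: "A \<ge> 0" and B: "B \<ge> 0"
    and gr: "\<And>z. norm (g z) \<le> A * exp (B * norm z)"
    and re: "\<And>x. x \<ge> 0 \<Longrightarrow> norm (g (of_real x)) \<le> K"
    and im: "\<And>y. y \<ge> 0 \<Longrightarrow> norm (g (\<i> * of_real y)) \<le> K"
    and z: "Re z \<ge> 0" "Im z \<ge> 0"
  shows "norm (g z) \<le> max K A"
proof -
  define u where "u = (\<lambda>z. (1 - \<i>) * z + 1 :: complex)"
  define c where "c = (\<lambda>z. csqrt (u z))"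
  have Reu: "Re (u z) = Re z + Im z + 1" and Imu: "Im (u z) = Im z - Re z" for z
    by (simp_all add: u_def)
  have c_hol: "c holomorphic_on {z. Re z + Im z + 1 > 0}"
    unfolding c_def
    by (rule holomorphic_on_csqrt') (auto simp: u_def complex_nonpos_Reals_iff intro!: holomorphic_intros)
  have c_est: "norm z * Re (c z) / 5 \<le> Re (c z ^ 3) \<and> Re (c z) ^ 2 \<ge> 4 / 5 * norm z \<and> Re (c z) \<ge> 0"
    if "Re z \<ge> 0" "Im z \<ge> 0" for z
  proof -
    define a b where "a = Re (c z)" and "b = Im (c z)"
    have c2: "c z ^ 2 = u z" unfolding c_def by simp
    have ab1: "a\<^sup>2 - b\<^sup>2 = Re z + Im z + 1" and ab2: "2 * a * b = Im z - Re z"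
      using arg_cong[OF c2, of Re] arg_cong[OF c2, of Im] unfolding a_def b_def
      by (simp_all add: Reu Imu Re_power2 Im_power2)
    have a0: "a \<ge> 0" unfolding a_def c_def using csqrt_principal[of "u z"] by auto
    have nz: "norm z \<le> Re z + Im z"
      using cmod_le[of z] that by simp
    have "a \<noteq> 0"
    proof
      assume "a = 0"
      then have "- b\<^sup>2 \<ge> 1" using ab1 that by simp
      then show False using zero_le_power2[of b] by linarith
    qed
    with a0 have apos: "a > 0" by simp
    have "2 * a * \<bar>b\<bar> \<le> a\<^sup>2 - b\<^sup>2"
    proof -
      have "2 * a * \<bar>b\<bar> = \<bar>Im z - Re z\<bar>" using ab2 apos by (metis abs_mult abs_of_nonneg a0 abs_numeral)
      also have "\<dots> \<le> a\<^sup>2 - b\<^sup>2" using ab1 that by simp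
      finally show ?thesis .
    qed
    then have "2 * \<bar>b\<bar> \<le> a"
    proof -
      assume h: "2 * a * \<bar>b\<bar> \<le> a\<^sup>2 - b\<^sup>2"
      then have "a * (2 * \<bar>b\<bar>) \<le> a * a"
        using zero_le_power2[of b] by (simp only: power2_eq_square mult_ac)
      then show ?thesis using apos by simp
    qed
    then have b2: "4 * b\<^sup>2 \<le> a\<^sup>2"
      using power_mono[of "2 * \<bar>b\<bar>" a 2] by (simp add: power_mult_distrib)
    have Rec3: "Re (c z ^ 3) = a * (a\<^sup>2 - 3 * b\<^sup>2)"
      unfolding a_def b_def by (simp add: power3_eq_cube power2_eq_square algebra_simps)
    have n1: "norm z \<le> a\<^sup>2" using nz ab1 zero_le_power2[of b] by linarith
    have "a * norm z / 5 \<le> a * (a\<^sup>2 - 3 * b\<^sup>2)"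
    proof -
      have "norm z / 5 \<le> a\<^sup>2 - 3 * b\<^sup>2" using n1 b2 zero_le_power2[of b] by linarith
      from mult_left_mono[OF this a0] show ?thesis by simp
    qed
    moreover have "4 / 5 * norm z \<le> a\<^sup>2" using n1 norm_ge_zero[of z] by linarith
    ultimately show ?thesis
      using a0 Rec3 unfolding a_def[symmetric] by (simp add: mult.commute)
  qed
  have key: "norm (g z) * exp (- \<delta> * Re (c z ^ 3)) \<le> max K A" if \<delta>: "\<delta> > 0" for \<delta>
  proof -
    define h where "h = (\<lambda>z. g z * exp (- of_real \<delta> * c z ^ 3))"
    have h_norm: "norm (h w) = norm (g w) * exp (- \<delta> * Re (c w ^ 3))" for w
      unfolding h_def by (simp add: norm_mult)
    (* The radius is so large that the damping factor beats the growth of g on the arc. *)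
    define R where "R = max (norm z) (5 / 4 * (5 * B / \<delta>)\<^sup>2) + 1"
    define S where "S = {w. 0 \<le> Re w \<and> 0 \<le> Im w \<and> norm w \<le> R}"
    have h_hol: "h holomorphic_on {z. Re z + Im z + 1 > 0}"
      unfolding h_def by (intro holomorphic_intros c_hol holomorphic_on_subset[OF hol]) auto
    have sub: "S \<subseteq> {z. Re z + Im z + 1 > 0}" unfolding S_def by auto
    have clS: "closed S"
    proof -
      have "S = {w. 0 \<le> Re w} \<inter> {w. 0 \<le> Im w} \<inter> cball 0 R" unfolding S_def by auto
      then show ?thesis by (simp add: closed_Int closed_halfspace_Re_ge closed_halfspace_Im_ge)
    qed
    have "norm (h z) \<le> max K A"
    proof (rule maximum_modulus_frontier[of h S])
      show "h holomorphic_on interior S"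
        using holomorphic_on_subset[OF h_hol] sub interior_subset by blast
      show "continuous_on (closure S) h"
        using clS holomorphic_on_imp_continuous_on[OF holomorphic_on_subset[OF h_hol sub]] by simp
      show "bounded S"
        by (rule bounded_subset[of "cball 0 R"]) (auto simp: S_def)
      show "z \<in> S" using z unfolding S_def R_def by auto
      fix w assume w: "w \<in> frontier S"
      then have wS: "w \<in> S" using clS frontier_subset_closed by blast
      have ex1: "exp (- \<delta> * Re (c w ^ 3)) \<le> 1"
      proof -
        have pos: "Re w \<ge> 0" "Im w \<ge> 0" using wS by (auto simp: S_def)
        have "0 \<le> norm w * Re (c w) / 5" using c_est[OF pos] by simp
        also have "\<dots> \<le> Re (c w ^ 3)" using c_est[OF pos] by (rule conjunct1)
        finally have "Re (c w ^ 3) \<ge> 0" .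
        then show ?thesis using \<delta> by simp
      qed
      have "Re w = 0 \<or> Im w = 0 \<or> norm w = R"
      proof (rule ccontr)
        assume neg: "\<not> (Re w = 0 \<or> Im w = 0 \<or> norm w = R)"
        let ?O = "{w. 0 < Re w} \<inter> {w. 0 < Im w} \<inter> ball 0 R"
        have "open ?O" by (intro open_Int open_halfspace_Re_gt open_halfspace_Im_gt open_ball)
        moreover have "w \<in> ?O" using neg wS unfolding S_def by auto
        moreover have "?O \<subseteq> S" unfolding S_def by auto
        ultimately have "w \<in> interior S" by (meson interiorI)
        then show False using w by (simp add: frontier_def)
      qed
      then consider "Re w = 0" | "Im w = 0" | "norm w = R" by blast
      then show "norm (h w) \<le> max K A"
      proof cases
        case 1
        then have "w = \<i> * of_real (Im w)" by (simp add: complex_eq_iff)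
        then have "norm (g w) \<le> K" using im[of "Im w"] wS unfolding S_def by auto
        then show ?thesis unfolding h_norm using ex1
          by (meson max.coboundedI1 mult_left_le norm_ge_zero order_trans)
      next
        case 2
        then have "w = of_real (Re w)" by (simp add: complex_eq_iff)
        then have "norm (g w) \<le> K" using re[of "Re w"] wS unfolding S_def by auto
        then show ?thesis unfolding h_norm using ex1
          by (meson max.coboundedI1 mult_left_le norm_ge_zero order_trans)
      next
        case 3
        have e: "norm w * Re (c w) / 5 \<le> Re (c w ^ 3)" "Re (c w) ^ 2 \<ge> 4 / 5 * norm w" "Re (c w) \<ge> 0"
          using c_est[of w] wS unfolding S_def by auto
        have "(5 * B / \<delta>)\<^sup>2 \<le> 4 / 5 * norm w" unfolding 3 R_def by simp
        then have "(5 * B / \<delta>)\<^sup>2 \<le> Re (c w) ^ 2" using e by linarith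
        then have "5 * B / \<delta> \<le> Re (c w)" using e(3) by (rule power2_le_imp_le)
        then have "B \<le> \<delta> * Re (c w) / 5" using \<delta> by (simp add: field_simps)
        then have "B * norm w \<le> \<delta> * Re (c w) / 5 * norm w" by (rule mult_right_mono) simp
        also have "\<dots> = \<delta> * (norm w * Re (c w) / 5)" by simp
        also have "\<dots> \<le> \<delta> * Re (c w ^ 3)" using e(1) \<delta> by (intro mult_left_mono) auto
        finally have BB: "B * norm w + - \<delta> * Re (c w ^ 3) \<le> 0" by simp
        have "norm (h w) \<le> A * exp (B * norm w) * exp (- \<delta> * Re (c w ^ 3))"
          unfolding h_norm by (intro mult_right_mono gr) auto
        also have "\<dots> = A * exp (B * norm w + - \<delta> * Re (c w ^ 3))" by (simp only: exp_add mult.assoc)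
        also have "\<dots> \<le> A * 1" using BB A by (intro mult_left_mono) auto
        finally show ?thesis by simp
      qed
    qed
    then show ?thesis by (simp only: h_norm)
  qed
  have "((\<lambda>\<delta>. norm (g z) * exp (- \<delta> * Re (c z ^ 3))) \<longlongrightarrow> norm (g z) * exp (- 0 * Re (c z ^ 3))) (at_right 0)"
    by (intro tendsto_intros)
  moreover have "eventually (\<lambda>\<delta>. norm (g z) * exp (- \<delta> * Re (c z ^ 3)) \<le> max K A) (at_right 0)"
    using key by (auto simp: eventually_at_right_less eventually_at_filter)
  ultimately have "norm (g z) * exp (- 0 * Re (c z ^ 3)) \<le> max K A"
    by (rule tendsto_upperbound) simp
  then show ?thesis by simp
qed

text \<open>Multiplication by \<open>exp (\<i> B z)\<close> cancels the growth along the positive imaginary axis, after which the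
quadrant version covers the first quadrant and, by rotation, the second. The lower half-plane follows by
reflection.\<close>

lemma phragmen_lindelof_real_line:
  assumes hol: "f holomorphic_on UNIV" and A: "A \<ge> 0" and B: "B \<ge> 0"
    and gr: "\<And>z. norm (f z) \<le> A * exp (B * norm z)"
    and re: "\<And>x. norm (f (of_real x)) \<le> K"
  shows "norm (f z) \<le> max K A * exp (B * \<bar>Im z\<bar>)"
proof -
  have upper: "norm (f z) \<le> max K A * exp (B * Im z)"
    if hol: "f holomorphic_on UNIV" and gr: "\<And>z. norm (f z) \<le> A * exp (B * norm z)"
      and re: "\<And>x. norm (f (of_real x)) \<le> K" and z: "Im z \<ge> 0" for f z
  proof -
    define g where "g = (\<lambda>z. f z * exp (\<i> * of_real B * z))"
    have g_norm: "norm (g z) = norm (f z) * exp (- B * Im z)" for z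
      unfolding g_def by (simp add: norm_mult)
    have g_hol: "g holomorphic_on UNIV" unfolding g_def by (intro holomorphic_intros hol)
    have g_gr: "norm (g z) \<le> A * exp ((2 * B) * norm z)" for z
    proof -
      have "\<bar>Im z\<bar> \<le> norm z" by (rule abs_Im_le_cmod)
      then have "- Im z \<le> norm z" by linarith
      then have "- B * Im z \<le> B * norm z" using B mult_left_mono[of "- Im z" "norm z" B] by simp
      then have "norm (g z) \<le> (A * exp (B * norm z)) * exp (B * norm z)"
        unfolding g_norm using gr[of z] A by (intro mult_mono) auto
      also have "\<dots> = A * exp ((2 * B) * norm z)" by (simp add: mult.assoc exp_add[symmetric])
      finally show ?thesis .
    qed
    have g_re: "norm (g (of_real x)) \<le> max K A" for x using re[of x] by (simp add: g_norm)
    have g_im: "norm (g (\<i> * of_real y)) \<le> max K A" if "y \<ge> 0" for y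
    proof -
      have "norm (g (\<i> * of_real y)) \<le> A * exp (B * y) * exp (- B * y)"
        unfolding g_norm using gr[of "\<i> * of_real y"] that A by (intro mult_mono) (auto simp: norm_mult)
      also have "\<dots> = A" by (simp add: mult.assoc exp_add[symmetric])
      finally show ?thesis by simp
    qed
    have "norm (g z) \<le> max (max K A) A"
    proof (cases "Re z \<ge> 0")
      case True
      show ?thesis
        by (rule phragmen_lindelof_quadrant[OF g_hol A _ g_gr]) (use True z B g_re g_im in auto)
    next
      case False
      have "norm (g (\<i> * (- \<i> * z))) \<le> max (max K A) A"
      proof (rule phragmen_lindelof_quadrant[of "\<lambda>u. g (\<i> * u)" A "2 * B"])
        show "(\<lambda>u. g (\<i> * u)) holomorphic_on UNIV"
          using holomorphic_on_compose_gen[OF _ g_hol, of "\<lambda>u. \<i> * u" UNIV]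
          by (auto simp: o_def intro!: holomorphic_intros)
        show "norm (g (\<i> * u)) \<le> A * exp (2 * B * norm u)" for u
          using g_gr[of "\<i> * u"] by (simp add: norm_mult)
        show "norm (g (\<i> * (\<i> * of_real y))) \<le> max K A" for y
          using g_re[of "- y"] by (simp add: mult.assoc[symmetric])
      qed (use False z B A g_im in auto)
      then show ?thesis by (simp add: mult.assoc[symmetric])
    qed
    then have "norm (f z) * exp (- B * Im z) \<le> max K A" unfolding g_norm by simp
    then have "norm (f z) * exp (- B * Im z) * exp (B * Im z) \<le> max K A * exp (B * Im z)"
      by (rule mult_right_mono) simp
    then show ?thesis by (simp add: mult.assoc exp_add[symmetric])
  qed
  show ?thesis
  proof (cases "Im z \<ge> 0")
    case True
    then show ?thesis using upper[OF hol gr re] by simp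
  next
    case False
    have "norm (f (- (- z))) \<le> max K A * exp (B * Im (- z))"
    proof (rule upper[of "\<lambda>z. f (- z)" "- z"])
      show "(\<lambda>z. f (- z)) holomorphic_on UNIV"
        using holomorphic_on_compose_gen[OF holomorphic_on_minus[OF holomorphic_on_ident] hol, of UNIV]
        by (simp add: o_def)
      show "norm (f (- of_real x)) \<le> K" for x using re[of "- x"] by simp
      show "norm (f (- z)) \<le> A * exp (B * norm z)" for z using gr[of "- z"] by simp
    qed (use False in auto)
    then show ?thesis using False by simp
  qed
qed

lemma norm_deriv_le_strip:
  assumes hol: "f holomorphic_on UNIV" and b: "\<And>z. \<bar>Im z\<bar> \<le> r + 1 \<Longrightarrow> norm (f z) \<le> C"
    and z: "\<bar>Im z\<bar> \<le> r"
  shows "norm (deriv f z) \<le> C"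
proof -
  have "norm ((deriv ^^ 1) f z) \<le> fact 1 * C / 1 ^ 1"
  proof (rule Cauchy_inequality[of f z 1 C 1])
    show "norm (f x) \<le> C" if x: "norm (z - x) = 1" for x
    proof -
      have "\<bar>Im (z - x)\<bar> \<le> 1" using abs_Im_le_cmod[of "z - x"] x by simp
      then show "norm (f x) \<le> C" using z by (intro b) auto
    qed
    show "f holomorphic_on ball z 1" by (rule holomorphic_on_subset[OF hol]) simp
    show "continuous_on (cball z 1) f"
      by (rule holomorphic_on_imp_continuous_on[OF holomorphic_on_subset[OF hol]]) simp
  qed simp
  then show ?thesis by simp
qed

section \<open>Radial and even integrands\<close>

text \<open>Polar coordinates for radial functions. Both measures agree on the half-lines \<open>{..a}\<close>, where the left one
measures a ball of radius \<open>a\<close>.\<close>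

lemma distr_norm_lborel:
  "distr (lborel :: 'a::euclidean_space measure) borel norm =
     density lborel (\<lambda>r. ennreal (real DIM('a) * unit_ball_vol (DIM('a)) * r ^ (DIM('a) - 1) * indicator {0..} r))"
    (is "?L = density lborel (\<lambda>r. ennreal (?c r))")
proof (rule measure_eqI_generator_eq[of "range (\<lambda>a::real. {..a})" UNIV _ _ "\<lambda>n::nat. {..real n}"])
  let ?n = "DIM('a)" and ?v = "unit_ball_vol (DIM('a))"
  have v0: "?v \<ge> 0" by simp
  have L: "emeasure ?L {..a} = (if a \<ge> 0 then ennreal (?v * a ^ ?n) else 0)" for a :: real
  proof -
    have "emeasure ?L {..a} = emeasure (lborel :: 'a measure) (norm -` {..a})"
      by (subst emeasure_distr) auto
    also have "norm -` {..a} = cball (0::'a) a" by auto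
    finally show ?thesis using emeasure_cball[of a "0::'a"] by (auto simp: cball_empty)
  qed
  have c_meas: "(\<lambda>r. ennreal (?c r)) \<in> borel_measurable lborel" by measurable
  show "emeasure ?L X = emeasure (density lborel (\<lambda>r. ennreal (?c r))) X"
    if "X \<in> range (\<lambda>a::real. {..a})" for X
  proof -
    obtain a where X: "X = {..a}" using \<open>X \<in> _\<close> by auto
    have "emeasure (density lborel (\<lambda>r. ennreal (?c r))) X = (\<integral>\<^sup>+r. ennreal (?c r) * indicator {..a} r \<partial>lborel)"
      unfolding X by (rule emeasure_density[OF c_meas]) auto
    also have "\<dots> = (if a \<ge> 0 then ennreal (?v * a ^ ?n) else 0)"
    proof (cases "a \<ge> 0")
      case True
      have "(\<integral>\<^sup>+r. ennreal (?c r) * indicator {..a} r \<partial>lborel)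
          = (\<integral>\<^sup>+r. ennreal (real ?n * ?v * r ^ (?n - 1)) * indicator {0..a} r \<partial>lborel)"
        by (intro nn_integral_cong) (auto simp: indicator_def)
      also have "\<dots> = ennreal (?v * a ^ ?n - ?v * 0 ^ ?n)"
      proof (rule nn_integral_FTC_Icc)
        show "DERIV (\<lambda>r. ?v * r ^ ?n) x :> real ?n * ?v * x ^ (?n - 1)" for x
          by (auto intro!: derivative_eq_intros)
      qed (use v0 True in auto)
      finally show ?thesis using True by (simp add: power_0_left)
    next
      case False
      have "(\<integral>\<^sup>+r. ennreal (?c r) * indicator {..a} r \<partial>lborel) = (\<integral>\<^sup>+(r::real). 0 \<partial>lborel)"
        using False by (intro nn_integral_cong) (auto simp: indicator_def)
      then show ?thesis using False by simp
    qed
    finally show ?thesis unfolding X L by simp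
  qed
  show "sets ?L = sigma_sets UNIV (range (\<lambda>a::real. {..a}))"
    "sets (density lborel (\<lambda>r. ennreal (?c r))) = sigma_sets UNIV (range (\<lambda>a::real. {..a}))"
    by (simp_all add: borel_eq_atMost)
  show "Int_stable (range (\<lambda>a::real. {..a}))"
  proof (rule Int_stableI)
    fix a b assume "a \<in> range (\<lambda>a::real. {..a})" "b \<in> range (\<lambda>a::real. {..a})"
    then obtain x y where "a = {..x}" "b = {..y}" by auto
    then have "a \<inter> b = {..min x y}" by auto
    then show "a \<inter> b \<in> range (\<lambda>a::real. {..a})" by auto
  qed
  show "(\<Union>i::nat. {..real i}) = UNIV" by (auto simp: real_arch_simple)
  show "emeasure ?L {..real i} \<noteq> \<infinity>" for i unfolding L by simp
qed auto

lemma integrable_radial: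
  fixes f :: "real \<Rightarrow> complex"
  assumes meas: "f \<in> borel_measurable borel"
    and int: "integrable lborel (\<lambda>x :: 'a::euclidean_space. f (norm x))"
  shows "set_integrable lborel {0..} (\<lambda>r. r ^ (DIM('a) - 1) *\<^sub>R f r)"
proof -
  have "integrable (distr (lborel :: 'a measure) borel norm) f"
    by (subst integrable_distr_eq) (use int meas in auto)
  then have "integrable lborel (\<lambda>r. (real DIM('a) * unit_ball_vol (DIM('a)) * r ^ (DIM('a) - 1) * indicator {0..} r) *\<^sub>R f r)"
    unfolding distr_norm_lborel by (subst (asm) integrable_density) (use meas in \<open>auto simp: indicator_def\<close>)
  then have "integrable lborel (\<lambda>r. (1 / (real DIM('a) * unit_ball_vol (DIM('a)))) *\<^sub>R
     ((real DIM('a) * unit_ball_vol (DIM('a)) * r ^ (DIM('a) - 1) * indicator {0..} r) *\<^sub>R f r))"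
    by (rule integrable_scaleR_right)
  then show ?thesis
    unfolding set_integrable_def using unit_ball_vol_pos[of "real DIM('a)"]
    by (simp add: mult_ac less_imp_neq[THEN not_sym])
qed

lemma integrable_even:
  fixes h :: "real \<Rightarrow> complex"
  assumes int: "set_integrable lborel {0..} h" and even: "\<And>x. h (- x) = h x"
  shows "integrable lborel h"
    and "integral\<^sup>L lborel h = 2 * (LINT x:{0..}|lborel. h x)"
proof -
  let ?p = "\<lambda>x. indicat_real {0..} x *\<^sub>R h x"
  have p: "integrable lborel ?p" using int unfolding set_integrable_def .
  have n: "integrable lborel (\<lambda>x. ?p (- x))"
    using lborel_integrable_real_affine[OF p, of "-1" 0] by simp
  have ne: "AE x in lborel. h x = ?p x + ?p (- x)"
    using AE_lborel_singleton[of "0::real"]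
    by eventually_elim (auto simp: indicator_def even)
  have hp: "integrable lborel (\<lambda>x. ?p x + ?p (- x))"
    using p n by (rule Bochner_Integration.integrable_add)
  have "h = (\<lambda>x. if x = 0 then h 0 else ?p x + ?p (- x))"
    by (auto simp: indicator_def even fun_eq_iff)
  moreover have "(\<lambda>x. if x = 0 then h 0 else ?p x + ?p (- x)) \<in> borel_measurable lborel"
    by (rule measurable_If) (use borel_measurable_integrable[OF hp] in auto)
  ultimately have hm: "h \<in> borel_measurable lborel" by simp
  show "integrable lborel h"
    by (subst integrable_cong_AE[OF hm borel_measurable_integrable[OF hp] ne]) (rule hp)
  have "integral\<^sup>L lborel h = integral\<^sup>L lborel (\<lambda>x. ?p x + ?p (- x))"
    by (rule integral_cong_AE[OF hm borel_measurable_integrable[OF hp] ne])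
  also have "\<dots> = integral\<^sup>L lborel ?p + integral\<^sup>L lborel (\<lambda>x. ?p (- x))"
    using p n by (rule Bochner_Integration.integral_add)
  also have "integral\<^sup>L lborel (\<lambda>x. ?p (- x)) = integral\<^sup>L lborel ?p"
    using lborel_integral_real_affine[of "-1" ?p 0] by simp
  finally show "integral\<^sup>L lborel h = 2 * (LINT x:{0..}|lborel. h x)"
    unfolding set_lebesgue_integral_def by simp
qed

lemma lborel_integral_halve:
  fixes h :: "real \<Rightarrow> complex"
  assumes "integrable lborel h"
  shows "integral\<^sup>L lborel h = (LINT x:{0..}|lborel. h x + h (- x))"
proof -
  have n: "integrable lborel (\<lambda>x. h (- x))"
    using lborel_integrable_real_affine[OF assms, of "-1" 0] by simp
  have i: "integrable lborel (\<lambda>x. h x + h (- x))" by (intro Bochner_Integration.integrable_add assms n)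
  have "integral\<^sup>L lborel (\<lambda>x. h x + h (- x)) = 2 * (LINT x:{0..}|lborel. h x + h (- x))"
    by (rule integrable_even(2)) (auto simp: set_integrable_def intro!: integrable_mult_indicator i)
  moreover have "integral\<^sup>L lborel (\<lambda>x. h x + h (- x)) = integral\<^sup>L lborel h + integral\<^sup>L lborel (\<lambda>x. h (- x))"
    by (intro Bochner_Integration.integral_add assms n)
  moreover have "integral\<^sup>L lborel (\<lambda>x. h (- x)) = integral\<^sup>L lborel h"
    using lborel_integral_real_affine[of "-1" h 0] by simp
  ultimately show ?thesis by simp
qed

lemma integrable_inverse_1_plus_square_UNIV: "integrable lborel (\<lambda>x::real. 1 / (1 + x\<^sup>2))"
  using integrable_inverse_1_plus_square by (simp add: einterval_def set_integrable_def inverse_eq_divide)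

lemma integrable_inverse_square_bound:
  fixes h :: "real \<Rightarrow> complex"
  assumes "h \<in> borel_measurable borel" "\<And>x. norm (h x) \<le> C / (1 + x\<^sup>2)"
  shows "integrable lborel h"
proof (rule Bochner_Integration.integrable_bound)
  show "integrable lborel (\<lambda>x::real. C * (1 / (1 + x\<^sup>2)))"
    by (intro integrable_mult_right integrable_inverse_1_plus_square_UNIV)
  show "AE x in lborel. norm (h x) \<le> norm (C * (1 / (1 + x\<^sup>2)))"
  proof (rule AE_I2)
    fix x
    show "norm (h x) \<le> norm (C * (1 / (1 + x\<^sup>2)))" using assms(2)[of x] by (rule order_trans) (simp add: divide_right_mono)
  qed
qed (use assms in auto)

section \<open>Derivatives of integrable functions of exponential type\<close>

lemma integrable_from_bounded_intervals:
  fixes g :: "real \<Rightarrow> real"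
  assumes meas: "g \<in> borel_measurable borel" and nn: "\<And>x. g x \<ge> 0"
    and int: "\<And>n::nat. set_integrable lborel {- real n..real n} g"
    and bd: "\<And>n::nat. (LINT x:{- real n..real n}|lborel. g x) \<le> C"
  shows "integrable lborel g"
proof (rule integrableI_nonneg)
  let ?u = "\<lambda>(n::nat) x. ennreal (indicat_real {- real n..real n} x *\<^sub>R g x)"
  have u_lim: "(\<lambda>n. ?u n x) \<longlonglongrightarrow> ennreal (g x)" for x
  proof (rule tendsto_eventually)
    have "eventually (\<lambda>n::nat. \<bar>x\<bar> \<le> real n) sequentially"
      by (rule eventually_sequentiallyI[of "nat \<lceil>\<bar>x\<bar>\<rceil>"]) linarith
    then show "eventually (\<lambda>n. ?u n x = ennreal (g x)) sequentially"
      by eventually_elim (auto simp: indicator_def)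
  qed
  have "(\<integral>\<^sup>+x. ennreal (g x) \<partial>lborel) = (\<integral>\<^sup>+x. liminf (\<lambda>n. ?u n x) \<partial>lborel)"
    using lim_imp_Liminf[OF _ u_lim] by (intro nn_integral_cong) simp
  also have "\<dots> \<le> liminf (\<lambda>n. \<integral>\<^sup>+x. ?u n x \<partial>lborel)"
    by (rule nn_integral_liminf) (use meas in auto)
  also have "\<dots> \<le> liminf (\<lambda>n::nat. ennreal C)"
  proof (rule Liminf_mono, rule always_eventually, rule allI)
    fix n :: nat
    have "(\<integral>\<^sup>+x. ?u n x \<partial>lborel) = ennreal (LINT x:{- real n..real n}|lborel. g x)"
      unfolding set_lebesgue_integral_def
      by (rule nn_integral_eq_integral) (use int[of n] nn in \<open>auto simp: set_integrable_def\<close>)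
    then show "(\<integral>\<^sup>+x. ?u n x \<partial>lborel) \<le> ennreal C" using bd[of n] by (simp add: ennreal_leI)
  qed
  also have "\<dots> = ennreal C" by (rule Liminf_const) simp
  finally show "(\<integral>\<^sup>+x. ennreal (g x) \<partial>lborel) < \<infinity>"
    by (simp add: le_less_trans)
qed (use meas nn in auto)

text \<open>A primitive of \<open>f\<close> is bounded on the real line because \<open>f\<close> is integrable, hence bounded in horizontal strips
by Phragmen--Lindelof. Cauchy estimates then bound \<open>f\<close>, \<open>f'\<close> and \<open>f''\<close> on the real line, and an
integration by parts estimates the integral of \<open>f'\<^sup>2\<close> by boundary terms and the integral of \<open>f f''\<close>.
This weak form of Bernstein's inequality makes \<open>f'\<close> integrable against kernels that decay like \<open>1 / x\<close>.\<close>

lemma exp_type_L1_deriv_L2: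
  assumes hol: "f holomorphic_on UNIV" and A: "A \<ge> 0" and B: "B \<ge> 0"
    and gr: "\<And>z. norm (f z) \<le> A * exp (B * norm z)"
    and real: "\<And>x. Im (f (of_real x)) = 0"
    and int: "integrable lborel (\<lambda>x. f (of_real x))"
  shows "integrable lborel (\<lambda>x. (norm (deriv f (of_real x)))\<^sup>2)"
proof -
  define I where "I = (LINT x|lborel. norm (f (of_real x)))"
  have vd: "((\<lambda>x. h (of_real x)) has_vector_derivative deriv h (of_real x)) (at x within S)"
    if "h holomorphic_on UNIV" for h x S
    by (rule has_vector_derivative_real_field)
       (rule holomorphic_derivI[OF that open_UNIV UNIV_I])
  have cont: "continuous_on S (\<lambda>x. h (complex_of_real x))" if "h holomorphic_on UNIV" for h :: "complex \<Rightarrow> complex" and S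
    by (rule continuous_on_compose2[OF holomorphic_on_imp_continuous_on[OF that] continuous_on_of_real_id]) simp
  obtain F where F: "\<And>z. (F has_field_derivative f z) (at z)"
    using holomorphic_convex_primitive'[of UNIV f] hol by auto
  have F_hol: "F holomorphic_on UNIV"
    using F by (meson field_differentiable_at_within field_differentiable_def holomorphic_on_def)
  have F_deriv: "deriv F = f"
    using F DERIV_imp_deriv by (intro ext) blast
  have Fint: "norm (F (of_real b) - F (of_real a)) \<le> I" if "a \<le> b" for a b
  proof -
    have "(LINT x|lborel. indicator {a..b} x *\<^sub>R f (of_real x)) = F (of_real b) - F (of_real a)"
      using vd[OF F_hol] cont[OF hol] unfolding F_deriv by (intro integral_FTC_Icc that) auto
    then have "norm (F (of_real b) - F (of_real a)) \<le> (LINT x|lborel. norm (indicator {a..b} x *\<^sub>R f (of_real x)))"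
      by (metis integral_norm_bound)
    also have "\<dots> \<le> I" unfolding I_def
    proof (rule integral_mono)
      show "integrable lborel (\<lambda>x. norm (indicat_real {a..b} x *\<^sub>R f (of_real x)))"
        by (intro integrable_norm integrable_mult_indicator int) auto
    qed (use int in \<open>auto simp: indicator_def\<close>)
    finally show ?thesis .
  qed
  have F_re: "norm (F (of_real x)) \<le> norm (F 0) + I" for x
  proof -
    have "norm (F (of_real x) - F 0) \<le> I"
      using Fint[of 0 x] Fint[of x 0] by (cases "x \<ge> 0") (auto simp: norm_minus_commute)
    then show ?thesis using norm_triangle_sub[of "F (of_real x)" "F 0"] by linarith
  qed
  have F_gr: "norm (F z) \<le> (norm (F 0) + A) * exp ((B + 1) * norm z)" for z
  proof -
    have "norm (F z - F 0) \<le> (A * exp (B * norm z)) * norm (z - 0)"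
    proof (rule field_differentiable_bound[of "cball 0 (norm z)" F f])
      show "norm (f w) \<le> A * exp (B * norm z)" if "w \<in> cball 0 (norm z)" for w
        using gr[of w] that A B
        by (elim order_trans) (auto intro!: mult_left_mono)
    qed (use F in \<open>auto intro: has_field_derivative_at_within\<close>)
    also have "\<dots> \<le> (A * exp (B * norm z)) * exp (norm z)"
    proof (rule mult_left_mono)
      show "norm (z - 0) \<le> exp (norm z)" by (rule order_trans[OF _ exp_ge_add_one_self]) simp
    qed (use A in simp)
    also have "\<dots> = A * exp ((B + 1) * norm z)"
      by (simp add: exp_add[symmetric] algebra_simps)
    finally have "norm (F z) \<le> norm (F 0) + A * exp ((B + 1) * norm z)"
      using norm_triangle_sub[of "F z" "F 0"] by linarith
    also have "norm (F 0) \<le> norm (F 0) * exp ((B + 1) * norm z)"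
      using mult_left_mono[of 1 "exp ((B + 1) * norm z)" "norm (F 0)"] B by simp
    finally show ?thesis by (simp add: algebra_simps)
  qed
  (* Three unit strips, one for each of the three derivatives of the primitive F. *)
  define K where "K = max (norm (F 0) + I) (norm (F 0) + A) * exp ((B + 1) * 3)"
  have K0: "max (norm (F 0) + I) (norm (F 0) + A) \<ge> 0" using A by (simp add: le_max_iff_disj)
  have F_strip: "norm (F z) \<le> K" if "\<bar>Im z\<bar> \<le> 3" for z
  proof -
    have "norm (F z) \<le> max (norm (F 0) + I) (norm (F 0) + A) * exp ((B + 1) * \<bar>Im z\<bar>)"
      by (rule phragmen_lindelof_real_line[OF F_hol _ _ F_gr F_re]) (use A B in auto)
    also have "\<dots> \<le> K"
    proof -
      have "(B + 1) * \<bar>Im z\<bar> \<le> (B + 1) * 3" using that B by (intro mult_left_mono) auto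
      then show ?thesis unfolding K_def using K0 by (intro mult_left_mono) auto
    qed
    finally show ?thesis .
  qed
  have f_strip: "norm (f z) \<le> K" if "\<bar>Im z\<bar> \<le> 2" for z
    using norm_deriv_le_strip[OF F_hol, of 2 K z] F_strip that unfolding F_deriv by auto
  have hol1: "deriv f holomorphic_on UNIV" and hol2: "deriv (deriv f) holomorphic_on UNIV"
    by (auto intro!: holomorphic_deriv hol)
  have f'_strip: "norm (deriv f z) \<le> K" if "\<bar>Im z\<bar> \<le> 1" for z
    using norm_deriv_le_strip[OF hol, of 1 K z] f_strip that by auto
  have f''_strip: "norm (deriv (deriv f) z) \<le> K" if "\<bar>Im z\<bar> \<le> 0" for z
    using norm_deriv_le_strip[OF hol1, of 0 K z] f'_strip that by auto
  have K_nn: "K \<ge> 0" using f_strip[of 0] norm_ge_zero[of "f 0"] by (simp del: norm_ge_zero)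
  define g0 where "g0 = (\<lambda>x. Re (f (of_real x)))"
  define g1 where "g1 = (\<lambda>x. Re (deriv f (of_real x)))"
  define g2 where "g2 = (\<lambda>x. Re (deriv (deriv f) (of_real x)))"
  have d0: "(g0 has_vector_derivative g1 x) (at x within S)" for x S
    unfolding g0_def g1_def by (rule bounded_linear.has_vector_derivative[OF bounded_linear_Re vd[OF hol]])
  have d1: "(g1 has_vector_derivative g2 x) (at x within S)" for x S
    unfolding g1_def g2_def by (rule bounded_linear.has_vector_derivative[OF bounded_linear_Re vd[OF hol1]])
  have Im1: "Im (deriv f (of_real x)) = 0" for x
  proof -
    have "((\<lambda>x. Im (f (of_real x))) has_vector_derivative Im (deriv f (of_real x))) (at x)"
      by (rule bounded_linear.has_vector_derivative[OF bounded_linear_Im vd[OF hol]])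
    then have "((\<lambda>x. 0 :: real) has_vector_derivative Im (deriv f (of_real x))) (at x)"
      by (simp add: real)
    then show ?thesis
      using vector_derivative_at by fastforce
  qed
  have sq: "(norm (deriv f (of_real x)))\<^sup>2 = (g1 x)\<^sup>2" for x
    using Im1[of x] unfolding g1_def by (simp add: cmod_def)
  have cg: "continuous_on S g0" "continuous_on S g1" "continuous_on S g2" for S
    unfolding g0_def g1_def g2_def by (intro continuous_intros cont hol hol1 hol2)+
  have gb: "\<bar>g0 x\<bar> \<le> K" "\<bar>g1 x\<bar> \<le> K" "\<bar>g2 x\<bar> \<le> K" for x
    using abs_Re_le_cmod[of "f (of_real x)"] abs_Re_le_cmod[of "deriv f (of_real x)"]
      abs_Re_le_cmod[of "deriv (deriv f) (of_real x)"]
      f_strip[of "of_real x"] f'_strip[of "of_real x"] f''_strip[of "of_real x"]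
    unfolding g0_def g1_def g2_def by auto
  have si: "set_integrable lborel {a..b} h" if "continuous_on {a..b} h" for a b and h :: "real \<Rightarrow> real"
    using borel_integrable_compact[of "{a..b}" h] that by (simp add: set_integrable_def)
  have "integrable lborel (\<lambda>x. (g1 x)\<^sup>2)"
  proof (rule integrable_from_bounded_intervals)
    show "(\<lambda>x. (g1 x)\<^sup>2) \<in> borel_measurable borel"
      by (intro borel_measurable_continuous_onI continuous_intros cg)
    show "set_integrable lborel {- real n..real n} (\<lambda>x. (g1 x)\<^sup>2)" for n
      by (intro si continuous_intros cg)
    show "(LINT x:{- real n..real n}|lborel. (g1 x)\<^sup>2) \<le> 2 * K\<^sup>2 + K * I" for n
    proof -
      let ?J = "{- real n..real n}"
      have "(LINT x|lborel. indicator ?J x *\<^sub>R (g0 x * g2 x + g1 x * g1 x)) = g0 (real n) * g1 (real n) - g0 (- real n) * g1 (- real n)"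
        by (rule integral_FTC_Icc)
           (auto intro!: has_vector_derivative_mult d0 d1 continuous_intros cg)
      then have ftc: "(LINT x:?J|lborel. g0 x * g2 x + g1 x * g1 x) = g0 (real n) * g1 (real n) - g0 (- real n) * g1 (- real n)"
        unfolding set_lebesgue_integral_def .
      have split: "(LINT x:?J|lborel. g0 x * g2 x + g1 x * g1 x) = (LINT x:?J|lborel. g0 x * g2 x) + (LINT x:?J|lborel. g1 x * g1 x)"
        by (intro set_integral_add si continuous_intros cg)
      have "\<bar>LINT x:?J|lborel. g0 x * g2 x\<bar> \<le> (LINT x|lborel. norm (indicator ?J x *\<^sub>R (g0 x * g2 x)))"
        unfolding set_lebesgue_integral_def real_norm_def[symmetric] by (rule integral_norm_bound)
      also have "\<dots> \<le> (LINT x|lborel. K * norm (f (of_real x)))"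
      proof (rule integral_mono)
        have "set_integrable lborel ?J (\<lambda>x. g0 x * g2 x)" by (intro si continuous_intros cg)
        then show "integrable lborel (\<lambda>x. norm (indicat_real ?J x *\<^sub>R (g0 x * g2 x)))"
          unfolding set_integrable_def by (rule integrable_norm)
        show "integrable lborel (\<lambda>x. K * norm (f (of_real x)))"
          by (intro integrable_mult_right integrable_norm int)
        fix x
        have "\<bar>g0 x\<bar> * \<bar>g2 x\<bar> \<le> norm (f (of_real x)) * K"
          using gb[of x] abs_Re_le_cmod[of "f (of_real x)"] unfolding g0_def by (intro mult_mono) auto
        then show "norm (indicat_real ?J x *\<^sub>R (g0 x * g2 x)) \<le> K * norm (f (of_real x))"
          using K_nn by (auto simp: indicator_def abs_mult mult.commute)
      qed
      also have "\<dots> = K * I" unfolding I_def by simp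
      finally have b1: "\<bar>LINT x:?J|lborel. g0 x * g2 x\<bar> \<le> K * I" .
      have b2: "\<bar>g0 x * g1 x\<bar> \<le> K\<^sup>2" for x
        using gb[of x] unfolding abs_mult power2_eq_square by (intro mult_mono) auto
      show ?thesis
        using ftc split b1 b2[of "real n"] b2[of "- real n"] by (simp add: power2_eq_square)
    qed
  qed simp
  then show ?thesis unfolding sq .
qed

lemma integrable_L2_times_decay:
  fixes f q :: "real \<Rightarrow> complex"
  assumes "integrable lborel (\<lambda>x. (norm (f x))\<^sup>2)"
    and fm: "f \<in> borel_measurable borel" and qm: "q \<in> borel_measurable borel"
    and q: "\<And>x. (norm (q x))\<^sup>2 \<le> C / (1 + x\<^sup>2)"
  shows "integrable lborel (\<lambda>x. f x * q x)"
proof (rule Bochner_Integration.integrable_bound)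
  show "integrable lborel (\<lambda>x. (norm (f x))\<^sup>2 + C * (1 / (1 + x\<^sup>2)))"
    using assms(1) integrable_inverse_1_plus_square_UNIV by (intro Bochner_Integration.integrable_add integrable_mult_right)
  show "AE x in lborel. norm (f x * q x) \<le> norm ((norm (f x))\<^sup>2 + C * (1 / (1 + x\<^sup>2)))"
  proof (rule AE_I2)
    fix x
    have "2 * (norm (f x) * norm (q x)) \<le> (norm (f x))\<^sup>2 + (norm (q x))\<^sup>2"
      using sum_squares_bound[of "norm (f x)" "norm (q x)"] by simp
    moreover have "norm (f x) * norm (q x) \<ge> 0" by simp
    ultimately have "norm (f x) * norm (q x) \<le> (norm (f x))\<^sup>2 + (norm (q x))\<^sup>2" by linarith
    also have "\<dots> \<le> (norm (f x))\<^sup>2 + C * (1 / (1 + x\<^sup>2))" using q[of x] by simp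
    finally show "norm (f x * q x) \<le> norm ((norm (f x))\<^sup>2 + C * (1 / (1 + x\<^sup>2)))"
      unfolding norm_mult real_norm_def by (rule order_trans[OF _ abs_ge_self])
  qed
qed (use fm qm in auto)

section \<open>Smooth bumps\<close>

text \<open>The derivatives of \<open>exp (- 1 / t)\<close>, continued by \<open>0\<close> to the left half-line: in terms of \<open>u = 1 / t\<close>,
differentiation maps \<open>p(u) exp (- u)\<close> to \<open>u\<^sup>2 (p(u) - p'(u)) exp (- u)\<close>. Smooth functions are represented
throughout by the sequence of their derivatives, which matches the notion of a test function.\<close>

primrec flat_poly :: "nat \<Rightarrow> real poly" where
  "flat_poly 0 = 1"
| "flat_poly (Suc k) = [:0, 0, 1:] * (flat_poly k - pderiv (flat_poly k))"

definition flat :: "nat \<Rightarrow> real \<Rightarrow> real" where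
  "flat k t = (if t \<le> 0 then 0 else poly (flat_poly k) (1 / t) * exp (- 1 / t))"

lemma poly_times_exp_minus_tendsto_0:
  fixes p :: "real poly"
  shows "((\<lambda>u. poly p u * exp (- u)) \<longlongrightarrow> 0) at_top"
proof -
  have "((\<lambda>u. \<Sum>i\<le>degree p. coeff p i * (u ^ i / exp u)) \<longlongrightarrow> (\<Sum>i\<le>degree p. coeff p i * 0)) at_top"
    by (intro tendsto_intros tendsto_power_div_exp_0)
  then show ?thesis
    by (simp add: poly_altdef sum_distrib_right exp_minus divide_inverse mult.assoc)
qed

lemma flat_has_derivative: "(flat k has_real_derivative flat (Suc k) t) (at t)"
proof -
  consider "t < 0" | "t > 0" | "t = 0" by linarith
  then show ?thesis
  proof cases
    case 1
    have "((\<lambda>_. 0) has_real_derivative 0) (at t)" by simp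
    then have "(flat k has_real_derivative 0) (at t)"
      by (rule has_field_derivative_transform_within_open[of _ _ _ "{..<0}"]) (use 1 in \<open>auto simp: flat_def\<close>)
    then show ?thesis using 1 by (simp add: flat_def)
  next
    case 2
    have "((\<lambda>t. poly (flat_poly k) (1 / t) * exp (- 1 / t)) has_real_derivative
        (poly (pderiv (flat_poly k)) (1 / t) * (- 1 / t\<^sup>2) * exp (- 1 / t) + poly (flat_poly k) (1 / t) * (exp (- 1 / t) * (1 / t\<^sup>2)))) (at t)"
      using 2 by (auto intro!: derivative_eq_intros DERIV_chain2[OF poly_DERIV] simp: power2_eq_square divide_simps)
    then have "(flat k has_real_derivative
        (poly (pderiv (flat_poly k)) (1 / t) * (- 1 / t\<^sup>2) * exp (- 1 / t) + poly (flat_poly k) (1 / t) * (exp (- 1 / t) * (1 / t\<^sup>2)))) (at t)"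
      by (rule has_field_derivative_transform_within_open[of _ _ _ "{0<..}"]) (use 2 in \<open>auto simp: flat_def\<close>)
    also have "(poly (pderiv (flat_poly k)) (1 / t) * (- 1 / t\<^sup>2) * exp (- 1 / t) + poly (flat_poly k) (1 / t) * (exp (- 1 / t) * (1 / t\<^sup>2)))
        = flat (Suc k) t"
      using 2 by (simp add: flat_def algebra_simps power2_eq_square)
    finally show ?thesis .
  next
    case 3
    have "((\<lambda>h. flat k h / h) \<longlongrightarrow> 0) (at 0)"
      unfolding filterlim_split_at_real
    proof (rule filterlim_split_at)
      show "((\<lambda>h. flat k h / h) \<longlongrightarrow> 0) (at_left 0)"
        by (rule tendsto_eventually) (auto simp: eventually_at_filter flat_def)
      have "((\<lambda>h. poly ([:0, 1:] * flat_poly k) (1 / h) * exp (- (1 / h))) \<longlongrightarrow> 0) (at_right 0)"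
        by (rule filterlim_compose[OF poly_times_exp_minus_tendsto_0])
           (use filterlim_inverse_at_top_right in \<open>simp add: inverse_eq_divide\<close>)
      moreover have "eventually (\<lambda>h. poly ([:0, 1:] * flat_poly k) (1 / h) * exp (- (1 / h)) = flat k h / h) (at_right 0)"
        by (auto simp: eventually_at_filter flat_def)
      ultimately show "((\<lambda>h. flat k h / h) \<longlongrightarrow> 0) (at_right 0)"
        by (rule Lim_transform_eventually)
    qed
    then show ?thesis
      using 3 by (simp add: DERIV_def flat_def)
  qed
qed

lemma leibniz_derivative_sequence:
  fixes A B :: "nat \<Rightarrow> real \<Rightarrow> real"
  assumes A: "\<And>k t. (A k has_real_derivative A (Suc k) t) (at t)"
    and B: "\<And>k t. (B k has_real_derivative B (Suc k) t) (at t)"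
  defines "D \<equiv> \<lambda>k t. \<Sum>i\<le>k. of_nat (k choose i) * A i t * B (k - i) t"
  shows "(D k has_real_derivative D (Suc k) t) (at t)"
proof -
  have "(D k has_real_derivative (\<Sum>i\<le>k. of_nat (k choose i) * (A (Suc i) t * B (k - i) t + A i t * B (Suc (k - i)) t))) (at t)"
    unfolding D_def
    by (rule DERIV_sum) (auto intro!: derivative_eq_intros A B simp: algebra_simps)
  also have "(\<Sum>i\<le>k. of_nat (k choose i) * (A (Suc i) t * B (k - i) t + A i t * B (Suc (k - i)) t)) = D (Suc k) t"
  proof -
    let ?T = "\<lambda>i. A i t * B (Suc k - i) t"
    have "(\<Sum>i\<le>k. of_nat (k choose i) * (A (Suc i) t * B (k - i) t + A i t * B (Suc (k - i)) t))
       = (\<Sum>i\<le>k. of_nat (k choose i) * ?T (Suc i)) + (\<Sum>i\<le>k. of_nat (k choose i) * ?T i)"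
      unfolding sum.distrib[symmetric]
      by (rule sum.cong) (auto simp: algebra_simps Suc_diff_le)
    also have "(\<Sum>i\<le>k. of_nat (k choose i) * ?T i) = (\<Sum>i\<le>Suc k. of_nat (k choose i) * ?T i)"
      by simp
    also have "\<dots> = ?T 0 + (\<Sum>i\<le>k. of_nat (k choose Suc i) * ?T (Suc i))"
      by (subst sum.atMost_Suc_shift) simp
    also have "(\<Sum>i\<le>k. of_nat (k choose i) * ?T (Suc i)) + (?T 0 + (\<Sum>i\<le>k. of_nat (k choose Suc i) * ?T (Suc i)))
       = ?T 0 + (\<Sum>i\<le>k. of_nat (Suc k choose Suc i) * ?T (Suc i))"
      by (simp add: sum.distrib algebra_simps)
    also have "\<dots> = (\<Sum>i\<le>Suc k. of_nat (Suc k choose i) * ?T i)"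
      by (subst sum.atMost_Suc_shift) simp
    finally show ?thesis unfolding D_def by (simp add: mult.assoc)
  qed
  finally show ?thesis .
qed

text \<open>The product of \<open>flat 0 (1/2 + t)\<close> and \<open>flat 0 (1/2 - t)\<close>, divided by its integral.\<close>

lemma bump_exists:
  obtains \<rho> :: "nat \<Rightarrow> real \<Rightarrow> real" where
    "\<And>k t. (\<rho> k has_real_derivative \<rho> (Suc k) t) (at t)"
    "\<And>k t. \<bar>t\<bar> \<ge> 1 / 2 \<Longrightarrow> \<rho> k t = 0"
    "\<And>t. \<rho> 0 (- t) = \<rho> 0 t" "\<And>t. \<rho> 0 t \<ge> 0"
    "integral\<^sup>L lborel (\<rho> 0) = 1"
proof -
  define A where "A = (\<lambda>k t. flat k (1 / 2 + t))"
  define B where "B = (\<lambda>k t. (- 1) ^ k * flat k (1 / 2 - t))"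
  define D where "D = (\<lambda>k t. \<Sum>i\<le>k. of_nat (k choose i) * A i t * B (k - i) t)"
  have A: "(A k has_real_derivative A (Suc k) t) (at t)" for k t
    unfolding A_def using flat_has_derivative[of k "1 / 2 + t"]
    by (rule DERIV_chain2[THEN DERIV_cong]) (auto intro!: derivative_eq_intros)
  have B: "(B k has_real_derivative B (Suc k) t) (at t)" for k t
  proof -
    have "((\<lambda>t. flat k (1 / 2 - t)) has_real_derivative flat (Suc k) (1 / 2 - t) * (- 1)) (at t)"
      using flat_has_derivative[of k "1 / 2 - t"]
      by (rule DERIV_chain2) (auto intro!: derivative_eq_intros)
    from DERIV_cmult[OF this, of "(- 1) ^ k"] show ?thesis unfolding B_def by simp
  qed
  have D: "(D k has_real_derivative D (Suc k) t) (at t)" for k t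
    unfolding D_def by (rule leibniz_derivative_sequence[of A B, OF A B])
  have D_supp: "D k t = 0" if "\<bar>t\<bar> \<ge> 1 / 2" for k t
    unfolding D_def
  proof (rule sum.neutral, rule ballI)
    fix i
    have "t \<ge> 1 / 2 \<or> t \<le> - 1 / 2" using that by linarith
    then show "of_nat (k choose i) * A i t * B (k - i) t = 0"
      by (auto simp: A_def B_def flat_def)
  qed
  have D_even: "D 0 (- t) = D 0 t" for t by (simp add: D_def A_def B_def)
  have D0: "D 0 t = A 0 t * B 0 t" for t by (simp add: D_def)
  have D_nn: "D 0 t \<ge> 0" for t unfolding D0 by (simp add: A_def B_def flat_def)
  have D_cont: "continuous_on S (D k)" for k S
    using D by (meson DERIV_isCont continuous_at_imp_continuous_on)
  define J where "J = integral\<^sup>L lborel (D 0)"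
  have int: "integrable lborel (D 0)"
  proof -
    have "set_integrable lborel {-1..1} (D 0)"
      using borel_integrable_compact[OF _ D_cont, of "{-1..1}" 0] by (simp add: set_integrable_def)
    moreover have "D 0 x = 0" if "x \<notin> {-1..1}" for x
      using that by (intro D_supp) auto
    then have "(\<lambda>x. indicat_real {-1..1} x *\<^sub>R D 0 x) = D 0"
      by (auto simp: fun_eq_iff indicator_def)
    ultimately show ?thesis unfolding set_integrable_def by simp
  qed
  have "J > 0"
  proof (rule ccontr)
    assume "\<not> J > 0"
    moreover have "J \<ge> 0" unfolding J_def by (rule Bochner_Integration.integral_nonneg) (simp add: D_nn)
    ultimately have "J = 0" by simp
    then have "AE x in lborel. D 0 x = 0"
      using integral_nonneg_eq_0_iff_AE[OF int] D_nn unfolding J_def by auto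
    then have "AE x in lborel. x \<notin> {- 1/2<..<1/2 :: real}"
      by eventually_elim (auto simp: D0 A_def B_def flat_def split: if_splits)
    then have "{- 1/2<..<1/2 :: real} \<in> null_sets lborel"
      by (subst AE_iff_null_sets) auto
    then have "emeasure lborel {- 1/2<..<1/2 :: real} = 0" by (rule null_setsD1)
    then show False by simp
  qed
  show ?thesis
  proof (rule that[of "\<lambda>k t. D k t / J"])
    show "((\<lambda>t. D k t / J) has_real_derivative D (Suc k) t / J) (at t)" for k t
      by (rule DERIV_cdivide[OF D])
    show "integral\<^sup>L lborel (\<lambda>t. D 0 t / J) = 1"
      using \<open>J > 0\<close> unfolding J_def by simp
  qed (use D_supp D_even D_nn \<open>J > 0\<close> in auto)
qed

section \<open>Fourier--Laplace transforms of functions with compact support\<close>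

definition fourier_laplace :: "(real \<Rightarrow> complex) \<Rightarrow> complex \<Rightarrow> complex" where
  "fourier_laplace f z = (LINT t|lborel. f t * exp (- \<i> * of_real t * z))"

lemma fourier_eq_fourier_laplace: "fourier f x = fourier_laplace f (of_real x)"
  by (simp add: fourier_def fourier_laplace_def)

lemma integrable_compact_support:
  fixes h :: "real \<Rightarrow> complex"
  assumes cont: "continuous_on UNIV h" and supp: "\<And>t. \<bar>t\<bar> \<ge> 1 \<Longrightarrow> h t = 0"
  shows "integrable lborel h" and "integral\<^sup>L lborel h = integral {-1..1} h"
proof -
  have eq: "(\<lambda>x. indicat_real {-1..1} x *\<^sub>R h x) = h"
    by (auto simp: fun_eq_iff indicator_def supp)
  have si: "set_integrable lborel {-1..1} h"
    using borel_integrable_compact[of "{-1..1}" h] continuous_on_subset[OF cont]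
    by (simp add: set_integrable_def)
  then show "integrable lborel h" unfolding set_integrable_def eq .
  show "integral\<^sup>L lborel h = integral {-1..1} h"
    using set_borel_integral_eq_integral(2)[OF si] unfolding set_lebesgue_integral_def eq by simp
qed

lemma integral_derivative_compact_support:
  fixes h h' :: "real \<Rightarrow> complex"
  assumes h: "\<And>t. (h has_vector_derivative h' t) (at t)" and cont: "continuous_on UNIV h'"
    and supp: "\<And>t. \<bar>t\<bar> \<ge> 1 \<Longrightarrow> h t = 0" "\<And>t. \<bar>t\<bar> \<ge> 1 \<Longrightarrow> h' t = 0"
  shows "integral\<^sup>L lborel h' = 0"
proof -
  have "(h' has_integral h 1 - h (- 1)) {-1..1}"
    by (rule fundamental_theorem_of_calculus) (use h in \<open>auto intro: has_vector_derivative_at_within\<close>)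
  then have "integral {-1..1} h' = 0" using supp(1)[of 1] supp(1)[of "-1"] by (simp add: integral_unique)
  then show ?thesis using integrable_compact_support(2)[OF cont supp(2)] by simp
qed

lemma fourier_laplace_field_derivative:
  assumes cont: "continuous_on UNIV f" and supp: "\<And>t. \<bar>t\<bar> \<ge> 1 \<Longrightarrow> f t = 0"
  shows "(fourier_laplace f has_field_derivative fourier_laplace (\<lambda>t. - \<i> * of_real t * f t) z) (at z)"
proof -
  have cf: "continuous_on A (\<lambda>x. f (g x))" if "continuous_on A g" for A and g :: "'b::topological_space \<Rightarrow> real"
    by (rule continuous_on_compose2[OF cont that]) simp
  have eq: "fourier_laplace f = (\<lambda>z. integral (cbox (-1) 1) (\<lambda>t. f t * exp (- \<i> * of_real t * z)))"
    unfolding fourier_laplace_def fun_eq_iff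
    by (auto intro!: integrable_compact_support(2) continuous_intros cont simp: supp)
  have eq': "fourier_laplace (\<lambda>t. - \<i> * of_real t * f t) z = integral (cbox (-1) 1) (\<lambda>t. f t * (exp (- \<i> * of_real t * z) * (- \<i> * of_real t)))"
  proof -
    have "fourier_laplace (\<lambda>t. - \<i> * of_real t * f t) z = (LINT t|lborel. f t * (exp (- \<i> * of_real t * z) * (- \<i> * of_real t)))"
      unfolding fourier_laplace_def by (simp add: mult_ac)
    also have "\<dots> = integral {-1..1} (\<lambda>t. f t * (exp (- \<i> * of_real t * z) * (- \<i> * of_real t)))"
      by (rule integrable_compact_support(2)) (auto intro!: continuous_intros cont simp: supp)
    finally show ?thesis by simp
  qed
  show ?thesis unfolding eq'
    unfolding eq
  proof (rule leibniz_rule_field_derivative[where U = UNIV])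
    show "((\<lambda>x. f t * exp (- \<i> * of_real t * x)) has_field_derivative f t * (exp (- \<i> * of_real t * x) * (- \<i> * of_real t))) (at x within UNIV)" for x t
      by (auto intro!: derivative_eq_intros)
    show "(\<lambda>t. f t * exp (- \<i> * of_real t * x)) integrable_on cbox (-1) 1" for x
      by (intro integrable_continuous continuous_intros cf)
    show "continuous_on (UNIV \<times> cbox (-1) 1) (\<lambda>(x, t). f t * (exp (- \<i> * of_real t * x) * (- \<i> * of_real t)))"
      unfolding case_prod_beta by (intro continuous_intros cf)
  qed auto
qed

lemma norm_fourier_laplace_le:
  assumes cont: "continuous_on UNIV f" and supp: "\<And>t. \<bar>t\<bar> \<ge> 1 \<Longrightarrow> f t = 0"
  shows "norm (fourier_laplace f z) \<le> (LINT t|lborel. norm (f t)) * exp \<bar>Im z\<bar>"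
proof -
  have "norm (fourier_laplace f z) \<le> (LINT t|lborel. norm (f t * exp (- \<i> * of_real t * z)))"
    unfolding fourier_laplace_def by (rule integral_norm_bound)
  also have "\<dots> \<le> (LINT t|lborel. norm (f t) * exp \<bar>Im z\<bar>)"
  proof (rule integral_mono)
    show "integrable lborel (\<lambda>t. norm (f t * exp (- \<i> * of_real t * z)))"
      by (intro integrable_norm integrable_compact_support(1)) (auto intro!: continuous_intros cont simp: supp)
    show "integrable lborel (\<lambda>t. norm (f t) * exp \<bar>Im z\<bar>)"
      by (intro integrable_mult_left integrable_norm integrable_compact_support(1)) (auto intro!: cont simp: supp)
    fix t
    show "norm (f t * exp (- \<i> * of_real t * z)) \<le> norm (f t) * exp \<bar>Im z\<bar>"
    proof (cases "\<bar>t\<bar> \<ge> 1")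
      case False
      have "t * Im z \<le> \<bar>t\<bar> * \<bar>Im z\<bar>" by (metis abs_ge_self abs_mult)
      also have "\<dots> \<le> 1 * \<bar>Im z\<bar>" using False by (intro mult_right_mono) auto
      finally show ?thesis by (auto simp: norm_mult intro!: mult_left_mono)
    qed (simp add: supp)
  qed
  finally show ?thesis by simp
qed

lemma fourier_laplace_derivative:
  assumes f: "\<And>t. (f has_vector_derivative f' t) (at t)" and cont: "continuous_on UNIV f'"
    and supp: "\<And>t. \<bar>t\<bar> \<ge> 1 \<Longrightarrow> f t = 0" "\<And>t. \<bar>t\<bar> \<ge> 1 \<Longrightarrow> f' t = 0"
  shows "fourier_laplace f' z = \<i> * z * fourier_laplace f z"
proof -
  have cf: "continuous_on UNIV f"
    using f by (meson continuous_at_imp_continuous_on has_vector_derivative_continuous)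
  let ?e = "\<lambda>t. exp (- \<i> * of_real t * z)"
  have e: "(?e has_vector_derivative - \<i> * z * ?e t) (at t)" for t
    by (rule has_vector_derivative_real_field[of "\<lambda>u. exp (- \<i> * u * z)"]) (auto intro!: derivative_eq_intros)
  have "(LINT t|lborel. f t * (- \<i> * z * ?e t) + f' t * ?e t) = 0"
  proof (rule integral_derivative_compact_support[of "\<lambda>t. f t * ?e t"])
    show "((\<lambda>t. f t * ?e t) has_vector_derivative f t * (- \<i> * z * ?e t) + f' t * ?e t) (at t)" for t
      by (rule has_vector_derivative_mult[OF f e])
  qed (auto intro!: continuous_intros cont cf simp: supp)
  moreover have "(LINT t|lborel. f t * (- \<i> * z * ?e t) + f' t * ?e t)
      = (LINT t|lborel. f t * (- \<i> * z * ?e t)) + (LINT t|lborel. f' t * ?e t)"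
    by (rule Bochner_Integration.integral_add)
       (auto intro!: integrable_compact_support(1) continuous_intros cont cf simp: supp)
  moreover have "(LINT t|lborel. f t * (- \<i> * z * ?e t)) = - \<i> * z * fourier_laplace f z"
    unfolding fourier_laplace_def by (subst integral_mult_right_zero[symmetric]) (simp add: mult_ac)
  ultimately show ?thesis unfolding fourier_laplace_def by (simp add: algebra_simps)
qed

section \<open>The kernel of the partial fraction expansion\<close>

text \<open>The ratio \<open>s\<close> of \<open>norm z\<close> to \<open>\<bar>Im z\<bar>\<close> measures how close \<open>z\<close> is to the real axis in direction. Each of
\<open>norm (t - z)\<close> and \<open>norm (t + z)\<close> is at least \<open>norm z / s\<close> and at least \<open>\<bar>t\<bar> / s\<close>. The growth
estimates below are stated in powers of \<open>s\<close>.\<close>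

lemma norm_diff_squares_lower:
  fixes t :: real and z :: complex
  assumes "Im z \<noteq> 0"
  defines "s \<equiv> norm z / \<bar>Im z\<bar>"
  shows "t\<^sup>2 + (norm z)\<^sup>2 \<le> 2 * s\<^sup>2 * norm ((of_real t)\<^sup>2 - z\<^sup>2)"
proof -
  have y0: "(Im z)\<^sup>2 > 0" using assms(1) by simp
  have s2: "s\<^sup>2 * (Im z)\<^sup>2 = (norm z)\<^sup>2" using assms(1) by (simp add: s_def power_divide)
  have one: "t\<^sup>2 + (norm z)\<^sup>2 \<le> 2 * (s\<^sup>2 * (norm (of_real t - u))\<^sup>2)"
    if u: "(Im u)\<^sup>2 = (Im z)\<^sup>2" "(Re u)\<^sup>2 = (Re z)\<^sup>2" for u :: complex
  proof -
    have n2: "(norm (of_real t - u))\<^sup>2 = (t - Re u)\<^sup>2 + (Im z)\<^sup>2"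
      using u by (simp add: cmod_power2)
    have nz: "(norm z)\<^sup>2 = (Re u)\<^sup>2 + (Im z)\<^sup>2" using u by (simp add: cmod_power2)
    have a: "(norm z)\<^sup>2 \<le> s\<^sup>2 * (norm (of_real t - u))\<^sup>2"
      unfolding n2 using s2 by (simp add: distrib_left)
    have "t\<^sup>2 * (Im z)\<^sup>2 \<le> (norm z)\<^sup>2 * (norm (of_real t - u))\<^sup>2"
    proof -
      have "(norm z)\<^sup>2 * (norm (of_real t - u))\<^sup>2 - t\<^sup>2 * (Im z)\<^sup>2 = (t * Re u - (Re u)\<^sup>2 - (Im z)\<^sup>2)\<^sup>2"
        unfolding n2 nz by (simp add: power2_eq_square algebra_simps)
      then show ?thesis using zero_le_power2[of "t * Re u - (Re u)\<^sup>2 - (Im z)\<^sup>2"] by linarith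
    qed
    also have "\<dots> = (s\<^sup>2 * (norm (of_real t - u))\<^sup>2) * (Im z)\<^sup>2" using s2 by (simp add: mult_ac)
    finally have b: "t\<^sup>2 \<le> s\<^sup>2 * (norm (of_real t - u))\<^sup>2" using y0 by simp
    show ?thesis using a b by simp
  qed
  have "(t\<^sup>2 + (norm z)\<^sup>2)\<^sup>2 \<le> (2 * (s\<^sup>2 * (norm (of_real t - z))\<^sup>2)) * (2 * (s\<^sup>2 * (norm (of_real t - (- z)))\<^sup>2))"
    unfolding power2_eq_square[of "t\<^sup>2 + (norm z)\<^sup>2"] by (intro mult_mono one) auto
  also have "\<dots> = (2 * s\<^sup>2 * (norm (of_real t - z) * norm (of_real t - (- z))))\<^sup>2"
    by (simp add: power2_eq_square mult_ac)
  also have "norm (of_real t - z) * norm (of_real t - (- z)) = norm ((of_real t)\<^sup>2 - z\<^sup>2)"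
    unfolding norm_mult[symmetric] by (simp add: power2_eq_square algebra_simps)
  finally show ?thesis by (rule power2_le_imp_le) simp
qed

text \<open>Twice the alternating sum of \<open>kappa e z\<close> over the zeros \<open>\<tau>\<close> is the partial fraction expansion of
\<open>\<Phi>\<^sub>1' / \<Phi>\<^sub>1 - \<Phi>\<^sub>2' / \<Phi>\<^sub>2\<close> at \<open>z\<close>, with \<open>e\<close> the parity \<open>\<epsilon>\<close>. The kernel \<open>kappa'\<close> is its derivative in \<open>t\<close>.\<close>

definition kappa :: "nat \<Rightarrow> complex \<Rightarrow> real \<Rightarrow> complex" where
  "kappa e z t = of_real t ^ (1 - e) * z ^ e / ((of_real t)\<^sup>2 - z\<^sup>2)"

definition kappa' :: "nat \<Rightarrow> complex \<Rightarrow> real \<Rightarrow> complex" where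
  "kappa' e z t = (if e = 0 then - ((of_real t)\<^sup>2 + z\<^sup>2) / ((of_real t)\<^sup>2 - z\<^sup>2)\<^sup>2
     else - 2 * of_real t * z / ((of_real t)\<^sup>2 - z\<^sup>2)\<^sup>2)"

lemma of_real_square_neq_square: "Im z \<noteq> 0 \<Longrightarrow> (of_real t)\<^sup>2 - z\<^sup>2 \<noteq> 0"
proof
  assume "Im z \<noteq> 0" "(of_real t)\<^sup>2 - z\<^sup>2 = 0"
  then have "z = of_real t \<or> z = - of_real t" using power2_eq_iff[of "of_real t" z] by auto
  then show False using \<open>Im z \<noteq> 0\<close> by auto
qed

lemma kappa_deriv:
  assumes "Im z \<noteq> 0" "e = 0 \<or> e = 1"
  shows "(kappa e z has_vector_derivative kappa' e z t) (at t)"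
proof -
  let ?K = "\<lambda>u. u ^ (1 - e) * z ^ e / (u\<^sup>2 - z\<^sup>2)"
  have "(?K has_field_derivative kappa' e z t) (at (of_real t))"
    using of_real_square_neq_square[OF assms(1), of t] assms(2)
    by (auto intro!: derivative_eq_intros simp: kappa'_def power2_eq_square divide_simps)
  then show ?thesis unfolding kappa_def
    by (rule has_vector_derivative_real_field[where f = ?K])
qed

lemma continuous_on_kappa': "Im z \<noteq> 0 \<Longrightarrow> continuous_on S (kappa' e z)"
  unfolding kappa'_def using of_real_square_neq_square
  by (cases "e = 0") (auto intro!: continuous_intros)

lemma norm_kappa'_le:
  assumes "Im z \<noteq> 0"
  shows "norm (kappa' e z t) \<le> 4 * (norm z / \<bar>Im z\<bar>) ^ 4 / (t\<^sup>2 + (norm z)\<^sup>2)"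
proof -
  let ?D = "norm ((of_real t)\<^sup>2 - z\<^sup>2)" and ?s = "norm z / \<bar>Im z\<bar>" and ?n = "t\<^sup>2 + (norm z)\<^sup>2"
  have z0: "z \<noteq> 0" using assms by auto
  have n0: "?n > 0" using z0 by (simp add: add_nonneg_pos)
  have D0: "?D > 0" using of_real_square_neq_square[OF assms] by simp
  have s2: "?s ^ 4 = (?s\<^sup>2)\<^sup>2" by simp
  have num: "norm (kappa' e z t) \<le> ?n / ?D\<^sup>2"
  proof (cases "e = 0")
    case True
    have "norm ((of_real t)\<^sup>2 + z\<^sup>2) \<le> ?n"
      using norm_triangle_ineq[of "(of_real t)\<^sup>2" "z\<^sup>2"] by (simp add: norm_power)
    then have "norm ((of_real t)\<^sup>2 + z\<^sup>2) / ?D\<^sup>2 \<le> ?n / ?D\<^sup>2" by (rule divide_right_mono) simp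
    then show ?thesis using True by (simp add: kappa'_def norm_divide norm_power norm_minus_commute del: norm_minus_cancel flip: norm_minus_cancel[of "(of_real t)\<^sup>2 + z\<^sup>2"])
  next
    case False
    have "2 * \<bar>t\<bar> * norm z \<le> ?n" using sum_squares_bound[of "\<bar>t\<bar>" "norm z"] by simp
    then have "2 * \<bar>t\<bar> * norm z / ?D\<^sup>2 \<le> ?n / ?D\<^sup>2" by (rule divide_right_mono) simp
    then show ?thesis using False by (simp add: kappa'_def norm_divide norm_power norm_mult)
  qed
  have "?n * ?n \<le> (2 * ?s\<^sup>2 * ?D) * (2 * ?s\<^sup>2 * ?D)"
    using norm_diff_squares_lower[OF assms, of t] n0 by (intro mult_mono) auto
  also have "\<dots> = 4 * ?s ^ 4 * ?D\<^sup>2" unfolding s2 by (simp add: power2_eq_square mult_ac)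
  finally have prod: "?n * ?n \<le> 4 * ?s ^ 4 * ?D\<^sup>2" .
  have "n / D \<le> X / n" if "n > 0" "D > 0" "n * n \<le> X * D" for n D X :: real
    using that by (simp add: divide_simps mult_ac)
  from this[OF n0 _ prod] have "?n / ?D\<^sup>2 \<le> 4 * ?s ^ 4 / ?n"
    using D0 by simp
  with num show ?thesis by linarith
qed

lemma integral_inverse_square_scaled:
  assumes "r > 0"
  shows "integrable lborel (\<lambda>t::real. 1 / (t\<^sup>2 + r\<^sup>2))"
    and "(LINT t|lborel. 1 / (t\<^sup>2 + r\<^sup>2)) = (LINT x|lborel. 1 / (1 + x\<^sup>2)) / r"
proof -
  have eq: "1 / (t\<^sup>2 + r\<^sup>2) = (1 / r\<^sup>2) * (1 / (1 + (0 + (1 / r) * t)\<^sup>2))" for t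
    using assms by (simp add: power_mult_distrib power_divide field_simps)
  have i: "integrable lborel (\<lambda>t. 1 / (1 + (0 + (1 / r) * t)\<^sup>2))"
    by (rule lborel_integrable_real_affine[OF integrable_inverse_1_plus_square_UNIV]) (use assms in simp)
  show "integrable lborel (\<lambda>t::real. 1 / (t\<^sup>2 + r\<^sup>2))"
    unfolding eq by (intro integrable_mult_right i)
  have "(LINT x::real|lborel. 1 / (1 + x\<^sup>2)) = \<bar>1 / r\<bar> *\<^sub>R (LINT t|lborel. 1 / (1 + (0 + (1 / r) * t)\<^sup>2))"
    by (rule lborel_integral_real_affine) (use assms in simp)
  then have *: "(LINT t|lborel. 1 / (1 + (0 + (1 / r) * t)\<^sup>2)) = r * (LINT x::real|lborel. 1 / (1 + x\<^sup>2))"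
    using assms by (simp add: field_simps)
  show "(LINT t|lborel. 1 / (t\<^sup>2 + r\<^sup>2)) = (LINT x|lborel. 1 / (1 + x\<^sup>2)) / r"
    unfolding eq integral_mult_right_zero * using assms by (simp add: power2_eq_square)
qed

lemma kappa'_integrable:
  assumes "Im z \<noteq> 0"
  shows "integrable lborel (kappa' e z)"
    and "(LINT t|lborel. norm (kappa' e z t)) \<le> 4 * (norm z / \<bar>Im z\<bar>) ^ 4 * (LINT x|lborel. 1 / (1 + x\<^sup>2)) / norm z"
proof -
  let ?C = "4 * (norm z / \<bar>Im z\<bar>) ^ 4"
  have z0: "norm z > 0" using assms by auto
  have dom: "integrable lborel (\<lambda>t. ?C * (1 / (t\<^sup>2 + (norm z)\<^sup>2)))"
    by (intro integrable_mult_right integral_inverse_square_scaled(1) z0)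
  have le: "norm (kappa' e z t) \<le> ?C * (1 / (t\<^sup>2 + (norm z)\<^sup>2))" for t
    using norm_kappa'_le[OF assms, of e t] by simp
  show i: "integrable lborel (kappa' e z)"
  proof (rule Bochner_Integration.integrable_bound[OF dom])
    show "kappa' e z \<in> borel_measurable lborel"
      using borel_measurable_continuous_onI[OF continuous_on_kappa'[OF assms]] by simp
    show "AE t in lborel. norm (kappa' e z t) \<le> norm (?C * (1 / (t\<^sup>2 + (norm z)\<^sup>2)))"
      using le by (auto intro!: AE_I2 order_trans[OF _ abs_ge_self] simp del: abs_mult)
  qed
  have "(LINT t|lborel. norm (kappa' e z t)) \<le> (LINT t|lborel. ?C * (1 / (t\<^sup>2 + (norm z)\<^sup>2)))"
    by (rule integral_mono[OF integrable_norm[OF i] dom le])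
  also have "\<dots> = ?C * (LINT x|lborel. 1 / (1 + x\<^sup>2)) / norm z"
    unfolding integral_mult_right_zero integral_inverse_square_scaled(2)[OF z0] by simp
  finally show "(LINT t|lborel. norm (kappa' e z t)) \<le> ?C * (LINT x|lborel. 1 / (1 + x\<^sup>2)) / norm z" .
qed

lemma kappa_tendsto_0:
  assumes "e = 0 \<or> e = 1"
  shows "(kappa e z \<longlongrightarrow> 0) at_top"
proof (rule Lim_null_comparison)
  show "eventually (\<lambda>t. norm (kappa e z t) \<le> (t + norm z) / (t\<^sup>2 - (norm z)\<^sup>2)) at_top"
    using eventually_gt_at_top[of "norm z"]
  proof eventually_elim
    case (elim t)
    then have t0: "t > 0" using norm_ge_zero[of z] by linarith
    have "norm (of_real t ^ (1 - e) * z ^ e) \<le> t + norm z"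
      using assms t0 by (auto simp: norm_mult)
    moreover have "t\<^sup>2 - (norm z)\<^sup>2 \<le> norm ((of_real t)\<^sup>2 - z\<^sup>2)"
      using norm_triangle_ineq2[of "(of_real t)\<^sup>2" "z\<^sup>2"] by (simp add: norm_power)
    moreover have "t\<^sup>2 - (norm z)\<^sup>2 > 0" using elim by (simp add: power_strict_mono)
    ultimately show ?case
      unfolding kappa_def norm_divide using t0 by (intro frac_le) auto
  qed
  show "((\<lambda>t. (t + norm z) / (t\<^sup>2 - (norm z)\<^sup>2)) \<longlongrightarrow> 0) at_top" by real_asymp
qed

section \<open>Sums of reciprocals of shifted squares\<close>

text \<open>Comparison of the sum with the integral of \<open>1 / (c\<^sup>2 t\<^sup>2 + r\<^sup>2)\<close>, an arctangent.\<close>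

lemma sum_inverse_squares_le:
  fixes s :: "nat \<Rightarrow> real"
  assumes c: "c > 0" and s: "\<And>k. s (Suc k) \<ge> c * real (Suc k)" and r: "r > 0"
  shows "(\<Sum>k<n. 1 / ((s (Suc k))\<^sup>2 + r\<^sup>2)) \<le> pi / (2 * c * r)"
proof -
  define A where "A = (\<lambda>t. arctan (c * t / r) / (c * r))"
  have "1 / ((s (Suc k))\<^sup>2 + r\<^sup>2) \<le> A (real (Suc k)) - A (real k)" for k
  proof -
    have dA: "(A has_real_derivative 1 / ((c * t)\<^sup>2 + r\<^sup>2)) (at t)" for t
      unfolding A_def using c r
      by (auto intro!: derivative_eq_intros simp: power2_eq_square divide_simps)
    obtain t where t: "real k < t" "t < real (Suc k)"
      and eq: "A (real (Suc k)) - A (real k) = (real (Suc k) - real k) * (1 / ((c * t)\<^sup>2 + r\<^sup>2))"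
      using MVT2[of "real k" "real (Suc k)" A "\<lambda>t. 1 / ((c * t)\<^sup>2 + r\<^sup>2)"] dA by auto
    have "c * t \<le> s (Suc k)" using s[of k] mult_left_mono[of t "real (Suc k)" c] t c by linarith
    then have "(c * t)\<^sup>2 \<le> (s (Suc k))\<^sup>2" using t c by (intro power_mono) auto
    then have "1 / ((s (Suc k))\<^sup>2 + r\<^sup>2) \<le> 1 / ((c * t)\<^sup>2 + r\<^sup>2)"
      using r by (intro divide_left_mono mult_pos_pos add_nonneg_pos) auto
    then show ?thesis unfolding eq by simp
  qed
  then have "(\<Sum>k<n. 1 / ((s (Suc k))\<^sup>2 + r\<^sup>2)) \<le> (\<Sum>k<n. A (real (Suc k)) - A (real k))"
    by (rule sum_mono)
  also have "\<dots> = A (real n) - A 0" by (induction n) auto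
  also have "\<dots> = arctan (c * real n / r) / (c * r)" by (simp add: A_def)
  also have "\<dots> \<le> (pi / 2) / (c * r)"
    using arctan_ubound[of "c * real n / r"] c r by (intro divide_right_mono) auto
  finally show ?thesis by (simp add: mult_ac)
qed

lemma sum_inverse_squares_ge:
  fixes s :: "nat \<Rightarrow> real"
  assumes c: "c > 0" and s: "\<And>k. k \<ge> K \<Longrightarrow> 0 \<le> s (Suc k) \<and> s (Suc k) \<le> c * real (Suc k)" and r: "r > 0"
  shows "(arctan (c * (real n + 1) / r) - arctan (c * (real K + 1) / r)) / (c * r) \<le> (\<Sum>k<n. 1 / ((s (Suc k))\<^sup>2 + r\<^sup>2))"
proof -
  define A where "A = (\<lambda>t. arctan (c * t / r) / (c * r))"
  have dA: "(A has_real_derivative 1 / ((c * t)\<^sup>2 + r\<^sup>2)) (at t)" for t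
    unfolding A_def using c r
    by (auto intro!: derivative_eq_intros simp: power2_eq_square divide_simps)
  have incr: "A (real (Suc k) + 1) - A (real (Suc k)) \<le> 1 / ((s (Suc k))\<^sup>2 + r\<^sup>2)" if "k \<ge> K" for k
  proof -
    obtain t where t: "real (Suc k) < t" "t < real (Suc k) + 1"
      and eq: "A (real (Suc k) + 1) - A (real (Suc k)) = (real (Suc k) + 1 - real (Suc k)) * (1 / ((c * t)\<^sup>2 + r\<^sup>2))"
      using MVT2[of "real (Suc k)" "real (Suc k) + 1" A "\<lambda>t. 1 / ((c * t)\<^sup>2 + r\<^sup>2)"] dA by auto
    have "s (Suc k) \<le> c * t" using s[OF that] mult_left_mono[of "real (Suc k)" t c] t c by linarith
    then have "(s (Suc k))\<^sup>2 \<le> (c * t)\<^sup>2" using s[OF that] by (intro power_mono) auto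
    then have "1 / ((c * t)\<^sup>2 + r\<^sup>2) \<le> 1 / ((s (Suc k))\<^sup>2 + r\<^sup>2)"
      using r by (intro divide_left_mono mult_pos_pos add_nonneg_pos) auto
    then show ?thesis unfolding eq by simp
  qed
  have "A (real n + 1) - A (real K + 1) \<le> (\<Sum>k<n. 1 / ((s (Suc k))\<^sup>2 + r\<^sup>2))"
  proof (cases "K \<le> n")
    case True
    then show ?thesis
    proof (induction n rule: dec_induct)
      case base
      have "0 \<le> (\<Sum>k<K. 1 / ((s (Suc k))\<^sup>2 + r\<^sup>2))" by (intro sum_nonneg) simp
      then show ?case by simp
    next
      case (step m)
      then show ?case using incr[of m] by (simp add: add.commute)
    qed
  next
    case False
    then have "A (real n + 1) \<le> A (real K + 1)"
      unfolding A_def using c r by (intro divide_right_mono) (auto intro!: arctan_monotone' divide_right_mono)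
    moreover have "0 \<le> (\<Sum>k<n. 1 / ((s (Suc k))\<^sup>2 + r\<^sup>2))" by (intro sum_nonneg) simp
    ultimately show ?thesis by linarith
  qed
  then show ?thesis by (simp add: A_def diff_divide_distrib)
qed

lemma sum_inverse_squares_le':
  fixes s :: "nat \<Rightarrow> real"
  assumes c: "c > 0" and s: "\<And>k. k \<ge> K \<Longrightarrow> s (Suc k) \<ge> c * real (Suc k)" and r: "r > 0"
  shows "(\<Sum>k<n. 1 / ((s (Suc k))\<^sup>2 + r\<^sup>2)) \<le> real K / r\<^sup>2 + pi / (2 * c * r)"
proof -
  define s' where "s' = (\<lambda>k. max (s k) (c * real k))"
  have "1 / ((s (Suc k))\<^sup>2 + r\<^sup>2) \<le> (if k < K then 1 / r\<^sup>2 else 0) + 1 / ((s' (Suc k))\<^sup>2 + r\<^sup>2)" for k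
  proof (cases "k < K")
    case True
    have "1 / ((s (Suc k))\<^sup>2 + r\<^sup>2) \<le> 1 / r\<^sup>2" using r by (intro divide_left_mono mult_pos_pos add_nonneg_pos) auto
    moreover have "0 \<le> 1 / ((s' (Suc k))\<^sup>2 + r\<^sup>2)" by simp
    ultimately have "1 / ((s (Suc k))\<^sup>2 + r\<^sup>2) \<le> 1 / r\<^sup>2 + 1 / ((s' (Suc k))\<^sup>2 + r\<^sup>2)" by linarith
    then show ?thesis using True by simp
  next
    case False
    then show ?thesis using s[of k] by (simp add: s'_def max_absorb1)
  qed
  then have "(\<Sum>k<n. 1 / ((s (Suc k))\<^sup>2 + r\<^sup>2)) \<le> (\<Sum>k<n. (if k < K then 1 / r\<^sup>2 else 0) + 1 / ((s' (Suc k))\<^sup>2 + r\<^sup>2))"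
    by (rule sum_mono)
  also have "\<dots> = (\<Sum>k<n. if k < K then 1 / r\<^sup>2 else 0) + (\<Sum>k<n. 1 / ((s' (Suc k))\<^sup>2 + r\<^sup>2))"
    by (rule sum.distrib)
  also have "(\<Sum>k<n. if k < K then 1 / r\<^sup>2 else 0) \<le> real K / r\<^sup>2"
  proof -
    have "(\<Sum>k<n. if k < K then 1 / r\<^sup>2 else 0) = (\<Sum>k\<in>{..<n} \<inter> {k. k < K}. 1 / r\<^sup>2)"
      by (subst sum.inter_restrict) auto
    also have "\<dots> \<le> (\<Sum>k<K. 1 / r\<^sup>2)" by (intro sum_mono2) auto
    finally show ?thesis by simp
  qed
  also have "(\<Sum>k<n. 1 / ((s' (Suc k))\<^sup>2 + r\<^sup>2)) \<le> pi / (2 * c * r)"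
    by (rule sum_inverse_squares_le[OF c _ r]) (simp add: s'_def)
  finally show ?thesis by simp
qed

section \<open>The zeros and the two factors\<close>

text \<open>
Everything that depends only on the product formula and on the location of the zeros.
\<close>

locale real_zeros =
  fixes \<phi> :: "complex \<Rightarrow> complex" and \<tau> :: "nat \<Rightarrow> real"
  assumes zeros_mono: "strict_mono_on {1..} \<tau>"
    and zeros: "\<tau> ` {1..} = {x :: real. 0 < x \<and> \<phi> (of_real x) = 0}"
    and zeros_asymp: "\<tau> \<sim>[sequentially] (\<lambda>k. pi * real k)"
    and product: "\<And>z. (\<lambda>k. 1 - z\<^sup>2 / of_real (\<tau> (Suc k)) ^ 2) has_prod \<phi> z"
begin

lemma tau_pos: "\<tau> (Suc k) > 0"
proof -
  have "\<tau> (Suc k) \<in> \<tau> ` {1..}" by auto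
  then show ?thesis unfolding zeros by simp
qed

lemma tau_zero: "\<phi> (of_real (\<tau> (Suc k))) = 0"
proof -
  have "\<tau> (Suc k) \<in> \<tau> ` {1..}" by auto
  then show ?thesis unfolding zeros by simp
qed

lemma tau_less: "j < k \<Longrightarrow> \<tau> (Suc j) < \<tau> (Suc k)"
  using zeros_mono by (auto simp: strict_mono_on_def)

lemma tau_quotient_tendsto: "(\<lambda>k. \<tau> k / (pi * real k)) \<longlonglongrightarrow> 1"
proof -
  have "eventually (\<lambda>k. \<tau> k \<noteq> 0 \<or> pi * real k \<noteq> 0) sequentially"
    using eventually_gt_at_top[of 0] by eventually_elim simp
  with zeros_asymp show ?thesis by (rule asymp_equivD_strong)
qed

lemma tau_lower: obtains c where "c > 0" "\<And>k. \<tau> (Suc k) \<ge> c * real (Suc k)"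
proof -
  have "(\<lambda>k. inverse (\<tau> k / (pi * real k))) \<longlonglongrightarrow> inverse 1"
    by (rule tendsto_inverse[OF tau_quotient_tendsto]) simp
  then have "Bseq (\<lambda>k. inverse (\<tau> k / (pi * real k)))"
    by (rule convergent_imp_Bseq[OF convergentI])
  then obtain K where K: "K > 0" "\<And>k. norm (inverse (\<tau> k / (pi * real k))) \<le> K"
    by (auto simp: Bseq_def)
  show ?thesis
  proof (rule that[of "pi / K"])
    show "\<tau> (Suc k) \<ge> pi / K * real (Suc k)" for k
      using K(2)[of "Suc k"] K(1) tau_pos[of k] by (simp add: field_simps)
  qed (use K in simp)
qed

lemma summable_tau_sq: "summable (\<lambda>k. 1 / (\<tau> (Suc k))\<^sup>2)"
proof -
  obtain c where c: "c > 0" "\<And>k. \<tau> (Suc k) \<ge> c * real (Suc k)" using tau_lower by blast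
  have "summable (\<lambda>k. 1 / c\<^sup>2 * (1 / real (Suc k) ^ 2))"
    by (intro summable_mult) (use inverse_squares_sums in \<open>auto simp: sums_iff add_ac\<close>)
  then show ?thesis
  proof (rule summable_comparison_test'[of _ 0])
    fix k
    have "(c * real (Suc k))\<^sup>2 \<le> (\<tau> (Suc k))\<^sup>2"
      using c(1) by (intro power_mono c(2)) auto
    then have "1 / (\<tau> (Suc k))\<^sup>2 \<le> 1 / (c * real (Suc k))\<^sup>2"
      using c(1) tau_pos[of k] by (intro divide_left_mono mult_pos_pos) auto
    then show "norm (1 / (\<tau> (Suc k))\<^sup>2) \<le> 1 / c\<^sup>2 * (1 / real (Suc k) ^ 2)"
      by (simp add: power_mult_distrib)
  qed
qed

lemma tau_at_top: "filterlim (\<lambda>k. \<tau> (Suc k)) at_top sequentially"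
proof -
  obtain c where c: "c > 0" "\<And>k. \<tau> (Suc k) \<ge> c * real (Suc k)" using tau_lower by blast
  have "filterlim (\<lambda>k. c * real (Suc k)) at_top sequentially"
    using c(1) by real_asymp
  then show ?thesis by (rule filterlim_at_top_mono) (use c(2) in auto)
qed

text \<open>The sign changes of \<open>\<sigma>\<close> on the positive half-line, preceded by the left end point \<open>0\<close>.\<close>

definition nodes :: "nat \<Rightarrow> real" where
  "nodes k = (if k = 0 then 0 else \<tau> k)"

lemma nodes_0 [simp]: "nodes 0 = 0" and nodes_Suc [simp]: "nodes (Suc k) = \<tau> (Suc k)"
  by (simp_all add: nodes_def)

lemma strict_mono_nodes: "strict_mono nodes"
  unfolding strict_mono_Suc_iff
proof
  fix k show "nodes k < nodes (Suc k)"
    by (cases k) (use tau_pos tau_less in auto)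
qed

lemma nodes_at_top: "filterlim nodes at_top sequentially"
  by (subst filterlim_sequentially_Suc[symmetric]) (simp add: tau_at_top)

lemma phi_partial_products: "(\<lambda>n. \<Prod>k<n. 1 - z\<^sup>2 / of_real (\<tau> (Suc k)) ^ 2) \<longlonglongrightarrow> \<phi> z"
  using has_prod_imp_tendsto[OF product[of z]] LIMSEQ_lessThan_iff_atMost by blast

lemma phi_eq_0_iff: "\<phi> z = 0 \<longleftrightarrow> (\<exists>k. z\<^sup>2 = of_real (\<tau> (Suc k)) ^ 2)"
  using tau_pos unfolding has_prod_eq_0_iff[OF product] by (auto simp: image_iff) (metis less_numeral_extra(3))+

lemma phi_nonreal: assumes "Im z \<noteq> 0" shows "\<phi> z \<noteq> 0"
proof
  assume "\<phi> z = 0"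
  then obtain k where "z\<^sup>2 = of_real (\<tau> (Suc k)) ^ 2" unfolding phi_eq_0_iff by blast
  then show False using of_real_square_neq_square[OF assms, of "\<tau> (Suc k)"] by simp
qed

lemma phi_real: "Im (\<phi> (of_real x)) = 0"
proof -
  have "(\<lambda>n. Im (\<Prod>k<n. 1 - (of_real x)\<^sup>2 / of_real (\<tau> (Suc k)) ^ 2)) \<longlonglongrightarrow> Im (\<phi> (of_real x))"
    by (intro tendsto_Im phi_partial_products)
  moreover have "Im (\<Prod>k<n. 1 - (of_real x)\<^sup>2 / of_real (\<tau> (Suc k)) ^ 2) = 0" for n
  proof -
    have "(\<Prod>k<n. 1 - (of_real x)\<^sup>2 / of_real (\<tau> (Suc k)) ^ 2) = complex_of_real (\<Prod>k<n. 1 - x\<^sup>2 / \<tau> (Suc k) ^ 2)"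
      by simp
    then show ?thesis by (simp only: Im_complex_of_real)
  qed
  ultimately show ?thesis by (simp add: LIMSEQ_const_iff)
qed

text \<open>Between two consecutive nodes exactly the first \<open>k\<close> factors of the product are negative, and \<open>\<phi>\<close> does not
vanish, so the sign survives the limit of the partial products.\<close>

lemma signature_between_nodes:
  assumes x: "nodes k < x" "x < nodes (Suc k)"
  shows "signature \<phi> x = (-1) ^ k"
proof -
  let ?f = "\<lambda>j. 1 - x\<^sup>2 / \<tau> (Suc j) ^ 2"
  have x0: "x > 0"
    using x(1) strict_mono_nodes by (metis nodes_0 le0 le_less_trans strict_mono_less_eq)
  have neg: "?f j < 0" if "j < k" for j
  proof -
    have "\<tau> (Suc j) \<le> nodes k"
      using that strict_mono_less_eq[OF strict_mono_nodes, of "Suc j" k] by simp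
    then have "\<tau> (Suc j) ^ 2 < x\<^sup>2" using x(1) tau_pos[of j] by (intro power_strict_mono) auto
    then show ?thesis using tau_pos[of j] by simp
  qed
  have pos: "?f j > 0" if "j \<ge> k" for j
  proof -
    have "nodes (Suc k) \<le> \<tau> (Suc j)"
      using that strict_mono_less_eq[OF strict_mono_nodes, of "Suc k" "Suc j"] by simp
    then have "x\<^sup>2 < \<tau> (Suc j) ^ 2" using x(2) x0 by (intro power_strict_mono) auto
    then show ?thesis using tau_pos[of j] by simp
  qed
  have sgn_partial: "sgn (\<Prod>j<n. ?f j) = (-1) ^ min n k" for n
  proof (induction n)
    case (Suc n)
    have "sgn (?f n) = (if n < k then -1 else 1)"
    proof (cases "n < k")
      case True
      then show ?thesis using sgn_neg[OF neg[OF True]] by simp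
    next
      case False
      then have "?f n > 0" by (intro pos) simp
      from sgn_pos[OF this] show ?thesis using False by simp
    qed
    then show ?case using Suc by (cases "n = k") (auto simp: sgn_mult min_def)
  qed simp
  have "(\<lambda>n. Re (\<Prod>j<n. 1 - (of_real x)\<^sup>2 / of_real (\<tau> (Suc j)) ^ 2)) \<longlonglongrightarrow> Re (\<phi> (of_real x))"
    by (intro tendsto_Re phi_partial_products)
  moreover have "Re (\<Prod>j<n. 1 - (of_real x)\<^sup>2 / of_real (\<tau> (Suc j)) ^ 2) = (\<Prod>j<n. ?f j)" for n
  proof -
    have "(\<Prod>j<n. 1 - (of_real x)\<^sup>2 / of_real (\<tau> (Suc j)) ^ 2) = complex_of_real (\<Prod>j<n. ?f j)"
      by simp
    then show ?thesis by (simp only: Re_complex_of_real)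
  qed
  ultimately have lim: "(\<lambda>n. (-1) ^ k * (\<Prod>j<n. ?f j)) \<longlonglongrightarrow> (-1) ^ k * Re (\<phi> (of_real x))"
    by (auto intro!: tendsto_intros)
  have ev: "(-1) ^ k * (\<Prod>j<n. ?f j) \<ge> 0" if "n \<ge> k" for n
  proof -
    have "(\<Prod>j<n. ?f j) = sgn (\<Prod>j<n. ?f j) * \<bar>\<Prod>j<n. ?f j\<bar>" by (rule mult_sgn_abs[symmetric])
    also have "sgn (\<Prod>j<n. ?f j) = (-1) ^ k" using that unfolding sgn_partial by simp
    finally have "(-1) ^ k * (\<Prod>j<n. ?f j) = ((-1) ^ k * (-1) ^ k) * \<bar>\<Prod>j<n. ?f j\<bar>"
      by (simp only: mult.assoc)
    then show ?thesis by (simp flip: power_mult_distrib)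
  qed
  have ge: "(-1) ^ k * Re (\<phi> (of_real x)) \<ge> 0"
    by (rule tendsto_lowerbound[OF lim]) (auto intro!: eventually_sequentiallyI[of k] ev)
  have "\<phi> (of_real x) \<noteq> 0"
  proof
    assume "\<phi> (of_real x) = 0"
    then have "x \<in> \<tau> ` {1..}" unfolding zeros using x0 by simp
    then obtain j where "j \<ge> 1" "x = \<tau> j" by auto
    then have "x = nodes j" by (simp add: nodes_def)
    then show False using x strict_mono_less[OF strict_mono_nodes] by (metis not_less_eq)
  qed
  then have "Re (\<phi> (of_real x)) \<noteq> 0" using phi_real[of x] complex_eq_iff by auto
  then show ?thesis
    using ge unfolding signature_def by (cases "Re (\<phi> (of_real x)) > 0"; cases "even k") (auto simp: sgn_real_def)
qed

text \<open>Coefficients of the factors \<open>1 + lin_coeff d m * z + quad_coeff1 d m * z\<^sup>2\<close> of \<open>\<Phi>\<^sub>1\<close>, one for each pair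
of zeros; for \<open>\<Phi>\<^sub>2\<close> the sign of \<open>lin_coeff\<close> changes and \<open>quad_coeff2\<close> takes the place of \<open>quad_coeff1\<close>.
In this form odd and even \<open>d\<close> are treated together.\<close>

definition lin_coeff :: "nat \<Rightarrow> nat \<Rightarrow> complex" where
  "lin_coeff d m = (if odd d then 1 / of_real (\<tau> (2 * m + 2)) - 1 / of_real (\<tau> (2 * m + 1)) else 0)"

definition quad_coeff1 :: "nat \<Rightarrow> nat \<Rightarrow> complex" where
  "quad_coeff1 d m = (if odd d then - 1 / of_real (\<tau> (2 * m + 1) * \<tau> (2 * m + 2)) else - 1 / of_real (\<tau> (2 * m + 1)) ^ 2)"

definition quad_coeff2 :: "nat \<Rightarrow> nat \<Rightarrow> complex" where
  "quad_coeff2 d m = (if odd d then - 1 / of_real (\<tau> (2 * m + 1) * \<tau> (2 * m + 2)) else - 1 / of_real (\<tau> (2 * m + 2)) ^ 2)"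

lemma tau_pos': "\<tau> (2 * m + 1) > 0" "\<tau> (2 * m + 2) > 0"
  using tau_pos[of "2 * m"] tau_pos[of "Suc (2 * m)"] by simp_all

lemma summable_tau_sq_sub: "summable (\<lambda>m. 1 / (\<tau> (2 * m + 1))\<^sup>2)" "summable (\<lambda>m. 1 / (\<tau> (2 * m + 2))\<^sup>2)"
proof -
  have "summable (\<lambda>m. (\<lambda>k. 1 / (\<tau> (Suc k))\<^sup>2) (2 * m))"
    using summable_reindex[OF summable_tau_sq, of "\<lambda>m. 2 * m"] by (simp add: o_def inj_on_def)
  then show "summable (\<lambda>m. 1 / (\<tau> (2 * m + 1))\<^sup>2)" by simp
  have "summable (\<lambda>m. (\<lambda>k. 1 / (\<tau> (Suc k))\<^sup>2) (2 * m + 1))"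
    using summable_reindex[OF summable_tau_sq, of "\<lambda>m. 2 * m + 1"] by (simp add: o_def inj_on_def)
  then show "summable (\<lambda>m. 1 / (\<tau> (2 * m + 2))\<^sup>2)" by simp
qed

text \<open>Grouping in pairs makes the linear coefficients summable: \<open>1 / \<tau> (2m + 1) - 1 / \<tau> (2m + 2)\<close> is at most the
telescoping difference \<open>1 / \<tau> (2m + 1) - 1 / \<tau> (2m + 3)\<close>.\<close>

lemma summable_lin_coeff: "summable (\<lambda>m. norm (lin_coeff d m))"
proof (cases "odd d")
  case True
  let ?t = "\<lambda>m. 1 / \<tau> (2 * m + 1)"
  have eq: "norm (lin_coeff d m) \<le> ?t m - ?t (Suc m)" for m
  proof -
    have a: "1 / \<tau> (2 * m + 2) < ?t m" "?t (Suc m) < 1 / \<tau> (2 * m + 2)"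
      using tau_pos' tau_pos'[of "Suc m"] tau_less[of "2 * m" "2 * m + 1"] tau_less[of "2 * m + 1" "2 * m + 2"]
      by (auto intro!: divide_strict_left_mono)
    have "lin_coeff d m = of_real (1 / \<tau> (2 * m + 2) - ?t m)" using True by (simp add: lin_coeff_def)
    then have "norm (lin_coeff d m) = ?t m - 1 / \<tau> (2 * m + 2)" using a(1) by (simp only: norm_of_real)
    then show ?thesis using a(2) by linarith
  qed
  have "?t \<longlonglongrightarrow> 0"
  proof -
    have "filterlim (\<lambda>m. \<tau> (Suc (2 * m))) at_top sequentially"
      by (rule filterlim_compose[OF tau_at_top]) (rule filterlim_subseq, simp add: strict_mono_def)
    then show ?thesis by (intro tendsto_divide_0[OF tendsto_const] filterlim_at_top_imp_at_infinity) simp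
  qed
  then have "summable (\<lambda>m. ?t m - ?t (Suc m))" using telescope_summable' by blast
  then show ?thesis by (rule summable_comparison_test'[of _ 0]) (use eq in simp)
qed (simp add: lin_coeff_def)

lemma summable_quad_coeff1: "summable (\<lambda>m. norm (quad_coeff1 d m))"
proof (rule summable_comparison_test'[OF summable_tau_sq_sub(1), of 0])
  fix m
  show "norm (norm (quad_coeff1 d m)) \<le> 1 / (\<tau> (2 * m + 1))\<^sup>2"
    using tau_pos'[of m] tau_less[of "2 * m" "2 * m + 1"]
    by (auto simp: quad_coeff1_def norm_divide norm_mult norm_power power2_eq_square intro!: divide_left_mono)
qed

lemma summable_quad_coeff2: "summable (\<lambda>m. norm (quad_coeff2 d m))"
proof (rule summable_comparison_test'[of "\<lambda>m. 1 / (\<tau> (2 * m + 1))\<^sup>2" 0, OF summable_tau_sq_sub(1)])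
  fix m
  show "norm (norm (quad_coeff2 d m)) \<le> 1 / (\<tau> (2 * m + 1))\<^sup>2"
    using tau_pos'[of m] tau_less[of "2 * m" "2 * m + 1"]
    by (auto simp: quad_coeff2_def norm_divide norm_mult norm_power power2_eq_square intro!: divide_left_mono mult_mono)
qed

lemma Phi1_factor:
  "Phi1 d \<tau> z = (\<Prod>m. 1 + lin_coeff d m * z + quad_coeff1 d m * z\<^sup>2)"
proof -
  have o: "(1 - z / of_real (\<tau> (2 * m + 1))) * (1 + z / of_real (\<tau> (2 * m + 2))) = 1 + lin_coeff d m * z + quad_coeff1 d m * z\<^sup>2" if "odd d" for m
    using tau_pos'[of m] that by (simp add: lin_coeff_def quad_coeff1_def divide_simps power2_eq_square) (simp add: algebra_simps)
  have e: "1 - z\<^sup>2 / of_real (\<tau> (2 * m + 1)) ^ 2 = 1 + lin_coeff d m * z + quad_coeff1 d m * z\<^sup>2" if "even d" for m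
    using that by (simp add: lin_coeff_def quad_coeff1_def)
  show ?thesis
  proof (cases "odd d")
    case True
    then show ?thesis unfolding Phi1_def by (simp only: if_True o not_False_eq_True)
  next
    case False
    then have "even d" by simp
    then show ?thesis using False unfolding Phi1_def by (simp only: if_False e)
  qed
qed

lemma Phi2_factor:
  "Phi2 d \<tau> z = (\<Prod>m. 1 + (- lin_coeff d m) * z + quad_coeff2 d m * z\<^sup>2)"
proof (cases "odd d")
  case True
  then show ?thesis unfolding Phi2_def Phi1_factor by (simp add: quad_coeff1_def quad_coeff2_def)
next
  case False
  then show ?thesis unfolding Phi2_def by (simp add: lin_coeff_def quad_coeff2_def)
qed

end

section \<open>The gap between the logarithmic derivatives of the factors\<close>

context real_zeros
begin

lemma phi_prodinf: "\<phi> z = (\<Prod>k. 1 + 0 * z + (- 1 / of_real (\<tau> (Suc k)) ^ 2) * z\<^sup>2)"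
  using has_prod_unique[OF product[of z]] by simp

lemma summable_phi_coeffs: "summable (\<lambda>k. norm (- 1 / of_real (\<tau> (Suc k)) ^ 2 :: complex))"
  using summable_tau_sq by (simp add: norm_divide norm_power)

lemma phi_holomorphic: "\<phi> holomorphic_on A"
proof -
  have eq: "\<phi> = (\<lambda>z. \<Prod>k. 1 + 0 * z + (- 1 / of_real (\<tau> (Suc k)) ^ 2) * z\<^sup>2)"
    by (rule ext) (rule phi_prodinf)
  have "\<phi> holomorphic_on UNIV"
    by (subst eq) (rule holomorphic_quadratic_prod, simp, rule summable_phi_coeffs)
  then show ?thesis by (rule holomorphic_on_subset) simp
qed

lemma Phi1_holomorphic: "Phi1 d \<tau> holomorphic_on A"
  unfolding Phi1_factor[abs_def]
  by (rule holomorphic_on_subset[OF holomorphic_quadratic_prod[OF summable_lin_coeff summable_quad_coeff1]]) simp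

lemma Phi2_holomorphic: "Phi2 d \<tau> holomorphic_on A"
  unfolding Phi2_factor[abs_def]
  by (rule holomorphic_on_subset[OF holomorphic_quadratic_prod]) (simp_all add: summable_lin_coeff summable_quad_coeff2)

lemma factor_product:
  "(1 + lin_coeff d m * z + quad_coeff1 d m * z\<^sup>2) * (1 + (- lin_coeff d m) * z + quad_coeff2 d m * z\<^sup>2)
    = (1 - z\<^sup>2 / of_real (\<tau> (2 * m + 1)) ^ 2) * (1 - z\<^sup>2 / of_real (\<tau> (2 * m + 2)) ^ 2)"
proof (cases "odd d")
  case True
  then show ?thesis
    using tau_pos'[of m] by (simp add: lin_coeff_def quad_coeff1_def quad_coeff2_def divide_simps power2_eq_square) (simp add: algebra_simps)
qed (simp add: lin_coeff_def quad_coeff1_def quad_coeff2_def)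

lemma phi_eq_Phi1_Phi2: "\<phi> z = Phi1 d \<tau> z * Phi2 d \<tau> z"
proof -
  let ?g = "\<lambda>k. 1 - z\<^sup>2 / of_real (\<tau> (Suc k)) ^ 2"
  have "(\<lambda>n. (\<Prod>m<n. 1 + lin_coeff d m * z + quad_coeff1 d m * z\<^sup>2) * (\<Prod>m<n. 1 + (- lin_coeff d m) * z + quad_coeff2 d m * z\<^sup>2)) \<longlonglongrightarrow> Phi1 d \<tau> z * Phi2 d \<tau> z"
    unfolding Phi1_factor Phi2_factor
    by (intro tendsto_mult tendsto_quadratic_prod) (simp_all add: summable_lin_coeff summable_quad_coeff1 summable_quad_coeff2)
  moreover have "(\<Prod>m<n. 1 + lin_coeff d m * z + quad_coeff1 d m * z\<^sup>2) * (\<Prod>m<n. 1 + (- lin_coeff d m) * z + quad_coeff2 d m * z\<^sup>2)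
      = (\<Prod>k<2 * n. ?g k)" for n
    unfolding prod.distrib[symmetric] factor_product by (induction n) (simp_all add: mult_ac)
  ultimately have "(\<lambda>n. \<Prod>k<2 * n. ?g k) \<longlonglongrightarrow> Phi1 d \<tau> z * Phi2 d \<tau> z" by simp
  moreover have "(\<lambda>n. \<Prod>k<2 * n. ?g k) \<longlonglongrightarrow> \<phi> z"
    by (rule filterlim_compose[OF phi_partial_products]) (rule filterlim_subseq, simp add: strict_mono_def)
  ultimately show ?thesis using LIMSEQ_unique by blast
qed

lemma signature_measurable: "signature \<phi> \<in> borel_measurable borel"
proof -
  have "continuous_on UNIV (\<lambda>x::real. Re (\<phi> (of_real x)))"
    by (intro continuous_intros continuous_on_compose2[OF holomorphic_on_imp_continuous_on[OF phi_holomorphic[of UNIV]]]) auto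
  then have [measurable]: "(\<lambda>x::real. Re (\<phi> (of_real x))) \<in> borel_measurable borel"
    by (rule borel_measurable_continuous_onI)
  show ?thesis unfolding signature_def[abs_def] sgn_real_def by measurable
qed

lemma signature_abs_le: "\<bar>signature \<phi> x\<bar> \<le> 1"
  by (simp add: signature_def sgn_real_def)

lemma signature_sums:
  fixes G G' :: "real \<Rightarrow> complex"
  assumes G: "\<And>x. x \<ge> 0 \<Longrightarrow> (G has_vector_derivative G' x) (at x)"
    and cont: "continuous_on {0..} G'"
    and int: "set_integrable lborel {0..} G'"
    and lim: "(\<lambda>k. G (\<tau> (Suc k))) \<longlonglongrightarrow> 0"
  shows "(\<lambda>k. (-1) ^ Suc k * G (\<tau> (Suc k))) sums
           (- (G 0 + (LINT x:{0..}|lborel. of_real (signature \<phi> x) * G' x)) / 2)"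
proof -
  have "(\<lambda>k. (-1) ^ Suc k * G (nodes (Suc k))) sums
           (- (G 0 + (LINT x:{0..}|lborel. of_real (signature \<phi> x) * G' x)) / 2)"
  proof (rule alternating_FTC[OF strict_mono_nodes nodes_0 nodes_at_top signature_between_nodes
        signature_measurable signature_abs_le G cont int])
    show "(\<lambda>k. G (nodes k)) \<longlonglongrightarrow> 0"
      by (subst filterlim_sequentially_Suc[symmetric]) (simp add: lim)
  qed
  then show ?thesis by simp
qed

text \<open>The difference \<open>\<Phi>\<^sub>1' / \<Phi>\<^sub>1 - \<Phi>\<^sub>2' / \<Phi>\<^sub>2\<close> as an integral against the signature. In this form it can be
estimated although the series of \<open>kappa_sums\<close> converges only conditionally for odd \<open>d\<close>, and it is this
integral that the Fourier transform of the signature produces.\<close>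

definition logderiv_gap :: "nat \<Rightarrow> complex \<Rightarrow> complex" where
  "logderiv_gap e z = - (kappa e z 0 + (LINT x:{0..}|lborel. of_real (signature \<phi> x) * kappa' e z x))"

lemma kappa_sums:
  assumes "Im z \<noteq> 0" and e: "e = 0 \<or> e = 1"
  shows "(\<lambda>k. (-1) ^ Suc k * kappa e z (\<tau> (Suc k))) sums (logderiv_gap e z / 2)"
  unfolding logderiv_gap_def
proof (rule signature_sums)
  show "set_integrable lborel {0..} (kappa' e z)"
    unfolding set_integrable_def by (rule integrable_mult_indicator) (use kappa'_integrable(1)[OF assms(1)] in auto)
  show "(\<lambda>k. kappa e z (\<tau> (Suc k))) \<longlonglongrightarrow> 0"
    by (rule filterlim_compose[OF kappa_tendsto_0[OF e] tau_at_top])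
qed (use assms in \<open>auto intro: kappa_deriv continuous_on_kappa'\<close>)

lemma norm_logderiv_gap_le:
  assumes "Im z \<noteq> 0" and e: "e = 0 \<or> e = 1"
  shows "norm (logderiv_gap e z) \<le> (1 + 4 * (LINT x|lborel. 1 / (1 + x\<^sup>2))) * (norm z / \<bar>Im z\<bar>) ^ 4 / norm z"
proof -
  let ?I = "LINT x::real|lborel. 1 / (1 + x\<^sup>2)" and ?s = "norm z / \<bar>Im z\<bar>"
  have z0: "norm z > 0" using assms by auto
  have s1: "?s ^ 4 \<ge> 1" using abs_Im_le_cmod[of z] assms(1) by (intro one_le_power) simp
  have "norm (LINT x:{0..}|lborel. of_real (signature \<phi> x) * kappa' e z x)
      \<le> (LINT x|lborel. norm (indicat_real {0..} x *\<^sub>R (of_real (signature \<phi> x) * kappa' e z x)))"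
    unfolding set_lebesgue_integral_def by (rule integral_norm_bound)
  also have "\<dots> \<le> (LINT x|lborel. norm (kappa' e z x))"
  proof (rule integral_mono_AE')
    show "AE x in lborel. norm (indicat_real {0..} x *\<^sub>R (of_real (signature \<phi> x) * kappa' e z x)) \<le> norm (kappa' e z x)"
      using signature_abs_le by (auto intro!: AE_I2 simp: indicator_def norm_mult mult_left_le_one_le)
  qed (use kappa'_integrable(1)[OF assms(1)] in auto)
  also have "\<dots> \<le> 4 * ?s ^ 4 * ?I / norm z" by (rule kappa'_integrable(2)[OF assms(1)])
  finally have b: "norm (LINT x:{0..}|lborel. of_real (signature \<phi> x) * kappa' e z x) \<le> 4 * ?s ^ 4 * ?I / norm z" .
  have "norm (kappa e z 0) \<le> 1 / norm z"
    using e z0 by (auto simp: kappa_def norm_divide norm_mult power2_eq_square)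
  also have "\<dots> \<le> ?s ^ 4 / norm z" using s1 z0 by (intro divide_right_mono) auto
  finally have a: "norm (kappa e z 0) \<le> ?s ^ 4 / norm z" .
  have "norm (logderiv_gap e z) \<le> norm (kappa e z 0) + norm (LINT x:{0..}|lborel. of_real (signature \<phi> x) * kappa' e z x)"
    unfolding logderiv_gap_def norm_minus_cancel by (rule norm_triangle_ineq)
  also have "\<dots> \<le> ?s ^ 4 / norm z + 4 * ?s ^ 4 * ?I / norm z" using a b by linarith
  also have "\<dots> = (1 + 4 * ?I) * ?s ^ 4 / norm z"
    unfolding add_divide_distrib[symmetric] by (simp add: algebra_simps)
  finally show ?thesis .
qed

text \<open>For each pair of consecutive zeros, the logarithmic derivatives of the corresponding factors of \<open>\<Phi>\<^sub>1\<close> and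
\<open>\<Phi>\<^sub>2\<close> differ by twice two consecutive terms of the alternating series of \<open>kappa\<close>.\<close>

lemma logderiv_gap_eq:
  assumes z: "Im z \<noteq> 0"
  shows "deriv (Phi1 d \<tau>) z / Phi1 d \<tau> z - deriv (Phi2 d \<tau>) z / Phi2 d \<tau> z = logderiv_gap (par d) z"
proof -
  let ?k = "\<lambda>k. (-1) ^ Suc k * kappa (par d) z (\<tau> (Suc k))"
  have nz: "Phi1 d \<tau> z \<noteq> 0" "Phi2 d \<tau> z \<noteq> 0"
    using phi_nonreal[OF z] phi_eq_Phi1_Phi2[of z d] by auto
  have eq1: "Phi1 d \<tau> = (\<lambda>z. \<Prod>m. 1 + lin_coeff d m * z + quad_coeff1 d m * z\<^sup>2)" by (rule ext) (rule Phi1_factor)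
  have eq2: "Phi2 d \<tau> = (\<lambda>z. \<Prod>m. 1 + (- lin_coeff d m) * z + quad_coeff2 d m * z\<^sup>2)" by (rule ext) (rule Phi2_factor)
  have s1: "(\<lambda>m. (lin_coeff d m + 2 * quad_coeff1 d m * z) / (1 + lin_coeff d m * z + quad_coeff1 d m * z\<^sup>2)) sums (deriv (Phi1 d \<tau>) z / Phi1 d \<tau> z)"
    using logderiv_quadratic_prod[OF summable_lin_coeff[of d] summable_quad_coeff1[of d], of z] nz
    unfolding eq1 by blast
  have s2: "(\<lambda>m. ((- lin_coeff d m) + 2 * quad_coeff2 d m * z) / (1 + (- lin_coeff d m) * z + quad_coeff2 d m * z\<^sup>2)) sums (deriv (Phi2 d \<tau>) z / Phi2 d \<tau> z)"
    using logderiv_quadratic_prod[of "\<lambda>m. - lin_coeff d m" "quad_coeff2 d" z] summable_lin_coeff[of d] summable_quad_coeff2[of d] nz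
    unfolding eq2 by simp
  have pair: "(lin_coeff d m + 2 * quad_coeff1 d m * z) / (1 + lin_coeff d m * z + quad_coeff1 d m * z\<^sup>2)
        - ((- lin_coeff d m) + 2 * quad_coeff2 d m * z) / (1 + (- lin_coeff d m) * z + quad_coeff2 d m * z\<^sup>2)
      = 2 * (\<Sum>k\<in>{m * 2..<m * 2 + 2}. ?k k)" for m
  proof -
    let ?a = "complex_of_real (\<tau> (2 * m + 1))" and ?b = "complex_of_real (\<tau> (2 * m + 2))"
    have ab: "?a \<noteq> 0" "?b \<noteq> 0" using tau_pos'[of m] by auto
    have az: "?a - z \<noteq> 0" "?a + z \<noteq> 0" "?b - z \<noteq> 0" "?b + z \<noteq> 0"
      using z by (auto simp: complex_eq_iff)
    have az2: "?a\<^sup>2 - z\<^sup>2 = (?a - z) * (?a + z)" "?b\<^sup>2 - z\<^sup>2 = (?b - z) * (?b + z)"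
      by (simp_all add: power2_eq_square algebra_simps)
    have "{m * 2..<m * 2 + 2} = {2 * m, 2 * m + 1}" by auto
    then have rhs: "(\<Sum>k\<in>{m * 2..<m * 2 + 2}. ?k k) = kappa (par d) z (\<tau> (2 * m + 2)) - kappa (par d) z (\<tau> (2 * m + 1))"
      by simp
    show ?thesis
    proof (cases "odd d")
      case True
      have f1: "1 + lin_coeff d m * z + quad_coeff1 d m * z\<^sup>2 = (?a - z) * (?b + z) / (?a * ?b)"
        and f2: "1 + (- lin_coeff d m) * z + quad_coeff2 d m * z\<^sup>2 = (?a + z) * (?b - z) / (?a * ?b)"
        and n1: "lin_coeff d m + 2 * quad_coeff1 d m * z = ((?a - z) - (?b + z)) / (?a * ?b)"
        and n2: "(- lin_coeff d m) + 2 * quad_coeff2 d m * z = ((?b - z) - (?a + z)) / (?a * ?b)"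
        using True ab by (simp_all add: lin_coeff_def quad_coeff1_def quad_coeff2_def divide_simps power2_eq_square) (simp_all add: algebra_simps)
      have "(lin_coeff d m + 2 * quad_coeff1 d m * z) / (1 + lin_coeff d m * z + quad_coeff1 d m * z\<^sup>2) = 1 / (?b + z) - 1 / (?a - z)"
        unfolding f1 n1 using ab az by (simp add: divide_simps)
      moreover have "((- lin_coeff d m) + 2 * quad_coeff2 d m * z) / (1 + (- lin_coeff d m) * z + quad_coeff2 d m * z\<^sup>2) = 1 / (?a + z) - 1 / (?b - z)"
        unfolding f2 n2 using ab az by (simp add: divide_simps)
      moreover have "1 / (?b + z) - 1 / (?a - z) - (1 / (?a + z) - 1 / (?b - z))
          = 2 * (?b / ((?b - z) * (?b + z)) - ?a / ((?a - z) * (?a + z)))"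
      proof -
        have "1 / (?b + z) + 1 / (?b - z) = 2 * (?b / ((?b - z) * (?b + z)))"
          "1 / (?a + z) + 1 / (?a - z) = 2 * (?a / ((?a - z) * (?a + z)))"
          using az by (simp_all add: divide_simps)
        then show ?thesis by (simp add: algebra_simps)
      qed
      moreover have "par d = 0" using True by (simp add: par_def)
      ultimately show ?thesis unfolding rhs unfolding kappa_def az2 by simp
    next
      case False
      have f1: "1 + lin_coeff d m * z + quad_coeff1 d m * z\<^sup>2 = (?a - z) * (?a + z) / ?a\<^sup>2"
        and f2: "1 + (- lin_coeff d m) * z + quad_coeff2 d m * z\<^sup>2 = (?b - z) * (?b + z) / ?b\<^sup>2"
        and n1: "lin_coeff d m + 2 * quad_coeff1 d m * z = - 2 * z / ?a\<^sup>2"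
        and n2: "(- lin_coeff d m) + 2 * quad_coeff2 d m * z = - 2 * z / ?b\<^sup>2"
        using False ab by (simp_all add: lin_coeff_def quad_coeff1_def quad_coeff2_def divide_simps power2_eq_square) (simp_all add: algebra_simps)
      have "par d = 1" using False by (simp add: par_def)
      then show ?thesis unfolding rhs unfolding kappa_def az2 f1 f2 n1 n2 using ab az by simp
    qed
  qed
  have "(\<lambda>m. \<Sum>k\<in>{m * 2..<m * 2 + 2}. ?k k) sums (logderiv_gap (par d) z / 2)"
    by (rule sums_group[OF kappa_sums]) (use z in \<open>auto simp: par_def\<close>)
  then have "(\<lambda>m. 2 * (\<Sum>k\<in>{m * 2..<m * 2 + 2}. ?k k)) sums (2 * (logderiv_gap (par d) z / 2))"
    by (rule sums_mult)
  moreover have "(\<lambda>m. 2 * (\<Sum>k\<in>{m * 2..<m * 2 + 2}. ?k k)) sums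
      (deriv (Phi1 d \<tau>) z / Phi1 d \<tau> z - deriv (Phi2 d \<tau>) z / Phi2 d \<tau> z)"
    using sums_diff[OF s1 s2] unfolding pair .
  ultimately show ?thesis using sums_unique2 by fastforce
qed

end

section \<open>The extremality condition as a summation formula\<close>

lemma exp_typeD:
  assumes "exp_type_at_most r f" "e > 0"
  obtains A where "A \<ge> 0" "\<And>z. norm (f z) \<le> A * exp ((r + e) * norm z)"
proof -
  obtain A where A: "\<And>z. norm (f z) \<le> A * exp ((r + e) * norm z)"
    using assms unfolding exp_type_at_most_def by blast
  have "0 \<le> norm (f 0)" by simp
  also have "\<dots> \<le> A" using A[of 0] by simp
  finally show ?thesis using that A by blast
qed

lemma exp_type_add:
  fixes f g :: "complex \<Rightarrow> complex"
  assumes "exp_type_at_most r f" "exp_type_at_most r g"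
  shows "exp_type_at_most r (\<lambda>z. f z + g z)"
  unfolding exp_type_at_most_def
proof (intro allI impI)
  fix e :: real assume e: "e > 0"
  obtain A where A: "\<And>z. norm (f z) \<le> A * exp ((r + e) * norm z)" using exp_typeD[OF assms(1) e] by metis
  obtain B where B: "\<And>z. norm (g z) \<le> B * exp ((r + e) * norm z)" using exp_typeD[OF assms(2) e] by metis
  have "norm (f z + g z) \<le> (A + B) * exp ((r + e) * norm z)" for z
    using norm_triangle_ineq[of "f z" "g z"] A[of z] B[of z] by (simp add: distrib_right)
  then show "\<exists>A. \<forall>z. norm (f z + g z) \<le> A * exp ((r + e) * norm z)" by blast
qed

lemma exp_type_cmult:
  fixes f :: "complex \<Rightarrow> complex"
  assumes "exp_type_at_most r f"
  shows "exp_type_at_most r (\<lambda>z. c * f z)"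
  unfolding exp_type_at_most_def
proof (intro allI impI)
  fix e :: real assume e: "e > 0"
  obtain A where A: "\<And>z. norm (f z) \<le> A * exp ((r + e) * norm z)" using exp_typeD[OF assms(1) e] by metis
  have "norm (c * f z) \<le> (norm c * A) * exp ((r + e) * norm z)" for z
    using mult_left_mono[OF A[of z], of "norm c"] by (simp add: norm_mult mult.assoc)
  then show "\<exists>A. \<forall>z. norm (c * f z) \<le> A * exp ((r + e) * norm z)" by blast
qed

lemma exp_type_mult_ident:
  fixes f :: "complex \<Rightarrow> complex"
  assumes "exp_type_at_most r f"
  shows "exp_type_at_most r (\<lambda>z. z * f z)"
  unfolding exp_type_at_most_def
proof (intro allI impI)
  fix e :: real assume e: "e > 0"
  then have e2: "e / 2 > 0" by simp
  obtain A where A0: "A \<ge> 0" and A: "\<And>z. norm (f z) \<le> A * exp ((r + e / 2) * norm z)" using exp_typeD[OF assms(1) e2] by metis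
  have "norm (z * f z) \<le> (2 / e * A) * exp ((r + e) * norm z)" for z
  proof -
    have "e / 2 * norm z \<le> exp (e / 2 * norm z)" using exp_ge_add_one_self[of "e / 2 * norm z"] by linarith
    then have "norm z \<le> 2 / e * exp (e / 2 * norm z)" using e by (simp add: field_simps)
    then have "norm (z * f z) \<le> (2 / e * exp (e / 2 * norm z)) * (A * exp ((r + e / 2) * norm z))"
      unfolding norm_mult using A e by (intro mult_mono) auto
    also have "\<dots> = (2 / e * A) * (exp (e / 2 * norm z) * exp ((r + e / 2) * norm z))" by (simp add: mult_ac)
    also have "exp (e / 2 * norm z) * exp ((r + e / 2) * norm z) = exp ((r + e) * norm z)"
      unfolding exp_add[symmetric] by (rule arg_cong[of _ _ exp]) (simp add: field_simps)
    finally show ?thesis .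
  qed
  then show "\<exists>A. \<forall>z. norm (z * f z) \<le> A * exp ((r + e) * norm z)" by blast
qed

lemma exp_type_deriv:
  assumes hol: "f holomorphic_on UNIV" and t: "exp_type_at_most r f" and r: "r \<ge> 0"
  shows "exp_type_at_most r (deriv f)"
  unfolding exp_type_at_most_def
proof (intro allI impI)
  fix e :: real assume e: "e > 0"
  obtain A where A0: "A \<ge> 0" and A: "\<And>z. norm (f z) \<le> A * exp ((r + e) * norm z)" using exp_typeD[OF t e] by metis
  have "norm (deriv f z) \<le> (A * exp (r + e)) * exp ((r + e) * norm z)" for z
  proof -
    have "norm ((deriv ^^ 1) f z) \<le> fact 1 * ((A * exp (r + e)) * exp ((r + e) * norm z)) / 1 ^ 1"
    proof (rule Cauchy_inequality[of f z 1 _ 1])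
      show "norm (f x) \<le> (A * exp (r + e)) * exp ((r + e) * norm z)" if x: "norm (z - x) = 1" for x
      proof -
        have "norm x \<le> norm z + 1" using norm_triangle_sub[of x z] x by (simp add: norm_minus_commute)
        then have "(r + e) * norm x \<le> (r + e) * (norm z + 1)" using r e by (intro mult_left_mono) auto
        then have "A * exp ((r + e) * norm x) \<le> A * exp ((r + e) + (r + e) * norm z)"
          using A0 by (intro mult_left_mono) (auto simp: algebra_simps)
        then show ?thesis using A[of x] by (simp add: exp_add mult.assoc)
      qed
      show "f holomorphic_on ball z 1" by (rule holomorphic_on_subset[OF hol]) simp
      show "continuous_on (cball z 1) f"
        by (rule holomorphic_on_imp_continuous_on[OF holomorphic_on_subset[OF hol]]) simp
    qed simp
    then show ?thesis by simp
  qed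
  then show "\<exists>A. \<forall>z. norm (deriv f z) \<le> A * exp ((r + e) * norm z)" by blast
qed

lemma exp_type_of_bound:
  fixes f :: "complex \<Rightarrow> complex"
  assumes "A \<ge> 0" "\<And>z. norm (f z) \<le> A * exp (r * norm z)"
  shows "exp_type_at_most r f"
  unfolding exp_type_at_most_def
proof (intro allI impI exI)
  fix e :: real and z :: complex assume e: "e > 0"
  have "A * exp (r * norm z) \<le> A * exp ((r + e) * norm z)"
    using e assms(1) by (intro mult_left_mono) (auto simp: distrib_right)
  with assms(2)[of z] show "norm (f z) \<le> A * exp ((r + e) * norm z)" by linarith
qed

text \<open>Division by \<open>z - w\<close> and then by \<open>z + w\<close> removes both zeros. The type is preserved because
\<open>norm (z\<^sup>2 - w\<^sup>2) \<ge> 1\<close> outside a disc.\<close>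

lemma divide_by_square_difference:
  assumes hol: "q holomorphic_on UNIV" and even: "\<And>z. q (- z) = q z" and w: "w \<noteq> 0" and q0: "q w = 0"
    and type: "exp_type_at_most r q" and r: "r \<ge> 0"
  obtains h where "h holomorphic_on UNIV" "\<And>z. h (- z) = h z" "\<And>z. q z = (z\<^sup>2 - w\<^sup>2) * h z"
    "exp_type_at_most r h"
proof -
  define h1 where "h1 = (\<lambda>z. if z = w then deriv q w else (q z - q w) / (z - w))"
  define h where "h = (\<lambda>z. if z = - w then deriv h1 (- w) else (h1 z - h1 (- w)) / (z - (- w)))"
  have h1: "h1 holomorphic_on UNIV"
    unfolding h1_def by (rule pole_lemma[OF hol]) simp
  have h: "h holomorphic_on UNIV"
    unfolding h_def by (rule pole_lemma[OF h1]) simp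
  have eq1: "q z = (z - w) * h1 z" for z by (simp add: h1_def q0)
  have "h1 (- w) = 0" using eq1[of "- w"] even[of w] q0 w by auto
  then have eq2: "h1 z = (z + w) * h z" for z
    by (cases "z = - w") (auto simp: h_def add_eq_0_iff2)
  have eq: "q z = (z\<^sup>2 - w\<^sup>2) * h z" for z
    unfolding eq1 eq2 by (simp add: power2_eq_square algebra_simps)
  have h': "(\<lambda>z. h (- z)) holomorphic_on UNIV"
    using holomorphic_on_compose_gen[OF holomorphic_on_minus[OF holomorphic_on_ident] h, of UNIV]
    by (simp add: o_def)
  have even_h: "h (- z) = h z" for z
  proof (rule analytic_continuation_open[of "- {w, - w}" UNIV "\<lambda>z. h (- z)" h z])
    show "- {w, - w} \<noteq> {}"
      by (metis Compl_UNIV_eq double_complement finite.emptyI finite.insertI infinite_UNIV_char_0)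
    show "h (- z) = h z" if "z \<in> - {w, - w}" for z
    proof -
      have "z\<^sup>2 - w\<^sup>2 \<noteq> 0" using that power2_eq_iff[of z w] by auto
      moreover have "(z\<^sup>2 - w\<^sup>2) * h (- z) = q (- z)" using eq[of "- z"] by simp
      then have "(z\<^sup>2 - w\<^sup>2) * h (- z) = (z\<^sup>2 - w\<^sup>2) * h z"
        unfolding even by (simp only: eq)
      ultimately show ?thesis by (metis mult_cancel_left)
    qed
    show "open (- {w, - w})" by (intro open_Compl finite_imp_closed) auto
  qed (use h h' in auto)
  have type_h: "exp_type_at_most r h"
    unfolding exp_type_at_most_def
  proof (intro allI impI)
    fix e :: real assume e: "e > 0"
    obtain A where A0: "A \<ge> 0" and A: "\<And>z. norm (q z) \<le> A * exp ((r + e) * norm z)" using exp_typeD[OF type e] by metis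
    have "compact (h ` cball 0 (norm w + 1))"
      by (intro compact_continuous_image holomorphic_on_imp_continuous_on holomorphic_on_subset[OF h]) auto
    then obtain B where B: "\<And>z. z \<in> cball 0 (norm w + 1) \<Longrightarrow> norm (h z) \<le> B"
      by (meson bounded_iff compact_imp_bounded imageI)
    have "norm (h z) \<le> max A B * exp ((r + e) * norm z)" for z
    proof (cases "norm z \<le> norm w + 1")
      case True
      then have "norm (h z) \<le> max A B * 1" using B[of z] by simp
      also have "\<dots> \<le> max A B * exp ((r + e) * norm z)"
        using A0 r e by (intro mult_left_mono) auto
      finally show ?thesis .
    next
      case False
      have "1 * 1 \<le> norm (z - w) * norm (z - - w)"
        using False norm_triangle_ineq2[of z w] norm_triangle_ineq2[of z "- w"] by (intro mult_mono) auto
      also have "\<dots> = norm (z\<^sup>2 - w\<^sup>2)"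
        unfolding norm_mult[symmetric] by (simp add: power2_eq_square algebra_simps)
      finally have "1 * norm (h z) \<le> norm (z\<^sup>2 - w\<^sup>2) * norm (h z)" by (intro mult_right_mono) auto
      also have "\<dots> = norm (q z)" unfolding eq[of z] norm_mult ..
      also have "\<dots> \<le> A * exp ((r + e) * norm z)" by (rule A)
      also have "\<dots> \<le> max A B * exp ((r + e) * norm z)" by (intro mult_right_mono) auto
      finally show ?thesis by simp
    qed
    then show "\<exists>A. \<forall>z. norm (h z) \<le> A * exp ((r + e) * norm z)" by blast
  qed
  show ?thesis by (rule that[OF h even_h eq type_h])
qed

lemma norm_kappa_square_le:
  assumes "Im z \<noteq> 0" and e: "e = 0 \<or> e = 1"
  obtains C where "\<And>t. (norm (kappa e z t))\<^sup>2 \<le> C / (1 + t\<^sup>2)"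
proof -
  let ?s = "norm z / \<bar>Im z\<bar>" and ?D = "\<lambda>t. norm ((of_real t)\<^sup>2 - z\<^sup>2)"
  define m where "m = min 1 ((norm z)\<^sup>2)"
  have m: "m > 0" "m \<le> 1" "m \<le> (norm z)\<^sup>2" using assms by (auto simp: m_def)
  have "(norm (kappa e z t))\<^sup>2 \<le> (4 * ?s ^ 4 / m) / (1 + t\<^sup>2)" for t
  proof -
    let ?n = "t\<^sup>2 + (norm z)\<^sup>2" and ?a = "(norm (of_real t ^ (1 - e) * z ^ e))\<^sup>2"
    have n: "m * (1 + t\<^sup>2) \<le> ?n"
      using m mult_right_mono[of m 1 "t\<^sup>2"] by (simp add: distrib_left)
    have n0: "m * (1 + t\<^sup>2) > 0" using m by (simp add: add_pos_nonneg)
    have D0: "?D t > 0" using of_real_square_neq_square[OF assms(1)] by simp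
    have "?a \<le> ?n" using e by (auto simp: norm_mult)
    then have "?a * (m * (1 + t\<^sup>2)) \<le> ?n * ?n" using n n0 by (intro mult_mono) auto
    also have "\<dots> \<le> (2 * ?s\<^sup>2 * ?D t) * (2 * ?s\<^sup>2 * ?D t)"
      using norm_diff_squares_lower[OF assms(1), of t] n n0 by (intro mult_mono) auto
    also have "\<dots> = 4 * ?s ^ 4 * (?D t)\<^sup>2" by (simp add: power2_eq_square power4_eq_xxxx mult_ac)
    finally have le: "?a * (m * (1 + t\<^sup>2)) \<le> 4 * ?s ^ 4 * (?D t)\<^sup>2" .
    have "a / D \<le> X / n" if "n > 0" "D > 0" "a * n \<le> X * D" for a n D X :: real
      using that by (simp add: divide_simps mult_ac)
    from this[OF n0 _ le] have "?a / (?D t)\<^sup>2 \<le> 4 * ?s ^ 4 / (m * (1 + t\<^sup>2))" using D0 by simp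
    then show ?thesis by (simp add: kappa_def norm_divide power_divide)
  qed
  then show ?thesis using that by blast
qed

text \<open>
Here \<open>a\<close> is the number \<open>a\<^sub>d\<close>, and \<open>d / (4 a)\<close> equals the constant \<open>C\<^sub>d \<omega>\<^bsub>d - 1\<^esub> / 2\<close> of the extremality
condition. Integrability of \<open>x ^ (d - 1) \<phi>(x)\<close> is what remains, in polar coordinates, of the
integrability of the radial extremal function.
\<close>

locale extremal_zeros = real_zeros +
  fixes d :: nat and a :: real
  assumes d_pos: "d \<ge> 1"
    and even: "\<And>z. \<phi> (- z) = \<phi> z"
    and phi_0: "\<phi> 0 = 1"
    and type: "exp_type_at_most 1 \<phi>"
    and weighted_L1: "integrable lborel (\<lambda>x. of_real x ^ (d - 1) * \<phi> (of_real x))"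
    and a_nz: "a \<noteq> 0"
    and quadrature: "\<And>g. g holomorphic_on UNIV \<Longrightarrow> (\<And>z. g (- z) = g z) \<Longrightarrow> exp_type_at_most 1 g \<Longrightarrow>
          integrable lborel (\<lambda>x :: real. of_real (\<bar>x\<bar> ^ (d - 1)) * g (of_real x)) \<Longrightarrow>
          g 0 = of_real (real d / (4 * a)) *
            (LINT x :: real|lborel. of_real (signature \<phi> x) * g (of_real x) * of_real (\<bar>x\<bar> ^ (d - 1)))"
begin

text \<open>The extremality condition is applied to \<open>g = G' / z ^ (d - 1)\<close>, where
\<open>G(z) = z ^ d (S(z) \<phi>(w) - \<phi>(z) S(w)) / (z\<^sup>2 - w\<^sup>2)\<close> is entire. On the half-line the integrand is
\<open>\<sigma> G'\<close>, so the integral becomes an alternating sum of the values of \<open>G\<close> at the zeros, where only the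
term with \<open>S\<close> survives; on the other side \<open>g 0\<close> is \<open>d\<close> times the value at \<open>0\<close> of the quotient. The
auxiliary function \<open>S\<close> decays on the real line, which gives convergence.\<close>

lemma extremal_sum:
  assumes S: "S holomorphic_on UNIV" "\<And>z. S (- z) = S z" "S 0 = 1" "\<And>x. Im (S (of_real x)) = 0"
    and A0: "A \<ge> 0" and S_bound: "\<And>z. norm (S z) \<le> A * exp (norm z)"
    and S_decay: "\<And>x. norm (of_real x ^ (d - 1) * S (of_real x)) \<le> C / (1 + x\<^sup>2)"
    and w: "Im w \<noteq> 0"
  shows "(\<lambda>k. (-1) ^ Suc k * (of_real (\<tau> (Suc k)) ^ d * S (of_real (\<tau> (Suc k))) / ((of_real (\<tau> (Suc k)))\<^sup>2 - w\<^sup>2)))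
           sums (of_real a * (1 - S w / \<phi> w) / w\<^sup>2)"
proof -
  define q where "q = (\<lambda>z. S z * \<phi> w + (- S w) * \<phi> z)"
  have w0: "w \<noteq> 0" using w by auto
  have phiw: "\<phi> w \<noteq> 0" by (rule phi_nonreal[OF w])
  have S_type: "exp_type_at_most 1 S"
    by (rule exp_type_of_bound[OF A0]) (use S_bound in simp)
  have q_type: "exp_type_at_most 1 q"
    using exp_type_add[OF exp_type_cmult[OF S_type, of "\<phi> w"] exp_type_cmult[OF type, of "- S w"]]
    unfolding q_def by (simp add: mult.commute)
  have q_hol: "q holomorphic_on UNIV"
    unfolding q_def by (intro holomorphic_intros S phi_holomorphic)
  obtain h where h: "h holomorphic_on UNIV" "\<And>z. h (- z) = h z" "\<And>z. q z = (z\<^sup>2 - w\<^sup>2) * h z"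
    "exp_type_at_most 1 h"
    by (rule divide_by_square_difference[OF q_hol _ w0 _ q_type]) (auto simp: q_def S even)
  define g where "g = (\<lambda>z. of_nat d * h z + z * deriv h z)"
  define G where "G = (\<lambda>z. z ^ d * h z)"
  have h': "deriv h holomorphic_on UNIV" by (intro holomorphic_deriv h) auto
  have dh: "(h has_field_derivative deriv h z) (at z)" for z
    using holomorphic_derivI[OF h(1)] by auto
  have g_hol: "g holomorphic_on UNIV" unfolding g_def by (intro holomorphic_intros h h')
  have dh_odd: "deriv h (- z) = - deriv h z" for z
  proof -
    have "((\<lambda>z. h (- z)) has_field_derivative deriv h (- z) * (- 1)) (at z)"
      by (rule DERIV_chain2[OF dh]) (auto intro!: derivative_eq_intros)
    then have "(h has_field_derivative - deriv h (- z)) (at z)" by (simp add: h(2))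
    then show ?thesis using DERIV_unique[OF dh] by fastforce
  qed
  have g_even: "g (- z) = g z" for z by (simp add: g_def h(2) dh_odd)
  have g_type: "exp_type_at_most 1 g"
    unfolding g_def by (intro exp_type_add exp_type_cmult exp_type_mult_ident exp_type_deriv h) auto
  have dG: "(G has_field_derivative z ^ (d - 1) * g z) (at z)" for z
  proof -
    have "(G has_field_derivative of_nat d * z ^ (d - 1) * h z + deriv h z * z ^ d) (at z)"
      unfolding G_def by (auto intro!: derivative_eq_intros dh)
    also have "of_nat d * z ^ (d - 1) * h z + deriv h z * z ^ d = z ^ (d - 1) * g z"
      using d_pos by (cases d) (auto simp: g_def algebra_simps)
    finally show ?thesis .
  qed
  (* G is (phi w * u - S w * f) times the kernel. The functions u and f are integrable, but only square
     integrability is known for their derivatives, which multiply the kernel in G'. *)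
  define f where "f = (\<lambda>z. z ^ (d - 1) * \<phi> z)"
  define u where "u = (\<lambda>z. z ^ (d - 1) * S z)"
  have f_hol: "f holomorphic_on UNIV" unfolding f_def by (intro holomorphic_intros phi_holomorphic)
  have u_hol: "u holomorphic_on UNIV" unfolding u_def by (intro holomorphic_intros S)
  have pow_type: "exp_type_at_most 1 F \<Longrightarrow> exp_type_at_most 1 (\<lambda>z. z ^ n * F z)" for F n
    by (induction n) (auto dest!: exp_type_mult_ident simp: mult.assoc)
  have L2: "integrable lborel (\<lambda>x. (norm (deriv F (of_real x)))\<^sup>2)"
    if F: "F holomorphic_on UNIV" "exp_type_at_most 1 F" "\<And>x. Im (F (of_real x)) = 0" "integrable lborel (\<lambda>x. F (of_real x))" for F
  proof -
    obtain B where B: "B \<ge> 0" "\<And>z. norm (F z) \<le> B * exp ((1 + 1) * norm z)" using exp_typeD[OF F(2) zero_less_one] by blast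
    show ?thesis by (rule exp_type_L1_deriv_L2[OF F(1) B(1) _ B(2) F(3,4)]) simp
  qed
  have Im_pow: "Im (of_real x ^ n * v) = x ^ n * Im v" for x n v
    by (simp del: of_real_power add: of_real_power[symmetric])
  have f_int: "integrable lborel (\<lambda>x. f (of_real x))" unfolding f_def by (rule weighted_L1)
  have f_L2: "integrable lborel (\<lambda>x. (norm (deriv f (of_real x)))\<^sup>2)"
    by (rule L2[OF f_hol _ _ f_int]) (auto simp: f_def Im_pow phi_real intro!: pow_type type)
  have cont: "continuous_on X (\<lambda>x. F (complex_of_real x))" if "F holomorphic_on UNIV" for F X
    by (rule continuous_on_compose2[OF holomorphic_on_imp_continuous_on[OF that] continuous_on_of_real_id]) simp
  have meas: "(\<lambda>x. F (complex_of_real x)) \<in> borel_measurable borel" if "F holomorphic_on UNIV" for F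
    by (rule borel_measurable_continuous_onI[OF cont[OF that]])
  have u_int: "integrable lborel (\<lambda>x. u (of_real x))"
    by (rule integrable_inverse_square_bound[OF meas[OF u_hol]]) (use S_decay in \<open>simp add: u_def\<close>)
  have u_L2: "integrable lborel (\<lambda>x. (norm (deriv u (of_real x)))\<^sup>2)"
    by (rule L2[OF u_hol _ _ u_int]) (auto simp: u_def Im_pow S intro!: pow_type S_type)
  have duf: "((\<lambda>z. \<phi> w * u z - S w * f z) has_field_derivative \<phi> w * deriv u z - S w * deriv f z) (at z)" for z
    by (intro DERIV_diff DERIV_cmult holomorphic_derivI[OF u_hol] holomorphic_derivI[OF f_hol]) auto
  have G_real: "G (of_real x) = (\<phi> w * u (of_real x) - S w * f (of_real x)) * kappa 0 w x" for x
  proof -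
    obtain n where d: "d = Suc n" using d_pos by (cases d) auto
    have "(of_real x)\<^sup>2 - w\<^sup>2 \<noteq> 0" by (rule of_real_square_neq_square[OF w])
    then have h_eq: "h (of_real x) = q (of_real x) / ((of_real x)\<^sup>2 - w\<^sup>2)" using h(3)[of "of_real x"] by simp
    have num: "of_real x ^ Suc n * q (of_real x) = (\<phi> w * (of_real x ^ n * S (of_real x)) - S w * (of_real x ^ n * \<phi> (of_real x))) * of_real x"
      by (simp add: q_def algebra_simps)
    show ?thesis
      unfolding G_def h_eq d u_def f_def kappa_def times_divide_eq_right num by simp
  qed
  define V where "V = (\<lambda>x. (\<phi> w * u (of_real x) - S w * f (of_real x)) * kappa' 0 w x +
      (\<phi> w * deriv u (of_real x) - S w * deriv f (of_real x)) * kappa 0 w x)"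
  have dG1: "((\<lambda>x. G (of_real x)) has_vector_derivative of_real x ^ (d - 1) * g (of_real x)) (at x)" for x
    by (rule has_vector_derivative_real_field[OF dG])
  have dG2: "((\<lambda>x. G (of_real x)) has_vector_derivative V x) (at x)" for x
    unfolding G_real V_def
    by (rule has_vector_derivative_mult[OF has_vector_derivative_real_field[OF duf] kappa_deriv[OF w]]) simp
  have V_eq: "V x = of_real x ^ (d - 1) * g (of_real x)" for x
    using vector_derivative_unique_at[OF dG2 dG1] .
  obtain CK where CK: "\<And>t. (norm (kappa 0 w t))\<^sup>2 \<le> CK / (1 + t\<^sup>2)" using norm_kappa_square_le[OF w, of 0] by blast
  have kcont: "continuous_on UNIV (kappa 0 w)"
    using kappa_deriv[OF w, of 0] by (meson continuous_at_imp_continuous_on has_vector_derivative_continuous)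
  have kmeas: "kappa 0 w \<in> borel_measurable borel" by (rule borel_measurable_continuous_onI[OF kcont])
  have k'meas: "kappa' 0 w \<in> borel_measurable borel" by (rule borel_measurable_continuous_onI[OF continuous_on_kappa'[OF w]])
  have k'bd: "norm (kappa' 0 w x) \<le> 4 * (norm w / \<bar>Im w\<bar>) ^ 4 / (norm w)\<^sup>2" for x
  proof -
    have "norm (kappa' 0 w x) \<le> 4 * (norm w / \<bar>Im w\<bar>) ^ 4 / (x\<^sup>2 + (norm w)\<^sup>2)" by (rule norm_kappa'_le[OF w])
    also have "\<dots> \<le> 4 * (norm w / \<bar>Im w\<bar>) ^ 4 / (norm w)\<^sup>2"
      using w0 by (intro divide_left_mono mult_pos_pos add_nonneg_pos) auto
    finally show ?thesis .
  qed
  have uf_k': "integrable lborel (\<lambda>x. (\<phi> w * u (of_real x) - S w * f (of_real x)) * kappa' 0 w x)"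
  proof (rule Bochner_Integration.integrable_bound)
    let ?M = "4 * (norm w / \<bar>Im w\<bar>) ^ 4 / (norm w)\<^sup>2"
    show "integrable lborel (\<lambda>x. (\<phi> w * u (of_real x) - S w * f (of_real x)) * of_real ?M)"
      by (intro integrable_mult_left Bochner_Integration.integrable_diff integrable_mult_right u_int f_int)
    show "AE x in lborel. norm ((\<phi> w * u (of_real x) - S w * f (of_real x)) * kappa' 0 w x)
        \<le> norm ((\<phi> w * u (of_real x) - S w * f (of_real x)) * of_real ?M)"
    proof (rule AE_I2)
      fix x
      have "norm (kappa' 0 w x) \<le> norm (complex_of_real ?M)"
        using k'bd[of x] unfolding norm_of_real by (rule order_trans) (rule abs_ge_self)
      then show "norm ((\<phi> w * u (of_real x) - S w * f (of_real x)) * kappa' 0 w x)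
        \<le> norm ((\<phi> w * u (of_real x) - S w * f (of_real x)) * of_real ?M)"
        unfolding norm_mult by (intro mult_left_mono) auto
    qed
  qed (use meas[OF u_hol] meas[OF f_hol] k'meas in measurable)
  have V_int: "integrable lborel V"
  proof -
    have "integrable lborel (\<lambda>x. deriv u (of_real x) * kappa 0 w x)"
      by (rule integrable_L2_times_decay[OF u_L2 meas kmeas CK]) (intro holomorphic_deriv u_hol open_UNIV)
    moreover have "integrable lborel (\<lambda>x. deriv f (of_real x) * kappa 0 w x)"
      by (rule integrable_L2_times_decay[OF f_L2 meas kmeas CK]) (intro holomorphic_deriv f_hol open_UNIV)
    ultimately have "integrable lborel (\<lambda>x. \<phi> w * (deriv u (of_real x) * kappa 0 w x) - S w * (deriv f (of_real x) * kappa 0 w x))"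
      by (intro Bochner_Integration.integrable_diff integrable_mult_right)
    then have "integrable lborel (\<lambda>x. (\<phi> w * deriv u (of_real x) - S w * deriv f (of_real x)) * kappa 0 w x)"
      by (simp add: algebra_simps)
    with uf_k' show ?thesis unfolding V_def by (rule Bochner_Integration.integrable_add)
  qed
  have V_set: "set_integrable lborel {0..} V"
    unfolding set_integrable_def by (rule integrable_mult_indicator[OF _ V_int]) simp
  have V_fun: "V = (\<lambda>x. of_real x ^ (d - 1) * g (of_real x))" by (rule ext) (rule V_eq)
  have V_cont: "continuous_on X V" for X
    unfolding V_fun by (intro continuous_intros cont g_hol)
  have G_tau: "G (of_real (\<tau> (Suc k))) = \<phi> w * (of_real (\<tau> (Suc k)) ^ d * S (of_real (\<tau> (Suc k))) / ((of_real (\<tau> (Suc k)))\<^sup>2 - w\<^sup>2))" for k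
    using d_pos unfolding G_real f_def u_def kappa_def tau_zero by (cases d) (auto simp: mult_ac)
  have u_bd: "norm (u (of_real x)) \<le> C" for x
  proof -
    have "norm (u (of_real x)) \<le> C / (1 + x\<^sup>2)" using S_decay[of x] by (simp add: u_def)
    also have "\<dots> \<le> C / 1"
    proof (rule divide_left_mono)
      have "0 \<le> C / (1 + 0\<^sup>2)" using order_trans[OF norm_ge_zero S_decay[of 0]] .
      then show "0 \<le> C" by simp
    qed (auto simp: add_pos_nonneg)
    finally show ?thesis by simp
  qed
  have G_lim: "(\<lambda>k. G (of_real (\<tau> (Suc k)))) \<longlonglongrightarrow> 0"
  proof (rule Lim_null_comparison)
    show "eventually (\<lambda>k. norm (G (of_real (\<tau> (Suc k)))) \<le> (norm (\<phi> w) * C) * norm (kappa 0 w (\<tau> (Suc k)))) sequentially"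
      unfolding G_real f_def tau_zero norm_mult
      by (intro always_eventually allI mult_right_mono) (auto simp: norm_mult intro!: mult_left_mono u_bd)
    have "(\<lambda>k. kappa 0 w (\<tau> (Suc k))) \<longlonglongrightarrow> 0"
      by (rule filterlim_compose[OF kappa_tendsto_0 tau_at_top]) simp
    then show "(\<lambda>k. (norm (\<phi> w) * C) * norm (kappa 0 w (\<tau> (Suc k)))) \<longlonglongrightarrow> 0"
      by (intro tendsto_mult_right_zero tendsto_norm_zero)
  qed
  let ?J = "LINT x:{0..}|lborel. of_real (signature \<phi> x) * V x"
  have sums: "(\<lambda>k. (-1) ^ Suc k * G (of_real (\<tau> (Suc k)))) sums (- (G (of_real 0) + ?J) / 2)"
    by (rule signature_sums[where G = "\<lambda>x. G (of_real x)" and G' = V, OF _ V_cont V_set G_lim]) (rule dG2)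
  have sig_even: "signature \<phi> (- x) = signature \<phi> x" for x
    using even[of "of_real x"] by (simp add: signature_def)
  have g_L1: "integrable lborel (\<lambda>x. of_real (\<bar>x\<bar> ^ (d - 1)) * g (of_real x))"
  proof (rule Bochner_Integration.integrable_bound[OF V_int])
    have "continuous_on UNIV (\<lambda>x. of_real (\<bar>x\<bar> ^ (d - 1)) * g (of_real x))"
      by (intro continuous_intros cont g_hol)
    then show "(\<lambda>x. of_real (\<bar>x\<bar> ^ (d - 1)) * g (of_real x)) \<in> borel_measurable lborel"
      using borel_measurable_continuous_onI by auto
    show "AE x in lborel. norm (of_real (\<bar>x\<bar> ^ (d - 1)) * g (of_real x)) \<le> norm (V x)"
      unfolding V_eq by (auto simp: norm_mult norm_power)
  qed
  have "g 0 = of_real (real d / (4 * a)) * (LINT x|lborel. of_real (signature \<phi> x) * g (of_real x) * of_real (\<bar>x\<bar> ^ (d - 1)))"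
    by (rule quadrature[OF g_hol g_even g_type g_L1])
  also have "(LINT x|lborel. of_real (signature \<phi> x) * g (of_real x) * of_real (\<bar>x\<bar> ^ (d - 1)))
      = 2 * (LINT x:{0..}|lborel. of_real (signature \<phi> x) * g (of_real x) * of_real (\<bar>x\<bar> ^ (d - 1)))"
  proof (rule integrable_even(2))
    show "set_integrable lborel {0..} (\<lambda>x. of_real (signature \<phi> x) * g (of_real x) * of_real (\<bar>x\<bar> ^ (d - 1)))"
      unfolding set_integrable_def
    proof (rule integrable_mult_indicator)
      show "integrable lborel (\<lambda>x. of_real (signature \<phi> x) * g (of_real x) * of_real (\<bar>x\<bar> ^ (d - 1)))"
      proof (rule Bochner_Integration.integrable_bound[OF g_L1])
        have "(\<lambda>x. complex_of_real (signature \<phi> x)) \<in> borel_measurable borel"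
          using signature_measurable by measurable
        then show "(\<lambda>x. of_real (signature \<phi> x) * g (of_real x) * of_real (\<bar>x\<bar> ^ (d - 1))) \<in> borel_measurable lborel"
          using meas[OF g_hol] by measurable
        show "AE x in lborel. norm (of_real (signature \<phi> x) * g (of_real x) * of_real (\<bar>x\<bar> ^ (d - 1))) \<le> norm (of_real (\<bar>x\<bar> ^ (d - 1)) * g (of_real x))"
        proof (rule AE_I2)
          fix x
          have "\<bar>signature \<phi> x\<bar> * (norm (g (of_real x)) * \<bar>x\<bar> ^ (d - 1)) \<le> 1 * (norm (g (of_real x)) * \<bar>x\<bar> ^ (d - 1))"
            by (intro mult_right_mono signature_abs_le) auto
          then show "norm (of_real (signature \<phi> x) * g (of_real x) * of_real (\<bar>x\<bar> ^ (d - 1))) \<le> norm (of_real (\<bar>x\<bar> ^ (d - 1)) * g (of_real x))"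
            by (simp add: norm_mult norm_power mult_ac)
        qed
      qed
    qed simp
    show "of_real (signature \<phi> (- x)) * g (of_real (- x)) * of_real (\<bar>- x\<bar> ^ (d - 1)) =
        of_real (signature \<phi> x) * g (of_real x) * of_real (\<bar>x\<bar> ^ (d - 1))" for x
      by (simp add: sig_even g_even)
  qed
  also have "(LINT x:{0..}|lborel. of_real (signature \<phi> x) * g (of_real x) * of_real (\<bar>x\<bar> ^ (d - 1))) = ?J"
    unfolding set_lebesgue_integral_def V_eq
    by (rule Bochner_Integration.integral_cong) (auto simp: indicator_def mult_ac)
  finally have g0: "g 0 = of_real (real d / (4 * a)) * (2 * ?J)" .
  have "h 0 = - (\<phi> w - S w) / w\<^sup>2"
    using h(3)[of 0] w0 by (simp add: q_def S phi_0 field_simps)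
  then have g0': "g 0 = of_nat d * (- (\<phi> w - S w) / w\<^sup>2)" by (simp add: g_def)
  have "of_nat d * (?J / (2 * of_real a)) = of_real (real d / (4 * a)) * (2 * ?J)"
    using a_nz by (simp add: field_simps)
  then have "of_nat d * (?J / (2 * of_real a)) = of_nat d * (- (\<phi> w - S w) / w\<^sup>2)"
    unfolding g0[symmetric] g0' .
  moreover have "complex_of_nat d \<noteq> 0" using d_pos by simp
  ultimately have "?J / (2 * of_real a) = - (\<phi> w - S w) / w\<^sup>2" using mult_left_cancel by blast
  then have J: "?J = - 2 * of_real a * (\<phi> w - S w) / w\<^sup>2" using a_nz by (simp add: field_simps)
  have "G (of_real 0) = 0" using d_pos by (simp add: G_def)
  then have "(\<lambda>k. (-1) ^ Suc k * G (of_real (\<tau> (Suc k)))) sums (of_real a * (\<phi> w - S w) / w\<^sup>2)"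
    using sums unfolding J by simp
  then have "(\<lambda>k. (-1) ^ Suc k * G (of_real (\<tau> (Suc k))) / \<phi> w) sums (of_real a * (\<phi> w - S w) / w\<^sup>2 / \<phi> w)"
    by (rule sums_divide)
  moreover have "(-1) ^ Suc k * G (of_real (\<tau> (Suc k))) / \<phi> w =
      (-1) ^ Suc k * (of_real (\<tau> (Suc k)) ^ d * S (of_real (\<tau> (Suc k))) / ((of_real (\<tau> (Suc k)))\<^sup>2 - w\<^sup>2))" for k
    unfolding G_tau using phiw by simp
  moreover have "of_real a * (\<phi> w - S w) / w\<^sup>2 / \<phi> w = of_real a * (1 - S w / \<phi> w) / w\<^sup>2"
    using phiw w0 by (simp add: divide_simps)
  ultimately show ?thesis by simp
qed

end

section \<open>The transform of a bump\<close>

text \<open>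
The function \<open>\<rho> k\<close> is the \<open>k\<close>-th derivative of an even bump \<open>\<rho> 0\<close> of mass one.
\<close>

locale bump_function =
  fixes \<rho> :: "nat \<Rightarrow> real \<Rightarrow> real"
  assumes rho_deriv: "\<And>k t. (\<rho> k has_real_derivative \<rho> (Suc k) t) (at t)"
    and rho_supp: "\<And>k t. \<bar>t\<bar> \<ge> 1 / 2 \<Longrightarrow> \<rho> k t = 0"
    and rho_even: "\<And>t. \<rho> 0 (- t) = \<rho> 0 t" and rho_nonneg: "\<And>t. \<rho> 0 t \<ge> 0"
    and rho_integral: "integral\<^sup>L lborel (\<rho> 0) = 1"
begin

definition bump :: "nat \<Rightarrow> real \<Rightarrow> complex" where "bump k t = of_real (\<rho> k t)"

text \<open>An even entire function of exponential type at most \<open>1/2\<close>, rapidly decreasing on the real line, with \<open>S 0 = 1\<close>.\<close>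

definition S :: "complex \<Rightarrow> complex" where "S = fourier_laplace (bump 0)"

lemma bump_deriv: "(bump k has_vector_derivative bump (Suc k) t) (at t)"
  unfolding bump_def using rho_deriv[of k t]
  by (simp add: has_real_derivative_iff_has_vector_derivative has_vector_derivative_of_real)

lemma bump_continuous: "continuous_on A (bump k)"
  using bump_deriv by (meson continuous_at_imp_continuous_on has_vector_derivative_continuous)

lemma bump_supp: "\<bar>t\<bar> \<ge> 1 / 2 \<Longrightarrow> bump k t = 0"
  by (simp add: bump_def rho_supp)

lemma bump_supp1: "\<bar>t\<bar> \<ge> 1 \<Longrightarrow> bump k t = 0"
  by (rule bump_supp) linarith

lemma fourier_laplace_bump: "fourier_laplace (bump k) z = (\<i> * z) ^ k * S z"
proof (induction k)
  case (Suc k)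
  then show ?case
    using fourier_laplace_derivative[OF bump_deriv bump_continuous bump_supp1 bump_supp1, of k z] by simp
qed (simp add: S_def)

lemma S_has_derivative: "(S has_field_derivative deriv S z) (at z)"
  and S_holomorphic: "S holomorphic_on A"
proof -
  have d: "(S has_field_derivative fourier_laplace (\<lambda>t. - \<i> * of_real t * bump 0 t) z) (at z)" for z
    unfolding S_def by (rule fourier_laplace_field_derivative[OF bump_continuous bump_supp1])
  then show "(S has_field_derivative deriv S z) (at z)" using DERIV_imp_deriv by metis
  show "S holomorphic_on A"
    using d by (meson field_differentiable_at_within field_differentiable_def holomorphic_on_def)
qed

lemma S_even: "S (- z) = S z"
proof -
  have "S (- z) = (LINT t|lborel. bump 0 t * exp (- \<i> * of_real t * (- z)))"
    by (simp add: S_def fourier_laplace_def)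
  also have "\<dots> = (LINT t|lborel. bump 0 (- t) * exp (- \<i> * of_real (- t) * (- z)))"
    using lborel_integral_real_affine[of "-1" "\<lambda>t. bump 0 t * exp (- \<i> * of_real t * (- z))" 0] by simp
  also have "\<dots> = S z" by (simp add: S_def fourier_laplace_def bump_def rho_even)
  finally show ?thesis .
qed

lemma S_0: "S 0 = 1"
  using rho_integral by (simp add: S_def fourier_laplace_def bump_def)

lemma S_real: "Im (S (of_real x)) = 0"
proof -
  have "cnj (S (of_real x)) = (LINT t|lborel. cnj (bump 0 t * exp (- \<i> * of_real t * of_real x)))"
    unfolding S_def fourier_laplace_def
    by (rule integral_bounded_linear[OF bounded_linear_cnj, symmetric])
       (auto intro!: integrable_compact_support(1) continuous_intros bump_continuous simp: bump_supp1)
  also have "\<dots> = S (- of_real x)" by (simp add: S_def fourier_laplace_def bump_def exp_cnj)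
  finally show ?thesis unfolding S_even by (simp add: complex_eq_iff)
qed

lemma S_bound: obtains A where "A \<ge> 0" "\<And>z. norm (S z) \<le> A * exp (norm z)"
proof (rule that)
  let ?A = "LINT t|lborel. norm (bump 0 t)"
  show A0: "?A \<ge> 0" by (rule Bochner_Integration.integral_nonneg) simp
  show "norm (S z) \<le> ?A * exp (norm z)" for z
  proof -
    have "norm (S z) \<le> ?A * exp \<bar>Im z\<bar>"
      unfolding S_def by (rule norm_fourier_laplace_le[OF bump_continuous bump_supp1])
    also have "\<dots> \<le> ?A * exp (norm z)"
      using A0 abs_Im_le_cmod[of z] by (intro mult_left_mono) auto
    finally show ?thesis .
  qed
qed

lemma S_power_bounded: obtains C where "\<And>x. norm (of_real x ^ m * S (of_real x)) \<le> C"
proof (rule that)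
  fix x
  have "norm (of_real x ^ m * S (of_real x)) = norm (fourier_laplace (bump m) (of_real x))"
    by (simp add: fourier_laplace_bump norm_mult norm_power)
  also have "\<dots> \<le> (LINT t|lborel. norm (bump m t)) * exp \<bar>Im (of_real x)\<bar>"
    by (rule norm_fourier_laplace_le[OF bump_continuous bump_supp1])
  finally show "norm (of_real x ^ m * S (of_real x)) \<le> (LINT t|lborel. norm (bump m t))" by simp
qed

lemma S_decay: obtains C where "\<And>x. norm (of_real x ^ m * S (of_real x)) \<le> C / (1 + x\<^sup>2)"
proof -
  obtain C1 where C1: "\<And>x. norm (of_real x ^ m * S (of_real x)) \<le> C1" using S_power_bounded by blast
  obtain C2 where C2: "\<And>x. norm (of_real x ^ (m + 2) * S (of_real x)) \<le> C2" using S_power_bounded by blast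
  show ?thesis
  proof (rule that[of "C1 + C2"])
    fix x
    have "norm (of_real x ^ m * S (of_real x)) * (1 + x\<^sup>2) = norm (of_real x ^ m * S (of_real x)) + norm (of_real x ^ (m + 2) * S (of_real x))"
      by (simp add: norm_mult norm_power power_add power2_eq_square algebra_simps)
    also have "\<dots> \<le> C1 + C2" by (intro add_mono C1 C2)
    finally show "norm (of_real x ^ m * S (of_real x)) \<le> (C1 + C2) / (1 + x\<^sup>2)"
      by (subst pos_le_divide_eq) (auto simp: add_pos_nonneg)
  qed
qed

lemma S_deriv_power_bounded: obtains C where "\<And>x. norm (of_real x ^ m * deriv S (of_real x)) \<le> C"
proof -
  obtain C1 where C1: "\<And>x. norm (of_real x ^ (m - 1) * S (of_real x)) \<le> C1" using S_power_bounded by blast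
  let ?T = "\<lambda>t. - \<i> * of_real t * bump m t"
  let ?C = "LINT t|lborel. norm (?T t)"
  have Tc: "continuous_on UNIV ?T" by (intro continuous_intros bump_continuous)
  have Ts: "\<bar>t\<bar> \<ge> 1 \<Longrightarrow> ?T t = 0" for t by (simp add: bump_supp1)
  show ?thesis
  proof (rule that[of "real m * C1 + ?C"])
    fix x
    let ?z = "complex_of_real x"
    have "((\<lambda>z. (\<i> * z) ^ m * S z) has_field_derivative
        of_nat m * (\<i> * ?z) ^ (m - 1) * \<i> * S ?z + deriv S ?z * (\<i> * ?z) ^ m) (at ?z)"
      by (auto intro!: derivative_eq_intros S_has_derivative)
    moreover have "((\<lambda>z. (\<i> * z) ^ m * S z) has_field_derivative fourier_laplace ?T ?z) (at ?z)"
      using fourier_laplace_field_derivative[OF bump_continuous[of UNIV m] bump_supp1[of _ m], of ?z]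
      by (simp add: fourier_laplace_bump[abs_def])
    ultimately have "fourier_laplace ?T ?z = of_nat m * (\<i> * ?z) ^ (m - 1) * \<i> * S ?z + deriv S ?z * (\<i> * ?z) ^ m"
      using DERIV_unique by blast
    then have "(\<i> * ?z) ^ m * deriv S ?z = fourier_laplace ?T ?z - of_nat m * (\<i> * ?z) ^ (m - 1) * \<i> * S ?z"
      by (simp add: mult.commute)
    then have "norm ((\<i> * ?z) ^ m * deriv S ?z) \<le> norm (fourier_laplace ?T ?z) + norm (of_nat m * (\<i> * ?z) ^ (m - 1) * \<i> * S ?z)"
      by (metis norm_triangle_ineq4)
    moreover have "norm (fourier_laplace ?T ?z) \<le> ?C"
      using norm_fourier_laplace_le[OF Tc Ts, of ?z] by simp
    moreover have "norm (of_nat m * (\<i> * ?z) ^ (m - 1) * \<i> * S ?z) \<le> real m * C1"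
      using mult_left_mono[OF C1[of x], of "real m"] by (simp add: norm_mult norm_power mult.assoc)
    ultimately show "norm (?z ^ m * deriv S ?z) \<le> real m * C1 + ?C"
      by (simp add: norm_mult norm_power)
  qed
qed

text \<open>On the imaginary axis \<open>S\<close> is the integral of the nonnegative bump against a positive exponential.\<close>

lemma S_imaginary_nonzero: "S (\<i> * of_real y) \<noteq> 0"
proof -
  have eq: "S (\<i> * of_real y) = of_real (LINT t|lborel. \<rho> 0 t * exp (y * t))"
  proof -
    have "S (\<i> * of_real y) = (LINT t|lborel. of_real (\<rho> 0 t * exp (y * t)))"
      unfolding S_def fourier_laplace_def bump_def
      by (rule Bochner_Integration.integral_cong) (auto simp: exp_of_real[symmetric] mult_ac)
    then show ?thesis by (simp only: integral_complex_of_real)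
  qed
  have cont: "continuous_on A (\<rho> 0)" for A
    using rho_deriv by (meson DERIV_isCont continuous_at_imp_continuous_on)
  have int: "integrable lborel (\<lambda>t. \<rho> 0 t * exp (c * t + b))" for c b
  proof -
    have "integrable lborel (\<lambda>t. complex_of_real (\<rho> 0 t * exp (c * t + b)))"
      by (rule integrable_compact_support(1)) (auto intro!: continuous_intros cont rho_supp)
    then show ?thesis by (simp only: complex_of_real_integrable_eq)
  qed
  have "exp (- \<bar>y\<bar>) = (LINT t|lborel. \<rho> 0 t * exp (- \<bar>y\<bar>))" using rho_integral by simp
  also have "\<dots> \<le> (LINT t|lborel. \<rho> 0 t * exp (y * t))"
  proof (rule integral_mono)
    show "integrable lborel (\<lambda>t. \<rho> 0 t * exp (- \<bar>y\<bar>))" using int[of 0 "- \<bar>y\<bar>"] by simp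
    show "integrable lborel (\<lambda>t. \<rho> 0 t * exp (y * t))" using int[of y 0] by simp
    fix t
    show "\<rho> 0 t * exp (- \<bar>y\<bar>) \<le> \<rho> 0 t * exp (y * t)"
    proof (cases "\<bar>t\<bar> \<ge> 1 / 2")
      case False
      have "- (y * t) \<le> \<bar>y\<bar> * \<bar>t\<bar>" by (metis abs_ge_minus_self abs_mult)
      also have "\<dots> \<le> \<bar>y\<bar> * 1" using False by (intro mult_left_mono) auto
      finally show ?thesis using rho_nonneg by (intro mult_left_mono) auto
    qed (simp add: rho_supp)
  qed
  finally have "(LINT t|lborel. \<rho> 0 t * exp (y * t)) > 0" using exp_gt_zero[of "- \<bar>y\<bar>"] by linarith
  then show ?thesis unfolding eq by simp
qed

end

section \<open>Moments and division of transforms\<close>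

definition moment :: "(real \<Rightarrow> complex) \<Rightarrow> nat \<Rightarrow> complex" where
  "moment f m = (LINT t|lborel. of_real t ^ m * f t)"

lemma moment_derivative:
  assumes f: "\<And>t. (f has_vector_derivative f' t) (at t)" and cont: "continuous_on UNIV f'"
    and supp: "\<And>t. \<bar>t\<bar> \<ge> 1 \<Longrightarrow> f t = 0" "\<And>t. \<bar>t\<bar> \<ge> 1 \<Longrightarrow> f' t = 0"
  shows "moment f' m = - of_nat m * moment f (m - 1)"
proof -
  have cf: "continuous_on UNIV f"
    using f by (meson continuous_at_imp_continuous_on has_vector_derivative_continuous)
  have pw: "((\<lambda>t. of_real t ^ m :: complex) has_vector_derivative of_nat m * of_real t ^ (m - 1)) (at t)" for t :: real
    by (rule has_vector_derivative_real_field[where f = "\<lambda>z. z ^ m"]) (auto intro!: derivative_eq_intros)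
  have "(LINT t|lborel. of_real t ^ m * f' t + of_nat m * of_real t ^ (m - 1) * f t) = 0"
  proof (rule integral_derivative_compact_support[of "\<lambda>t. of_real t ^ m * f t"])
    show "((\<lambda>t. of_real t ^ m * f t) has_vector_derivative of_real t ^ m * f' t + of_nat m * of_real t ^ (m - 1) * f t) (at t)" for t
      by (rule has_vector_derivative_mult[OF pw f])
  qed (auto intro!: continuous_intros cont cf simp: supp)
  moreover have "(LINT t|lborel. of_real t ^ m * f' t + of_nat m * of_real t ^ (m - 1) * f t)
      = (LINT t|lborel. of_real t ^ m * f' t) + (LINT t|lborel. of_nat m * of_real t ^ (m - 1) * f t)"
    by (rule Bochner_Integration.integral_add)
       (auto intro!: integrable_compact_support(1) continuous_intros cont cf simp: supp)
  moreover have "(LINT t|lborel. of_nat m * of_real t ^ (m - 1) * f t) = of_nat m * moment f (m - 1)"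
    unfolding moment_def by (subst integral_mult_right_zero[symmetric]) (simp add: mult_ac)
  ultimately show ?thesis unfolding moment_def by (simp add: add_eq_0_iff2)
qed

lemma moment_linear:
  assumes "continuous_on UNIV f" "continuous_on UNIV g"
    and supp: "\<And>t. \<bar>t\<bar> \<ge> 1 \<Longrightarrow> f t = 0" "\<And>t. \<bar>t\<bar> \<ge> 1 \<Longrightarrow> g t = 0"
  shows "moment (\<lambda>t. a * f t + b * g t) m = a * moment f m + b * moment g m"
proof -
  have "moment (\<lambda>t. a * f t + b * g t) m = (LINT t|lborel. a * (of_real t ^ m * f t) + b * (of_real t ^ m * g t))"
    unfolding moment_def by (simp add: algebra_simps)
  also have "\<dots> = (LINT t|lborel. a * (of_real t ^ m * f t)) + (LINT t|lborel. b * (of_real t ^ m * g t))"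
    by (rule Bochner_Integration.integral_add)
       (auto intro!: integrable_compact_support(1) continuous_intros assms simp: supp)
  finally show ?thesis by (simp add: moment_def)
qed

lemma fourier_laplace_linear:
  assumes "continuous_on UNIV f" "continuous_on UNIV g"
    and supp: "\<And>t. \<bar>t\<bar> \<ge> 1 \<Longrightarrow> f t = 0" "\<And>t. \<bar>t\<bar> \<ge> 1 \<Longrightarrow> g t = 0"
  shows "fourier_laplace (\<lambda>t. a * f t + b * g t) z = a * fourier_laplace f z + b * fourier_laplace g z"
proof -
  have "fourier_laplace (\<lambda>t. a * f t + b * g t) z = (LINT t|lborel. a * (f t * exp (- \<i> * of_real t * z)) + b * (g t * exp (- \<i> * of_real t * z)))"
    unfolding fourier_laplace_def by (simp add: algebra_simps)
  also have "\<dots> = (LINT t|lborel. a * (f t * exp (- \<i> * of_real t * z))) + (LINT t|lborel. b * (g t * exp (- \<i> * of_real t * z)))"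
    by (rule Bochner_Integration.integral_add)
       (auto intro!: integrable_compact_support(1) continuous_intros assms simp: supp)
  finally show ?thesis by (simp add: fourier_laplace_def)
qed

lemma fourier_laplace_integrable:
  fixes T :: "nat \<Rightarrow> real \<Rightarrow> complex"
  assumes T: "\<And>k t. (T k has_vector_derivative T (Suc k) t) (at t)"
    and supp: "\<And>k t. \<bar>t\<bar> \<ge> 1 \<Longrightarrow> T k t = 0"
  shows "integrable lborel (\<lambda>x. fourier_laplace (T 0) (of_real x))"
proof -
  have cont: "continuous_on A (T k)" for k A
    using T by (meson continuous_at_imp_continuous_on has_vector_derivative_continuous)
  let ?C = "\<lambda>k. LINT t|lborel. norm (T k t)"
  have bd: "norm (fourier_laplace (T k) (of_real x)) \<le> ?C k" for k x
    using norm_fourier_laplace_le[OF cont supp, of k "of_real x"] by simp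
  have 2: "fourier_laplace (T 2) z = - (z\<^sup>2) * fourier_laplace (T 0) z" for z
  proof -
    have "fourier_laplace (T 1) z = \<i> * z * fourier_laplace (T 0) z"
      using fourier_laplace_derivative[OF T cont supp supp, of 0 z] by simp
    moreover have "fourier_laplace (T 2) z = \<i> * z * fourier_laplace (T 1) z"
      using fourier_laplace_derivative[OF T cont supp supp, of 1 z] by (simp add: numeral_2_eq_2)
    moreover have "\<i> * z * (\<i> * z * F) = (\<i> * \<i>) * z\<^sup>2 * F" for F
      by (simp only: power2_eq_square mult_ac)
    ultimately show ?thesis by simp
  qed
  have der: "(fourier_laplace (T 0) has_field_derivative fourier_laplace (\<lambda>t. - \<i> * of_real t * T 0 t) z) (at z)" for z
    by (rule fourier_laplace_field_derivative[OF cont supp])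
  have "continuous_on UNIV (fourier_laplace (T 0))"
    using der by (meson DERIV_isCont continuous_at_imp_continuous_on)
  then have "continuous_on UNIV (\<lambda>x. fourier_laplace (T 0) (complex_of_real x))"
    by (rule continuous_on_compose2[OF _ continuous_on_of_real_id]) simp
  then have meas: "(\<lambda>x. fourier_laplace (T 0) (complex_of_real x)) \<in> borel_measurable borel"
    by (rule borel_measurable_continuous_onI)
  show ?thesis
  proof (rule integrable_inverse_square_bound[OF meas])
    fix x :: real
    have "norm (fourier_laplace (T 0) (of_real x)) * (1 + x\<^sup>2)
        = norm (fourier_laplace (T 0) (of_real x)) + norm (fourier_laplace (T 2) (of_real x))"
      unfolding 2 by (simp add: norm_mult norm_power algebra_simps)
    also have "\<dots> \<le> ?C 0 + ?C 2" by (intro add_mono bd)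
    finally show "norm (fourier_laplace (T 0) (of_real x)) \<le> (?C 0 + ?C 2) / (1 + x\<^sup>2)"
      by (subst pos_le_divide_eq) (auto simp: add_pos_nonneg)
  qed
qed

text \<open>The sequence \<open>X\<close> is a test function solving \<open>X' + y X = D\<close>; on the Fourier side, the transform of \<open>D\<close> is
divided by \<open>\<i> (z - \<i> y)\<close>. The solution \<open>exp (- y t) \<integral> exp (y s) D s ds\<close> vanishes to the right of the
support of \<open>D\<close> exactly because the transform of \<open>D\<close> vanishes at \<open>\<i> y\<close>.\<close>

lemma resolvent_exists:
  fixes D :: "nat \<Rightarrow> real \<Rightarrow> complex" and y :: real
  assumes D: "\<And>k t. (D k has_vector_derivative D (Suc k) t) (at t)"
    and supp: "\<And>k t. \<bar>t\<bar> \<ge> 1 / 2 \<Longrightarrow> D k t = 0"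
    and zero: "fourier_laplace (D 0) (\<i> * of_real y) = 0"
  obtains X where "\<And>k t. (X k has_vector_derivative X (Suc k) t) (at t)"
    "\<And>k t. \<bar>t\<bar> \<ge> 1 / 2 \<Longrightarrow> X k t = 0"
    "\<And>t. X 1 t = - of_real y * X 0 t + D 0 t"
proof -
  have cont: "continuous_on A (D k)" for k A
    using D by (meson continuous_at_imp_continuous_on has_vector_derivative_continuous)
  define f where "f = (\<lambda>s. D 0 s * exp (of_real (y * s)))"
  define J where "J = (\<lambda>t. integral {-1..t} f)"
  have f_cont: "continuous_on A f" for A unfolding f_def by (intro continuous_intros cont)
  have f_supp: "f t = 0" if "\<bar>t\<bar> \<ge> 1 / 2" for t using supp[OF that] by (simp add: f_def)
  have J_left: "J t = 0" if "t \<le> - 1 / 2" for t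
  proof -
    have "J t = integral {-1..t} (\<lambda>_. 0)"
      unfolding J_def using that by (intro integral_cong f_supp) auto
    then show ?thesis by simp
  qed
  have J_deriv: "(J has_vector_derivative f t) (at t)" for t
  proof (cases "t < - 1 / 2")
    case True
    have "((\<lambda>_. 0) has_vector_derivative 0) (at t)" by simp
    then have "(J has_vector_derivative 0) (at t)"
      by (rule has_vector_derivative_transform_within_open[of _ _ _ "{..<- 1 / 2}"]) (use True J_left in auto)
    then show ?thesis using True f_supp[of t] by simp
  next
    case False
    have "(J has_vector_derivative f t) (at t within {-1..t + 1})"
      unfolding J_def by (rule integral_has_vector_derivative[OF f_cont]) (use False in auto)
    moreover have "at t within {-1..t + 1} = at t" by (rule at_within_Icc_at) (use False in auto)
    ultimately show ?thesis by simp
  qed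
  have J_1: "J 1 = 0"
  proof -
    have "J 1 = integral\<^sup>L lborel f"
      unfolding J_def by (rule integrable_compact_support(2)[symmetric, OF f_cont f_supp]) simp
    also have "\<dots> = fourier_laplace (D 0) (\<i> * of_real y)"
      unfolding fourier_laplace_def f_def by (simp add: mult_ac)
    finally show ?thesis using zero by simp
  qed
  have J_right: "J t = 0" if "t \<ge> 1 / 2" for t
  proof -
    have dz: "(J has_vector_derivative 0) (at x within {1 / 2..})" if "x \<in> {1 / 2..}" for x
      using has_vector_derivative_at_within[OF J_deriv, of x] f_supp[of x] that by simp
    obtain c where c: "\<And>x. x \<in> {1 / 2..} \<Longrightarrow> J x = c"
      using has_vector_derivative_zero_constant[OF convex_real_interval(1) dz] by blast
    have "J t = c" "J 1 = c" using that by (auto intro!: c)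
    then show ?thesis using J_1 by simp
  qed
  define X where "X = rec_nat (\<lambda>t. exp (- of_real (y * t)) * J t) (\<lambda>k Xk t. - of_real y * Xk t + D k t)"
  have X_0: "X 0 t = exp (- of_real (y * t)) * J t" and X_Suc: "X (Suc k) t = - of_real y * X k t + D k t" for k t
    by (simp_all add: X_def)
  have X_deriv: "(X k has_vector_derivative X (Suc k) t) (at t)" for k t
  proof (induction k)
    case 0
    have "((\<lambda>z::complex. exp (- of_real y * z)) has_field_derivative - of_real y * exp (- of_real y * of_real t)) (at (of_real t))"
      by (auto intro!: derivative_eq_intros)
    from has_vector_derivative_real_field[OF this, of UNIV]
    have ex: "((\<lambda>t. exp (- complex_of_real (y * t))) has_vector_derivative - of_real y * exp (- of_real (y * t))) (at t)"
      by simp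
    have "(X 0 has_vector_derivative exp (- of_real (y * t)) * f t + - of_real y * exp (- of_real (y * t)) * J t) (at t)"
    proof -
      have "X 0 = (\<lambda>t. exp (- of_real (y * t)) * J t)" by (rule ext) (rule X_0)
      then show ?thesis using has_vector_derivative_mult[OF ex J_deriv] by (simp only:)
    qed
    also have "exp (- of_real (y * t)) * f t + - of_real y * exp (- of_real (y * t)) * J t = X (Suc 0) t"
      unfolding X_Suc X_0 f_def by (simp add: exp_minus)
    finally show ?case .
  next
    case (Suc k)
    have "((\<lambda>t. - of_real y * X k t + D k t) has_vector_derivative - of_real y * X (Suc k) t + D (Suc k) t) (at t)"
      by (intro has_vector_derivative_add has_vector_derivative_mult_right Suc D)
    moreover have "X (Suc k) = (\<lambda>t. - of_real y * X k t + D k t)" by (rule ext) (rule X_Suc)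
    ultimately show ?case by (simp only: X_Suc[of "Suc k"])
  qed
  show ?thesis
  proof (rule that[of X])
    show "X k t = 0" if "\<bar>t\<bar> \<ge> 1 / 2" for k t
    proof (induction k)
      case 0
      have "t \<ge> 1 / 2 \<or> t \<le> - 1 / 2" using that by linarith
      then show ?case using J_left J_right by (auto simp: X_0)
    next
      case (Suc k)
      then show ?case using supp[OF that] by (simp add: X_Suc)
    qed
    show "X 1 t = - of_real y * X 0 t + D 0 t" for t using X_Suc[of 0 t] by simp
  qed (rule X_deriv)
qed

text \<open>A product with \<open>kappa\<close> has a derivative of order \<open>1 / (1 + x\<^sup>2)\<close>, with a constant linear in the bounds for
the other factor; the linearity makes the bound uniform in a parameter.\<close>

lemma kappa_product_derivative_bound:
  assumes w: "Im w \<noteq> 0" and e: "e = 0 \<or> e = 1"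
  obtains K where "\<And>C x v v'. norm v \<le> C \<Longrightarrow> norm v' \<le> C \<Longrightarrow> norm (of_real x * v') \<le> C \<Longrightarrow>
    norm (v' * kappa e w x + v * kappa' e w x) \<le> C * K / (1 + x\<^sup>2)"
proof -
  obtain K1 where K1: "\<And>t. (norm (kappa e w t))\<^sup>2 \<le> K1 / (1 + t\<^sup>2)" using norm_kappa_square_le[OF w e] by blast
  define m where "m = min 1 ((norm w)\<^sup>2)"
  have m: "m > 0" "m \<le> 1" "m \<le> (norm w)\<^sup>2" using w by (auto simp: m_def)
  let ?s = "norm w / \<bar>Im w\<bar>"
  define K2 where "K2 = 4 * ?s ^ 4 / m"
  have K2: "norm (kappa' e w t) \<le> K2 / (1 + t\<^sup>2)" for t
  proof -
    have n: "m * (1 + t\<^sup>2) \<le> t\<^sup>2 + (norm w)\<^sup>2"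
      using m mult_right_mono[of m 1 "t\<^sup>2"] by (simp add: distrib_left)
    have n0: "m * (1 + t\<^sup>2) > 0" using m by (simp add: add_pos_nonneg)
    have "norm (kappa' e w t) \<le> 4 * ?s ^ 4 / (t\<^sup>2 + (norm w)\<^sup>2)" by (rule norm_kappa'_le[OF w])
    also have "\<dots> \<le> 4 * ?s ^ 4 / (m * (1 + t\<^sup>2))"
    proof (rule divide_left_mono[OF n])
      have "0 < t\<^sup>2 + (norm w)\<^sup>2" using n n0 by linarith
      then show "0 < (t\<^sup>2 + (norm w)\<^sup>2) * (m * (1 + t\<^sup>2))" using n0 by (rule mult_pos_pos)
    qed simp
    finally show ?thesis by (simp add: K2_def)
  qed
  have K1_nn: "K1 \<ge> 0" using order_trans[OF zero_le_power2 K1[of 0]] by simp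
  show ?thesis
  proof (rule that[of "sqrt (2 * K1) + K2"])
    fix C x and v v' :: complex
    assume v: "norm v \<le> C" "norm v' \<le> C" "norm (of_real x * v') \<le> C"
    have C0: "C \<ge> 0" using v(1) norm_ge_zero order_trans by blast
    have p: "1 + x\<^sup>2 > 0" by (simp add: add_pos_nonneg)
    have "(norm v')\<^sup>2 * (1 + x\<^sup>2) = (norm v')\<^sup>2 + (norm (of_real x * v'))\<^sup>2"
      by (simp add: norm_mult power_mult_distrib algebra_simps)
    also have "\<dots> \<le> C\<^sup>2 + C\<^sup>2" using v by (intro add_mono power_mono) auto
    finally have "(norm v')\<^sup>2 \<le> 2 * C\<^sup>2 / (1 + x\<^sup>2)" using p by (simp add: pos_le_divide_eq)
    then have "(norm (v' * kappa e w x))\<^sup>2 \<le> (2 * C\<^sup>2 / (1 + x\<^sup>2)) * (K1 / (1 + x\<^sup>2))"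
      unfolding norm_mult power_mult_distrib using K1[of x] p by (intro mult_mono) auto
    also have "\<dots> = (C * sqrt (2 * K1) / (1 + x\<^sup>2))\<^sup>2"
      using K1_nn by (simp add: power_divide power_mult_distrib power2_eq_square)
    finally have a: "norm (v' * kappa e w x) \<le> C * sqrt (2 * K1) / (1 + x\<^sup>2)"
      by (rule power2_le_imp_le) (use C0 K1_nn p in auto)
    have b: "norm (v * kappa' e w x) \<le> C * (K2 / (1 + x\<^sup>2))"
      unfolding norm_mult using v(1) K2[of x] C0 by (intro mult_mono) auto
    have "norm (v' * kappa e w x + v * kappa' e w x) \<le> norm (v' * kappa e w x) + norm (v * kappa' e w x)"
      by (rule norm_triangle_ineq)
    also have "\<dots> \<le> C * (sqrt (2 * K1) + K2) / (1 + x\<^sup>2)"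
      using a b by (simp add: distrib_left add_divide_distrib)
    finally show "norm (v' * kappa e w x + v * kappa' e w x) \<le> C * (sqrt (2 * K1) + K2) / (1 + x\<^sup>2)" .
  qed
qed

context bump_function
begin

text \<open>The moments up to order \<open>k + 1\<close> of the \<open>k\<close>-th derivative of the bump follow from those of the bump itself by
\<open>k\<close> integrations by parts; the last one vanishes because the bump is even.\<close>

lemma moment_bump_less: "m < k \<Longrightarrow> moment (bump k) m = 0"
proof (induction k arbitrary: m)
  case (Suc k)
  have "moment (bump (Suc k)) m = - of_nat m * moment (bump k) (m - 1)"
    by (rule moment_derivative[OF bump_deriv bump_continuous bump_supp1 bump_supp1])
  then show ?case using Suc by (cases m) auto
qed simp

lemma moment_bump_diag: "moment (bump k) k = (-1) ^ k * fact k"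
proof (induction k)
  case 0
  then show ?case using rho_integral by (simp add: moment_def bump_def)
next
  case (Suc k)
  have "moment (bump (Suc k)) (Suc k) = - of_nat (Suc k) * moment (bump k) (Suc k - 1)"
    by (rule moment_derivative[OF bump_deriv bump_continuous bump_supp1 bump_supp1])
  then show ?case using Suc by (simp add: algebra_simps)
qed

lemma moment_bump_superdiag: "moment (bump k) (Suc k) = 0"
proof (induction k)
  case 0
  have "moment (bump 0) 1 = (LINT t|lborel. of_real (- t) ^ 1 * bump 0 (- t))"
    unfolding moment_def using lborel_integral_real_affine[of "-1" "\<lambda>t. of_real t ^ 1 * bump 0 t" 0] by simp
  also have "\<dots> = - moment (bump 0) 1" by (simp add: moment_def bump_def rho_even)
  finally show ?case by simp
next
  case (Suc k)
  have "moment (bump (Suc k)) (Suc (Suc k)) = - of_nat (Suc (Suc k)) * moment (bump k) (Suc (Suc k) - 1)"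
    by (rule moment_derivative[OF bump_deriv bump_continuous bump_supp1 bump_supp1])
  then show ?case using Suc by simp
qed

text \<open>The \<open>k\<close>-th derivative of the approximate identity \<open>\<rho> (t / \<delta>) / \<delta>\<close>. Its transform \<open>S (\<delta> z)\<close> tends to \<open>1\<close>
with \<open>\<delta>\<close>, so that it plays the part of a Dirac mass that is still a test function.\<close>

definition squeezed :: "real \<Rightarrow> nat \<Rightarrow> real \<Rightarrow> complex" where
  "squeezed \<delta> k t = bump k (t / \<delta>) / of_real \<delta> ^ Suc k"

lemma squeezed_deriv:
  assumes "\<delta> > 0"
  shows "(squeezed \<delta> k has_vector_derivative squeezed \<delta> (Suc k) t) (at t)"
proof -
  have "((bump k \<circ> (\<lambda>t. t / \<delta>)) has_vector_derivative (1 / \<delta>) *\<^sub>R bump (Suc k) (t / \<delta>)) (at t)"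
    by (rule vector_diff_chain_at[OF _ bump_deriv])
       (use assms in \<open>auto intro!: derivative_eq_intros simp: has_real_derivative_iff_has_vector_derivative[symmetric]\<close>)
  then have "((\<lambda>t. (1 / of_real \<delta> ^ Suc k) * bump k (t / \<delta>)) has_vector_derivative (1 / of_real \<delta> ^ Suc k) * ((1 / \<delta>) *\<^sub>R bump (Suc k) (t / \<delta>))) (at t)"
    unfolding o_def by (rule has_vector_derivative_mult_right)
  then show ?thesis
    using assms by (simp add: squeezed_def[abs_def] scaleR_conv_of_real field_simps)
qed

lemma squeezed_supp: "0 < \<delta> \<Longrightarrow> \<delta> \<le> 1 \<Longrightarrow> \<bar>t\<bar> \<ge> 1 / 2 \<Longrightarrow> squeezed \<delta> k t = 0"
proof -
  assume \<delta>: "0 < \<delta>" "\<delta> \<le> 1" and t: "\<bar>t\<bar> \<ge> 1 / 2"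
  have "\<bar>t\<bar> \<le> \<bar>t\<bar> / \<delta>" using \<delta> by (simp add: le_divide_eq mult_left_le)
  then have "\<bar>t / \<delta>\<bar> \<ge> 1 / 2" using t \<delta> by (simp add: abs_divide)
  then show ?thesis by (simp add: squeezed_def bump_supp)
qed

lemma fourier_laplace_squeezed:
  assumes "\<delta> > 0"
  shows "fourier_laplace (squeezed \<delta> 0) z = S (of_real \<delta> * z)"
proof -
  have "S (of_real \<delta> * z) = \<bar>1 / \<delta>\<bar> *\<^sub>R (LINT t|lborel. bump 0 (0 + (1 / \<delta>) * t) * exp (- \<i> * of_real (0 + (1 / \<delta>) * t) * (of_real \<delta> * z)))"
    unfolding S_def fourier_laplace_def by (rule lborel_integral_real_affine) (use assms in simp)
  also have "\<dots> = (LINT t|lborel. \<bar>1 / \<delta>\<bar> *\<^sub>R (bump 0 (0 + (1 / \<delta>) * t) * exp (- \<i> * of_real (0 + (1 / \<delta>) * t) * (of_real \<delta> * z))))"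
    by simp
  also have "\<dots> = fourier_laplace (squeezed \<delta> 0) z"
    unfolding fourier_laplace_def
    by (rule Bochner_Integration.integral_cong) (use assms in \<open>auto simp: squeezed_def scaleR_conv_of_real field_simps\<close>)
  finally show ?thesis by simp
qed

lemma moment_squeezed:
  assumes "\<delta> > 0"
  shows "moment (squeezed \<delta> 0) m = of_real \<delta> ^ m * moment (bump 0) m"
proof -
  have aff: "moment (bump 0) m = \<bar>1 / \<delta>\<bar> *\<^sub>R (LINT t|lborel. of_real (0 + (1 / \<delta>) * t) ^ m * bump 0 (0 + (1 / \<delta>) * t))"
    unfolding moment_def by (rule lborel_integral_real_affine) (use assms in simp)
  have "of_real \<delta> ^ m * moment (bump 0) m = (LINT t|lborel. of_real \<delta> ^ m * (\<bar>1 / \<delta>\<bar> *\<^sub>R (of_real (0 + (1 / \<delta>) * t) ^ m * bump 0 (0 + (1 / \<delta>) * t))))"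
    unfolding aff by simp
  also have "\<dots> = moment (squeezed \<delta> 0) m"
    unfolding moment_def
  proof (rule Bochner_Integration.integral_cong)
    fix t
    have alg: "c ^ m * ((1 / c) * ((u / c) ^ m * r)) = u ^ m * (r / c)" if "c \<noteq> 0" for c u r :: complex
      using that by (simp add: power_divide)
    have "\<bar>1 / \<delta>\<bar> *\<^sub>R v = (1 / of_real \<delta>) * v" for v :: complex
      using assms by (simp add: scaleR_conv_of_real)
    then have "of_real \<delta> ^ m * (\<bar>1 / \<delta>\<bar> *\<^sub>R (of_real (0 + (1 / \<delta>) * t) ^ m * bump 0 (0 + (1 / \<delta>) * t)))
        = of_real \<delta> ^ m * ((1 / of_real \<delta>) * ((of_real t / of_real \<delta>) ^ m * bump 0 (t / \<delta>)))"
      by simp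
    also have "\<dots> = of_real t ^ m * (bump 0 (t / \<delta>) / of_real \<delta>)"
      by (rule alg) (use assms in simp)
    finally show "of_real \<delta> ^ m * (\<bar>1 / \<delta>\<bar> *\<^sub>R (of_real (0 + (1 / \<delta>) * t) ^ m * bump 0 (0 + (1 / \<delta>) * t)))
        = of_real t ^ m * squeezed \<delta> 0 t"
      by (simp add: squeezed_def)
  qed simp
  finally show ?thesis by simp
qed

end

section \<open>Pairing the signature with a test function\<close>

lemma par_cases: "par d = 0 \<or> par d = 1"
  by (simp add: par_def)

lemma twice_half_deg: "d \<ge> 1 \<Longrightarrow> 2 * (half_deg d + par d) + 1 = d + par d"
  by (auto simp: half_deg_def par_def elim!: oddE evenE)

text \<open>The moments of the solution of \<open>X' + y X = D\<close> in terms of the moments \<open>\<mu>\<close> of \<open>D\<close>: an integration by parts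
shows that \<open>y X\<^sub>m = m X\<^bsub>m - 1\<^esub> + \<mu>\<^sub>m\<close>.\<close>

primrec resolvent_moments :: "complex \<Rightarrow> (nat \<Rightarrow> complex) \<Rightarrow> nat \<Rightarrow> complex" where
  "resolvent_moments y \<mu> 0 = \<mu> 0 / y"
| "resolvent_moments y \<mu> (Suc m) = (of_nat (Suc m) * resolvent_moments y \<mu> m + \<mu> (Suc m)) / y"

lemma resolvent_moments_eq:
  assumes "y \<noteq> 0" "\<And>m. y * X m = of_nat m * X (m - 1) + \<mu> m"
  shows "X m = resolvent_moments y \<mu> m"
proof (induction m)
  case 0
  then show ?case using assms(2)[of 0] assms(1) by (simp add: eq_divide_eq mult.commute)
next
  case (Suc m)
  then show ?case using assms(2)[of "Suc m"] assms(1) by (simp add: eq_divide_eq mult.commute)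
qed

lemma tendsto_resolvent_moments:
  assumes "y \<noteq> 0" "\<And>m. (\<lambda>n. \<mu>' n m) \<longlonglongrightarrow> \<mu> m"
  shows "(\<lambda>n. resolvent_moments y (\<mu>' n) m) \<longlonglongrightarrow> resolvent_moments y \<mu> m"
  by (induction m) (auto intro!: tendsto_intros assms)

lemma resolvent_moments_linear:
  "resolvent_moments y (\<lambda>m. a * \<mu> m + b * \<nu> m) m = a * resolvent_moments y \<mu> m + b * resolvent_moments y \<nu> m"
  by (induction m) (simp_all add: add_divide_distrib algebra_simps)

lemma resolvent_moments_delta:
  assumes "y \<noteq> 0"
  shows "resolvent_moments y (\<lambda>m. if m = 0 then 1 else 0) m = fact m / y ^ (m + 1)"
  by (induction m) (use assms in \<open>simp_all add: field_simps\<close>)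

context bump_function
begin

lemma resolvent_moments_bump:
  assumes "y \<noteq> 0"
  shows "m < k \<Longrightarrow> resolvent_moments y (moment (bump k)) m = 0"
    and "resolvent_moments y (moment (bump k)) k = (-1) ^ k * fact k / y"
    and "resolvent_moments y (moment (bump k)) (Suc k) = (-1) ^ k * fact (Suc k) / y\<^sup>2"
proof -
  have less: "resolvent_moments y (moment (bump k)) m = 0" if "m < k" for m
    using that by (induction m) (simp_all add: moment_bump_less)
  then show "m < k \<Longrightarrow> resolvent_moments y (moment (bump k)) m = 0" .
  show diag: "resolvent_moments y (moment (bump k)) k = (-1) ^ k * fact k / y"
    using less by (cases k) (simp_all add: moment_bump_diag[of 0, simplified] moment_bump_diag[of "Suc n" for n, simplified])
  show "resolvent_moments y (moment (bump k)) (Suc k) = (-1) ^ k * fact (Suc k) / y\<^sup>2"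
    by (simp add: diag moment_bump_superdiag power2_eq_square)
qed

end

text \<open>
The coefficients \<open>p\<close> of the polynomial to which the transform of the signature restricts on \<open>(-1, 1)\<close>.
\<close>

locale signature_polynomial = extremal_zeros + bump_function +
  fixes p :: "nat \<Rightarrow> real"
  assumes p_top: "p (half_deg d) = (-1) ^ half_deg d * (2 / 2 ^ par d) * (4 * a / fact d)"
    and signature_transform: "\<And>\<psi>. test_function_on {-1<..<1} \<psi> \<Longrightarrow>
      2 / 2 ^ par d * \<i> ^ par d * fourier_distr (\<lambda>x. of_real (signature_tilde d \<phi> x)) \<psi>
        = (LINT t|lborel. of_real (P_fun d p t) * \<psi> t)"
begin

text \<open>The derivatives of \<open>S (\<delta> x) kappa w x\<close> and of \<open>x ^ m S x kappa w x\<close> with respect to \<open>x\<close>.\<close>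

definition squeezed_deriv_kappa :: "complex \<Rightarrow> real \<Rightarrow> real \<Rightarrow> complex" where
  "squeezed_deriv_kappa w \<delta> x = of_real \<delta> * deriv S (of_real (\<delta> * x)) * kappa (par d) w x
     + S (of_real (\<delta> * x)) * kappa' (par d) w x"

definition power_deriv_kappa :: "nat \<Rightarrow> complex \<Rightarrow> real \<Rightarrow> complex" where
  "power_deriv_kappa m w x = deriv (\<lambda>z. z ^ m * S z) (of_real x) * kappa (par d) w x
     + of_real x ^ m * S (of_real x) * kappa' (par d) w x"

lemma power_S_holomorphic: "(\<lambda>z. z ^ m * S z) holomorphic_on A"
  by (intro holomorphic_intros S_holomorphic)

lemma signature_of_real_measurable: "(\<lambda>x. complex_of_real (signature \<phi> x)) \<in> borel_measurable borel"
  using signature_measurable by measurable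

lemma continuous_on_of_real_entire:
  assumes "F holomorphic_on UNIV"
  shows "continuous_on X (\<lambda>x. F (complex_of_real x))"
  by (rule continuous_on_compose2[OF holomorphic_on_imp_continuous_on[OF assms] continuous_on_of_real_id]) simp

lemma continuous_on_kappa: "Im w \<noteq> 0 \<Longrightarrow> continuous_on X (kappa (par d) w)"
  using kappa_deriv[OF _ par_cases]
  by (meson continuous_at_imp_continuous_on has_vector_derivative_continuous)

lemma continuous_on_squeezed_deriv_kappa:
  assumes "Im w \<noteq> 0"
  shows "continuous_on X (squeezed_deriv_kappa w \<delta>)"
proof -
  have "continuous_on X (\<lambda>x. F (complex_of_real (\<delta> * x)))" if "F holomorphic_on UNIV" for F
    by (rule continuous_on_compose2[OF continuous_on_of_real_entire[OF that, of UNIV]]) (auto intro!: continuous_intros)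
  then show ?thesis
    unfolding squeezed_deriv_kappa_def[abs_def]
    by (intro continuous_intros continuous_on_kappa continuous_on_kappa' assms)
       (auto intro!: S_holomorphic holomorphic_deriv)
qed

lemma continuous_on_power_deriv_kappa:
  assumes "Im w \<noteq> 0"
  shows "continuous_on X (power_deriv_kappa m w)"
  unfolding power_deriv_kappa_def[abs_def]
  by (intro continuous_intros continuous_on_kappa continuous_on_kappa' assms continuous_on_of_real_entire
      S_holomorphic holomorphic_deriv power_S_holomorphic open_UNIV)

lemma squeezed_deriv_kappa_bound:
  assumes w: "Im w \<noteq> 0"
  obtains C where "\<And>\<delta> x. 0 < \<delta> \<Longrightarrow> \<delta> \<le> 1 \<Longrightarrow> norm (squeezed_deriv_kappa w \<delta> x) \<le> C / (1 + x\<^sup>2)"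
proof -
  obtain K where K: "\<And>C x v v'. norm v \<le> C \<Longrightarrow> norm v' \<le> C \<Longrightarrow> norm (of_real x * v') \<le> C \<Longrightarrow>
    norm (v' * kappa (par d) w x + v * kappa' (par d) w x) \<le> C * K / (1 + x\<^sup>2)"
    using kappa_product_derivative_bound[OF w par_cases] by blast
  obtain C0 where C0: "\<And>x. norm (of_real x ^ 0 * S (of_real x)) \<le> C0" using S_power_bounded by blast
  obtain C1 where C1: "\<And>x. norm (of_real x ^ 0 * deriv S (of_real x)) \<le> C1" using S_deriv_power_bounded by blast
  obtain C2 where C2: "\<And>x. norm (of_real x ^ 1 * deriv S (of_real x)) \<le> C2" using S_deriv_power_bounded by blast
  let ?C = "max C0 (max C1 C2)"
  show ?thesis
  proof (rule that[of "?C * K"])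
    fix \<delta> x :: real assume \<delta>: "0 < \<delta>" "\<delta> \<le> 1"
    show "norm (squeezed_deriv_kappa w \<delta> x) \<le> ?C * K / (1 + x\<^sup>2)"
      unfolding squeezed_deriv_kappa_def
    proof (rule K)
      show "norm (S (of_real (\<delta> * x))) \<le> ?C" using C0[of "\<delta> * x"] by simp
      have "\<delta> * norm (deriv S (of_real (\<delta> * x))) \<le> 1 * norm (deriv S (of_real (\<delta> * x)))"
        using \<delta> by (intro mult_right_mono) auto
      also have "\<dots> \<le> C1" using C1[of "\<delta> * x"] by simp
      finally show "norm (of_real \<delta> * deriv S (of_real (\<delta> * x))) \<le> ?C" using \<delta> by (simp add: norm_mult)
      have "norm (of_real x * (of_real \<delta> * deriv S (of_real (\<delta> * x)))) = norm (of_real (\<delta> * x) ^ 1 * deriv S (of_real (\<delta> * x)))"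
        by (simp add: mult_ac)
      also have "\<dots> \<le> C2" by (rule C2)
      finally show "norm (of_real x * (of_real \<delta> * deriv S (of_real (\<delta> * x)))) \<le> ?C" by simp
    qed
  qed
qed

lemma power_deriv_kappa_integrable:
  assumes w: "Im w \<noteq> 0"
  shows "integrable lborel (power_deriv_kappa m w)"
proof -
  obtain K where K: "\<And>C x v v'. norm v \<le> C \<Longrightarrow> norm v' \<le> C \<Longrightarrow> norm (of_real x * v') \<le> C \<Longrightarrow>
    norm (v' * kappa (par d) w x + v * kappa' (par d) w x) \<le> C * K / (1 + x\<^sup>2)"
    using kappa_product_derivative_bound[OF w par_cases] by blast
  have dV: "deriv (\<lambda>z. z ^ m * S z) z = of_nat m * z ^ (m - 1) * S z + deriv S z * z ^ m" for z
    by (rule DERIV_imp_deriv) (auto intro!: derivative_eq_intros S_has_derivative)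
  obtain C0 where C0: "\<And>x. norm (of_real x ^ m * S (of_real x)) \<le> C0" using S_power_bounded by blast
  obtain C1 where C1: "\<And>x. norm (of_real x ^ (m - 1) * S (of_real x)) \<le> C1" using S_power_bounded by blast
  obtain C2 where C2: "\<And>x. norm (of_real x ^ m * deriv S (of_real x)) \<le> C2" using S_deriv_power_bounded by blast
  obtain C3 where C3: "\<And>x. norm (of_real x ^ Suc m * deriv S (of_real x)) \<le> C3" using S_deriv_power_bounded by blast
  let ?C = "max C0 (max (real m * C1 + C2) (real m * C0 + C3))"
  show ?thesis
  proof (rule integrable_inverse_square_bound[OF borel_measurable_continuous_onI[OF continuous_on_power_deriv_kappa[OF w]]])
    fix x :: real
    let ?z = "complex_of_real x"
    show "norm (power_deriv_kappa m w x) \<le> ?C * K / (1 + x\<^sup>2)"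
      unfolding power_deriv_kappa_def
    proof (rule K)
      show "norm (?z ^ m * S ?z) \<le> ?C" using C0[of x] by simp
      have "norm (deriv (\<lambda>z. z ^ m * S z) ?z) \<le> norm (of_nat m * ?z ^ (m - 1) * S ?z) + norm (deriv S ?z * ?z ^ m)"
        unfolding dV by (rule norm_triangle_ineq)
      also have "norm (of_nat m * ?z ^ (m - 1) * S ?z) \<le> real m * C1"
        using mult_left_mono[OF C1[of x], of "real m"] by (simp add: norm_mult mult.assoc)
      also have "norm (deriv S ?z * ?z ^ m) \<le> C2" using C2[of x] by (simp add: mult.commute)
      finally show "norm (deriv (\<lambda>z. z ^ m * S z) ?z) \<le> ?C" by simp
      have "?z * deriv (\<lambda>z. z ^ m * S z) ?z = of_nat m * (?z ^ m * S ?z) + ?z ^ Suc m * deriv S ?z"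
        unfolding dV by (cases m) (auto simp: algebra_simps)
      then have "norm (?z * deriv (\<lambda>z. z ^ m * S z) ?z) \<le> norm (of_nat m * (?z ^ m * S ?z)) + norm (?z ^ Suc m * deriv S ?z)"
        by (simp only: norm_triangle_ineq)
      also have "norm (of_nat m * (?z ^ m * S ?z)) \<le> real m * C0"
        using mult_left_mono[OF C0[of x], of "real m"] by (simp add: norm_mult)
      also have "norm (?z ^ Suc m * deriv S ?z) \<le> C3" by (rule C3)
      finally show "norm (?z * deriv (\<lambda>z. z ^ m * S z) ?z) \<le> ?C" by simp
    qed
  qed
qed

lemma squeezed_deriv_kappa_integrable:
  assumes w: "Im w \<noteq> 0" and \<delta>: "0 < \<delta>" "\<delta> \<le> 1"
  shows "integrable lborel (squeezed_deriv_kappa w \<delta>)"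
proof -
  obtain C where C: "\<And>\<delta> x. 0 < \<delta> \<Longrightarrow> \<delta> \<le> 1 \<Longrightarrow> norm (squeezed_deriv_kappa w \<delta> x) \<le> C / (1 + x\<^sup>2)"
    using squeezed_deriv_kappa_bound[OF w] by blast
  show ?thesis
    by (rule integrable_inverse_square_bound[OF borel_measurable_continuous_onI[OF continuous_on_squeezed_deriv_kappa[OF w]] C[OF \<delta>]])
qed

lemma signature_times_set_integrable:
  fixes h :: "real \<Rightarrow> complex"
  assumes "integrable lborel h"
  shows "set_integrable lborel {0..} (\<lambda>x. of_real (signature \<phi> x) * h x)"
  unfolding set_integrable_def
proof (rule integrable_mult_indicator)
  show "integrable lborel (\<lambda>x. of_real (signature \<phi> x) * h x)"
  proof (rule Bochner_Integration.integrable_bound[OF assms])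
    show "(\<lambda>x. of_real (signature \<phi> x) * h x) \<in> borel_measurable lborel"
      using signature_of_real_measurable borel_measurable_integrable[OF assms] by measurable
    show "AE x in lborel. norm (of_real (signature \<phi> x) * h x) \<le> norm (h x)"
      using signature_abs_le by (auto intro!: AE_I2 simp: norm_mult mult_left_le_one_le)
  qed
qed simp

text \<open>Dominated convergence as \<open>\<delta>\<close> tends to \<open>0\<close>, through the bound that is uniform in \<open>\<delta>\<close>.\<close>

lemma squeezed_limit:
  assumes w: "Im w \<noteq> 0"
  shows "(\<lambda>n. LINT x:{0..}|lborel. of_real (signature \<phi> x) * squeezed_deriv_kappa w (1 / real (Suc n)) x)
    \<longlonglongrightarrow> (LINT x:{0..}|lborel. of_real (signature \<phi> x) * kappa' (par d) w x)"
proof -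
  obtain C where C: "\<And>\<delta> x. 0 < \<delta> \<Longrightarrow> \<delta> \<le> 1 \<Longrightarrow> norm (squeezed_deriv_kappa w \<delta> x) \<le> C / (1 + x\<^sup>2)"
    using squeezed_deriv_kappa_bound[OF w] by blast
  let ?d = "\<lambda>n. 1 / real (Suc n)"
  have d0: "?d \<longlonglongrightarrow> 0" using LIMSEQ_Suc[OF lim_1_over_n] by simp
  show ?thesis
    unfolding set_lebesgue_integral_def
  proof (rule integral_dominated_convergence[where w = "\<lambda>x. C * (1 / (1 + x\<^sup>2))"])
    show "integrable lborel (\<lambda>x::real. C * (1 / (1 + x\<^sup>2)))"
      by (intro integrable_mult_right integrable_inverse_1_plus_square_UNIV)
    show "(\<lambda>x. indicat_real {0..} x *\<^sub>R (of_real (signature \<phi> x) * kappa' (par d) w x)) \<in> borel_measurable lborel"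
      using signature_times_set_integrable[OF kappa'_integrable(1)[OF w]] unfolding set_integrable_def
      by (rule borel_measurable_integrable)
    show "(\<lambda>x. indicat_real {0..} x *\<^sub>R (of_real (signature \<phi> x) * squeezed_deriv_kappa w (?d n) x)) \<in> borel_measurable lborel" for n
      using signature_times_set_integrable[OF squeezed_deriv_kappa_integrable[OF w, of "?d n"]] unfolding set_integrable_def
      by (intro borel_measurable_integrable) simp
    show "AE x in lborel. norm (indicat_real {0..} x *\<^sub>R (of_real (signature \<phi> x) * squeezed_deriv_kappa w (?d n) x)) \<le> C * (1 / (1 + x\<^sup>2))" for n
    proof (rule AE_I2)
      fix x
      have "norm (indicat_real {0..} x *\<^sub>R (of_real (signature \<phi> x) * squeezed_deriv_kappa w (?d n) x)) \<le> norm (squeezed_deriv_kappa w (?d n) x)"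
        using signature_abs_le[of x] by (auto simp: indicator_def norm_mult mult_left_le_one_le)
      also have "\<dots> \<le> C / (1 + x\<^sup>2)" by (rule C) auto
      finally show "norm (indicat_real {0..} x *\<^sub>R (of_real (signature \<phi> x) * squeezed_deriv_kappa w (?d n) x)) \<le> C * (1 / (1 + x\<^sup>2))"
        by simp
    qed
    show "AE x in lborel. (\<lambda>n. indicat_real {0..} x *\<^sub>R (of_real (signature \<phi> x) * squeezed_deriv_kappa w (?d n) x))
        \<longlonglongrightarrow> indicat_real {0..} x *\<^sub>R (of_real (signature \<phi> x) * kappa' (par d) w x)"
    proof (rule AE_I2)
      fix x
      have dx: "(\<lambda>n. complex_of_real (?d n * x)) \<longlonglongrightarrow> of_real (0 * x)"
        by (intro tendsto_of_real tendsto_mult d0 tendsto_const)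
      have isC: "isCont F (of_real (0 * x))" if "F holomorphic_on UNIV" for F
        using holomorphic_on_imp_continuous_on[OF that] by (simp add: continuous_on_eq_continuous_at)
      have S1: "(\<lambda>n. S (of_real (?d n * x))) \<longlonglongrightarrow> S (of_real (0 * x))"
        by (rule isCont_tendsto_compose[OF isC dx]) (rule S_holomorphic)
      have S2: "(\<lambda>n. deriv S (of_real (?d n * x))) \<longlonglongrightarrow> deriv S (of_real (0 * x))"
        by (rule isCont_tendsto_compose[OF isC dx]) (intro holomorphic_deriv S_holomorphic open_UNIV)
      have "(\<lambda>n. squeezed_deriv_kappa w (?d n) x) \<longlonglongrightarrow>
          of_real 0 * deriv S (of_real (0 * x)) * kappa (par d) w x + S (of_real (0 * x)) * kappa' (par d) w x"
        unfolding squeezed_deriv_kappa_def by (intro tendsto_add tendsto_mult S1 S2 tendsto_of_real d0 tendsto_const)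
      then have "(\<lambda>n. squeezed_deriv_kappa w (?d n) x) \<longlonglongrightarrow> kappa' (par d) w x" by (simp add: S_0)
      then show "(\<lambda>n. indicat_real {0..} x *\<^sub>R (of_real (signature \<phi> x) * squeezed_deriv_kappa w (?d n) x))
        \<longlonglongrightarrow> indicat_real {0..} x *\<^sub>R (of_real (signature \<phi> x) * kappa' (par d) w x)"
        by (intro tendsto_scaleR tendsto_mult tendsto_const)
    qed
  qed
qed

end

section \<open>The transform of the signature on the unit interval\<close>

context signature_polynomial
begin

lemma signature_even: "signature \<phi> (- x) = signature \<phi> x"
  using even[of "of_real x"] by (simp add: signature_def)

lemma signature_tilde_transform:
  fixes g :: "real \<Rightarrow> complex"
  assumes "integrable lborel (\<lambda>x. of_real (signature_tilde d \<phi> x) * g x)"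
  shows "(LINT x|lborel. of_real (signature_tilde d \<phi> x) * g x)
    = (LINT x:{0..}|lborel. of_real (signature \<phi> x) * (g x + (-1) ^ par d * g (- x)))"
proof -
  have eq: "of_real (signature_tilde d \<phi> x) * g x + of_real (signature_tilde d \<phi> (- x)) * g (- x)
      = of_real (signature \<phi> x) * (g x + (-1) ^ par d * g (- x))" if "x \<ge> 0" for x
    using that by (cases "x = 0") (auto simp: signature_tilde_def signature_even par_def sgn_real_def algebra_simps)
  show ?thesis
    unfolding lborel_integral_halve[OF assms] set_lebesgue_integral_def
    by (rule Bochner_Integration.integral_cong) (auto simp: indicator_def eq)
qed

text \<open>The signature is paired with a test function that makes \<open>kappa\<close> appear. Let \<open>D\<close> be the combination of the
approximate identity and of the derivative of order \<open>2 M\<close> of the bump whose transform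
\<open>A z = w ^ (2M) S w S (\<delta> z) - S (\<delta> w) z ^ (2M) S z\<close> vanishes at \<open>w\<close>, let \<open>X' + y X = D\<close>, and take the
test function \<open>t X t\<close>. Its transform is the derivative of \<open>A x / (x - w)\<close>, and the part of that quotient
that the parity of the signature selects is \<open>A x kappa w x\<close>. On the other side, the transform of the
signature is the polynomial with coefficients \<open>p\<close> on the support of the test function, and so only
moments of \<open>X\<close> enter.\<close>

lemma squeezed_identity:
  assumes y: "y > 0" and \<delta>: "0 < \<delta>" "\<delta> \<le> 1"
  defines "w \<equiv> \<i> * complex_of_real y" and "M \<equiv> half_deg d + par d"
  defines "B \<equiv> w ^ (2 * M) * S w"
  shows "2 / 2 ^ par d * \<i> ^ par d *
      (2 * (B * (LINT x:{0..}|lborel. of_real (signature \<phi> x) * squeezed_deriv_kappa w \<delta> x)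
        - S (of_real \<delta> * w) * (LINT x:{0..}|lborel. of_real (signature \<phi> x) * power_deriv_kappa (2 * M) w x)))
    = (\<Sum>n\<le>half_deg d. of_real (p n) * resolvent_moments (of_real y)
        (\<lambda>m. B * (of_real \<delta> ^ m * moment (bump 0) m) + (- S (of_real \<delta> * w) * (-1) ^ M) * moment (bump (2 * M)) m) (2 * n + par d + 1))"
proof -
  have w: "Im w \<noteq> 0" "w \<noteq> 0" using y by (auto simp: w_def)
  define c where "c = - S (of_real \<delta> * w) * (-1) ^ M"
  define D where "D = (\<lambda>k t. B * squeezed \<delta> k t + c * bump (2 * M + k) t)"
  have D: "(D k has_vector_derivative D (Suc k) t) (at t)" for k t
  proof -
    have "(bump (2 * M + k) has_vector_derivative bump (2 * M + Suc k) t) (at t)"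
      using bump_deriv[of "2 * M + k" t] by simp
    then show ?thesis
      unfolding D_def by (intro has_vector_derivative_add has_vector_derivative_mult_right squeezed_deriv \<delta>)
  qed
  have sq_cont: "continuous_on A (squeezed \<delta> k)" for A k
    using squeezed_deriv[OF \<delta>(1)] by (meson continuous_at_imp_continuous_on has_vector_derivative_continuous)
  have sq_supp: "\<bar>t\<bar> \<ge> 1 \<Longrightarrow> squeezed \<delta> k t = 0" for k t
    by (rule squeezed_supp[OF \<delta>]) linarith
  have D_supp: "D k t = 0" if "\<bar>t\<bar> \<ge> 1 / 2" for k t
    unfolding D_def using squeezed_supp[OF \<delta> that] bump_supp[OF that] by simp
  define A where "A = (\<lambda>z. B * S (of_real \<delta> * z) - S (of_real \<delta> * w) * (z ^ (2 * M) * S z))"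
  have FD: "fourier_laplace (D 0) z = A z" for z
  proof -
    have "fourier_laplace (D 0) z = B * fourier_laplace (squeezed \<delta> 0) z + c * fourier_laplace (bump (2 * M)) z"
      unfolding D_def using fourier_laplace_linear[OF sq_cont bump_continuous sq_supp bump_supp1, of B 0 c "2 * M" z] by simp
    moreover have "(\<i> * z) ^ (2 * M) = (-1) ^ M * z ^ (2 * M)"
      unfolding power_mult by (simp add: power_mult_distrib power_minus[of "z\<^sup>2" M])
    then have "c * fourier_laplace (bump (2 * M)) z = - S (of_real \<delta> * w) * (((-1) ^ M * (-1) ^ M) * (z ^ (2 * M) * S z))"
      unfolding fourier_laplace_bump c_def by (simp only: mult_ac minus_mult_left[symmetric])
    ultimately show ?thesis
      unfolding fourier_laplace_squeezed[OF \<delta>(1)] A_def by (simp flip: power_mult_distrib)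
  qed
  have Aw: "A w = 0" by (simp add: A_def B_def)
  obtain X where X: "\<And>k t. (X k has_vector_derivative X (Suc k) t) (at t)"
    and X_supp: "\<And>k t. \<bar>t\<bar> \<ge> 1 / 2 \<Longrightarrow> X k t = 0"
    and X1: "\<And>t. X 1 t = - of_real y * X 0 t + D 0 t"
    using resolvent_exists[of D y, OF D D_supp] FD[of w] Aw unfolding w_def by auto
  have X_cont: "continuous_on A (X k)" for k A
    using X by (meson continuous_at_imp_continuous_on has_vector_derivative_continuous)
  have D_cont: "continuous_on A (D k)" for k A
    using D by (meson continuous_at_imp_continuous_on has_vector_derivative_continuous)
  have X_supp1: "\<bar>t\<bar> \<ge> 1 \<Longrightarrow> X k t = 0" for k t by (rule X_supp) linarith
  have D_supp1: "\<bar>t\<bar> \<ge> 1 \<Longrightarrow> D k t = 0" for k t by (rule D_supp) linarith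
  have X1_fun: "X 1 = (\<lambda>t. (- of_real y) * X 0 t + 1 * D 0 t)" by (rule ext) (use X1 in simp)
  (* The derivatives of t X t by the Leibniz rule. *)
  define T where "T = (\<lambda>k t. of_real t * X k t + of_nat k * X (k - 1) t)"
  have T: "(T k has_vector_derivative T (Suc k) t) (at t)" for k t
  proof -
    have t': "(complex_of_real has_vector_derivative 1) (at t)"
      using has_vector_derivative_real_field[of "\<lambda>z. z" 1 t UNIV] by simp
    have "((\<lambda>t. of_real t * X k t) has_vector_derivative of_real t * X (Suc k) t + 1 * X k t) (at t)"
      by (rule has_vector_derivative_mult[OF t' X])
    moreover have "((\<lambda>t. of_nat k * X (k - 1) t) has_vector_derivative of_nat k * X k t) (at t)"
    proof (cases k)
      case (Suc j)
      then show ?thesis using has_vector_derivative_mult_right[OF X[of j t], of "of_nat k"] by simp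
    qed simp
    ultimately have "(T k has_vector_derivative (of_real t * X (Suc k) t + 1 * X k t) + of_nat k * X k t) (at t)"
      unfolding T_def by (rule has_vector_derivative_add)
    then show ?thesis by (simp add: T_def algebra_simps)
  qed
  have T_supp: "T k t = 0" if "\<bar>t\<bar> \<ge> 1 / 2" for k t unfolding T_def using X_supp[OF that] by simp
  have T_test: "test_function_on {-1<..<1} (T 0)"
  proof -
    have "{t. T 0 t \<noteq> 0} \<subseteq> {- 1 / 2..1 / 2}"
    proof
      fix t assume "t \<in> {t. T 0 t \<noteq> 0}"
      then have "\<not> \<bar>t\<bar> \<ge> 1 / 2" using T_supp by blast
      then show "t \<in> {- 1 / 2..1 / 2}" by auto
    qed
    then have cl: "closure {t. T 0 t \<noteq> 0} \<subseteq> {- 1 / 2..1 / 2}" by (rule closure_minimal) simp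
    have "compact (closure {t. T 0 t \<noteq> 0})"
      using compact_Int_closed[OF compact_Icc closed_closure, of "- 1 / 2" "1 / 2" "{t. T 0 t \<noteq> 0}"] cl
      by (simp add: Int_absorb1)
    moreover have "closure {t. T 0 t \<noteq> 0} \<subseteq> {-1<..<1}"
      by (rule order_trans[OF cl]) auto
    moreover have "\<exists>D. D 0 = T 0 \<and> (\<forall>k t. (D k has_vector_derivative D (Suc k) t) (at t))"
      using T by blast
    ultimately show ?thesis unfolding test_function_on_def by blast
  qed
  define g where "g = (\<lambda>x. fourier_laplace (T 0) (complex_of_real x))"
  define G where "G = (\<lambda>z. \<i> * fourier_laplace (X 0) z)"
  have T0: "T 0 = (\<lambda>t. of_real t * X 0 t)" by (simp add: T_def fun_eq_iff)
  have dG: "(G has_field_derivative fourier_laplace (T 0) z) (at z)" for z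
  proof -
    have "(fourier_laplace (X 0) has_field_derivative fourier_laplace (\<lambda>t. - \<i> * of_real t * X 0 t) z) (at z)"
      by (rule fourier_laplace_field_derivative[OF X_cont X_supp1])
    then have "(G has_field_derivative \<i> * fourier_laplace (\<lambda>t. - \<i> * of_real t * X 0 t) z) (at z)"
      unfolding G_def by (rule DERIV_cmult)
    also have "fourier_laplace (\<lambda>t. - \<i> * of_real t * X 0 t) z = - \<i> * fourier_laplace (T 0) z"
      unfolding fourier_laplace_def T0 by (subst integral_mult_right_zero[symmetric]) (simp add: mult_ac)
    finally show ?thesis by simp
  qed
  have Gz: "G z * (z - w) = A z" for z
  proof -
    have "fourier_laplace (X 1) z = \<i> * z * fourier_laplace (X 0) z"
      using fourier_laplace_derivative[OF X X_cont X_supp1 X_supp1, of 0 z] by simp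
    moreover have "fourier_laplace (X 1) z = (- of_real y) * fourier_laplace (X 0) z + 1 * fourier_laplace (D 0) z"
      unfolding X1_fun by (rule fourier_laplace_linear[OF X_cont D_cont X_supp1 D_supp1])
    ultimately have "A z = (\<i> * z + of_real y) * fourier_laplace (X 0) z"
      unfolding FD by (simp add: algebra_simps)
    moreover have "\<i> * z + of_real y = \<i> * (z - w)" by (simp add: w_def algebra_simps)
    ultimately show ?thesis by (simp add: G_def)
  qed
  have A_even: "A (- z) = A z" for z
    using S_even[of "of_real \<delta> * z"] by (simp add: A_def S_even)
  have E_eq: "G (of_real x) - (-1) ^ par d * G (- of_real x) = 2 * (A (of_real x) * kappa (par d) w x)" for x :: real
  proof -
    let ?x = "complex_of_real x"
    have n1: "?x - w \<noteq> 0" "?x + w \<noteq> 0" using w by (auto simp: complex_eq_iff)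
    have D2: "?x\<^sup>2 - w\<^sup>2 = (?x - w) * (?x + w)" by (simp add: power2_eq_square algebra_simps)
    have G1: "G ?x = A ?x / (?x - w)" using Gz[of ?x] n1 by (simp add: field_simps)
    have "G (- ?x) * (?x + w) = - (G (- ?x) * (- ?x - w))" by (simp add: algebra_simps)
    also have "\<dots> = - A ?x" unfolding Gz A_even ..
    finally have G2: "G (- ?x) = - A ?x / (?x + w)" by (rule eq_divide_imp[OF n1(2)])
    have e: "par d = 0 \<or> par d = 1" by (rule par_cases)
    (* This is where the parity of d selects the kernel. *)
    have "1 / (?x - w) + (-1) ^ par d / (?x + w) = 2 * kappa (par d) w x"
      using e n1 unfolding kappa_def D2 by (auto simp: divide_simps)
    then have "A ?x * (1 / (?x - w) + (-1) ^ par d / (?x + w)) = A ?x * (2 * kappa (par d) w x)" by simp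
    then show ?thesis unfolding G1 G2 by (simp add: algebra_simps)
  qed
  have dE1: "((\<lambda>x. G (of_real x) - (-1) ^ par d * G (- of_real x)) has_vector_derivative g x + (-1) ^ par d * g (- x)) (at x)" for x
  proof -
    have "((\<lambda>x. G (of_real x)) has_vector_derivative g x) (at x)"
      unfolding g_def by (rule has_vector_derivative_real_field[OF dG])
    moreover have "((\<lambda>x. (-1) ^ par d * G (- of_real x)) has_vector_derivative (-1) ^ par d * (- g (- x))) (at x)"
    proof (rule has_vector_derivative_mult_right)
      have "((\<lambda>z. G (- z)) has_field_derivative fourier_laplace (T 0) (- of_real x) * (- 1)) (at (of_real x))"
        by (rule DERIV_chain2[OF dG]) (auto intro!: derivative_eq_intros)
      then show "((\<lambda>x. G (- of_real x)) has_vector_derivative (- g (- x))) (at x)"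
        unfolding g_def using has_vector_derivative_real_field[of "\<lambda>z. G (- z)" _ x UNIV] by simp
    qed
    ultimately have "((\<lambda>x. G (of_real x) - (-1) ^ par d * G (- of_real x)) has_vector_derivative g x - (-1) ^ par d * (- g (- x))) (at x)"
      by (rule has_vector_derivative_diff)
    then show ?thesis by simp
  qed
  have dA: "((\<lambda>x. A (of_real x)) has_vector_derivative
      B * (of_real \<delta> * deriv S (of_real (\<delta> * x))) - S (of_real \<delta> * w) * deriv (\<lambda>z. z ^ (2 * M) * S z) (of_real x)) (at x)" for x
  proof (rule has_vector_derivative_real_field)
    have "((\<lambda>z. S (of_real \<delta> * z)) has_field_derivative deriv S (of_real \<delta> * of_real x) * of_real \<delta>) (at (of_real x))"
      by (rule DERIV_chain2[OF S_has_derivative]) (auto intro!: derivative_eq_intros)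
    moreover have "((\<lambda>z. z ^ (2 * M) * S z) has_field_derivative deriv (\<lambda>z. z ^ (2 * M) * S z) (of_real x)) (at (of_real x))"
      by (rule holomorphic_derivI[OF power_S_holomorphic open_UNIV UNIV_I])
    ultimately have "(A has_field_derivative B * (deriv S (of_real \<delta> * of_real x) * of_real \<delta>)
        - S (of_real \<delta> * w) * deriv (\<lambda>z. z ^ (2 * M) * S z) (of_real x)) (at (of_real x))"
      unfolding A_def by (intro DERIV_diff DERIV_cmult)
    then show "(A has_field_derivative B * (of_real \<delta> * deriv S (of_real (\<delta> * x)))
        - S (of_real \<delta> * w) * deriv (\<lambda>z. z ^ (2 * M) * S z) (of_real x)) (at (of_real x))"
      by (simp add: mult.commute)
  qed
  have g_eq: "g x + (-1) ^ par d * g (- x) = 2 * (B * squeezed_deriv_kappa w \<delta> x - S (of_real \<delta> * w) * power_deriv_kappa (2 * M) w x)" for x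
  proof -
    have "((\<lambda>x. 2 * (A (of_real x) * kappa (par d) w x)) has_vector_derivative
        2 * (A (of_real x) * kappa' (par d) w x + (B * (of_real \<delta> * deriv S (of_real (\<delta> * x)))
          - S (of_real \<delta> * w) * deriv (\<lambda>z. z ^ (2 * M) * S z) (of_real x)) * kappa (par d) w x)) (at x)"
      by (rule has_vector_derivative_mult_right[OF has_vector_derivative_mult[OF dA kappa_deriv[OF w(1) par_cases]]])
    from vector_derivative_unique_at[OF dE1[unfolded E_eq] this]
    show ?thesis by (simp add: squeezed_deriv_kappa_def power_deriv_kappa_def A_def algebra_simps)
  qed
  have g_int: "integrable lborel g"
    unfolding g_def by (rule fourier_laplace_integrable[of T, OF T]) (rule T_supp, linarith)
  have tilde_int: "integrable lborel (\<lambda>x. of_real (signature_tilde d \<phi> x) * g x)"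
  proof (rule Bochner_Integration.integrable_bound[OF g_int])
    have "(\<lambda>x. complex_of_real (signature_tilde d \<phi> x)) \<in> borel_measurable borel"
      unfolding signature_tilde_def using signature_measurable by measurable
    then show "(\<lambda>x. of_real (signature_tilde d \<phi> x) * g x) \<in> borel_measurable lborel"
      using borel_measurable_integrable[OF g_int] by measurable
    have "\<bar>signature_tilde d \<phi> x\<bar> \<le> 1" for x
      using signature_abs_le[of x] by (auto simp: signature_tilde_def abs_mult sgn_real_def)
    then show "AE x in lborel. norm (of_real (signature_tilde d \<phi> x) * g x) \<le> norm (g x)"
      by (auto intro!: AE_I2 simp: norm_mult mult_left_le_one_le)
  qed
  have "fourier_distr (\<lambda>x. of_real (signature_tilde d \<phi> x)) (T 0) = (LINT x|lborel. of_real (signature_tilde d \<phi> x) * g x)"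
    unfolding fourier_distr_def fourier_eq_fourier_laplace g_def ..
  also have "\<dots> = (LINT x:{0..}|lborel. of_real (signature \<phi> x) * (2 * (B * squeezed_deriv_kappa w \<delta> x - S (of_real \<delta> * w) * power_deriv_kappa (2 * M) w x)))"
    unfolding signature_tilde_transform[OF tilde_int] g_eq ..
  also have "\<dots> = (LINT x:{0..}|lborel. (2 * B) * (of_real (signature \<phi> x) * squeezed_deriv_kappa w \<delta> x)
       - (2 * S (of_real \<delta> * w)) * (of_real (signature \<phi> x) * power_deriv_kappa (2 * M) w x))"
    unfolding set_lebesgue_integral_def by (rule Bochner_Integration.integral_cong) (auto simp: algebra_simps)
  also have "\<dots> = (LINT x:{0..}|lborel. (2 * B) * (of_real (signature \<phi> x) * squeezed_deriv_kappa w \<delta> x))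
       - (LINT x:{0..}|lborel. (2 * S (of_real \<delta> * w)) * (of_real (signature \<phi> x) * power_deriv_kappa (2 * M) w x))"
    by (rule set_integral_diff)
       (intro set_integrable_mult_right signature_times_set_integrable squeezed_deriv_kappa_integrable power_deriv_kappa_integrable w \<delta>)+
  also have "\<dots> = 2 * (B * (LINT x:{0..}|lborel. of_real (signature \<phi> x) * squeezed_deriv_kappa w \<delta> x)
        - S (of_real \<delta> * w) * (LINT x:{0..}|lborel. of_real (signature \<phi> x) * power_deriv_kappa (2 * M) w x))"
    by (simp only: set_integral_mult_right) (simp add: algebra_simps)
  finally have lhs: "fourier_distr (\<lambda>x. of_real (signature_tilde d \<phi> x)) (T 0) = \<dots>" .
  have mX: "moment (X 0) m = resolvent_moments (of_real y) (moment (D 0)) m" for m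
  proof (rule resolvent_moments_eq)
    fix m
    have "moment (X (Suc 0)) m = - of_nat m * moment (X 0) (m - 1)"
      by (rule moment_derivative[OF X X_cont X_supp1 X_supp1])
    moreover have "moment (X 1) m = (- of_real y) * moment (X 0) m + 1 * moment (D 0) m"
      unfolding X1_fun by (rule moment_linear[OF X_cont D_cont X_supp1 D_supp1])
    ultimately show "of_real y * moment (X 0) m = of_nat m * moment (X 0) (m - 1) + moment (D 0) m"
      by (simp add: algebra_simps)
  qed (use y in simp)
  have mD: "moment (D 0) = (\<lambda>m. B * (of_real \<delta> ^ m * moment (bump 0) m) + c * moment (bump (2 * M)) m)"
  proof (rule ext)
    fix m
    have "moment (D 0) m = B * moment (squeezed \<delta> 0) m + c * moment (bump (2 * M)) m"
      unfolding D_def using moment_linear[OF sq_cont bump_continuous sq_supp bump_supp1, of B 0 c "2 * M" m] by simp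
    then show "moment (D 0) m = B * (of_real \<delta> ^ m * moment (bump 0) m) + c * moment (bump (2 * M)) m"
      unfolding moment_squeezed[OF \<delta>(1)] .
  qed
  have "(LINT t|lborel. of_real (P_fun d p t) * T 0 t)
      = (LINT t|lborel. (\<Sum>n\<le>half_deg d. of_real (p n) * (of_real t ^ (2 * n + par d + 1) * X 0 t)))"
    unfolding P_fun_def T0 by (simp add: sum_distrib_left sum_distrib_right mult_ac)
  also have "\<dots> = (\<Sum>n\<le>half_deg d. (LINT t|lborel. of_real (p n) * (of_real t ^ (2 * n + par d + 1) * X 0 t)))"
    by (rule Bochner_Integration.integral_sum)
       (auto intro!: integrable_compact_support(1) continuous_intros X_cont simp: X_supp1)
  also have "\<dots> = (\<Sum>n\<le>half_deg d. of_real (p n) * moment (X 0) (2 * n + par d + 1))"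
    by (simp add: moment_def)
  finally have rhs: "(LINT t|lborel. of_real (P_fun d p t) * T 0 t) = \<dots>" .
  show ?thesis
    using signature_transform[OF T_test] unfolding lhs rhs mX mD c_def .
qed

end

section \<open>The identity on the imaginary axis\<close>

context signature_polynomial
begin

lemma poly_R_poly:
  "poly (R_poly d p) z = of_nat (par d) / 2 * z ^ (2 * (half_deg d + par d)) +
     2 ^ par d / 8 * (\<Sum>n\<le>half_deg d. (-1) ^ n * fact (2 * n + par d + 1) * of_real (p n) * z ^ (2 * (half_deg d - n)))"
  unfolding R_poly_def by (simp add: poly_monom poly_sum)

text \<open>As \<open>\<delta>\<close> tends to \<open>0\<close>, the factor \<open>S (\<delta> x)\<close> disappears, and with it all moments of the approximate identity
except the one of order zero.\<close>

lemma squeezed_identity_limit: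
  assumes y: "y > 0"
  defines "w \<equiv> \<i> * complex_of_real y" and "M \<equiv> half_deg d + par d"
  defines "B \<equiv> w ^ (2 * M) * S w"
  shows "2 / 2 ^ par d * \<i> ^ par d *
      (2 * (B * (LINT x:{0..}|lborel. of_real (signature \<phi> x) * kappa' (par d) w x)
        - (LINT x:{0..}|lborel. of_real (signature \<phi> x) * power_deriv_kappa (2 * M) w x)))
    = (\<Sum>n\<le>half_deg d. of_real (p n) * (B * (fact (2 * n + par d + 1) / of_real y ^ (2 * n + par d + 2))
        + (- ((-1) ^ M)) * resolvent_moments (of_real y) (moment (bump (2 * M))) (2 * n + par d + 1)))"
proof -
  have w: "Im w \<noteq> 0" using y by (simp add: w_def)
  let ?d = "\<lambda>n. 1 / real (Suc n)"
  have d0: "?d \<longlonglongrightarrow> 0" using LIMSEQ_Suc[OF lim_1_over_n] by simp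
  have "(\<lambda>n. complex_of_real (?d n)) \<longlonglongrightarrow> of_real 0" by (rule tendsto_of_real[OF d0])
  then have d0c: "(\<lambda>n. complex_of_real (?d n)) \<longlonglongrightarrow> 0" by (simp only: of_real_0)
  have y0: "complex_of_real y \<noteq> 0" using y by simp
  have Sd: "(\<lambda>n. S (of_real (?d n) * w)) \<longlonglongrightarrow> 1"
  proof -
    have "isCont S 0" using S_has_derivative DERIV_isCont by blast
    moreover have "(\<lambda>n. of_real (?d n) * w) \<longlonglongrightarrow> 0" using tendsto_mult_right[OF d0c, of w] by simp
    ultimately have "(\<lambda>n. S (of_real (?d n) * w)) \<longlonglongrightarrow> S 0" by (rule isCont_tendsto_compose)
    then show ?thesis by (simp add: S_0)
  qed
  define \<mu> where "\<mu> = (\<lambda>n m. B * (of_real (?d n) ^ m * moment (bump 0) m) + (- S (of_real (?d n) * w) * (-1) ^ M) * moment (bump (2 * M)) m)"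
  define \<mu>0 where "\<mu>0 = (\<lambda>m. B * (if m = 0 then 1 else 0) + (- ((-1) ^ M)) * moment (bump (2 * M)) m)"
  have mu: "(\<lambda>n. \<mu> n m) \<longlonglongrightarrow> \<mu>0 m" for m
  proof -
    have lim1: "(\<lambda>n. of_real (?d n) ^ m * moment (bump 0) m) \<longlonglongrightarrow> (if m = 0 then 1 else 0)"
    proof (cases m)
      case 0
      then show ?thesis using moment_bump_diag[of 0] by simp
    next
      case (Suc j)
      have "(\<lambda>n. of_real (?d n) ^ m * moment (bump 0) m) \<longlonglongrightarrow> 0 ^ m * moment (bump 0) m"
        by (intro tendsto_intros d0c)
      then show ?thesis using Suc by simp
    qed
    have "(\<lambda>n. - S (of_real (?d n) * w) * (-1) ^ M) \<longlonglongrightarrow> - 1 * (-1) ^ M"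
      by (intro tendsto_mult tendsto_minus tendsto_const Sd)
    then have lim2: "(\<lambda>n. - S (of_real (?d n) * w) * (-1) ^ M) \<longlonglongrightarrow> - ((-1) ^ M)"
      by (simp only: mult_minus_left mult_1_left)
    show ?thesis
      unfolding \<mu>_def \<mu>0_def
      by (rule tendsto_add[OF tendsto_mult[OF tendsto_const lim1] tendsto_mult[OF lim2 tendsto_const]])
  qed
  have "(\<lambda>n. 2 / 2 ^ par d * \<i> ^ par d *
      (2 * (B * (LINT x:{0..}|lborel. of_real (signature \<phi> x) * squeezed_deriv_kappa w (?d n) x)
        - S (of_real (?d n) * w) * (LINT x:{0..}|lborel. of_real (signature \<phi> x) * power_deriv_kappa (2 * M) w x))))
     \<longlonglongrightarrow> 2 / 2 ^ par d * \<i> ^ par d *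
      (2 * (B * (LINT x:{0..}|lborel. of_real (signature \<phi> x) * kappa' (par d) w x)
        - 1 * (LINT x:{0..}|lborel. of_real (signature \<phi> x) * power_deriv_kappa (2 * M) w x)))"
    by (intro tendsto_mult tendsto_diff tendsto_const squeezed_limit w Sd)
  moreover have "2 / 2 ^ par d * \<i> ^ par d *
      (2 * (B * (LINT x:{0..}|lborel. of_real (signature \<phi> x) * squeezed_deriv_kappa w (?d n) x)
        - S (of_real (?d n) * w) * (LINT x:{0..}|lborel. of_real (signature \<phi> x) * power_deriv_kappa (2 * M) w x)))
     = (\<Sum>k\<le>half_deg d. of_real (p k) * resolvent_moments (of_real y) (\<mu> n) (2 * k + par d + 1))" for n
    unfolding \<mu>_def B_def w_def M_def by (rule squeezed_identity[OF y]) auto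
  moreover have "(\<lambda>n. \<Sum>k\<le>half_deg d. of_real (p k) * resolvent_moments (of_real y) (\<mu> n) (2 * k + par d + 1))
      \<longlonglongrightarrow> (\<Sum>k\<le>half_deg d. of_real (p k) * resolvent_moments (of_real y) \<mu>0 (2 * k + par d + 1))"
    by (intro tendsto_sum tendsto_mult tendsto_const tendsto_resolvent_moments y0 mu)
  moreover have "resolvent_moments (of_real y) \<mu>0 m =
      B * (fact m / of_real y ^ (m + 1)) + (- ((-1) ^ M)) * resolvent_moments (of_real y) (moment (bump (2 * M))) m" for m
    unfolding \<mu>0_def resolvent_moments_linear resolvent_moments_delta[OF y0] ..
  ultimately show ?thesis
    using LIMSEQ_unique by (simp only: mult_1_left) (simp add: LIMSEQ_unique)
qed

text \<open>Since \<open>2 M + 1 - \<epsilon> = d\<close>, the values of \<open>x ^ (2M) S x kappa w x\<close> at the zeros are multiples of the terms of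
\<open>extremal_sum\<close>, and the integral of the derivative against the signature is an alternating sum of these values.\<close>

lemma power_deriv_kappa_integral:
  assumes w: "Im w \<noteq> 0"
  defines "M \<equiv> half_deg d + par d"
  shows "(LINT x:{0..}|lborel. of_real (signature \<phi> x) * power_deriv_kappa (2 * M) w x)
    = - 2 * w ^ par d * (of_real a * (1 - S w / \<phi> w) / w\<^sup>2)"
proof -
  define G where "G = (\<lambda>x. (of_real x ^ (2 * M) * S (of_real x)) * kappa (par d) w x)"
  have M: "2 * M + (1 - par d) = d" using twice_half_deg[OF d_pos] par_cases[of d] unfolding M_def by auto
  have dG: "(G has_vector_derivative power_deriv_kappa (2 * M) w x) (at x)" for x
  proof -
    have "((\<lambda>x. of_real x ^ (2 * M) * S (of_real x)) has_vector_derivative deriv (\<lambda>z. z ^ (2 * M) * S z) (of_real x)) (at x)"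
      by (rule has_vector_derivative_real_field[OF holomorphic_derivI[OF power_S_holomorphic open_UNIV UNIV_I]])
    from has_vector_derivative_mult[OF this kappa_deriv[OF w par_cases]]
    show ?thesis unfolding G_def power_deriv_kappa_def by (simp add: add.commute)
  qed
  have G_tau: "G (\<tau> (Suc k)) = w ^ par d * (of_real (\<tau> (Suc k)) ^ d * S (of_real (\<tau> (Suc k))) / ((of_real (\<tau> (Suc k)))\<^sup>2 - w\<^sup>2))" for k
  proof -
    have "complex_of_real (\<tau> (Suc k)) ^ d = of_real (\<tau> (Suc k)) ^ (2 * M) * of_real (\<tau> (Suc k)) ^ (1 - par d)"
      unfolding power_add[symmetric] M ..
    then show ?thesis by (simp add: G_def kappa_def)
  qed
  obtain C where C: "\<And>x. norm (of_real x ^ (2 * M) * S (of_real x)) \<le> C" using S_power_bounded by blast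
  have lim: "(\<lambda>k. G (\<tau> (Suc k))) \<longlonglongrightarrow> 0"
  proof (rule Lim_null_comparison)
    show "eventually (\<lambda>k. norm (G (\<tau> (Suc k))) \<le> C * norm (kappa (par d) w (\<tau> (Suc k)))) sequentially"
      unfolding G_def norm_mult[of _ "kappa _ _ _"] by (intro always_eventually allI mult_right_mono C) auto
    have "(\<lambda>k. kappa (par d) w (\<tau> (Suc k))) \<longlonglongrightarrow> 0"
      by (rule filterlim_compose[OF kappa_tendsto_0[OF par_cases] tau_at_top])
    then show "(\<lambda>k. C * norm (kappa (par d) w (\<tau> (Suc k)))) \<longlonglongrightarrow> 0"
      by (intro tendsto_mult_right_zero tendsto_norm_zero)
  qed
  have "set_integrable lborel {0..} (power_deriv_kappa (2 * M) w)"
    unfolding set_integrable_def by (rule integrable_mult_indicator[OF _ power_deriv_kappa_integrable[OF w]]) simp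
  then have s1: "(\<lambda>k. (-1) ^ Suc k * G (\<tau> (Suc k))) sums
      (- (G 0 + (LINT x:{0..}|lborel. of_real (signature \<phi> x) * power_deriv_kappa (2 * M) w x)) / 2)"
    by (intro signature_sums dG continuous_on_power_deriv_kappa w lim)
  have G0: "G 0 = 0"
  proof (cases "M = 0")
    case True
    then have "par d = 0" by (simp add: M_def)
    then show ?thesis by (simp add: G_def kappa_def)
  qed (simp add: G_def)
  obtain A where A: "A \<ge> 0" "\<And>z. norm (S z) \<le> A * exp (norm z)" using S_bound by blast
  obtain C' where C': "\<And>x. norm (of_real x ^ (d - 1) * S (of_real x)) \<le> C' / (1 + x\<^sup>2)" using S_decay by blast
  have "(\<lambda>k. (-1) ^ Suc k * (of_real (\<tau> (Suc k)) ^ d * S (of_real (\<tau> (Suc k))) / ((of_real (\<tau> (Suc k)))\<^sup>2 - w\<^sup>2)))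
           sums (of_real a * (1 - S w / \<phi> w) / w\<^sup>2)"
    by (rule extremal_sum[OF S_holomorphic S_even S_0 S_real A C' w])
  then have "(\<lambda>k. w ^ par d * ((-1) ^ Suc k * (of_real (\<tau> (Suc k)) ^ d * S (of_real (\<tau> (Suc k))) / ((of_real (\<tau> (Suc k)))\<^sup>2 - w\<^sup>2))))
           sums (w ^ par d * (of_real a * (1 - S w / \<phi> w) / w\<^sup>2))"
    by (rule sums_mult)
  then have "(\<lambda>k. (-1) ^ Suc k * G (\<tau> (Suc k))) sums (w ^ par d * (of_real a * (1 - S w / \<phi> w) / w\<^sup>2))"
    unfolding G_tau by (simp only: mult_ac)
  from sums_unique2[OF this s1[unfolded G0]]
  have "w ^ par d * (of_real a * (1 - S w / \<phi> w) / w\<^sup>2) = - (0 + (LINT x:{0..}|lborel. of_real (signature \<phi> x) * power_deriv_kappa (2 * M) w x)) / 2" .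
  moreover have "Y = - 2 * X" if "X = - (0 + Y) / 2" for X Y :: complex using that by simp
  ultimately show ?thesis by (simp only: mult.assoc)
qed

text \<open>The two evaluations are combined at \<open>w = \<i> y\<close>. The moments of the derivative of order \<open>2 M\<close> of the bump
contribute only through the top coefficient of the polynomial, whose prescribed value makes them cancel
the part of \<open>extremal_sum\<close> that is free of \<open>S w / \<phi> w\<close>. What is left is a multiple of \<open>S w\<close>, and after
division by \<open>S w\<close> the choice of the bump has disappeared.\<close>

lemma logderiv_gap_imaginary:
  assumes y: "y > 0"
  defines "w \<equiv> \<i> * complex_of_real y"
  shows "w ^ (d + 1) * logderiv_gap (par d) w * \<phi> w = 2 * poly (R_poly d p) w * \<phi> w - 2 * of_real a"
proof -
  define M N e where "M = half_deg d + par d" and "N = half_deg d" and "e = par d"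
  define F where "F = logderiv_gap e w"
  define B where "B = w ^ (2 * M) * S w"
  define s1 where "s1 = (\<Sum>n\<le>N. of_real (p n) * (fact (2 * n + e + 1) / complex_of_real y ^ (2 * n + e + 2)))"
  have w: "Im w \<noteq> 0" "w \<noteq> 0" and y0: "complex_of_real y \<noteq> 0" using y by (auto simp: w_def)
  have phiw: "\<phi> w \<noteq> 0" by (rule phi_nonreal[OF w(1)])
  have Sw: "S w \<noteq> 0" unfolding w_def by (rule S_imaginary_nonzero)
  have e: "e = 0 \<or> e = 1" unfolding e_def by (rule par_cases)
  have M: "2 * M + 1 = d + e" using twice_half_deg[OF d_pos] by (simp add: M_def e_def)
  have MN: "M = N + e" by (simp add: M_def N_def e_def)
  have tail: "(\<Sum>n\<le>N. of_real (p n) * ((- ((-1) ^ M)) * resolvent_moments (of_real y) (moment (bump (2 * M))) (2 * n + e + 1)))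
      = - ((-1) ^ e * (8 * of_real a / 2 ^ e) / of_real y ^ (2 - e))"
  proof -
    have z: "resolvent_moments (of_real y) (moment (bump (2 * M))) (2 * n + e + 1) = 0" if "n < N" for n
      by (rule resolvent_moments_bump(1)[OF y0]) (use that e in \<open>auto simp: MN\<close>)
    have "(\<Sum>n\<le>N. of_real (p n) * ((- ((-1) ^ M)) * resolvent_moments (of_real y) (moment (bump (2 * M))) (2 * n + e + 1)))
      = (\<Sum>n\<in>{N}. of_real (p n) * ((- ((-1) ^ M)) * resolvent_moments (of_real y) (moment (bump (2 * M))) (2 * n + e + 1)))"
    proof (rule sum.mono_neutral_right)
      show "\<forall>n\<in>{..N} - {N}. of_real (p n) * ((- ((-1) ^ M)) * resolvent_moments (of_real y) (moment (bump (2 * M))) (2 * n + e + 1)) = 0"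
      proof
        fix n assume "n \<in> {..N} - {N}"
        then have "n < N" by auto
        then show "of_real (p n) * ((- ((-1) ^ M)) * resolvent_moments (of_real y) (moment (bump (2 * M))) (2 * n + e + 1)) = 0"
          by (simp only: z mult_zero_right)
      qed
    qed auto
    also have "\<dots> = of_real (p N) * ((- ((-1) ^ M)) * (fact d / of_real y ^ (2 - e)))"
    proof -
      have "resolvent_moments (of_real y) (moment (bump (2 * M))) (2 * N + e + 1) = fact d / of_real y ^ (2 - e)"
        using e
      proof
        assume e0: "e = 0"
        then have idx: "2 * N + e + 1 = Suc (2 * M)" "Suc (2 * M) = d" using M MN by auto
        show ?thesis unfolding idx(1) resolvent_moments_bump(3)[OF y0] unfolding idx(2) by (simp add: e0)
      next
        assume e1: "e = 1"
        then have idx: "2 * N + e + 1 = 2 * M" "2 * M = d" using M MN by auto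
        have "resolvent_moments (of_real y) (moment (bump (2 * M))) (2 * M) = fact (2 * M) / of_real y"
          using resolvent_moments_bump(2)[OF y0, of "2 * M"] by simp
        then show ?thesis unfolding idx(1) using idx(2) e1 by simp
      qed
      then show ?thesis by (simp only: sum.insert finite.emptyI empty_iff not_False_eq_True sum.empty add_0_right)
    qed
    also have "p N = (-1) ^ N * (2 / 2 ^ e) * (4 * a / fact d)" using p_top by (simp add: N_def e_def)
    also have "complex_of_real ((-1) ^ N * (2 / 2 ^ e) * (4 * a / fact d)) * ((- ((-1) ^ M)) * (fact d / of_real y ^ (2 - e)))
        = - (((-1) ^ N * (-1) ^ M) * (8 * of_real a / 2 ^ e) / of_real y ^ (2 - e))"
      by simp
    also have "(-1) ^ N * (-1) ^ M = ((-1) ^ e :: complex)"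
      unfolding MN power_add by (simp flip: power_mult_distrib mult.assoc)
    finally show ?thesis .
  qed
  have kap: "(LINT x:{0..}|lborel. of_real (signature \<phi> x) * kappa' e w x) = - F + of_nat e / w"
  proof -
    have "kappa e w 0 = - of_nat e / w"
      using e w by (auto simp: kappa_def power2_eq_square)
    then show ?thesis unfolding F_def logderiv_gap_def by (simp add: algebra_simps)
  qed
  have pdk: "(LINT x:{0..}|lborel. of_real (signature \<phi> x) * power_deriv_kappa (2 * M) w x)
      = - 2 * w ^ e * (of_real a * (1 - S w / \<phi> w) / w\<^sup>2)"
    unfolding M_def e_def by (rule power_deriv_kappa_integral[OF w(1)])
  have "2 / 2 ^ e * \<i> ^ e * (2 * (B * (- F + of_nat e / w) - (- 2 * w ^ e * (of_real a * (1 - S w / \<phi> w) / w\<^sup>2))))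
      = (\<Sum>n\<le>N. of_real (p n) * (B * (fact (2 * n + e + 1) / of_real y ^ (2 * n + e + 2))
        + (- ((-1) ^ M)) * resolvent_moments (of_real y) (moment (bump (2 * M))) (2 * n + e + 1)))"
    using squeezed_identity_limit[OF y, folded w_def M_def e_def N_def] unfolding kap pdk B_def .
  also have "\<dots> = B * s1 + (\<Sum>n\<le>N. of_real (p n) * ((- ((-1) ^ M)) * resolvent_moments (of_real y) (moment (bump (2 * M))) (2 * n + e + 1)))"
    unfolding s1_def by (simp add: sum.distrib sum_distrib_left algebra_simps)
  finally have main: "2 / 2 ^ e * \<i> ^ e * (2 * (B * (- F + of_nat e / w) + 2 * w ^ e * (of_real a * (1 - S w / \<phi> w) / w\<^sup>2)))
      = B * s1 - (-1) ^ e * (8 * of_real a / 2 ^ e) / of_real y ^ (2 - e)"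
    unfolding tail by simp
  (* The prescribed top coefficient of p enters through this equality. *)
  have canc: "2 / 2 ^ e * \<i> ^ e * (2 * (2 * w ^ e * (of_real a / w\<^sup>2))) = - ((-1) ^ e * (8 * of_real a / 2 ^ e) / of_real y ^ (2 - e))"
    using e y0 by (auto simp: w_def power2_eq_square field_simps)
  have "2 / 2 ^ e * \<i> ^ e * (2 * (B * (- F + of_nat e / w) + 2 * w ^ e * (of_real a * (1 - S w / \<phi> w) / w\<^sup>2)))
     = S w * (2 / 2 ^ e * \<i> ^ e * (2 * (w ^ (2 * M) * (- F + of_nat e / w) - 2 * w ^ e * (of_real a / (\<phi> w * w\<^sup>2)))))
       + 2 / 2 ^ e * \<i> ^ e * (2 * (2 * w ^ e * (of_real a / w\<^sup>2)))"
    using w phiw by (simp add: B_def diff_divide_distrib algebra_simps)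
  with main have "S w * (2 / 2 ^ e * \<i> ^ e * (2 * (w ^ (2 * M) * (- F + of_nat e / w) - 2 * w ^ e * (of_real a / (\<phi> w * w\<^sup>2))))) = S w * (w ^ (2 * M) * s1)"
    unfolding canc B_def by (simp add: mult_ac)
  then have red: "2 / 2 ^ e * \<i> ^ e * (2 * (w ^ (2 * M) * (- F + of_nat e / w) - 2 * w ^ e * (of_real a / (\<phi> w * w\<^sup>2)))) = w ^ (2 * M) * s1"
    using mult_left_cancel[OF Sw] by blast
  have d1: "d + 1 = 2 * M + (2 - e)" "d + 1 = 2 * N + e + 2" using M MN e by auto
  define Q where "Q = (\<Sum>n\<le>N. (-1) ^ n * fact (2 * n + e + 1) * complex_of_real (p n) * w ^ (2 * (N - n)))"
  have s1Q: "w ^ (d + 1) * s1 = - (\<i> ^ e * Q)"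
  proof -
    have "w ^ (d + 1) * (of_real (p n) * (fact (2 * n + e + 1) / complex_of_real y ^ (2 * n + e + 2)))
        = - (\<i> ^ e * ((-1) ^ n * fact (2 * n + e + 1) * complex_of_real (p n) * w ^ (2 * (N - n))))" if "n \<le> N" for n
    proof -
      have "d + 1 = 2 * (N - n) + (2 * n + e + 2)" using d1(2) that by simp
      then have "w ^ (d + 1) = w ^ (2 * (N - n)) * w ^ (2 * n + e + 2)" by (simp only: power_add)
      also have "w ^ (2 * n + e + 2) = \<i> ^ (2 * n + e + 2) * of_real y ^ (2 * n + e + 2)"
        unfolding w_def by (rule power_mult_distrib)
      also have "\<i> ^ (2 * n + e + 2) = - ((-1) ^ n * \<i> ^ e)" by (simp add: power_add power_mult)
      finally show ?thesis using y0 by (simp add: field_simps)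
    qed
    then show ?thesis unfolding s1_def Q_def sum_distrib_left sum_negf[symmetric] by (intro sum.cong) auto
  qed
  have "w ^ (2 - e) * (2 / 2 ^ e * \<i> ^ e * (2 * (w ^ (2 * M) * (- F + of_nat e / w) - 2 * w ^ e * (of_real a / (\<phi> w * w\<^sup>2))))) = w ^ (d + 1) * s1"
    unfolding red d1(1) power_add by (simp add: mult_ac)
  then have fin: "\<i> ^ e * (4 / 2 ^ e * (w ^ (d + 1) * (- F) + w ^ (d + 1) * (of_nat e / w) - 2 * of_real a / \<phi> w)) = \<i> ^ e * (- Q)"
  proof -
    assume h: "w ^ (2 - e) * (2 / 2 ^ e * \<i> ^ e * (2 * (w ^ (2 * M) * (- F + of_nat e / w) - 2 * w ^ e * (of_real a / (\<phi> w * w\<^sup>2))))) = w ^ (d + 1) * s1"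
    have w2: "w ^ (2 - e) * w ^ e = w\<^sup>2" using e by (auto simp: power2_eq_square)
    have f1: "2 * of_real a / \<phi> w = 2 * (w ^ (2 - e) * w ^ e) * (of_real a / (\<phi> w * w\<^sup>2))"
      unfolding w2 using w phiw by simp
    have "\<i> ^ e * (4 / 2 ^ e * (w ^ (d + 1) * (- F) + w ^ (d + 1) * (of_nat e / w) - 2 * of_real a / \<phi> w))
      = w ^ (2 - e) * (2 / 2 ^ e * \<i> ^ e * (2 * (w ^ (2 * M) * (- F + of_nat e / w) - 2 * w ^ e * (of_real a / (\<phi> w * w\<^sup>2)))))"
      unfolding f1 d1(1) power_add by (simp add: algebra_simps)
    then show ?thesis unfolding h s1Q by simp
  qed
  then have "4 / 2 ^ e * (w ^ (d + 1) * (- F) + w ^ (d + 1) * (of_nat e / w) - 2 * of_real a / \<phi> w) = - Q"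
    using mult_left_cancel[of "\<i> ^ e"] by fastforce
  then have fin2: "w ^ (d + 1) * F = w ^ (d + 1) * (of_nat e / w) - 2 * of_real a / \<phi> w + 2 ^ e / 4 * Q"
    using e by (auto simp: field_simps)
  have we: "w ^ (d + 1) * (of_nat e / w) = of_nat e * w ^ (2 * M)"
    using e w M by (auto simp: d1(1))
  have bump: "2 * poly (R_poly d p) w = of_nat e * w ^ (2 * M) + 2 ^ e / 4 * Q"
    unfolding poly_R_poly Q_def N_def e_def M_def by simp
  have "w ^ (d + 1) * F = 2 * poly (R_poly d p) w - 2 * of_real a / \<phi> w"
    unfolding fin2 we bump by simp
  then show ?thesis using phiw unfolding F_def e_def by (simp add: left_diff_distrib)
qed

end

section \<open>Growth of the logarithmic derivative\<close>

text \<open>On the circle of radius \<open>r\<close> one has \<open>u\<^sup>2 - r\<^sup>2 = 2 \<i> Im u u\<close>, so the factor \<open>(u\<^sup>2 - r\<^sup>2) ^ m\<close> absorbs the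
singularity of the bound at the real axis. The maximum principle is applied with \<open>r = 2 norm z\<close>, where the
factor is comparable to \<open>r ^ (2m)\<close> at \<open>z\<close>.\<close>

lemma entire_polynomial_growth_off_real_axis:
  assumes hol: "f holomorphic_on UNIV"
    and bd: "\<And>z. Im z \<noteq> 0 \<Longrightarrow> norm z \<ge> 1 \<Longrightarrow> norm (f z) \<le> C * norm z ^ n * (norm z / \<bar>Im z\<bar>) ^ m"
    and C: "C \<ge> 0" and m: "m > 0" and z: "norm z \<ge> 1"
  shows "norm (f z) \<le> C * (8 / 3) ^ m * 2 ^ n * norm z ^ n"
proof -
  define r where "r = 2 * norm z"
  have r: "r \<ge> 1" "r > 0" using z by (auto simp: r_def)
  define h where "h = (\<lambda>u. f u * (u\<^sup>2 - (of_real r)\<^sup>2) ^ m)"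
  have h_hol: "h holomorphic_on X" for X
    unfolding h_def by (intro holomorphic_intros holomorphic_on_subset[OF hol]) auto
  have frontier_bd: "norm (h u) \<le> C * r ^ n * (2 * r\<^sup>2) ^ m" if u: "norm u = r" for u
  proof (cases "Im u = 0")
    case True
    then have "u\<^sup>2 = (of_real (Re u))\<^sup>2" by (metis complex_is_Real_iff of_real_Re)
    also have "\<dots> = (of_real r)\<^sup>2"
    proof -
      have "(Re u)\<^sup>2 = r\<^sup>2" using True u cmod_power2[of u] by simp
      then show ?thesis by (metis of_real_power)
    qed
    finally show ?thesis using m C r by (simp add: h_def power_0_left)
  next
    case False
    have eq: "u\<^sup>2 - (of_real r)\<^sup>2 = 2 * \<i> * of_real (Im u) * u"
    proof -
      have "(of_real r)\<^sup>2 = u * cnj u" using u complex_norm_square[of u] by simp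
      then have "u\<^sup>2 - (of_real r)\<^sup>2 = u * (u - cnj u)" by (simp add: power2_eq_square algebra_simps)
      then show ?thesis unfolding complex_diff_cnj by simp
    qed
    have "norm (h u) = norm (f u) * (2 * \<bar>Im u\<bar> * r) ^ m"
      unfolding h_def eq by (simp add: norm_mult norm_power u)
    also have "\<dots> \<le> (C * r ^ n * (r / \<bar>Im u\<bar>) ^ m) * (2 * \<bar>Im u\<bar> * r) ^ m"
      using bd[of u] False u r by (intro mult_right_mono) auto
    also have "\<dots> = C * r ^ n * (r / \<bar>Im u\<bar> * (2 * \<bar>Im u\<bar> * r)) ^ m"
      by (simp only: power_mult_distrib mult_ac)
    also have "r / \<bar>Im u\<bar> * (2 * \<bar>Im u\<bar> * r) = 2 * r\<^sup>2" using False by (simp add: power2_eq_square)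
    finally show ?thesis .
  qed
  have "norm (h z) \<le> C * r ^ n * (2 * r\<^sup>2) ^ m"
  proof (rule maximum_modulus_frontier[of h "cball 0 r"])
    show "continuous_on (closure (cball 0 r)) h" using h_hol holomorphic_on_imp_continuous_on by blast
    show "norm (h u) \<le> C * r ^ n * (2 * r\<^sup>2) ^ m" if "u \<in> frontier (cball 0 r)" for u
      using frontier_bd that r by simp
  qed (use r in \<open>auto simp: r_def h_hol\<close>)
  moreover have "(3 / 4 * r\<^sup>2) ^ m \<le> norm ((z\<^sup>2 - (of_real r)\<^sup>2) ^ m)"
  proof -
    have "norm ((of_real r)\<^sup>2 :: complex) - norm (z\<^sup>2) \<le> norm (z\<^sup>2 - (of_real r)\<^sup>2)"
      using norm_triangle_ineq2[of "(of_real r)\<^sup>2" "z\<^sup>2"] by (simp add: norm_minus_commute)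
    moreover have "norm ((of_real r)\<^sup>2 :: complex) - norm (z\<^sup>2) = 3 / 4 * r\<^sup>2"
      by (simp add: norm_power r_def power_mult_distrib)
    ultimately show ?thesis unfolding norm_power[of "z\<^sup>2 - _"] using r by (intro power_mono) auto
  qed
  ultimately have "norm (f z) * (3 / 4 * r\<^sup>2) ^ m \<le> C * r ^ n * (2 * r\<^sup>2) ^ m"
    unfolding h_def norm_mult by (meson mult_left_mono norm_ge_zero order_trans)
  also have "C * r ^ n * (2 * r\<^sup>2) ^ m = (C * (8 / 3) ^ m * r ^ n) * (3 / 4 * r\<^sup>2) ^ m"
  proof -
    have "(2 * r\<^sup>2) ^ m = (8 / 3) ^ m * (3 / 4 * r\<^sup>2) ^ m" unfolding power_mult_distrib[symmetric] by simp
    then show ?thesis by simp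
  qed
  finally have "norm (f z) \<le> C * (8 / 3) ^ m * r ^ n" using r by simp
  then show ?thesis by (simp add: r_def power_mult_distrib mult_ac)
qed

text \<open>Boundedness near infinity of the argument \<open>1 / (\<i> y)\<close> leaves only a constant, which the limit determines.\<close>

lemma poly_bounded_on_axis_imp_zero:
  fixes r :: "complex poly"
  assumes bd: "\<And>y. 0 < y \<Longrightarrow> y \<le> y0 \<Longrightarrow> norm (poly r (1 / (\<i> * of_real y))) \<le> C" and y0: "y0 > 0"
    and lim: "((\<lambda>y. poly r (1 / (\<i> * of_real y))) \<longlongrightarrow> 0) at_top"
  shows "r = 0"
proof -
  obtain c r' where r: "r = pCons c r'" by (cases r)
  have "r' = 0"
  proof (rule ccontr)
    assume "r' \<noteq> 0"
    then obtain b where b: "\<And>z. b \<le> norm z \<Longrightarrow> C + 1 \<le> norm (poly (pCons c r') z)"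
      using poly_infinity by blast
    define y where "y = min y0 (1 / max b 1)"
    have y: "0 < y" "y \<le> y0" "y \<le> 1 / max b 1" using y0 by (auto simp: y_def)
    have "b \<le> 1 / y"
    proof -
      have "m \<le> 1 / y" if "m > 0" "y \<le> 1 / m" for m using that y(1) by (simp add: pos_le_divide_eq mult.commute)
      from this[of "max b 1"] have "max b 1 \<le> 1 / y" using y by simp
      then show ?thesis by linarith
    qed
    then have "b \<le> norm (1 / (\<i> * of_real y))" using y by (simp add: norm_divide norm_mult)
    from b[OF this] bd[OF y(1,2)] show False unfolding r by simp
  qed
  then have "((\<lambda>y::real. c) \<longlongrightarrow> 0) at_top" using lim unfolding r by simp
  then have "c = 0" by (simp add: tendsto_const_iff)
  then show ?thesis using \<open>r' = 0\<close> r by simp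
qed

context real_zeros
begin

lemma logderiv_sums:
  assumes "\<phi> z \<noteq> 0"
  shows "(\<lambda>k. - 2 * z / ((of_real (\<tau> (Suc k)))\<^sup>2 - z\<^sup>2)) sums (deriv \<phi> z / \<phi> z)"
proof -
  have eq: "\<phi> = (\<lambda>z. \<Prod>k. 1 + 0 * z + (- 1 / of_real (\<tau> (Suc k)) ^ 2) * z\<^sup>2)"
    by (rule ext) (rule phi_prodinf)
  have "(\<lambda>k. (0 + 2 * (- 1 / of_real (\<tau> (Suc k)) ^ 2) * z) / (1 + 0 * z + (- 1 / of_real (\<tau> (Suc k)) ^ 2) * z\<^sup>2)) sums (deriv \<phi> z / \<phi> z)"
    using logderiv_quadratic_prod[of "\<lambda>_. 0" "\<lambda>k. - 1 / of_real (\<tau> (Suc k)) ^ 2" z] summable_phi_coeffs assms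
    unfolding eq by simp
  moreover have "(0 + 2 * (- 1 / of_real (\<tau> (Suc k)) ^ 2) * z) / (1 + 0 * z + (- 1 / of_real (\<tau> (Suc k)) ^ 2) * z\<^sup>2)
      = - 2 * z / ((of_real (\<tau> (Suc k)))\<^sup>2 - z\<^sup>2)" for k
  proof -
    have t: "complex_of_real (\<tau> (Suc k)) \<noteq> 0" using tau_pos[of k] by simp
    have "1 + 0 * z + (- 1 / of_real (\<tau> (Suc k)) ^ 2) * z\<^sup>2 = ((of_real (\<tau> (Suc k)))\<^sup>2 - z\<^sup>2) / (of_real (\<tau> (Suc k)))\<^sup>2"
      using t by (simp add: field_simps)
    then show ?thesis using t by simp
  qed
  ultimately show ?thesis by (simp only:)
qed

lemma norm_logderiv_le:
  obtains C where "C \<ge> 0" "\<And>z. Im z \<noteq> 0 \<Longrightarrow> norm (deriv \<phi> z / \<phi> z) \<le> C * (norm z / \<bar>Im z\<bar>) ^ 2"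
proof -
  obtain c where c: "c > 0" "\<And>k. \<tau> (Suc k) \<ge> c * real (Suc k)" using tau_lower by blast
  show ?thesis
  proof (rule that[of "2 * pi / c"])
    fix z assume z: "Im z \<noteq> 0"
    let ?s = "norm z / \<bar>Im z\<bar>"
    have z0: "norm z > 0" using z by auto
    have bnd: "norm (- 2 * z / ((of_real (\<tau> (Suc k)))\<^sup>2 - z\<^sup>2)) \<le> 4 * norm z * ?s\<^sup>2 * (1 / ((\<tau> (Suc k))\<^sup>2 + (norm z)\<^sup>2))" for k
    proof -
      let ?D = "norm ((of_real (\<tau> (Suc k)))\<^sup>2 - z\<^sup>2)" and ?n = "(\<tau> (Suc k))\<^sup>2 + (norm z)\<^sup>2"
      have D0: "?D > 0" using of_real_square_neq_square[OF z] by simp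
      have n0: "?n > 0" using z0 by (simp add: add_nonneg_pos)
      have "?n \<le> 2 * ?s\<^sup>2 * ?D" by (rule norm_diff_squares_lower[OF z])
      moreover have "1 / D \<le> X / n" if "n > 0" "D > 0" "n \<le> X * D" for n D X :: real
        using that by (simp add: divide_simps mult_ac)
      ultimately have "1 / ?D \<le> 2 * ?s\<^sup>2 / ?n" using D0 n0 by blast
      then have "2 * norm z * (1 / ?D) \<le> 2 * norm z * (2 * ?s\<^sup>2 / ?n)" by (rule mult_left_mono) simp
      then show ?thesis by (simp add: norm_divide norm_mult)
    qed
    have partial: "norm (\<Sum>k<n. - 2 * z / ((of_real (\<tau> (Suc k)))\<^sup>2 - z\<^sup>2)) \<le> 2 * pi / c * ?s\<^sup>2" for n
    proof -
      have "norm (\<Sum>k<n. - 2 * z / ((of_real (\<tau> (Suc k)))\<^sup>2 - z\<^sup>2)) \<le> (\<Sum>k<n. 4 * norm z * ?s\<^sup>2 * (1 / ((\<tau> (Suc k))\<^sup>2 + (norm z)\<^sup>2)))"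
        by (rule sum_norm_le) (rule bnd)
      also have "\<dots> = 4 * norm z * ?s\<^sup>2 * (\<Sum>k<n. 1 / ((\<tau> (Suc k))\<^sup>2 + (norm z)\<^sup>2))" by (rule sum_distrib_left[symmetric])
      also have "\<dots> \<le> 4 * norm z * ?s\<^sup>2 * (pi / (2 * c * norm z))"
        by (intro mult_left_mono sum_inverse_squares_le c z0) auto
      also have "\<dots> = 2 * pi / c * ?s\<^sup>2" using z0 c(1) by (simp add: field_simps)
      finally show ?thesis .
    qed
    show "norm (deriv \<phi> z / \<phi> z) \<le> 2 * pi / c * ?s ^ 2"
    proof (rule tendsto_upperbound)
      show "(\<lambda>n. norm (\<Sum>k<n. - 2 * z / ((of_real (\<tau> (Suc k)))\<^sup>2 - z\<^sup>2))) \<longlonglongrightarrow> norm (deriv \<phi> z / \<phi> z)"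
        using logderiv_sums[OF phi_nonreal[OF z]] unfolding sums_def by (rule tendsto_norm)
    qed (use partial in auto)
  qed (use c in simp)
qed

lemma logderiv_has_derivative:
  assumes "\<phi> z \<noteq> 0"
  shows "((\<lambda>z. deriv \<phi> z / \<phi> z) has_field_derivative (deriv (deriv \<phi>) z / \<phi> z - (deriv \<phi> z / \<phi> z)\<^sup>2)) (at z)"
proof -
  have 1: "(\<phi> has_field_derivative deriv \<phi> z) (at z)"
    by (rule holomorphic_derivI[OF phi_holomorphic open_UNIV UNIV_I])
  have 2: "(deriv \<phi> has_field_derivative deriv (deriv \<phi>) z) (at z)"
    by (rule holomorphic_derivI[OF holomorphic_deriv[OF phi_holomorphic open_UNIV] open_UNIV UNIV_I])
  show ?thesis
    using DERIV_divide[OF 2 1 assms] by (rule DERIV_cong) (use assms in \<open>simp add: field_simps power2_eq_square\<close>)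
qed

text \<open>Cauchy's inequality for \<open>\<phi>' / \<phi>\<close> on the disc of radius \<open>\<bar>Im z\<bar> / 2\<close>, where \<open>norm x / \<bar>Im x\<bar>\<close> is at most three
times its value at the centre. Its radius accounts for the additional factor \<open>norm z / \<bar>Im z\<bar>\<close> over \<open>norm z\<close>.\<close>

lemma norm_logderiv_deriv_le:
  obtains C where "C \<ge> 0" "\<And>z. Im z \<noteq> 0 \<Longrightarrow>
    norm (deriv (deriv \<phi>) z / \<phi> z - (deriv \<phi> z / \<phi> z)\<^sup>2) \<le> C * (norm z / \<bar>Im z\<bar>) ^ 3 / norm z"
proof -
  obtain C where C: "C \<ge> 0" "\<And>z. Im z \<noteq> 0 \<Longrightarrow> norm (deriv \<phi> z / \<phi> z) \<le> C * (norm z / \<bar>Im z\<bar>) ^ 2"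
    using norm_logderiv_le by blast
  show ?thesis
  proof (rule that[of "18 * C"])
    fix z assume z: "Im z \<noteq> 0"
    let ?s = "norm z / \<bar>Im z\<bar>" and ?r = "\<bar>Im z\<bar> / 2" and ?L = "\<lambda>z. deriv \<phi> z / \<phi> z"
    have z0: "norm z > 0" using z by auto
    have near: "Im x \<noteq> 0 \<and> norm (?L x) \<le> C * (9 * ?s\<^sup>2)" if x: "norm (z - x) \<le> ?r" for x
    proof -
      have "\<bar>Im (z - x)\<bar> \<le> ?r" using abs_Im_le_cmod[of "z - x"] x by linarith
      moreover have "\<bar>Im z\<bar> \<le> \<bar>Im x\<bar> + \<bar>Im (z - x)\<bar>" using abs_triangle_ineq[of "Im x" "Im (z - x)"] by simp
      ultimately have im: "\<bar>Im x\<bar> \<ge> \<bar>Im z\<bar> / 2" by linarith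
      then have im0: "Im x \<noteq> 0" using z by auto
      have "norm x \<le> norm z + ?r" using norm_triangle_sub[of x z] x by (simp add: norm_minus_commute)
      then have "norm x \<le> 3 / 2 * norm z" using abs_Im_le_cmod[of z] by linarith
      then have "norm x / \<bar>Im x\<bar> \<le> (3 / 2 * norm z) / (\<bar>Im z\<bar> / 2)"
        using im z by (intro frac_le) auto
      also have "\<dots> = 3 * ?s" by simp
      finally have "(norm x / \<bar>Im x\<bar>)\<^sup>2 \<le> (3 * ?s)\<^sup>2" by (intro power_mono) auto
      then have "C * (norm x / \<bar>Im x\<bar>)\<^sup>2 \<le> C * (9 * ?s\<^sup>2)"
        using C(1) by (intro mult_left_mono) (auto simp: power_mult_distrib power_divide)
      then show ?thesis using C(2)[OF im0] im0 by linarith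
    qed
    have hol: "?L holomorphic_on cball z ?r"
      by (intro holomorphic_intros phi_holomorphic holomorphic_on_subset[OF holomorphic_deriv[OF phi_holomorphic open_UNIV]])
         (use near phi_nonreal in \<open>auto simp: dist_norm\<close>)
    have "norm ((deriv ^^ 1) ?L z) \<le> fact 1 * (C * (9 * ?s\<^sup>2)) / ?r ^ 1"
    proof (rule Cauchy_inequality[of ?L z ?r])
      show "?L holomorphic_on ball z ?r" by (rule holomorphic_on_subset[OF hol]) (rule ball_subset_cball)
      show "continuous_on (cball z ?r) ?L" by (rule holomorphic_on_imp_continuous_on[OF hol])
    qed (use z near in auto)
    moreover have "deriv ?L z = deriv (deriv \<phi>) z / \<phi> z - (?L z)\<^sup>2"
      by (rule DERIV_imp_deriv[OF logderiv_has_derivative[OF phi_nonreal[OF z]]])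
    moreover have "fact 1 * (C * (9 * ?s\<^sup>2)) / ?r ^ 1 = 18 * C * ?s ^ 3 / norm z"
      using z z0 by (simp add: field_simps power2_eq_square power3_eq_cube)
    ultimately show "norm (deriv (deriv \<phi>) z / \<phi> z - (?L z)\<^sup>2) \<le> 18 * C * ?s ^ 3 / norm z" by simp
  qed (use C in simp)
qed

text \<open>Because of \<open>\<tau> k \<sim> \<pi> k\<close> the sum behaves like the integral of \<open>2 y / (y\<^sup>2 + \<pi>\<^sup>2 t\<^sup>2)\<close> over the positive half-line,
which is \<open>1\<close>. The finitely many zeros that are not yet close to \<open>\<pi> k\<close> contribute \<open>O(1 / y)\<close>.\<close>

lemma imaginary_sum_tendsto:
  "((\<lambda>y. \<Sum>k. 2 * y / (y\<^sup>2 + (\<tau> (Suc k))\<^sup>2)) \<longlongrightarrow> 1) at_top"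
    (is "(?S \<longlongrightarrow> 1) at_top")
proof -
  have summ: "summable (\<lambda>k. 2 * y / (y\<^sup>2 + (\<tau> (Suc k))\<^sup>2))" if y: "y > 0" for y :: real
  proof (rule summable_comparison_test'[of "\<lambda>k. 2 * y * (1 / (\<tau> (Suc k))\<^sup>2)" 0])
    show "summable (\<lambda>k. 2 * y * (1 / (\<tau> (Suc k))\<^sup>2))" by (intro summable_mult summable_tau_sq)
    fix k
    have "2 * y / (y\<^sup>2 + (\<tau> (Suc k))\<^sup>2) \<le> 2 * y / (\<tau> (Suc k))\<^sup>2"
      using y tau_pos[of k] by (intro divide_left_mono mult_pos_pos add_pos_pos) auto
    then show "norm (2 * y / (y\<^sup>2 + (\<tau> (Suc k))\<^sup>2)) \<le> 2 * y * (1 / (\<tau> (Suc k))\<^sup>2)" using y by simp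
  qed
  have part: "(\<lambda>n. 2 * y * (\<Sum>k<n. 1 / ((\<tau> (Suc k))\<^sup>2 + y\<^sup>2))) \<longlonglongrightarrow> ?S y" if y: "y > 0" for y :: real
    using summable_LIMSEQ[OF summ[OF y]] by (simp add: sum_distrib_left add.commute)
  have ev: "eventually (\<lambda>k. l * (pi * real k) < \<tau> k \<and> \<tau> k < u * (pi * real k)) sequentially"
    if "l < 1" "1 < u" for l u :: real
  proof -
    have "eventually (\<lambda>k. l < \<tau> k / (pi * real k)) sequentially"
      "eventually (\<lambda>k. \<tau> k / (pi * real k) < u) sequentially"
      using order_tendstoD[OF tau_quotient_tendsto] that by auto
    then show ?thesis using eventually_gt_at_top[of 0]
      by eventually_elim (simp add: field_simps)
  qed
  have upper: "eventually (\<lambda>y. ?S y < b) at_top" if b: "b > 1" for b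
  proof -
    define l where "l = (1 + 1 / b) / 2"
    have l: "0 < l" "l < 1" "1 / l < b" using b by (auto simp: l_def field_simps)
    obtain K where K: "\<And>k. k \<ge> K \<Longrightarrow> l * (pi * real k) < \<tau> k"
      using ev[OF l(2), of 2] unfolding eventually_sequentially by force
    have le: "?S y \<le> 2 * real K / y + 1 / l" if y: "y > 0" for y
    proof (rule LIMSEQ_le_const2[OF part[OF y]], intro exI allI impI)
      fix n
      have "(\<Sum>k<n. 1 / ((\<tau> (Suc k))\<^sup>2 + y\<^sup>2)) \<le> real K / y\<^sup>2 + pi / (2 * (l * pi) * y)"
      proof (rule sum_inverse_squares_le'[OF _ _ y])
        show "l * pi * real (Suc k) \<le> \<tau> (Suc k)" if "K \<le> k" for k
          using K[of "Suc k"] that by (simp add: mult.assoc)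
      qed (use l in auto)
      then have "2 * y * (\<Sum>k<n. 1 / ((\<tau> (Suc k))\<^sup>2 + y\<^sup>2)) \<le> 2 * y * (real K / y\<^sup>2 + pi / (2 * (l * pi) * y))"
        using y by (intro mult_left_mono) auto
      also have "\<dots> = 2 * real K / y + 1 / l" using y l by (simp add: field_simps power2_eq_square)
      finally show "2 * y * (\<Sum>k<n. 1 / ((\<tau> (Suc k))\<^sup>2 + y\<^sup>2)) \<le> 2 * real K / y + 1 / l" .
    qed
    have "((\<lambda>y. 2 * real K / y + 1 / l) \<longlongrightarrow> 1 / l) at_top" by real_asymp
    then have "eventually (\<lambda>y. 2 * real K / y + 1 / l < b) at_top" using l(3) by (rule order_tendstoD)
    then show ?thesis using eventually_gt_at_top[of 0] by eventually_elim (use le in force)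
  qed
  have lower: "eventually (\<lambda>y. b < ?S y) at_top" if b: "b < 1" for b
  proof -
    define b' where "b' = max b (1 / 2)"
    have b': "0 < b'" "b' < 1" "b \<le> b'" using b by (auto simp: b'_def)
    define u where "u = (1 + 1 / b') / 2"
    have u: "1 < u" "b' < 1 / u" using b' by (auto simp: u_def field_simps)
    obtain K where K: "\<And>k. k \<ge> K \<Longrightarrow> \<tau> k < u * (pi * real k)"
      using ev[OF _ u(1), of 0] unfolding eventually_sequentially by force
    let ?c = "u * pi"
    have c: "?c > 0" using u by simp
    have ge: "2 / ?c * (pi / 2 - arctan (?c * (real K + 1) / y)) \<le> ?S y" if y: "y > 0" for y
    proof -
      have below: "2 * y * ((arctan (?c * (real n + 1) / y) - arctan (?c * (real K + 1) / y)) / (?c * y)) \<le> 2 * y * (\<Sum>k<n. 1 / ((\<tau> (Suc k))\<^sup>2 + y\<^sup>2))" for n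
      proof (rule mult_left_mono, rule sum_inverse_squares_ge[OF c _ y])
        show "0 \<le> \<tau> (Suc k) \<and> \<tau> (Suc k) \<le> ?c * real (Suc k)" if "K \<le> k" for k
          using K[of "Suc k"] tau_pos[of k] that by (simp add: mult.assoc)
      qed (use y in simp)
      have "(\<lambda>n. arctan (?c * (real n + 1) / y)) \<longlonglongrightarrow> pi / 2"
        by (rule filterlim_compose[OF tendsto_arctan_at_top]) (use c y in real_asymp)
      then have "(\<lambda>n. 2 * y * ((arctan (?c * (real n + 1) / y) - arctan (?c * (real K + 1) / y)) / (?c * y)))
         \<longlonglongrightarrow> 2 * y * ((pi / 2 - arctan (?c * (real K + 1) / y)) / (?c * y))"
        by (intro tendsto_intros) (use c y in auto)
      moreover have "2 * y * ((pi / 2 - arctan (?c * (real K + 1) / y)) / (?c * y)) = 2 / ?c * (pi / 2 - arctan (?c * (real K + 1) / y))"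
        using y by simp
      ultimately have lim: "(\<lambda>n. 2 * y * ((arctan (?c * (real n + 1) / y) - arctan (?c * (real K + 1) / y)) / (?c * y)))
         \<longlonglongrightarrow> 2 / ?c * (pi / 2 - arctan (?c * (real K + 1) / y))" by simp
      show ?thesis by (rule LIMSEQ_le[OF lim part[OF y]]) (use below in blast)
    qed
    have "((\<lambda>y. ?c * (real K + 1) / y) \<longlongrightarrow> 0) at_top" by real_asymp
    then have "((\<lambda>y. 2 / ?c * (pi / 2 - arctan (?c * (real K + 1) / y))) \<longlongrightarrow> 2 / ?c * (pi / 2 - arctan 0)) at_top"
      by (intro tendsto_intros)
    moreover have "2 / ?c * (pi / 2 - arctan 0) = 1 / u" using u by simp
    ultimately have "eventually (\<lambda>y. b' < 2 / ?c * (pi / 2 - arctan (?c * (real K + 1) / y))) at_top"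
      using u(2) by (intro order_tendstoD(1)) auto
    then show ?thesis using eventually_gt_at_top[of 0]
      by eventually_elim (use ge b'(3) in force)
  qed
  show ?thesis by (rule order_tendstoI) (use upper lower in auto)
qed

lemma logderiv_imaginary:
  assumes y: "y > 0"
  shows "deriv \<phi> (\<i> * of_real y) / \<phi> (\<i> * of_real y) = - \<i> * of_real (\<Sum>k. 2 * y / (y\<^sup>2 + (\<tau> (Suc k))\<^sup>2))"
    and "(\<Sum>k. 2 * y / (y\<^sup>2 + (\<tau> (Suc k))\<^sup>2)) \<le> 2 * y * (\<Sum>k. 1 / (\<tau> (Suc k))\<^sup>2)"
    and "(\<Sum>k. 2 * y / (y\<^sup>2 + (\<tau> (Suc k))\<^sup>2)) \<ge> 0"
proof -
  let ?t = "\<lambda>k. 2 * y / (y\<^sup>2 + (\<tau> (Suc k))\<^sup>2)"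
  have le: "?t k \<le> 2 * y * (1 / (\<tau> (Suc k))\<^sup>2)" for k
  proof -
    have "2 * y / (y\<^sup>2 + (\<tau> (Suc k))\<^sup>2) \<le> 2 * y / (\<tau> (Suc k))\<^sup>2"
      using y tau_pos[of k] by (intro divide_left_mono mult_pos_pos add_pos_pos) auto
    then show ?thesis by simp
  qed
  have nn: "?t k \<ge> 0" for k using y by (intro divide_nonneg_nonneg) auto
  have s2: "summable (\<lambda>k. 2 * y * (1 / (\<tau> (Suc k))\<^sup>2))" by (intro summable_mult summable_tau_sq)
  have s: "summable ?t"
    by (rule summable_comparison_test'[OF s2, of 0]) (use le nn in \<open>simp only: real_norm_def abs_of_nonneg\<close>)
  show "suminf ?t \<le> 2 * y * (\<Sum>k. 1 / (\<tau> (Suc k))\<^sup>2)"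
    unfolding suminf_mult[OF summable_tau_sq, symmetric] by (rule suminf_le[OF le s s2])
  show "suminf ?t \<ge> 0" by (rule suminf_nonneg[OF s nn])
  have "\<phi> (\<i> * of_real y) \<noteq> 0" by (rule phi_nonreal) (use y in simp)
  from logderiv_sums[OF this]
  have "(\<lambda>k. - 2 * (\<i> * of_real y) / ((of_real (\<tau> (Suc k)))\<^sup>2 - (\<i> * of_real y)\<^sup>2)) sums (deriv \<phi> (\<i> * of_real y) / \<phi> (\<i> * of_real y))" .
  moreover have "- 2 * (\<i> * of_real y) / ((of_real (\<tau> (Suc k)))\<^sup>2 - (\<i> * of_real y)\<^sup>2) = - \<i> * of_real (?t k)" for k
    by (simp add: power_mult_distrib add.commute)
  moreover have "(\<lambda>k. - \<i> * of_real (?t k)) sums (- \<i> * of_real (suminf ?t))"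
    by (intro sums_mult sums_of_real summable_sums s)
  ultimately show "deriv \<phi> (\<i> * of_real y) / \<phi> (\<i> * of_real y) = - \<i> * of_real (suminf ?t)"
    using sums_unique2 by force
qed

end

section \<open>Expansion at the origin and the polynomial K\<close>

lemma norm_poly_le_power:
  fixes p :: "complex poly"
  assumes "degree p \<le> n"
  obtains C where "C \<ge> 0" "\<And>z. norm z \<ge> 1 \<Longrightarrow> norm (poly p z) \<le> C * norm z ^ n"
proof (rule that[of "\<Sum>i\<le>degree p. norm (coeff p i)"])
  fix z :: complex assume z: "norm z \<ge> 1"
  have "norm (poly p z) \<le> (\<Sum>i\<le>degree p. norm (coeff p i * z ^ i))"
    unfolding poly_altdef by (rule norm_sum)
  also have "\<dots> \<le> (\<Sum>i\<le>degree p. norm (coeff p i) * norm z ^ n)"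
    using z assms by (intro sum_mono) (auto simp: norm_mult norm_power intro!: mult_left_mono power_increasing)
  finally show "norm (poly p z) \<le> (\<Sum>i\<le>degree p. norm (coeff p i)) * norm z ^ n"
    by (simp add: sum_distrib_right)
qed (simp add: sum_nonneg)

lemma degree_R_poly:
  assumes "d \<ge> 1" shows "degree (R_poly d p) \<le> 2 * (half_deg d + par d)"
  unfolding R_poly_def
  by (intro degree_add_le order_trans[OF degree_monom_le] order_trans[OF degree_smult_le] degree_sum_le
      order_trans[OF degree_monom_le]) auto

lemma coeff_R_poly_odd: "odd k \<Longrightarrow> coeff (R_poly d p) k = 0"
  unfolding R_poly_def by (auto simp: coeff_sum intro!: sum.neutral)

lemma poly_R_poly_r_coeff:
  assumes "d \<ge> 1"
  shows "poly (R_poly d p) z = (\<Sum>j\<le>half_deg d + par d. r_coeff d p j * z ^ (2 * j))"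
proof -
  let ?M = "half_deg d + par d"
  have "poly (R_poly d p) z = (\<Sum>i\<le>2 * ?M. coeff (R_poly d p) i * z ^ i)"
    unfolding poly_altdef
    by (rule sum.mono_neutral_left) (use degree_R_poly[OF assms, of p] in \<open>auto simp: coeff_eq_0\<close>)
  also have "\<dots> = (\<Sum>i\<in>(\<lambda>j. 2 * j) ` {..?M}. coeff (R_poly d p) i * z ^ i)"
  proof (rule sum.mono_neutral_right)
    show "\<forall>i\<in>{..2 * ?M} - (\<lambda>j. 2 * j) ` {..?M}. coeff (R_poly d p) i * z ^ i = 0"
    proof
      fix i assume i: "i \<in> {..2 * ?M} - (\<lambda>j. 2 * j) ` {..?M}"
      have "odd i"
      proof (rule ccontr)
        assume "\<not> odd i"
        then obtain j where "i = 2 * j" by (auto elim: evenE)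
        then show False using i by auto
      qed
      then show "coeff (R_poly d p) i * z ^ i = 0" by (simp add: coeff_R_poly_odd)
    qed
  qed auto
  also have "\<dots> = (\<Sum>j\<le>?M. coeff (R_poly d p) (2 * j) * z ^ (2 * j))"
    by (subst sum.reindex) (auto simp: inj_on_def)
  finally show ?thesis unfolding r_coeff_def .
qed

lemma degree_K_poly:
  assumes "d \<ge> 1" shows "degree (K_poly d \<tau> p) \<le> d + 1"
proof -
  have "2 * n + par d \<le> d + 1" if "n \<le> half_deg d" for n
    using twice_half_deg[OF assms] that par_cases[of d] by auto
  then show ?thesis
    unfolding K_poly_def
    by (intro degree_add_le order_trans[OF degree_monom_le] order_trans[OF degree_smult_le] degree_sum_le
        order_trans[OF degree_monom_le]) auto
qed

lemma poly_K_poly: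
  "poly (K_poly d \<tau> p) z = z ^ (d + 1) / 4 +
     2 * (\<Sum>n\<le>half_deg d. (\<Sum>j\<le>n. r_coeff d p j * of_real (lambda_sum d \<tau> (n - j))) * z ^ (2 * n + par d))"
  unfolding K_poly_def by (simp add: poly_monom poly_sum)

text \<open>Apart from its leading term, \<open>K\<close> is a truncation of the product of \<open>R\<close> with the power series
\<open>2 \<Sum> \<lambda>\<^sub>q z ^ (2q + \<epsilon>)\<close> of \<open>\<Phi>\<^sub>1' / \<Phi>\<^sub>1 - \<Phi>\<^sub>2' / \<Phi>\<^sub>2\<close>. Collecting the terms with a fixed coefficient of \<open>R\<close>
shows how far the series is followed for each of them.\<close>

lemma poly_K_poly_triangle:
  "poly (K_poly d \<tau> p) z = z ^ (d + 1) / 4 +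
     (\<Sum>j\<le>half_deg d. r_coeff d p j * z ^ (2 * j) * (2 * (\<Sum>q\<le>half_deg d - j. of_real (lambda_sum d \<tau> q) * z ^ (2 * q + par d))))"
proof -
  let ?N = "half_deg d" and ?g = "\<lambda>j q. r_coeff d p j * of_real (lambda_sum d \<tau> q) * z ^ (2 * (j + q) + par d)"
  have "(\<Sum>n\<le>?N. (\<Sum>j\<le>n. r_coeff d p j * of_real (lambda_sum d \<tau> (n - j))) * z ^ (2 * n + par d))
      = (\<Sum>n\<le>?N. \<Sum>j\<le>n. ?g j (n - j))"
    by (simp add: sum_distrib_right)
  also have "\<dots> = (\<Sum>(j, q)\<in>{(j, q). j + q \<le> ?N}. ?g j q)"
    by (rule sum.triangle_reindex_eq[symmetric])
  also have "\<dots> = (\<Sum>(j, q)\<in>(SIGMA j:{..?N}. {..?N - j}). ?g j q)"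
    by (rule sum.cong) auto
  also have "\<dots> = (\<Sum>j\<le>?N. \<Sum>q\<le>?N - j. ?g j q)"
    by (subst sum.Sigma) auto
  also have "\<dots> = (\<Sum>j\<le>?N. r_coeff d p j * z ^ (2 * j) * (\<Sum>q\<le>?N - j. of_real (lambda_sum d \<tau> q) * z ^ (2 * q + par d)))"
    unfolding sum_distrib_left by (intro sum.cong refl) (simp add: power_add algebra_simps)
  finally show ?thesis
    unfolding poly_K_poly by (simp add: sum_distrib_left mult_ac)
qed

context real_zeros
begin

lemma kappa_imaginary_bound:
  assumes e: "e = 0 \<or> e = 1" and y: "y > 0"
  shows "norm (kappa e (\<i> * of_real y) (\<tau> (Suc k))) \<le> y ^ e / \<tau> (Suc k) ^ (e + 1)"
proof -
  have t: "\<tau> (Suc k) > 0" by (rule tau_pos)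
  have "(of_real (\<tau> (Suc k)))\<^sup>2 - (\<i> * of_real y)\<^sup>2 = complex_of_real ((\<tau> (Suc k))\<^sup>2 + y\<^sup>2)"
    by (simp add: power_mult_distrib)
  then have "norm (kappa e (\<i> * of_real y) (\<tau> (Suc k))) = \<tau> (Suc k) ^ (1 - e) * y ^ e / ((\<tau> (Suc k))\<^sup>2 + y\<^sup>2)"
    unfolding kappa_def using t y by (simp only: norm_divide norm_of_real) (simp add: norm_mult norm_power)
  also have "\<dots> \<le> \<tau> (Suc k) ^ (1 - e) * y ^ e / (\<tau> (Suc k))\<^sup>2"
    using t y by (intro divide_left_mono mult_nonneg_nonneg mult_pos_pos add_pos_pos) auto
  also have "\<dots> = y ^ e / \<tau> (Suc k) ^ (e + 1)" using e t by (auto simp: power2_eq_square)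
  finally show ?thesis .
qed

text \<open>The geometric series for \<open>1 / (1 - (w / \<tau>)\<^sup>2)\<close> with its exact remainder, which is again a multiple of
\<open>kappa\<close> and is absolutely summable over the zeros.\<close>

lemma kappa_expansion:
  assumes e: "e = 0 \<or> e = 1" and y: "y > 0"
  defines "w \<equiv> \<i> * complex_of_real y"
  shows "kappa e w (\<tau> (Suc k)) = (\<Sum>q\<le>m. w ^ (2 * q + e) * of_real (1 / \<tau> (Suc k) ^ (2 * q + e + 1)))
    + kappa e w (\<tau> (Suc k)) * (w / of_real (\<tau> (Suc k))) ^ (2 * m + 2)"
proof -
  let ?t = "complex_of_real (\<tau> (Suc k))"
  have t: "?t \<noteq> 0" using tau_pos[of k] by simp
  have D: "?t\<^sup>2 - w\<^sup>2 \<noteq> 0" by (rule of_real_square_neq_square) (use y in \<open>simp add: w_def\<close>)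
  have k1: "kappa e w (\<tau> (Suc k)) * (1 - (w / ?t)\<^sup>2) = w ^ e / ?t ^ (e + 1)"
    unfolding kappa_def using e t D by (auto simp: divide_simps power2_eq_square)
  have "(1 - (w / ?t)\<^sup>2) * (\<Sum>q<Suc m. ((w / ?t)\<^sup>2) ^ q) = 1 - ((w / ?t)\<^sup>2) ^ Suc m"
    by (rule one_diff_power_eq[symmetric])
  then have "kappa e w (\<tau> (Suc k)) * (1 - (w / ?t)\<^sup>2) * (\<Sum>q\<le>m. ((w / ?t)\<^sup>2) ^ q)
      = kappa e w (\<tau> (Suc k)) * (1 - ((w / ?t)\<^sup>2) ^ Suc m)"
    by (simp only: mult.assoc lessThan_Suc_atMost)
  then have "w ^ e / ?t ^ (e + 1) * (\<Sum>q\<le>m. ((w / ?t)\<^sup>2) ^ q) = kappa e w (\<tau> (Suc k)) - kappa e w (\<tau> (Suc k)) * ((w / ?t)\<^sup>2) ^ Suc m"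
    unfolding k1 by (simp only: right_diff_distrib mult_1_right)
  moreover have "w ^ e / ?t ^ (e + 1) * (\<Sum>q\<le>m. ((w / ?t)\<^sup>2) ^ q) = (\<Sum>q\<le>m. w ^ (2 * q + e) * of_real (1 / \<tau> (Suc k) ^ (2 * q + e + 1)))"
    unfolding sum_distrib_left
  proof (rule sum.cong)
    fix q
    have "((w / ?t)\<^sup>2) ^ q = w ^ (2 * q) / ?t ^ (2 * q)" by (simp only: power_mult power_divide)
    then show "w ^ e / ?t ^ (e + 1) * ((w / ?t)\<^sup>2) ^ q = w ^ (2 * q + e) * of_real (1 / \<tau> (Suc k) ^ (2 * q + e + 1))"
      by (simp add: power_add mult_ac)
  qed simp
  moreover have "((w / ?t)\<^sup>2) ^ Suc m = (w / ?t) ^ (2 * m + 2)" by (simp only: power_mult[symmetric]) simp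
  ultimately show ?thesis by (simp add: algebra_simps)
qed

lemma remainder_summable:
  assumes e: "e = 0 \<or> e = 1" and y: "y > 0"
  defines "w \<equiv> \<i> * complex_of_real y"
  shows "summable (\<lambda>k. (-1) ^ Suc k * (kappa e w (\<tau> (Suc k)) * (w / of_real (\<tau> (Suc k))) ^ (2 * m + 2)))"
    and "norm (\<Sum>k. (-1) ^ Suc k * (kappa e w (\<tau> (Suc k)) * (w / of_real (\<tau> (Suc k))) ^ (2 * m + 2)))
      \<le> y ^ (2 * m + 2 + e) * (\<Sum>k. 1 / (\<tau> (Suc k))\<^sup>2) / \<tau> 1 ^ (2 * m + 1 + e)"
proof -
  let ?f = "\<lambda>k. (-1) ^ Suc k * (kappa e w (\<tau> (Suc k)) * (w / of_real (\<tau> (Suc k))) ^ (2 * m + 2))"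
  let ?g = "\<lambda>k. (y ^ (2 * m + 2 + e) / \<tau> 1 ^ (2 * m + 1 + e)) * (1 / (\<tau> (Suc k))\<^sup>2)"
  have t1: "\<tau> 1 > 0" using tau_pos[of 0] by simp
  have le: "norm (?f k) \<le> ?g k" for k
  proof -
    have t: "\<tau> (Suc k) > 0" by (rule tau_pos)
    have t1k: "\<tau> 1 \<le> \<tau> (Suc k)" using tau_less[of 0 k] by (cases k) auto
    have "norm (?f k) = norm (kappa e w (\<tau> (Suc k))) * (y / \<tau> (Suc k)) ^ (2 * m + 2)"
      using t y by (simp only: norm_mult norm_power norm_divide) (simp add: w_def norm_mult)
    also have "\<dots> \<le> y ^ e / \<tau> (Suc k) ^ (e + 1) * (y / \<tau> (Suc k)) ^ (2 * m + 2)"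
      unfolding w_def using t y by (intro mult_right_mono kappa_imaginary_bound e) auto
    also have "\<dots> = y ^ (2 * m + 2 + e) / (\<tau> (Suc k) ^ (2 * m + 1 + e) * (\<tau> (Suc k))\<^sup>2)"
      using t by (simp add: power_add power_divide power2_eq_square field_simps)
    also have "\<dots> \<le> y ^ (2 * m + 2 + e) / (\<tau> 1 ^ (2 * m + 1 + e) * (\<tau> (Suc k))\<^sup>2)"
      using t t1 t1k y by (intro divide_left_mono mult_right_mono power_mono mult_pos_pos) auto
    finally show ?thesis by simp
  qed
  have sg: "summable ?g" by (intro summable_mult summable_tau_sq)
  have sn: "summable (\<lambda>k. norm (?f k))" by (rule summable_comparison_test'[OF sg, of 0]) (use le in simp)
  then show "summable ?f" by (rule summable_norm_cancel)
  have "norm (suminf ?f) \<le> (\<Sum>k. norm (?f k))" by (rule summable_norm[OF sn])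
  also have "\<dots> \<le> suminf ?g" by (rule suminf_le[OF le sn sg])
  also have "\<dots> = (y ^ (2 * m + 2 + e) / \<tau> 1 ^ (2 * m + 1 + e)) * (\<Sum>k. 1 / (\<tau> (Suc k))\<^sup>2)"
    by (rule suminf_mult[OF summable_tau_sq])
  finally show "norm (suminf ?f) \<le> y ^ (2 * m + 2 + e) * (\<Sum>k. 1 / (\<tau> (Suc k))\<^sup>2) / \<tau> 1 ^ (2 * m + 1 + e)" by simp
qed

text \<open>For \<open>q \<ge> 1\<close> the series converges absolutely. For \<open>q = 0\<close> it is the difference of the convergent alternating
series of \<open>kappa\<close> at \<open>w = \<i>\<close> and an absolutely convergent remainder.\<close>

lemma lambda_sums:
  "(\<lambda>k. (-1) ^ Suc k / \<tau> (Suc k) ^ (2 * q + par d + 1)) sums lambda_sum d \<tau> q"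
proof -
  let ?e = "par d" and ?w = "\<i> * complex_of_real 1"
  let ?l = "\<lambda>q k. (-1) ^ Suc k / \<tau> (Suc k) ^ (2 * q + par d + 1)"
  have s0: "summable (?l 0)"
  proof -
    have "summable (\<lambda>k. (-1) ^ Suc k * kappa ?e ?w (\<tau> (Suc k))
        - (-1) ^ Suc k * (kappa ?e ?w (\<tau> (Suc k)) * (?w / of_real (\<tau> (Suc k))) ^ (2 * 0 + 2)))"
      by (intro summable_diff sums_summable[OF kappa_sums[OF _ par_cases]] remainder_summable par_cases) auto
    moreover have "(-1) ^ Suc k * kappa ?e ?w (\<tau> (Suc k))
        - (-1) ^ Suc k * (kappa ?e ?w (\<tau> (Suc k)) * (?w / of_real (\<tau> (Suc k))) ^ (2 * 0 + 2)) = ?w ^ ?e * of_real (?l 0 k)" for k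
    proof -
      have "kappa ?e ?w (\<tau> (Suc k)) - kappa ?e ?w (\<tau> (Suc k)) * (?w / of_real (\<tau> (Suc k))) ^ (2 * 0 + 2)
          = (\<Sum>q\<le>0. ?w ^ (2 * q + ?e) * of_real (1 / \<tau> (Suc k) ^ (2 * q + ?e + 1)))"
        using kappa_expansion[OF par_cases[of d], of 1 k 0] by (simp only: zero_less_one diff_eq_eq)
      also have "\<dots> = ?w ^ ?e * of_real (1 / \<tau> (Suc k) ^ (?e + 1))" by simp
      finally have "(-1) ^ Suc k * kappa ?e ?w (\<tau> (Suc k))
        - (-1) ^ Suc k * (kappa ?e ?w (\<tau> (Suc k)) * (?w / of_real (\<tau> (Suc k))) ^ (2 * 0 + 2))
        = (-1) ^ Suc k * (?w ^ ?e * of_real (1 / \<tau> (Suc k) ^ (?e + 1)))"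
        by (simp only: right_diff_distrib[symmetric])
      then show ?thesis by simp
    qed
    ultimately have "summable (\<lambda>k. ?w ^ ?e * complex_of_real (?l 0 k))" by (simp only:)
    then have "summable (\<lambda>k. complex_of_real (?l 0 k))" by (subst (asm) summable_cmult_iff) auto
    then show ?thesis by (simp only: summable_of_real_iff)
  qed
  have "summable (?l q)"
  proof (cases "q = 0")
    case False
    have t1: "\<tau> 1 > 0" using tau_pos[of 0] by simp
    show ?thesis
    proof (rule summable_comparison_test'[of "\<lambda>k. 1 / \<tau> 1 ^ (2 * q + par d - 1) * (1 / (\<tau> (Suc k))\<^sup>2)" 0])
      show "summable (\<lambda>k. 1 / \<tau> 1 ^ (2 * q + par d - 1) * (1 / (\<tau> (Suc k))\<^sup>2))"
        by (intro summable_mult summable_tau_sq)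
      fix k
      have t: "\<tau> (Suc k) > 0" by (rule tau_pos)
      have t1k: "\<tau> 1 \<le> \<tau> (Suc k)" using tau_less[of 0 k] by (cases k) auto
      have "2 * q + par d + 1 = (2 * q + par d - 1) + 2" using False by simp
      then have "\<tau> (Suc k) ^ (2 * q + par d + 1) = \<tau> (Suc k) ^ (2 * q + par d - 1) * (\<tau> (Suc k))\<^sup>2"
        by (simp only: power_add)
      then have "norm (?l q k) = 1 / (\<tau> (Suc k) ^ (2 * q + par d - 1) * (\<tau> (Suc k))\<^sup>2)"
        using t by (simp only: norm_divide) (simp add: norm_power norm_mult)
      also have "\<dots> \<le> 1 / (\<tau> 1 ^ (2 * q + par d - 1) * (\<tau> (Suc k))\<^sup>2)"
        using t t1 t1k by (intro divide_left_mono mult_right_mono power_mono mult_pos_pos) auto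
      finally show "norm (?l q k) \<le> 1 / \<tau> 1 ^ (2 * q + par d - 1) * (1 / (\<tau> (Suc k))\<^sup>2)" by simp
    qed
  qed (use s0 in simp)
  then show ?thesis unfolding lambda_sum_def by (rule summable_sums)
qed

text \<open>The expansion at the origin of \<open>\<Phi>\<^sub>1' / \<Phi>\<^sub>1 - \<Phi>\<^sub>2' / \<Phi>\<^sub>2\<close> along the imaginary axis.\<close>

lemma logderiv_gap_expansion:
  assumes y: "y > 0"
  defines "w \<equiv> \<i> * complex_of_real y"
  shows "norm (logderiv_gap (par d) w - 2 * (\<Sum>q\<le>m. of_real (lambda_sum d \<tau> q) * w ^ (2 * q + par d)))
     \<le> (2 * (\<Sum>k. 1 / (\<tau> (Suc k))\<^sup>2) / \<tau> 1 ^ (2 * m + 1 + par d)) * y ^ (2 * m + 2 + par d)"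
proof -
  let ?e = "par d"
  let ?rem = "\<lambda>k. (-1) ^ Suc k * (kappa ?e w (\<tau> (Suc k)) * (w / of_real (\<tau> (Suc k))) ^ (2 * m + 2))"
  have w: "Im w \<noteq> 0" using y by (simp add: w_def)
  have "(\<lambda>k. \<Sum>q\<le>m. w ^ (2 * q + ?e) * of_real ((-1) ^ Suc k / \<tau> (Suc k) ^ (2 * q + ?e + 1))) sums (\<Sum>q\<le>m. w ^ (2 * q + ?e) * of_real (lambda_sum d \<tau> q))"
    by (intro sums_sum sums_mult sums_of_real lambda_sums)
  moreover have "?rem sums (suminf ?rem)"
    unfolding w_def by (intro summable_sums remainder_summable par_cases y)
  ultimately have "(\<lambda>k. (\<Sum>q\<le>m. w ^ (2 * q + ?e) * of_real ((-1) ^ Suc k / \<tau> (Suc k) ^ (2 * q + ?e + 1))) + ?rem k)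
      sums ((\<Sum>q\<le>m. w ^ (2 * q + ?e) * of_real (lambda_sum d \<tau> q)) + suminf ?rem)" by (rule sums_add)
  moreover have "(\<Sum>q\<le>m. w ^ (2 * q + ?e) * of_real ((-1) ^ Suc k / \<tau> (Suc k) ^ (2 * q + ?e + 1))) + ?rem k
      = (-1) ^ Suc k * kappa ?e w (\<tau> (Suc k))" for k
  proof -
    have "(\<Sum>q\<le>m. w ^ (2 * q + ?e) * of_real ((-1) ^ Suc k / \<tau> (Suc k) ^ (2 * q + ?e + 1)))
        = (-1) ^ Suc k * (\<Sum>q\<le>m. w ^ (2 * q + ?e) * of_real (1 / \<tau> (Suc k) ^ (2 * q + ?e + 1)))"
      unfolding sum_distrib_left by (intro sum.cong) auto
    then have "(\<Sum>q\<le>m. w ^ (2 * q + ?e) * of_real ((-1) ^ Suc k / \<tau> (Suc k) ^ (2 * q + ?e + 1))) + ?rem k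
      = (-1) ^ Suc k * ((\<Sum>q\<le>m. w ^ (2 * q + ?e) * of_real (1 / \<tau> (Suc k) ^ (2 * q + ?e + 1)))
          + kappa ?e w (\<tau> (Suc k)) * (w / of_real (\<tau> (Suc k))) ^ (2 * m + 2))"
      by (simp only: distrib_left)
    then show ?thesis
      using kappa_expansion[OF par_cases[of d] y, of k m] unfolding w_def by (simp only:)
  qed
  ultimately have "(\<lambda>k. (-1) ^ Suc k * kappa ?e w (\<tau> (Suc k))) sums ((\<Sum>q\<le>m. w ^ (2 * q + ?e) * of_real (lambda_sum d \<tau> q)) + suminf ?rem)"
    by (simp only:)
  from sums_unique2[OF this kappa_sums[OF w par_cases]]
  have "logderiv_gap ?e w - 2 * (\<Sum>q\<le>m. of_real (lambda_sum d \<tau> q) * w ^ (2 * q + ?e)) = 2 * suminf ?rem"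
    by (simp add: mult.commute field_simps)
  then have "norm (logderiv_gap ?e w - 2 * (\<Sum>q\<le>m. of_real (lambda_sum d \<tau> q) * w ^ (2 * q + ?e))) = 2 * norm (suminf ?rem)"
    by (simp only: norm_mult) simp
  also have "\<dots> \<le> 2 * (y ^ (2 * m + 2 + ?e) * (\<Sum>k. 1 / (\<tau> (Suc k))\<^sup>2) / \<tau> 1 ^ (2 * m + 1 + ?e))"
    unfolding w_def by (intro mult_left_mono remainder_summable(2) par_cases y) auto
  finally show ?thesis by (simp add: mult_ac)
qed

end

section \<open>The Wronskian identity and the differential equations\<close>

context signature_polynomial
begin

abbreviation "\<Phi>\<^sub>1 \<equiv> Phi1 d \<tau>"
abbreviation "\<Phi>\<^sub>2 \<equiv> Phi2 d \<tau>"
abbreviation "Rp \<equiv> poly (R_poly d p)"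
abbreviation "R'p \<equiv> poly (pderiv (R_poly d p))"
abbreviation "Kp \<equiv> poly (K_poly d \<tau> p)"

lemma deriv_Phi1: "(\<Phi>\<^sub>1 has_field_derivative deriv \<Phi>\<^sub>1 z) (at z)"
  and deriv2_Phi1: "(deriv \<Phi>\<^sub>1 has_field_derivative deriv (deriv \<Phi>\<^sub>1) z) (at z)"
  and deriv_Phi2: "(\<Phi>\<^sub>2 has_field_derivative deriv \<Phi>\<^sub>2 z) (at z)"
  and deriv2_Phi2: "(deriv \<Phi>\<^sub>2 has_field_derivative deriv (deriv \<Phi>\<^sub>2) z) (at z)"
  by (rule holomorphic_derivI[OF _ open_UNIV UNIV_I], intro holomorphic_deriv Phi1_holomorphic Phi2_holomorphic open_UNIV)+

text \<open>Both sides are entire, and they agree on the positive imaginary axis.\<close>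

lemma wronskian_identity:
  "z ^ (d + 1) * (deriv \<Phi>\<^sub>1 z * \<Phi>\<^sub>2 z - \<Phi>\<^sub>1 z * deriv \<Phi>\<^sub>2 z) - 2 * Rp z * \<Phi>\<^sub>1 z * \<Phi>\<^sub>2 z = - 2 * of_real a"
proof -
  define E where "E = (\<lambda>z. z ^ (d + 1) * (deriv \<Phi>\<^sub>1 z * \<Phi>\<^sub>2 z - \<Phi>\<^sub>1 z * deriv \<Phi>\<^sub>2 z) - 2 * Rp z * \<Phi>\<^sub>1 z * \<Phi>\<^sub>2 z + 2 * of_real a)"
  let ?U = "(\<lambda>y. \<i> * complex_of_real y) ` {0<..}"
  have "E z = 0"
  proof (rule analytic_continuation[of E UNIV ?U \<i>])
    show "E holomorphic_on UNIV"
      unfolding E_def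
      by (intro holomorphic_intros holomorphic_deriv Phi1_holomorphic Phi2_holomorphic open_UNIV
          holomorphic_on_compose_gen[of _ _ _ UNIV, unfolded o_def]) 
    show "\<i> islimpt ?U"
      unfolding islimpt_approachable
    proof (intro allI impI)
      fix \<epsilon> :: real assume \<epsilon>: "\<epsilon> > 0"
      show "\<exists>x'\<in>?U. x' \<noteq> \<i> \<and> dist x' \<i> < \<epsilon>"
      proof (rule bexI[of _ "\<i> * complex_of_real (1 + \<epsilon> / 2)"])
        have "\<i> * complex_of_real (1 + \<epsilon> / 2) - \<i> = \<i> * of_real (\<epsilon> / 2)" by (simp add: algebra_simps)
        then have "dist (\<i> * complex_of_real (1 + \<epsilon> / 2)) \<i> = \<epsilon> / 2"
          unfolding dist_norm using \<epsilon> by (simp only: norm_mult) simp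
        then show "\<i> * complex_of_real (1 + \<epsilon> / 2) \<noteq> \<i> \<and> dist (\<i> * complex_of_real (1 + \<epsilon> / 2)) \<i> < \<epsilon>"
          using \<epsilon> by auto
        show "\<i> * complex_of_real (1 + \<epsilon> / 2) \<in> ?U"
          by (rule imageI) (use \<epsilon> in \<open>simp add: add_pos_pos\<close>)
      qed
    qed
    show "E w = 0" if wU: "w \<in> ?U" for w
    proof -
      obtain y where y: "y > 0" and wy: "w = \<i> * complex_of_real y" using wU by auto
      then have im: "Im w \<noteq> 0" by simp
      have nz: "\<Phi>\<^sub>1 w \<noteq> 0" "\<Phi>\<^sub>2 w \<noteq> 0"
        using phi_nonreal[OF im] phi_eq_Phi1_Phi2[of w d] by auto
      have "logderiv_gap (par d) w * \<phi> w = deriv \<Phi>\<^sub>1 w * \<Phi>\<^sub>2 w - \<Phi>\<^sub>1 w * deriv \<Phi>\<^sub>2 w"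
        unfolding logderiv_gap_eq[OF im, of d, symmetric] phi_eq_Phi1_Phi2[of w d] using nz by (simp add: field_simps)
      then have "w ^ (d + 1) * (deriv \<Phi>\<^sub>1 w * \<Phi>\<^sub>2 w - \<Phi>\<^sub>1 w * deriv \<Phi>\<^sub>2 w) = 2 * Rp w * \<phi> w - 2 * of_real a"
        using logderiv_gap_imaginary[OF y] unfolding wy[symmetric] by (simp only: mult.assoc)
      then show ?thesis unfolding E_def phi_eq_Phi1_Phi2[of w d] by (simp add: algebra_simps)
    qed
  qed auto
  then show ?thesis unfolding E_def by (simp add: add_eq_0_iff2)
qed

text \<open>The left-hand sides of the two equations of the system.\<close>

definition ode1 :: "complex \<Rightarrow> complex" where
  "ode1 z = z ^ (d + 1) * deriv (deriv \<Phi>\<^sub>1) z + (of_nat (d + 1) * z ^ d - 2 * Rp z) * deriv \<Phi>\<^sub>1 z + (Kp z - R'p z) * \<Phi>\<^sub>1 z"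

definition ode2 :: "complex \<Rightarrow> complex" where
  "ode2 z = z ^ (d + 1) * deriv (deriv \<Phi>\<^sub>2) z + (of_nat (d + 1) * z ^ d + 2 * Rp z) * deriv \<Phi>\<^sub>2 z + (Kp z + R'p z) * \<Phi>\<^sub>2 z"

text \<open>Differentiating the identity of \<open>wronskian_identity\<close> gives exactly the difference of the two sides.\<close>

lemma ode_cross: "\<Phi>\<^sub>2 z * ode1 z = \<Phi>\<^sub>1 z * ode2 z"
proof -
  have "((\<lambda>z. z ^ (d + 1) * (deriv \<Phi>\<^sub>1 z * \<Phi>\<^sub>2 z - \<Phi>\<^sub>1 z * deriv \<Phi>\<^sub>2 z) - 2 * Rp z * \<Phi>\<^sub>1 z * \<Phi>\<^sub>2 z) has_field_derivative
      (\<Phi>\<^sub>2 z * ode1 z - \<Phi>\<^sub>1 z * ode2 z)) (at z)"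
    unfolding ode1_def ode2_def
    by (rule derivative_eq_intros deriv_Phi1 deriv2_Phi1 deriv_Phi2 deriv2_Phi2 poly_DERIV refl)+
       (simp add: algebra_simps)
  then have "((\<lambda>z. - 2 * complex_of_real a) has_field_derivative (\<Phi>\<^sub>2 z * ode1 z - \<Phi>\<^sub>1 z * ode2 z)) (at z)"
    unfolding wronskian_identity .
  moreover have "((\<lambda>z. - 2 * complex_of_real a) has_field_derivative 0) (at z)" by simp
  ultimately have "\<Phi>\<^sub>2 z * ode1 z - \<Phi>\<^sub>1 z * ode2 z = 0" by (rule DERIV_unique)
  then show ?thesis by simp
qed

text \<open>The common value of \<open>ode1 / \<Phi>\<^sub>1\<close> and \<open>ode2 / \<Phi>\<^sub>2\<close>. Since \<open>\<Phi>\<^sub>1\<close> and \<open>\<Phi>\<^sub>2\<close> have no common zero, one of the two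
quotients is available at every point, and the result is entire.\<close>

definition ode_quotient :: "complex \<Rightarrow> complex" where
  "ode_quotient z = (if \<Phi>\<^sub>1 z \<noteq> 0 then ode1 z / \<Phi>\<^sub>1 z else ode2 z / \<Phi>\<^sub>2 z)"

lemma no_common_zero: "\<Phi>\<^sub>1 z \<noteq> 0 \<or> \<Phi>\<^sub>2 z \<noteq> 0"
  using wronskian_identity[of z] a_nz by auto

lemma ode_quotient_eq1: "\<Phi>\<^sub>1 z \<noteq> 0 \<Longrightarrow> ode_quotient z = ode1 z / \<Phi>\<^sub>1 z"
  and ode_quotient_eq2: "\<Phi>\<^sub>2 z \<noteq> 0 \<Longrightarrow> ode_quotient z = ode2 z / \<Phi>\<^sub>2 z"
proof -
  show "\<Phi>\<^sub>1 z \<noteq> 0 \<Longrightarrow> ode_quotient z = ode1 z / \<Phi>\<^sub>1 z" by (simp add: ode_quotient_def)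
  assume "\<Phi>\<^sub>2 z \<noteq> 0"
  then show "ode_quotient z = ode2 z / \<Phi>\<^sub>2 z"
    using ode_cross[of z] by (auto simp: ode_quotient_def field_simps)
qed

lemma ode1_quot: "ode1 z = ode_quotient z * \<Phi>\<^sub>1 z" and ode2_quot: "ode2 z = ode_quotient z * \<Phi>\<^sub>2 z"
proof -
  show "ode1 z = ode_quotient z * \<Phi>\<^sub>1 z"
    using ode_quotient_eq1[of z] ode_cross[of z] no_common_zero[of z] by (cases "\<Phi>\<^sub>1 z = 0") auto
  show "ode2 z = ode_quotient z * \<Phi>\<^sub>2 z"
    using ode_quotient_eq2[of z] ode_cross[of z] no_common_zero[of z] by (cases "\<Phi>\<^sub>2 z = 0") auto
qed

lemma ode_holomorphic: "ode1 holomorphic_on A" "ode2 holomorphic_on A"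
proof -
  have "ode1 holomorphic_on UNIV" "ode2 holomorphic_on UNIV"
    unfolding ode1_def ode2_def
    by (intro holomorphic_intros holomorphic_deriv Phi1_holomorphic Phi2_holomorphic open_UNIV
        holomorphic_on_compose_gen[of _ _ _ UNIV, unfolded o_def])+
  then show "ode1 holomorphic_on A" "ode2 holomorphic_on A" by (auto intro: holomorphic_on_subset)
qed

lemma ode_quotient_holomorphic: "ode_quotient holomorphic_on UNIV"
proof -
  have op: "open {z. F z \<noteq> 0}" if "F holomorphic_on UNIV" for F :: "complex \<Rightarrow> complex"
    using holomorphic_on_imp_continuous_on[OF that] by (rule open_Collect_neq) (intro continuous_intros)
  have 1: "ode_quotient holomorphic_on {z. \<Phi>\<^sub>1 z \<noteq> 0}"
  proof (rule holomorphic_transform)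
    show "(\<lambda>z. ode1 z / \<Phi>\<^sub>1 z) holomorphic_on {z. \<Phi>\<^sub>1 z \<noteq> 0}"
      by (intro holomorphic_on_divide ode_holomorphic Phi1_holomorphic) auto
  qed (simp add: ode_quotient_eq1)
  have 2: "ode_quotient holomorphic_on {z. \<Phi>\<^sub>2 z \<noteq> 0}"
  proof (rule holomorphic_transform)
    show "(\<lambda>z. ode2 z / \<Phi>\<^sub>2 z) holomorphic_on {z. \<Phi>\<^sub>2 z \<noteq> 0}"
      by (intro holomorphic_on_divide ode_holomorphic Phi2_holomorphic) auto
  qed (simp add: ode_quotient_eq2)
  have "ode_quotient holomorphic_on ({z. \<Phi>\<^sub>1 z \<noteq> 0} \<union> {z. \<Phi>\<^sub>2 z \<noteq> 0})"
    by (rule holomorphic_on_Un[OF 1 2 op op]) (rule Phi1_holomorphic Phi2_holomorphic)+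
  moreover have "{z. \<Phi>\<^sub>1 z \<noteq> 0} \<union> {z. \<Phi>\<^sub>2 z \<noteq> 0} = UNIV" using no_common_zero by auto
  ultimately show ?thesis by simp
qed

text \<open>The mean of the two expressions: the terms with \<open>R'\<close> cancel, and only \<open>\<phi>\<close> and the difference of the
logarithmic derivatives of \<open>\<Phi>\<^sub>1\<close> and \<open>\<Phi>\<^sub>2\<close> remain.\<close>

lemma ode_quotient_formula:
  assumes nz: "\<Phi>\<^sub>1 z \<noteq> 0" "\<Phi>\<^sub>2 z \<noteq> 0"
  shows "ode_quotient z = z ^ (d + 1) * (deriv (deriv \<phi>) z / \<phi> z / 2 - ((deriv \<phi> z / \<phi> z)\<^sup>2 - (deriv \<Phi>\<^sub>1 z / \<Phi>\<^sub>1 z - deriv \<Phi>\<^sub>2 z / \<Phi>\<^sub>2 z)\<^sup>2) / 4)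
     + of_nat (d + 1) * z ^ d * (deriv \<phi> z / \<phi> z) / 2 + (Kp z - Rp z * (deriv \<Phi>\<^sub>1 z / \<Phi>\<^sub>1 z - deriv \<Phi>\<^sub>2 z / \<Phi>\<^sub>2 z))"
proof -
  have phi_fun: "\<phi> = (\<lambda>z. \<Phi>\<^sub>1 z * \<Phi>\<^sub>2 z)" by (rule ext) (rule phi_eq_Phi1_Phi2)
  have d1: "deriv \<phi> = (\<lambda>z. deriv \<Phi>\<^sub>1 z * \<Phi>\<^sub>2 z + deriv \<Phi>\<^sub>2 z * \<Phi>\<^sub>1 z)"
  proof
    fix u show "deriv \<phi> u = deriv \<Phi>\<^sub>1 u * \<Phi>\<^sub>2 u + deriv \<Phi>\<^sub>2 u * \<Phi>\<^sub>1 u"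
      unfolding phi_fun by (rule DERIV_imp_deriv[OF DERIV_mult[OF deriv_Phi1 deriv_Phi2]])
  qed
  have d2: "deriv (deriv \<phi>) z = (deriv (deriv \<Phi>\<^sub>1) z * \<Phi>\<^sub>2 z + deriv \<Phi>\<^sub>2 z * deriv \<Phi>\<^sub>1 z) + (deriv (deriv \<Phi>\<^sub>2) z * \<Phi>\<^sub>1 z + deriv \<Phi>\<^sub>1 z * deriv \<Phi>\<^sub>2 z)"
    unfolding d1 by (rule DERIV_imp_deriv[OF DERIV_add[OF DERIV_mult[OF deriv2_Phi1 deriv_Phi2] DERIV_mult[OF deriv2_Phi2 deriv_Phi1]]])
  define l1 l2 m1 m2 where "l1 = deriv \<Phi>\<^sub>1 z / \<Phi>\<^sub>1 z" and "l2 = deriv \<Phi>\<^sub>2 z / \<Phi>\<^sub>2 z"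
    and "m1 = deriv (deriv \<Phi>\<^sub>1) z / \<Phi>\<^sub>1 z" and "m2 = deriv (deriv \<Phi>\<^sub>2) z / \<Phi>\<^sub>2 z"
  have L: "deriv \<phi> z / \<phi> z = l1 + l2"
    unfolding d1 phi_eq_Phi1_Phi2[of z d] l1_def l2_def using nz by (simp add: field_simps)
  have M: "deriv (deriv \<phi>) z / \<phi> z = m1 + m2 + 2 * l1 * l2"
    unfolding d2 phi_eq_Phi1_Phi2[of z d] l1_def l2_def m1_def m2_def using nz by (simp add: field_simps)
  have q1: "ode_quotient z = z ^ (d + 1) * m1 + (of_nat (d + 1) * z ^ d - 2 * Rp z) * l1 + (Kp z - R'p z)"
    unfolding ode_quotient_eq1[OF nz(1)] ode1_def l1_def m1_def using nz by (simp add: add_divide_distrib)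
  have q2: "ode_quotient z = z ^ (d + 1) * m2 + (of_nat (d + 1) * z ^ d + 2 * Rp z) * l2 + (Kp z + R'p z)"
    unfolding ode_quotient_eq2[OF nz(2)] ode2_def l2_def m2_def using nz by (simp add: add_divide_distrib)
  have avg: "X = (Y + Z) / 2" if "X = Y" "X = Z" for X Y Z :: complex using that by simp
  show ?thesis
    unfolding L M l1_def[symmetric] l2_def[symmetric] avg[OF q1 q2]
    by (simp add: field_simps power2_eq_square)
qed

lemma ode_quotient_formula_nonreal:
  assumes z: "Im z \<noteq> 0"
  shows "ode_quotient z = z ^ (d + 1) * (deriv (deriv \<phi>) z / \<phi> z / 2 - ((deriv \<phi> z / \<phi> z)\<^sup>2 - (logderiv_gap (par d) z)\<^sup>2) / 4)
     + of_nat (d + 1) * z ^ d * (deriv \<phi> z / \<phi> z) / 2 + (Kp z - Rp z * logderiv_gap (par d) z)"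
proof -
  have nz: "\<Phi>\<^sub>1 z \<noteq> 0" "\<Phi>\<^sub>2 z \<noteq> 0"
    using phi_nonreal[OF z] phi_eq_Phi1_Phi2[of z d] by auto
  show ?thesis using ode_quotient_formula[OF nz] unfolding logderiv_gap_eq[OF z] .
qed

lemma degree_R_poly_le: "degree (R_poly d p) \<le> d"
  using degree_R_poly[OF d_pos, of p] twice_half_deg[OF d_pos] par_cases[of d] by auto

lemma halved_and_quartered_bound:
  fixes x u v b c m A B D :: real
  assumes "x \<le> u + v" "v \<le> (b + c) / 4" "u = m / 2" "m \<le> A" "b \<le> B" "c \<le> D"
  shows "x \<le> A / 2 + (B + D) / 4"
  using assms by argo

text \<open>Each of \<open>\<phi>' / \<phi>\<close>, \<open>\<phi>'' / \<phi>\<close> and the gap of the logarithmic derivatives is bounded by a power of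
\<open>norm z / \<bar>Im z\<bar>\<close> when \<open>norm z \<ge> 1\<close>; the highest power that occurs is the eighth, in the square of the gap.\<close>

lemma ode_quotient_growth:
  obtains C where "C \<ge> 0" "\<And>z. Im z \<noteq> 0 \<Longrightarrow> norm z \<ge> 1 \<Longrightarrow> norm (ode_quotient z) \<le> C * norm z ^ (d + 1) * (norm z / \<bar>Im z\<bar>) ^ 8"
proof -
  obtain C1 where C1: "C1 \<ge> 0" "\<And>z. Im z \<noteq> 0 \<Longrightarrow> norm (deriv \<phi> z / \<phi> z) \<le> C1 * (norm z / \<bar>Im z\<bar>) ^ 2"
    using norm_logderiv_le by blast
  obtain C2 where C2: "C2 \<ge> 0" "\<And>z. Im z \<noteq> 0 \<Longrightarrow>
    norm (deriv (deriv \<phi>) z / \<phi> z - (deriv \<phi> z / \<phi> z)\<^sup>2) \<le> C2 * (norm z / \<bar>Im z\<bar>) ^ 3 / norm z"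
    using norm_logderiv_deriv_le by blast
  define C3 where "C3 = 1 + 4 * (LINT x::real|lborel. 1 / (1 + x\<^sup>2))"
  have C3: "C3 \<ge> 0" unfolding C3_def by (intro add_nonneg_nonneg mult_nonneg_nonneg Bochner_Integration.integral_nonneg) auto
  obtain CR where CR: "CR \<ge> 0" "\<And>z. norm z \<ge> 1 \<Longrightarrow> norm (Rp z) \<le> CR * norm z ^ d"
    using norm_poly_le_power[OF degree_R_poly_le] by blast
  obtain CK where CK: "CK \<ge> 0" "\<And>z. norm z \<ge> 1 \<Longrightarrow> norm (Kp z) \<le> CK * norm z ^ (d + 1)"
    using norm_poly_le_power[OF degree_K_poly[OF d_pos]] by blast
  define C where "C = (C2 + C1\<^sup>2) / 2 + (C1\<^sup>2 + C3\<^sup>2) / 4 + real (d + 1) * C1 / 2 + (CK + CR * C3)"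
  show ?thesis
  proof (rule that[of C])
    show "C \<ge> 0" unfolding C_def using C1(1) C2(1) C3 CR(1) CK(1) by (intro add_nonneg_nonneg) auto
    fix z assume z: "Im z \<noteq> 0" "norm z \<ge> 1"
    define s where "s = norm z / \<bar>Im z\<bar>"
    have s1: "s \<ge> 1" unfolding s_def using abs_Im_le_cmod[of z] z(1) by simp
    have sp: "s ^ i \<le> s ^ 8" if "i \<le> 8" for i using power_increasing[OF that s1] .
    have s8: "s ^ 8 \<ge> 1" using s1 by (rule one_le_power)
    let ?L = "deriv \<phi> z / \<phi> z" and ?F = "logderiv_gap (par d) z" and ?M = "deriv (deriv \<phi>) z / \<phi> z"
    have L: "norm ?L \<le> C1 * s ^ 2" using C1(2)[OF z(1)] by (simp add: s_def)
    have L8: "norm ?L \<le> C1 * s ^ 8" using L mult_left_mono[OF sp[of 2] C1(1)] by linarith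
    have LL: "norm (?L\<^sup>2) \<le> C1\<^sup>2 * s ^ 8"
    proof -
      have "norm (?L\<^sup>2) \<le> (C1 * s ^ 2)\<^sup>2" unfolding norm_power using L by (intro power_mono) auto
      also have "\<dots> = C1\<^sup>2 * s ^ 4" by (simp add: power_mult_distrib)
      also have "\<dots> \<le> C1\<^sup>2 * s ^ 8" by (intro mult_left_mono sp) auto
      finally show ?thesis .
    qed
    have F0: "norm ?F \<le> C3 * s ^ 4"
    proof -
      have "norm ?F \<le> C3 * s ^ 4 / norm z" using norm_logderiv_gap_le[OF z(1) par_cases[of d]] by (simp add: C3_def s_def)
      also have "\<dots> \<le> C3 * s ^ 4 / 1" using z(2) C3 s1 by (intro divide_left_mono mult_nonneg_nonneg) auto
      finally show ?thesis by simp
    qed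
    have F8: "norm ?F \<le> C3 * s ^ 8" using F0 mult_left_mono[OF sp[of 4] C3] by linarith
    have FF: "norm (?F\<^sup>2) \<le> C3\<^sup>2 * s ^ 8"
    proof -
      have "norm (?F\<^sup>2) \<le> (C3 * s ^ 4)\<^sup>2" unfolding norm_power using F0 by (intro power_mono) auto
      also have "\<dots> = C3\<^sup>2 * s ^ 8" by (simp add: power_mult_distrib)
      finally show ?thesis .
    qed
    have M: "norm ?M \<le> (C2 + C1\<^sup>2) * s ^ 8"
    proof -
      have "norm (?M - ?L\<^sup>2) \<le> C2 * s ^ 3 / norm z" using C2(2)[OF z(1)] by (simp add: s_def)
      also have "\<dots> \<le> C2 * s ^ 3 / 1" using z(2) C2 s1 by (intro divide_left_mono mult_nonneg_nonneg) auto
      also have "\<dots> \<le> C2 * s ^ 8" using mult_left_mono[OF sp[of 3] C2(1)] by simp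
      finally have "norm (?M - ?L\<^sup>2) \<le> C2 * s ^ 8" .
      then show ?thesis using norm_triangle_sub[of ?M "?L\<^sup>2"] LL by (simp add: distrib_right)
    qed
    have T1: "norm (z ^ (d + 1) * (?M / 2 - (?L\<^sup>2 - ?F\<^sup>2) / 4)) \<le> norm z ^ (d + 1) * (((C2 + C1\<^sup>2) / 2 + (C1\<^sup>2 + C3\<^sup>2) / 4) * s ^ 8)"
    proof -
      have n1: "norm (?M / 2 - (?L\<^sup>2 - ?F\<^sup>2) / 4) \<le> norm (?M / 2) + norm ((?L\<^sup>2 - ?F\<^sup>2) / 4)" by (rule norm_triangle_ineq4)
      have n2: "norm ((?L\<^sup>2 - ?F\<^sup>2) / 4) \<le> (norm (?L\<^sup>2) + norm (?F\<^sup>2)) / 4"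
        using divide_right_mono[OF norm_triangle_ineq4[of "?L\<^sup>2" "?F\<^sup>2"], of 4] by (simp only: norm_divide norm_numeral)
      have n3: "norm (?M / 2) = norm ?M / 2" by (simp only: norm_divide norm_numeral)
      have "norm (?M / 2 - (?L\<^sup>2 - ?F\<^sup>2) / 4) \<le> ((C2 + C1\<^sup>2) * s ^ 8) / 2 + (C1\<^sup>2 * s ^ 8 + C3\<^sup>2 * s ^ 8) / 4"
        by (rule halved_and_quartered_bound[OF n1 n2 n3 M LL FF])
      also have "\<dots> = ((C2 + C1\<^sup>2) / 2 + (C1\<^sup>2 + C3\<^sup>2) / 4) * s ^ 8" by (simp add: field_simps)
      finally have "norm (?M / 2 - (?L\<^sup>2 - ?F\<^sup>2) / 4) \<le> ((C2 + C1\<^sup>2) / 2 + (C1\<^sup>2 + C3\<^sup>2) / 4) * s ^ 8" .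
      then show ?thesis unfolding norm_mult norm_power by (intro mult_left_mono) auto
    qed
    have T2: "norm (of_nat (d + 1) * z ^ d * ?L / 2) \<le> norm z ^ (d + 1) * (real (d + 1) * C1 / 2 * s ^ 8)"
    proof -
      have "norm (of_nat (d + 1) * z ^ d * ?L / 2) = real (d + 1) * norm z ^ d * norm ?L / 2"
        by (simp only: norm_mult norm_power norm_divide norm_of_nat) simp
      also have "\<dots> \<le> real (d + 1) * norm z ^ (d + 1) * (C1 * s ^ 8) / 2"
        using z(2) L8 by (intro divide_right_mono mult_mono mult_left_mono power_increasing) auto
      finally show ?thesis by (simp add: mult_ac)
    qed
    have T3: "norm (Kp z - Rp z * ?F) \<le> norm z ^ (d + 1) * ((CK + CR * C3) * s ^ 8)"
    proof -
      have "norm (Rp z * ?F) \<le> (CR * norm z ^ (d + 1)) * (C3 * s ^ 8)"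
      proof -
        have "norm (Rp z) \<le> CR * norm z ^ d" by (rule CR(2)[OF z(2)])
        also have "\<dots> \<le> CR * norm z ^ (d + 1)" using z(2) CR(1) by (intro mult_left_mono power_increasing) auto
        finally show ?thesis unfolding norm_mult using F8 CR(1) by (intro mult_mono) auto
      qed
      moreover have "norm (Kp z) \<le> CK * norm z ^ (d + 1) * s ^ 8"
      proof -
        have "CK * norm z ^ (d + 1) * 1 \<le> CK * norm z ^ (d + 1) * s ^ 8"
          using s8 CK(1) by (intro mult_left_mono) auto
        then show ?thesis using CK(2)[OF z(2)] by linarith
      qed
      ultimately show ?thesis using norm_triangle_ineq4[of "Kp z" "Rp z * ?F"] by (simp add: algebra_simps)
    qed
    have "norm (ode_quotient z) \<le> norm (z ^ (d + 1) * (?M / 2 - (?L\<^sup>2 - ?F\<^sup>2) / 4)) + norm (of_nat (d + 1) * z ^ d * ?L / 2) + norm (Kp z - Rp z * ?F)"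
      unfolding ode_quotient_formula_nonreal[OF z(1)]
      by (rule order_trans[OF norm_triangle_ineq add_mono[OF norm_triangle_ineq order_refl]])
    also have "\<dots> \<le> norm z ^ (d + 1) * (((C2 + C1\<^sup>2) / 2 + (C1\<^sup>2 + C3\<^sup>2) / 4) * s ^ 8)
        + norm z ^ (d + 1) * (real (d + 1) * C1 / 2 * s ^ 8) + norm z ^ (d + 1) * ((CK + CR * C3) * s ^ 8)"
      by (intro add_mono T1 T2 T3)
    also have "\<dots> = C * norm z ^ (d + 1) * s ^ 8" unfolding C_def by (simp add: algebra_simps)
    finally show "norm (ode_quotient z) \<le> C * norm z ^ (d + 1) * (norm z / \<bar>Im z\<bar>) ^ 8" by (simp add: s_def)
  qed
qed

end

section \<open>Vanishing of the common quotient\<close>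

context signature_polynomial
begin

text \<open>The polynomial \<open>K\<close> is made so that it agrees with the product of \<open>R\<close> and the gap up to order \<open>z ^ (d + 1)\<close>.
For even \<open>d\<close> the top term of \<open>R\<close> does not enter \<open>K\<close>; its product with the gap is itself of that order.\<close>

lemma K_minus_RF_near_0:
  obtains C where "\<And>y. 0 < y \<Longrightarrow> y \<le> 1 \<Longrightarrow>
    norm (Kp (\<i> * of_real y) - Rp (\<i> * of_real y) * logderiv_gap (par d) (\<i> * of_real y)) \<le> C * y ^ (d + 1)"
proof -
  let ?N = "half_deg d" and ?e = "par d" and ?r = "r_coeff d p"
  let ?lam = "\<lambda>q. complex_of_real (lambda_sum d \<tau> q)"
  define T where "T = (\<lambda>m w. 2 * (\<Sum>q\<le>m. ?lam q * w ^ (2 * q + ?e)))"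
  define c where "c = (\<lambda>m. 2 * (\<Sum>k. 1 / (\<tau> (Suc k))\<^sup>2) / \<tau> 1 ^ (2 * m + 1 + ?e))"
  have rem: "norm (logderiv_gap ?e (\<i> * of_real y) - T m (\<i> * of_real y)) \<le> c m * y ^ (2 * m + 2 + ?e)" if "y > 0" for y m
    unfolding T_def c_def by (rule logderiv_gap_expansion[OF that])
  have e: "?e = 0 \<or> ?e = 1" by (rule par_cases)
  have dN: "d + 1 = 2 * ?N + 2 + ?e" using twice_half_deg[OF d_pos] by simp
  define C where "C = 1 / 4 + (\<Sum>j\<le>?N. norm (?r j) * c (?N - j)) + norm (?r (?N + 1)) * (2 * norm (?lam 0) + c 0)"
  have c0: "c 0 \<ge> 0"
  proof -
    have "0 \<le> c 0 * 1 ^ (2 * 0 + 2 + ?e)" using order_trans[OF norm_ge_zero rem[of 1 0]] by simp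
    then show ?thesis by simp
  qed
  show ?thesis
  proof (rule that[of C])
    fix y :: real assume y: "0 < y" "y \<le> 1"
    define w where "w = \<i> * complex_of_real y"
    have nw: "norm w = y" using y by (simp add: w_def norm_mult)
    let ?F = "logderiv_gap ?e w"
    define tail where "tail = (if ?e = 1 then ?r (?N + 1) * w ^ (2 * (?N + 1)) * ?F else 0)"
    have R: "Rp w * ?F = (\<Sum>j\<le>?N. ?r j * w ^ (2 * j) * ?F) + tail"
      unfolding poly_R_poly_r_coeff[OF d_pos] sum_distrib_right tail_def using e by auto
    have K: "Kp w = w ^ (d + 1) / 4 + (\<Sum>j\<le>?N. ?r j * w ^ (2 * j) * T (?N - j) w)"
      unfolding poly_K_poly_triangle T_def ..
    have diff: "Kp w - Rp w * ?F = w ^ (d + 1) / 4 - (\<Sum>j\<le>?N. ?r j * w ^ (2 * j) * (?F - T (?N - j) w)) - tail"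
      unfolding R K by (simp add: right_diff_distrib sum_subtractf)
    have b1: "norm (\<Sum>j\<le>?N. ?r j * w ^ (2 * j) * (?F - T (?N - j) w)) \<le> (\<Sum>j\<le>?N. norm (?r j) * c (?N - j)) * y ^ (d + 1)"
      unfolding sum_distrib_right
    proof (rule sum_norm_le)
      fix j assume "j \<in> {..?N}"
      then have idx: "2 * j + (2 * (?N - j) + 2 + ?e) = d + 1" using dN by auto
      have "norm (?r j * w ^ (2 * j) * (?F - T (?N - j) w)) \<le> norm (?r j) * y ^ (2 * j) * (c (?N - j) * y ^ (2 * (?N - j) + 2 + ?e))"
        unfolding norm_mult norm_power nw using rem[OF y(1), of "?N - j"] y unfolding w_def[symmetric]
        by (intro mult_left_mono) auto
      also have "\<dots> = norm (?r j) * c (?N - j) * (y ^ (2 * j) * y ^ (2 * (?N - j) + 2 + ?e))" by simp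
      also have "y ^ (2 * j) * y ^ (2 * (?N - j) + 2 + ?e) = y ^ (d + 1)" unfolding power_add[symmetric] idx ..
      finally show "norm (?r j * w ^ (2 * j) * (?F - T (?N - j) w)) \<le> norm (?r j) * c (?N - j) * y ^ (d + 1)" .
    qed
    have b2: "norm tail \<le> norm (?r (?N + 1)) * (2 * norm (?lam 0) + c 0) * y ^ (d + 1)"
    proof (cases "?e = 1")
      case True
      have "norm ?F \<le> norm (T 0 w) + norm (?F - T 0 w)" by (rule norm_triangle_sub)
      also have "norm (T 0 w) = 2 * norm (?lam 0) * y" unfolding T_def using True nw by (simp add: norm_mult)
      also have "norm (?F - T 0 w) \<le> c 0 * y"
      proof -
        have "norm (?F - T 0 w) \<le> c 0 * y ^ 3" using rem[OF y(1), of 0] True unfolding w_def by (simp add: numeral_3_eq_3 numeral_2_eq_2)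
        also have "\<dots> \<le> c 0 * y" using c0 y power_decreasing[of 1 3 y] by (intro mult_left_mono) auto
        finally show ?thesis .
      qed
      finally have F: "norm ?F \<le> (2 * norm (?lam 0) + c 0) * y" by (simp add: distrib_right)
      have "norm tail = norm (?r (?N + 1)) * y ^ (2 * (?N + 1)) * norm ?F"
      proof -
        have "tail = ?r (?N + 1) * w ^ (2 * (?N + 1)) * ?F" unfolding tail_def by (rule if_P[OF True])
        then show ?thesis by (simp only: norm_mult norm_power nw)
      qed
      also have "\<dots> \<le> norm (?r (?N + 1)) * y ^ (2 * (?N + 1)) * ((2 * norm (?lam 0) + c 0) * y)"
        using F y by (intro mult_left_mono) auto
      also have "\<dots> = norm (?r (?N + 1)) * (2 * norm (?lam 0) + c 0) * (y ^ (2 * (?N + 1)) * y)" by simp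
      also have "y ^ (2 * (?N + 1)) * y = y ^ (d + 1)" unfolding dN True by (simp add: power_add power2_eq_square)
      finally show ?thesis .
    next
      case False
      then show ?thesis using c0 y by (simp add: tail_def)
    qed
    have "norm (Kp w - Rp w * ?F) \<le> norm (w ^ (d + 1) / 4) + norm (\<Sum>j\<le>?N. ?r j * w ^ (2 * j) * (?F - T (?N - j) w)) + norm tail"
      unfolding diff by (rule order_trans[OF norm_triangle_ineq4 add_mono[OF norm_triangle_ineq4 order_refl]])
    also have "norm (w ^ (d + 1) / 4) = 1 / 4 * y ^ (d + 1)" by (simp only: norm_divide norm_power nw) simp
    also have "1 / 4 * y ^ (d + 1) + norm (\<Sum>j\<le>?N. ?r j * w ^ (2 * j) * (?F - T (?N - j) w)) + norm tail \<le> C * y ^ (d + 1)"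
      using b1 b2 unfolding C_def by (simp only: distrib_right)
    finally show "norm (Kp (\<i> * of_real y) - Rp (\<i> * of_real y) * logderiv_gap ?e (\<i> * of_real y)) \<le> C * y ^ (d + 1)"
      unfolding w_def .
  qed
qed

text \<open>The coefficient of \<open>z ^ (d + 1)\<close> is continuous at \<open>0\<close>, the logarithmic derivative of the even function \<open>\<phi>\<close> is
\<open>O(y)\<close>, and the remaining part is covered by \<open>K_minus_RF_near_0\<close>.\<close>

lemma ode_quotient_bounded_near_0:
  obtains y0 C where "y0 > 0" "\<And>y. 0 < y \<Longrightarrow> y \<le> y0 \<Longrightarrow> norm (ode_quotient (\<i> * of_real y) / (\<i> * of_real y) ^ (d + 1)) \<le> C"
proof -
  define H where "H = (\<lambda>z. deriv (deriv \<phi>) z / \<phi> z / 2 - ((deriv \<phi> z / \<phi> z)\<^sup>2 - (deriv \<Phi>\<^sub>1 z / \<Phi>\<^sub>1 z - deriv \<Phi>\<^sub>2 z / \<Phi>\<^sub>2 z)\<^sup>2) / 4)"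
  have nz0: "\<phi> 0 \<noteq> 0" "\<Phi>\<^sub>1 0 \<noteq> 0" "\<Phi>\<^sub>2 0 \<noteq> 0" using phi_0 phi_eq_Phi1_Phi2[of 0 d] by auto
  have isC: "isCont F 0" if "F holomorphic_on UNIV" for F :: "complex \<Rightarrow> complex"
    using holomorphic_on_imp_continuous_on[OF that] by (simp add: continuous_on_eq_continuous_at)
  have cont: "isCont H 0"
    unfolding H_def
    by (intro continuous_intros isC holomorphic_deriv phi_holomorphic Phi1_holomorphic Phi2_holomorphic open_UNIV nz0) auto
  then obtain r where r: "r > 0" "\<And>z. dist z 0 < r \<Longrightarrow> dist (H z) (H 0) < 1"
    unfolding continuous_at_eps_delta using zero_less_one by blast
  obtain CK where CK: "\<And>y. 0 < y \<Longrightarrow> y \<le> 1 \<Longrightarrow>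
    norm (Kp (\<i> * of_real y) - Rp (\<i> * of_real y) * logderiv_gap (par d) (\<i> * of_real y)) \<le> CK * y ^ (d + 1)"
    using K_minus_RF_near_0 by blast
  define y0 where "y0 = min 1 (r / 2)"
  define \<Sigma> where "\<Sigma> = (\<Sum>k. 1 / (\<tau> (Suc k))\<^sup>2)"
  show ?thesis
  proof (rule that[of y0 "(norm (H 0) + 1) + real (d + 1) * \<Sigma> + CK"])
    show "y0 > 0" using r by (simp add: y0_def)
    fix y :: real assume y: "0 < y" "y \<le> y0"
    define w where "w = \<i> * complex_of_real y"
    have w: "w \<noteq> 0" "Im w \<noteq> 0" and nw: "norm w = y" using y by (auto simp: w_def norm_mult)
    have yr: "y \<le> 1" "y < r" using y r by (auto simp: y0_def)
    have nz: "\<Phi>\<^sub>1 w \<noteq> 0" "\<Phi>\<^sub>2 w \<noteq> 0"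
      using phi_nonreal[OF w(2)] phi_eq_Phi1_Phi2[of w d] by auto
    let ?L = "deriv \<phi> w / \<phi> w"
    have q: "ode_quotient w = w ^ (d + 1) * H w + of_nat (d + 1) * w ^ d * ?L / 2 + (Kp w - Rp w * logderiv_gap (par d) w)"
      unfolding H_def logderiv_gap_eq[OF w(2), of d, symmetric] by (rule ode_quotient_formula[OF nz])
    have "ode_quotient w / w ^ (d + 1) = H w + of_nat (d + 1) * (?L / w) / 2 + (Kp w - Rp w * logderiv_gap (par d) w) / w ^ (d + 1)"
      unfolding q add_divide_distrib using w by simp
    then have "norm (ode_quotient w / w ^ (d + 1)) \<le> norm (H w) + norm (of_nat (d + 1) * (?L / w) / 2) + norm ((Kp w - Rp w * logderiv_gap (par d) w) / w ^ (d + 1))"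
      by (simp only:) (rule order_trans[OF norm_triangle_ineq add_mono[OF norm_triangle_ineq order_refl]])
    moreover have "norm (H w) \<le> norm (H 0) + 1"
      using r(2)[of w] yr nw norm_triangle_sub[of "H w" "H 0"] by (simp add: dist_norm)
    moreover have "norm (of_nat (d + 1) * (?L / w) / 2) \<le> real (d + 1) * \<Sigma>"
    proof -
      have "norm ?L \<le> 2 * y * \<Sigma>"
        unfolding w_def logderiv_imaginary(1)[OF y(1)] using logderiv_imaginary(2,3)[OF y(1)]
        by (simp add: norm_mult \<Sigma>_def)
      then have "norm (?L / w) \<le> 2 * \<Sigma>" using y(1) by (simp only: norm_divide[of "deriv \<phi> w / \<phi> w" w] nw pos_divide_le_eq) (simp only: mult_ac)
      then have "real (d + 1) * norm (?L / w) / 2 \<le> real (d + 1) * (2 * \<Sigma>) / 2" by (intro divide_right_mono mult_left_mono) auto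
      moreover have "norm (of_nat (d + 1) * (?L / w) / 2) = real (d + 1) * norm (?L / w) / 2"
        by (simp only: norm_mult norm_divide norm_of_nat norm_numeral)
      moreover have "real (d + 1) * (2 * \<Sigma>) / 2 = real (d + 1) * \<Sigma>" by simp
      ultimately show ?thesis by (simp only:)
    qed
    moreover have "norm ((Kp w - Rp w * logderiv_gap (par d) w) / w ^ (d + 1)) \<le> CK"
      using CK[OF y(1) yr(1)] y(1) unfolding w_def[symmetric] norm_divide norm_power nw by (simp add: pos_divide_le_eq)
    ultimately show "norm (ode_quotient (\<i> * of_real y) / (\<i> * of_real y) ^ (d + 1)) \<le> (norm (H 0) + 1) + real (d + 1) * \<Sigma> + CK"
      unfolding w_def by linarith
  qed
qed

text \<open>Along the positive imaginary axis \<open>\<phi>' / \<phi>\<close> tends to \<open>- \<i>\<close>, so \<open>((\<phi>' / \<phi>)\<^sup>2 + 1) / 4\<close> tends to \<open>0\<close>; the summand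
\<open>1/4\<close> is the leading coefficient of \<open>K\<close>. All other terms are \<open>O(1 / y)\<close>.\<close>

lemma ode_quotient_tendsto_0: "((\<lambda>y. ode_quotient (\<i> * of_real y) / (\<i> * of_real y) ^ (d + 1)) \<longlongrightarrow> 0) at_top"
proof -
  let ?w = "\<lambda>y. \<i> * complex_of_real y"
  let ?L = "\<lambda>y. deriv \<phi> (?w y) / \<phi> (?w y)" and ?F = "\<lambda>y. logderiv_gap (par d) (?w y)"
  let ?D = "\<lambda>y. deriv (deriv \<phi>) (?w y) / \<phi> (?w y) - (?L y)\<^sup>2"
  define k where "k = K_poly d \<tau> p - monom (1 / 4) (d + 1)"
  have degk: "degree k \<le> d"
  proof -
    have "2 * n + par d \<le> d" if "n \<le> half_deg d" for n
      using twice_half_deg[OF d_pos] that par_cases[of d] by auto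
    then show ?thesis
      unfolding k_def K_poly_def
      by (simp, intro order_trans[OF degree_smult_le] degree_sum_le order_trans[OF degree_monom_le]) auto
  qed
  have Kk: "Kp z = z ^ (d + 1) / 4 + poly k z" for z by (simp add: k_def poly_monom)
  obtain C2 where C2: "\<And>z. Im z \<noteq> 0 \<Longrightarrow>
    norm (deriv (deriv \<phi>) z / \<phi> z - (deriv \<phi> z / \<phi> z)\<^sup>2) \<le> C2 * (norm z / \<bar>Im z\<bar>) ^ 3 / norm z"
    using norm_logderiv_deriv_le by blast
  obtain C1 where C1: "\<And>z. Im z \<noteq> 0 \<Longrightarrow> norm (deriv \<phi> z / \<phi> z) \<le> C1 * (norm z / \<bar>Im z\<bar>) ^ 2"
    using norm_logderiv_le by blast
  define C3 where "C3 = 1 + 4 * (LINT x::real|lborel. 1 / (1 + x\<^sup>2))"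
  obtain CR where CR: "CR \<ge> 0" "\<And>z. norm z \<ge> 1 \<Longrightarrow> norm (Rp z) \<le> CR * norm z ^ d"
    using norm_poly_le_power[OF degree_R_poly_le] by blast
  obtain CK where CK: "CK \<ge> 0" "\<And>z. norm z \<ge> 1 \<Longrightarrow> norm (poly k z) \<le> CK * norm z ^ d"
    using norm_poly_le_power[OF degk] by blast
  have ev: "eventually (\<lambda>y::real. y \<ge> 1) at_top" by (rule eventually_ge_at_top)
  have null: "(f \<longlongrightarrow> 0) at_top" if "\<And>y. y \<ge> 1 \<Longrightarrow> norm (f y) \<le> C / y" for f :: "real \<Rightarrow> complex" and C
  proof (rule Lim_null_comparison)
    show "eventually (\<lambda>y. norm (f y) \<le> C / y) at_top" using ev by eventually_elim (rule that)
    show "((\<lambda>y. C / y) \<longlongrightarrow> 0) at_top" by real_asymp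
  qed
  have nw: "norm (?w y) = y" "Im (?w y) = y" if "y \<ge> 1" for y using that by (simp_all add: norm_mult)
  have D0: "(?D \<longlongrightarrow> 0) at_top"
  proof (rule null[of _ C2])
    fix y :: real assume y: "y \<ge> 1"
    have "norm (?D y) \<le> C2 * (norm (?w y) / \<bar>Im (?w y)\<bar>) ^ 3 / norm (?w y)"
      by (rule C2) (use y in simp)
    then show "norm (?D y) \<le> C2 / y" unfolding nw[OF y] using y by simp
  qed
  have Fb: "norm (?F y) \<le> C3 / y" if "y \<ge> 1" for y
    using norm_logderiv_gap_le[of "?w y" "par d"] par_cases[of d] that by (simp add: nw C3_def norm_mult)
  have F0: "(?F \<longlongrightarrow> 0) at_top" by (rule null[OF Fb])
  have Lw0: "((\<lambda>y. ?L y / ?w y) \<longlongrightarrow> 0) at_top"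
  proof (rule null[of _ C1])
    fix y :: real assume y: "y \<ge> 1"
    have "norm (?L y) \<le> C1" using C1[of "?w y"] y by (simp add: norm_mult)
    then have "norm (?L y) / y \<le> C1 / y" using y by (intro divide_right_mono) auto
    then show "norm (?L y / ?w y) \<le> C1 / y" unfolding norm_divide[of "?L y"] nw(1)[OF y] .
  qed
  have k0: "((\<lambda>y. poly k (?w y) / ?w y ^ (d + 1)) \<longlongrightarrow> 0) at_top"
  proof (rule null[of _ CK])
    fix y :: real assume y: "y \<ge> 1"
    have "norm (poly k (?w y)) \<le> CK * y ^ d" using CK(2)[of "?w y"] y by (simp add: norm_mult)
    then have "norm (poly k (?w y)) / y ^ (d + 1) \<le> CK * y ^ d / y ^ (d + 1)" using y by (intro divide_right_mono) auto
    then show "norm (poly k (?w y) / ?w y ^ (d + 1)) \<le> CK / y" unfolding norm_divide norm_power nw(1)[OF y] using y by simp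
  qed
  have RF0: "((\<lambda>y. Rp (?w y) * ?F y / ?w y ^ (d + 1)) \<longlongrightarrow> 0) at_top"
  proof (rule null[of _ "CR * C3"])
    fix y :: real assume y: "y \<ge> 1"
    have C30: "C3 \<ge> 0" unfolding C3_def by (intro add_nonneg_nonneg mult_nonneg_nonneg Bochner_Integration.integral_nonneg) auto
    have "norm (Rp (?w y)) \<le> CR * y ^ d" using CR(2)[of "?w y"] y by (simp add: norm_mult)
    moreover have "norm (?F y) \<le> C3"
    proof -
      have "C3 / y \<le> C3 / 1" using y C30 by (intro divide_left_mono) auto
      then show ?thesis using Fb[OF y] by simp
    qed
    ultimately have "norm (Rp (?w y) * ?F y) \<le> (CR * y ^ d) * C3" unfolding norm_mult using y CR(1) by (intro mult_mono) auto
    then have "norm (Rp (?w y) * ?F y) / y ^ (d + 1) \<le> (CR * y ^ d) * C3 / y ^ (d + 1)" using y by (intro divide_right_mono) auto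
    then show "norm (Rp (?w y) * ?F y / ?w y ^ (d + 1)) \<le> CR * C3 / y"
      unfolding norm_divide[of "Rp (?w y) * ?F y"] norm_power nw(1)[OF y] using y by simp
  qed
  have L2: "((\<lambda>y. (?L y)\<^sup>2 + 1) \<longlongrightarrow> 0) at_top"
  proof -
    let ?S = "\<lambda>y. \<Sum>k. 2 * y / (y\<^sup>2 + (\<tau> (Suc k))\<^sup>2)"
    have "((\<lambda>y. (- \<i> * complex_of_real (?S y))\<^sup>2 + 1) \<longlongrightarrow> (- \<i> * complex_of_real 1)\<^sup>2 + 1) at_top"
      by (intro tendsto_add tendsto_power tendsto_mult tendsto_const tendsto_of_real imaginary_sum_tendsto)
    then have "((\<lambda>y. (- \<i> * complex_of_real (?S y))\<^sup>2 + 1) \<longlongrightarrow> 0) at_top" by simp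
    moreover have "eventually (\<lambda>y. (- \<i> * complex_of_real (?S y))\<^sup>2 + 1 = (?L y)\<^sup>2 + 1) at_top"
      using ev by eventually_elim (use logderiv_imaginary(1) in auto)
    ultimately show ?thesis by (rule Lim_transform_eventually)
  qed
  have "((\<lambda>y. ?D y / 2 + ((?L y)\<^sup>2 + 1) / 4 + (?F y)\<^sup>2 / 4 + of_nat (d + 1) / 2 * (?L y / ?w y)
      + (poly k (?w y) / ?w y ^ (d + 1) - Rp (?w y) * ?F y / ?w y ^ (d + 1))) \<longlongrightarrow> 0 / 2 + 0 / 4 + 0\<^sup>2 / 4 + of_nat (d + 1) / 2 * 0 + (0 - 0)) at_top"
    by (intro tendsto_add tendsto_diff tendsto_divide tendsto_mult tendsto_power tendsto_const D0 L2 F0 Lw0 k0 RF0) auto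
  then have lim: "((\<lambda>y. ?D y / 2 + ((?L y)\<^sup>2 + 1) / 4 + (?F y)\<^sup>2 / 4 + of_nat (d + 1) / 2 * (?L y / ?w y)
      + (poly k (?w y) / ?w y ^ (d + 1) - Rp (?w y) * ?F y / ?w y ^ (d + 1))) \<longlongrightarrow> 0) at_top" by simp
  have "eventually (\<lambda>y. ?D y / 2 + ((?L y)\<^sup>2 + 1) / 4 + (?F y)\<^sup>2 / 4 + of_nat (d + 1) / 2 * (?L y / ?w y)
      + (poly k (?w y) / ?w y ^ (d + 1) - Rp (?w y) * ?F y / ?w y ^ (d + 1)) = ode_quotient (?w y) / ?w y ^ (d + 1)) at_top"
    using ev
  proof eventually_elim
    case (elim y)
    then have w: "Im (?w y) \<noteq> 0" "?w y \<noteq> 0" by auto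
    have gen: "D / 2 + (L\<^sup>2 + 1) / 4 + F\<^sup>2 / 4 + n / 2 * (L / z) + (kz / z ^ (d + 1) - RF / z ^ (d + 1))
        = (z ^ (d + 1) * ((D + L\<^sup>2) / 2 - (L\<^sup>2 - F\<^sup>2) / 4) + n * z ^ d * L / 2 + (z ^ (d + 1) / 4 + kz - RF)) / z ^ (d + 1)"
      if "z \<noteq> 0" for n D L F kz RF z :: complex
    proof -
      have "(z ^ (d + 1) * ((D + L\<^sup>2) / 2 - (L\<^sup>2 - F\<^sup>2) / 4) + n * z ^ d * L / 2 + (z ^ (d + 1) / 4 + kz - RF)) / z ^ (d + 1)
          = ((D + L\<^sup>2) / 2 - (L\<^sup>2 - F\<^sup>2) / 4) + n * (z ^ d / z ^ (d + 1)) * L / 2 + (1 / 4 + kz / z ^ (d + 1) - RF / z ^ (d + 1))"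
        using that by (simp add: add_divide_distrib diff_divide_distrib)
      also have "z ^ d / z ^ (d + 1) = 1 / z" using that by simp
      finally show ?thesis by (simp add: add_divide_distrib diff_divide_distrib distrib_right)
    qed
    show ?case
      unfolding gen[OF w(2)] ode_quotient_formula_nonreal[OF w(1)] Kk by simp
  qed
  with lim show ?thesis by (rule Lim_transform_eventually)
qed

text \<open>By its growth the quotient is a polynomial of degree at most \<open>d + 1\<close>. Divided by \<open>z ^ (d + 1)\<close> it is a
polynomial in \<open>1 / z\<close>, bounded as \<open>z\<close> tends to \<open>0\<close> along the imaginary axis and tending to \<open>0\<close> at infinity.\<close>

lemma ode_quotient_eq_0: "ode_quotient z = 0"
proof -
  obtain C where C: "C \<ge> 0" "\<And>z. Im z \<noteq> 0 \<Longrightarrow> norm z \<ge> 1 \<Longrightarrow> norm (ode_quotient z) \<le> C * norm z ^ (d + 1) * (norm z / \<bar>Im z\<bar>) ^ 8"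
    using ode_quotient_growth by blast
  define c where "c = (\<lambda>k. (deriv ^^ k) ode_quotient 0 / fact k)"
  have poly: "ode_quotient z = (\<Sum>k\<le>d + 1. c k * z ^ k)" for z
    unfolding c_def
  proof (rule Liouville_polynomial[OF ode_quotient_holomorphic, of 1 "C * (8 / 3) ^ 8 * 2 ^ (d + 1)"])
    show "norm (ode_quotient z) \<le> C * (8 / 3) ^ 8 * 2 ^ (d + 1) * norm z ^ (d + 1)" if "1 \<le> norm z" for z
      by (rule entire_polynomial_growth_off_real_axis[OF ode_quotient_holomorphic C(2) C(1) _ that]) simp_all
  qed
  define r where "r = (\<Sum>j\<le>d + 1. monom (c (d + 1 - j)) j)"
  have r: "poly r (1 / z) = ode_quotient z / z ^ (d + 1)" if "z \<noteq> 0" for z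
  proof -
    have "poly r (1 / z) = (\<Sum>j\<le>d + 1. c (d + 1 - j) * (1 / z) ^ j)" by (simp add: r_def poly_sum poly_monom)
    also have "\<dots> = (\<Sum>k\<le>d + 1. c k * (1 / z) ^ (d + 1 - k))"
      by (rule sum.reindex_bij_witness[of _ "\<lambda>k. d + 1 - k" "\<lambda>j. d + 1 - j"]) auto
    also have "\<dots> = (\<Sum>k\<le>d + 1. c k * z ^ k / z ^ (d + 1))"
      by (rule sum.cong) (use that in \<open>auto simp: power_diff power_one_over divide_simps\<close>)
    finally show ?thesis unfolding poly[of z] by (simp only: sum_divide_distrib)
  qed
  obtain y0 B where B: "y0 > 0" "\<And>y. 0 < y \<Longrightarrow> y \<le> y0 \<Longrightarrow> norm (ode_quotient (\<i> * of_real y) / (\<i> * of_real y) ^ (d + 1)) \<le> B"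
    using ode_quotient_bounded_near_0 by blast
  have "r = 0"
  proof (rule poly_bounded_on_axis_imp_zero[OF _ B(1)])
    show "norm (poly r (1 / (\<i> * of_real y))) \<le> B" if "0 < y" "y \<le> y0" for y
      using B(2)[OF that] that by (subst r) auto
    have "eventually (\<lambda>y::real. ode_quotient (\<i> * of_real y) / (\<i> * of_real y) ^ (d + 1) = poly r (1 / (\<i> * of_real y))) at_top"
      using eventually_gt_at_top[of 0] by eventually_elim (subst r, auto)
    with ode_quotient_tendsto_0 show "((\<lambda>y. poly r (1 / (\<i> * of_real y))) \<longlongrightarrow> 0) at_top"
      by (rule Lim_transform_eventually)
  qed
  then have nz: "ode_quotient z = 0" if "z \<noteq> 0" for z using r[OF that] that by simp
  have "ode_quotient z = 0"
    by (rule analytic_continuation_open[of "- {0}" UNIV ode_quotient "\<lambda>_. 0"])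
       (use nz ode_quotient_holomorphic in \<open>auto intro: exI[of _ 1]\<close>)
  then show ?thesis .
qed

lemma ode1_eq_0: "ode1 z = 0" and ode2_eq_0: "ode2 z = 0"
  by (simp_all only: ode1_quot ode2_quot ode_quotient_eq_0 mult_zero_left)

end

section \<open>The exponentially modified factors\<close>

text \<open>The algebraic core of the change of unknown \<open>y = exp (s h) F\<close>: with \<open>E = exp (s h)\<close>, \<open>h' = R / z ^ (d + 1)\<close>
and \<open>q = z ^ d\<close>, the three summands are \<open>y''\<close>, \<open>(d + 1) / z y'\<close> and the potential times \<open>y\<close>.\<close>

lemma gauge_algebra:
  fixes z q R R1 F0 F1 F2 E K n s :: complex
  assumes nz: "z \<noteq> 0" "q \<noteq> 0" and s: "s * s = 1"
    and eq: "z * q * F2 + (n * q + 2 * s * R) * F1 + (K + s * R1) * F0 = 0"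
  shows "E * (s * (R / (z * q))) * (F1 + s * (R / (z * q)) * F0)
      + E * (F2 + (s * ((R1 * (z * q) - R * (n * q)) / ((z * q) * (z * q))) * F0 + s * (R / (z * q)) * F1))
      + n / z * (E * (F1 + s * (R / (z * q)) * F0)) + (K / (z * q) - R\<^sup>2 / (z * q)\<^sup>2) * (E * F0) = 0"
proof -
  define u v k m where "u = R / (z * q)" and "v = R1 / (z * q)" and "k = K / (z * q)" and "m = n / z"
  have R: "R = u * (z * q)" and R1: "R1 = v * (z * q)" and K: "K = k * (z * q)" and n: "n = m * z"
    using nz by (simp_all add: u_def v_def k_def m_def)
  have q: "(v * (z * q) * (z * q) - u * (z * q) * (m * z * q)) / ((z * q) * (z * q)) = v - u * m"
    using nz by (simp add: field_simps)
  have simps: "u * (z * q) / (z * q) = u" "k * (z * q) / (z * q) = k" "m * z / z = m"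
    "(u * (z * q))\<^sup>2 / (z * q)\<^sup>2 = u\<^sup>2"
    using nz by (simp_all add: power_mult_distrib)
  have "(z * q) * (F2 + (m + 2 * s * u) * F1 + (k + s * v) * F0) = 0"
    using eq unfolding R R1 K n by (simp only: algebra_simps)
  then have "F2 + (m + 2 * s * u) * F1 + (k + s * v) * F0 = 0" using nz by simp
  moreover have "X = - A - B" if "X + A + B = 0" for X A B :: complex
    using that by (simp add: eq_diff_eq eq_neg_iff_add_eq_0 add_ac)
  ultimately have F2: "F2 = - ((m + 2 * s * u) * F1) - (k + s * v) * F0" by blast
  have ss: "s * (s * x) = x" for x using s by (simp add: mult.assoc[symmetric])
  show ?thesis
    unfolding R R1 K n q simps F2 by (simp add: algebra_simps power2_eq_square ss)
qed

text \<open>The factor \<open>exp (s h)\<close> removes the term with \<open>R\<close> in front of \<open>F'\<close>. Since \<open>s\<^sup>2 = 1\<close>, the resulting potential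
is the same for \<open>s = 1\<close> and \<open>s = - 1\<close>, so that both functions end up with one equation.\<close>

lemma gauge_transform:
  fixes h F K :: "complex \<Rightarrow> complex" and R :: "complex poly" and s :: complex and d :: nat
  defines "y \<equiv> \<lambda>z. exp (s * h z) * F z"
  assumes D: "open D" "0 \<notin> D"
    and h: "\<And>z. z \<in> D \<Longrightarrow> (h has_field_derivative poly R z / z ^ (d + 1)) (at z)"
    and F: "F holomorphic_on UNIV"
  shows gauge_transform_deriv:
      "z \<in> D \<Longrightarrow> (y has_field_derivative exp (s * h z) * (deriv F z + s * (poly R z / z ^ (d + 1)) * F z)) (at z)"
    and gauge_transform_holomorphic: "y holomorphic_on D"
    and gauge_transform_solves_ode:
      "s * s = 1 \<Longrightarrow> (\<And>z. z ^ (d + 1) * deriv (deriv F) z + (of_nat (d + 1) * z ^ d + 2 * s * poly R z) * deriv F z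
          + (K z + s * poly (pderiv R) z) * F z = 0) \<Longrightarrow>
       solves_ode2_on D (\<lambda>z. of_nat (d + 1) / z) (\<lambda>z. K z / z ^ (d + 1) - (poly R z)\<^sup>2 / z ^ (2 * d + 2)) y"
proof -
  have F1: "(F has_field_derivative deriv F z) (at z)" for z
    by (rule holomorphic_derivI[OF F open_UNIV UNIV_I])
  have F2: "(deriv F has_field_derivative deriv (deriv F) z) (at z)" for z
    by (rule holomorphic_derivI[OF holomorphic_deriv[OF F open_UNIV] open_UNIV UNIV_I])
  have y: "(y has_field_derivative exp (s * h z) * (deriv F z + s * (poly R z / z ^ (d + 1)) * F z)) (at z)"
    if "z \<in> D" for z
  proof -
    have "(y has_field_derivative (exp (s * h z) * (s * (poly R z / z ^ (d + 1)))) * F z + deriv F z * exp (s * h z)) (at z)"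
      unfolding y_def
      by (rule DERIV_mult[OF DERIV_chain2[OF DERIV_exp DERIV_cmult[OF h[OF that]]] F1])
    then show ?thesis by (rule back_subst) (simp only: distrib_left mult_ac add.commute)
  qed
  then show "z \<in> D \<Longrightarrow> (y has_field_derivative exp (s * h z) * (deriv F z + s * (poly R z / z ^ (d + 1)) * F z)) (at z)" .
  show hol: "y holomorphic_on D" by (rule holomorphic_onI) (use y in \<open>auto simp: field_differentiable_def intro: has_field_derivative_at_within\<close>)
  assume s: "s * s = 1" and eq: "\<And>z. z ^ (d + 1) * deriv (deriv F) z + (of_nat (d + 1) * z ^ d + 2 * s * poly R z) * deriv F z
          + (K z + s * poly (pderiv R) z) * F z = 0"
  show "solves_ode2_on D (\<lambda>z. of_nat (d + 1) / z) (\<lambda>z. K z / z ^ (d + 1) - (poly R z)\<^sup>2 / z ^ (2 * d + 2)) y"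
    unfolding solves_ode2_on_def
  proof (intro conjI ballI hol)
    fix z assume z: "z \<in> D"
    then have nz: "z \<noteq> 0" "z ^ d \<noteq> 0" using D by auto
    let ?u = "\<lambda>z. poly R z / z ^ (d + 1)"
    define u' where "u' = (poly (pderiv R) z * (z * z ^ d) - poly R z * (of_nat (d + 1) * z ^ d)) / ((z * z ^ d) * (z * z ^ d))"
    have pw: "((\<lambda>z. z ^ (d + 1)) has_field_derivative of_nat (d + 1) * z ^ d) (at z)"
      using DERIV_power[OF DERIV_ident, of "d + 1" z UNIV] by simp
    have u: "(?u has_field_derivative u') (at z)"
      using DERIV_divide[OF poly_DERIV[of R z] pw] nz unfolding u'_def by simp
    let ?g = "\<lambda>z. exp (s * h z) * (deriv F z + s * ?u z * F z)"
    have "(?g has_field_derivative (exp (s * h z) * (s * ?u z)) * (deriv F z + s * ?u z * F z)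
         + (deriv (deriv F) z + (s * u' * F z + deriv F z * (s * ?u z))) * exp (s * h z)) (at z)"
      by (rule DERIV_mult[OF DERIV_chain2[OF DERIV_exp DERIV_cmult[OF h[OF z]]] DERIV_add[OF F2 DERIV_mult[OF DERIV_cmult[OF u] F1]]])
    moreover have "?g w = deriv y w" if "w \<in> D" for w using DERIV_imp_deriv[OF y[OF that]] by simp
    ultimately have "(deriv y has_field_derivative (exp (s * h z) * (s * ?u z)) * (deriv F z + s * ?u z * F z)
         + (deriv (deriv F) z + (s * u' * F z + deriv F z * (s * ?u z))) * exp (s * h z)) (at z)"
      by (rule has_field_derivative_transform_within_open[OF _ D(1) z])
    then have y2: "deriv (deriv y) z = exp (s * h z) * (s * ?u z) * (deriv F z + s * ?u z * F z)
         + exp (s * h z) * (deriv (deriv F) z + (s * u' * F z + s * ?u z * deriv F z))"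
      by (simp only: DERIV_imp_deriv mult.commute[of _ "exp (s * h z)"] mult.commute[of "deriv F z"])
    have y1: "deriv y z = exp (s * h z) * (deriv F z + s * ?u z * F z)" by (rule DERIV_imp_deriv[OF y[OF z]])
    have zd: "z ^ (d + 1) = z * z ^ d" "z ^ (2 * d + 2) = (z * z ^ d)\<^sup>2"
      by (simp_all add: power_add power2_eq_square mult_2)
    show "deriv (deriv y) z + of_nat (d + 1) / z * deriv y z + (K z / z ^ (d + 1) - (poly R z)\<^sup>2 / z ^ (2 * d + 2)) * y z = 0"
      unfolding y1 y2 unfolding y_def u'_def zd
      by (rule gauge_algebra[OF nz s]) (use eq[of z] in \<open>simp only: zd\<close>)
  qed
qed

lemma lin_indep2_on_wronskian:
  assumes D: "open D" "z \<in> D" and f: "f holomorphic_on D" and g: "g holomorphic_on D"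
    and W: "wronskian f g z \<noteq> 0"
  shows "lin_indep2_on D f g"
  unfolding lin_indep2_on_def
proof (intro allI impI)
  fix a b :: complex assume zero: "\<forall>z\<in>D. a * f z + b * g z = 0"
  have "((\<lambda>z. a * f z + b * g z) has_field_derivative a * deriv f z + b * deriv g z) (at z)"
    by (intro DERIV_add DERIV_cmult holomorphic_derivI[OF f D] holomorphic_derivI[OF g D])
  then have "((\<lambda>z. 0) has_field_derivative a * deriv f z + b * deriv g z) (at z)"
    by (rule has_field_derivative_transform_within_open[OF _ D]) (use zero in auto)
  then have "a * deriv f z + b * deriv g z = 0" by (rule DERIV_unique) simp
  moreover have "a * f z + b * g z = 0" using zero D by blast
  moreover have "a * wronskian f g z = (a * f z + b * g z) * deriv g z - (a * deriv f z + b * deriv g z) * g z"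
    "b * wronskian f g z = (a * deriv f z + b * deriv g z) * f z - (a * f z + b * g z) * deriv f z"
    unfolding wronskian_def by (simp_all add: algebra_simps)
  ultimately have "a * wronskian f g z = 0" "b * wronskian f g z = 0" by (simp_all only:) simp_all
  then show "a = 0 \<and> b = 0" using W by simp
qed

context signature_polynomial
begin

text \<open>Term by term; the logarithm accounts for the top coefficient \<open>1/2\<close> of \<open>R\<close> when \<open>d\<close> is even.\<close>

lemma h_fun_derivative:
  assumes z: "z \<notin> \<real>\<^sub>\<le>\<^sub>0"
  shows "(h_fun d p has_field_derivative Rp z / z ^ (d + 1)) (at z)"
proof -
  let ?N = "half_deg d" and ?r = "r_coeff d p"
  have nz: "z \<noteq> 0" using z by auto
  have dN: "d + 1 = 2 * ?N + 2 + par d" using twice_half_deg[OF d_pos] by simp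
  have inv: "((\<lambda>z. 1 / z ^ Suc m) has_field_derivative - (of_nat (Suc m) / z ^ (m + 2))) (at z)" for m
  proof -
    have "((\<lambda>z. inverse (z ^ Suc m)) has_field_derivative - (inverse (z ^ Suc m) * (of_nat (Suc m) * z ^ m) * inverse (z ^ Suc m))) (at z)"
      using DERIV_inverse'[OF DERIV_power[OF DERIV_ident, of "Suc m" z UNIV]] nz by (simp del: of_nat_Suc)
    then show ?thesis unfolding divide_inverse mult_1_left
      by (rule back_subst) (use nz in \<open>simp add: divide_simps del: of_nat_Suc\<close>)
  qed
  have summand: "((\<lambda>z. ?r j / of_nat (d - 2 * j) * (1 / z ^ (d - 2 * j))) has_field_derivative - (?r j * z ^ (2 * j) / z ^ (d + 1))) (at z)"
    if "j \<in> {..?N}" for j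
  proof -
    have "2 * j < d" using that dN by auto
    then obtain m where m: "d - 2 * j = Suc m" by (cases "d - 2 * j") auto
    then have dm: "d + 1 = (m + 2) + 2 * j" using dN that by auto
    have "((\<lambda>z. ?r j / of_nat (Suc m) * (1 / z ^ Suc m)) has_field_derivative ?r j / of_nat (Suc m) * (- (of_nat (Suc m) / z ^ (m + 2)))) (at z)"
      by (rule DERIV_cmult[OF inv])
    moreover have "?r j / of_nat (Suc m) * (- (of_nat (Suc m) / z ^ (m + 2))) = - (?r j * z ^ (2 * j) / z ^ (d + 1))"
      unfolding dm power_add[of z "m + 2"] using nz by (simp del: of_nat_Suc)
    ultimately show ?thesis unfolding m by simp
  qed
  have "(h_fun d p has_field_derivative of_nat (par d) / 2 * inverse z - (\<Sum>j\<le>?N. - (?r j * z ^ (2 * j) / z ^ (d + 1)))) (at z)"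
    unfolding h_fun_def[abs_def]
    by (intro DERIV_diff DERIV_cmult has_field_derivative_Ln z DERIV_sum summand)
  moreover have "of_nat (par d) / 2 * inverse z - (\<Sum>j\<le>?N. - (?r j * z ^ (2 * j) / z ^ (d + 1))) = Rp z / z ^ (d + 1)"
  proof (cases "par d = 0")
    case True
    then show ?thesis unfolding poly_R_poly_r_coeff[OF d_pos] by (simp add: sum_negf sum_divide_distrib)
  next
    case False
    then have e: "par d = 1" using par_cases[of d] by simp
    have r: "?r (?N + 1) = 1 / 2"
      unfolding r_coeff_def R_poly_def e by (auto simp: coeff_sum intro!: sum.neutral)
    have top: "z ^ (2 * (?N + 1)) / z ^ (d + 1) = inverse z"
      unfolding dN e using nz by (simp add: field_simps)
    have "Rp z = (\<Sum>j\<le>?N. ?r j * z ^ (2 * j)) + 1 / 2 * z ^ (2 * (?N + 1))"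
      unfolding poly_R_poly_r_coeff[OF d_pos] e r[symmetric] by simp
    then have "Rp z / z ^ (d + 1) = (\<Sum>j\<le>?N. ?r j * z ^ (2 * j) / z ^ (d + 1)) + 1 / 2 * (z ^ (2 * (?N + 1)) / z ^ (d + 1))"
      by (simp only: add_divide_distrib sum_divide_distrib times_divide_eq_right)
    then show ?thesis unfolding top e by (simp add: sum_negf)
  qed
  ultimately show ?thesis by simp
qed

lemma open_slit: "open (- \<real>\<^sub>\<le>\<^sub>0 :: complex set)"
  by (simp add: closed_nonpos_Reals_complex open_Compl)

lemma tilde_eq:
  "Phi1_tilde d \<tau> p = (\<lambda>z. exp (- 1 * h_fun d p z) * \<Phi>\<^sub>1 z)"
  "Phi2_tilde d \<tau> p = (\<lambda>z. exp (1 * h_fun d p z) * \<Phi>\<^sub>2 z)"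
  by (auto simp: Phi1_tilde_def Phi2_tilde_def)

lemma zero_notin_slit: "(0 :: complex) \<notin> - \<real>\<^sub>\<le>\<^sub>0" by simp

lemma tilde_deriv:
  assumes "z \<in> - \<real>\<^sub>\<le>\<^sub>0"
  shows "(Phi1_tilde d \<tau> p has_field_derivative exp (- 1 * h_fun d p z) * (deriv \<Phi>\<^sub>1 z + - 1 * (Rp z / z ^ (d + 1)) * \<Phi>\<^sub>1 z)) (at z)"
    and "(Phi2_tilde d \<tau> p has_field_derivative exp (1 * h_fun d p z) * (deriv \<Phi>\<^sub>2 z + 1 * (Rp z / z ^ (d + 1)) * \<Phi>\<^sub>2 z)) (at z)"
  unfolding tilde_eq
  by (rule gauge_transform_deriv[OF open_slit zero_notin_slit h_fun_derivative _ assms]; simp add: Phi1_holomorphic Phi2_holomorphic)+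

lemma tilde_holomorphic: "Phi1_tilde d \<tau> p holomorphic_on - \<real>\<^sub>\<le>\<^sub>0" "Phi2_tilde d \<tau> p holomorphic_on - \<real>\<^sub>\<le>\<^sub>0"
  unfolding tilde_eq
  by (rule gauge_transform_holomorphic[OF open_slit zero_notin_slit h_fun_derivative]; simp add: Phi1_holomorphic Phi2_holomorphic)+

lemma tilde_solves_ode:
  "solves_ode2_on (- \<real>\<^sub>\<le>\<^sub>0) (\<lambda>z. of_nat (d + 1) / z) (\<lambda>z. Kp z / z ^ (d + 1) - (Rp z)\<^sup>2 / z ^ (2 * d + 2)) (Phi1_tilde d \<tau> p)"
  "solves_ode2_on (- \<real>\<^sub>\<le>\<^sub>0) (\<lambda>z. of_nat (d + 1) / z) (\<lambda>z. Kp z / z ^ (d + 1) - (Rp z)\<^sup>2 / z ^ (2 * d + 2)) (Phi2_tilde d \<tau> p)"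
proof -
  have eq1: "z ^ (d + 1) * deriv (deriv \<Phi>\<^sub>1) z + (of_nat (d + 1) * z ^ d + 2 * (- 1) * Rp z) * deriv \<Phi>\<^sub>1 z
      + (Kp z + - 1 * R'p z) * \<Phi>\<^sub>1 z = 0" for z
    using ode1_eq_0[of z] unfolding ode1_def by simp
  show "solves_ode2_on (- \<real>\<^sub>\<le>\<^sub>0) (\<lambda>z. of_nat (d + 1) / z) (\<lambda>z. Kp z / z ^ (d + 1) - (Rp z)\<^sup>2 / z ^ (2 * d + 2)) (Phi1_tilde d \<tau> p)"
    unfolding tilde_eq
    by (rule gauge_transform_solves_ode[OF open_slit zero_notin_slit h_fun_derivative Phi1_holomorphic _ eq1]) simp_all
  have eq2: "z ^ (d + 1) * deriv (deriv \<Phi>\<^sub>2) z + (of_nat (d + 1) * z ^ d + 2 * 1 * Rp z) * deriv \<Phi>\<^sub>2 z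
      + (Kp z + 1 * R'p z) * \<Phi>\<^sub>2 z = 0" for z
    using ode2_eq_0[of z] unfolding ode2_def by simp
  show "solves_ode2_on (- \<real>\<^sub>\<le>\<^sub>0) (\<lambda>z. of_nat (d + 1) / z) (\<lambda>z. Kp z / z ^ (d + 1) - (Rp z)\<^sup>2 / z ^ (2 * d + 2)) (Phi2_tilde d \<tau> p)"
    unfolding tilde_eq
    by (rule gauge_transform_solves_ode[OF open_slit zero_notin_slit h_fun_derivative Phi2_holomorphic _ eq2]) simp_all
qed

text \<open>The exponential factors cancel, and what remains is \<open>wronskian_identity\<close> divided by \<open>z ^ (d + 1)\<close>.\<close>

lemma tilde_wronskian:
  assumes z: "z \<in> - \<real>\<^sub>\<le>\<^sub>0"
  shows "wronskian (Phi1_tilde d \<tau> p) (Phi2_tilde d \<tau> p) z = 2 * of_real a / z ^ (d + 1)"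
proof -
  have nz: "z ^ (d + 1) \<noteq> 0" using z by auto
  have ee: "exp (- h_fun d p z) * exp (h_fun d p z) = 1" by (simp add: exp_minus)
  define u where "u = Rp z / z ^ (d + 1)"
  have R: "Rp z = z ^ (d + 1) * u" using nz by (simp add: u_def)
  have gen: "A * f * (B * (g1 + 1 * v * g)) - A * (f1 + - 1 * v * f) * (B * g) = (A * B) * (f * g1 - f1 * g + 2 * v * f * g)"
    for A B f f1 g g1 v :: complex by (simp add: algebra_simps)
  have "wronskian (Phi1_tilde d \<tau> p) (Phi2_tilde d \<tau> p) z = \<Phi>\<^sub>1 z * deriv \<Phi>\<^sub>2 z - deriv \<Phi>\<^sub>1 z * \<Phi>\<^sub>2 z + 2 * u * \<Phi>\<^sub>1 z * \<Phi>\<^sub>2 z"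
    unfolding wronskian_def DERIV_imp_deriv[OF tilde_deriv(1)[OF z]] DERIV_imp_deriv[OF tilde_deriv(2)[OF z]]
    unfolding tilde_eq u_def[symmetric] gen using ee by simp
  moreover have "z ^ (d + 1) * (\<Phi>\<^sub>1 z * deriv \<Phi>\<^sub>2 z - deriv \<Phi>\<^sub>1 z * \<Phi>\<^sub>2 z + 2 * u * \<Phi>\<^sub>1 z * \<Phi>\<^sub>2 z) = 2 * of_real a"
    using wronskian_identity[of z] unfolding R by (simp add: algebra_simps)
  ultimately show ?thesis using nz by (simp add: eq_divide_eq mult.commute)
qed

lemma tilde_lin_indep: "lin_indep2_on (- \<real>\<^sub>\<le>\<^sub>0) (Phi1_tilde d \<tau> p) (Phi2_tilde d \<tau> p)"
proof (rule lin_indep2_on_wronskian[OF open_slit _ tilde_holomorphic])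
  show 1: "(1 :: complex) \<in> - \<real>\<^sub>\<le>\<^sub>0" by simp
  show "wronskian (Phi1_tilde d \<tau> p) (Phi2_tilde d \<tau> p) 1 \<noteq> 0"
    using tilde_wronskian[OF 1] a_nz by simp
qed

end

section \<open>The radial extremal function\<close>

lemma radial_extremal_integrable:
  assumes "radial_extremal TYPE('n::finite) \<phi>"
  shows "integrable lborel (\<lambda>x :: real ^ 'n. \<phi> (of_real (norm x)))"
proof -
  have hol: "\<phi> holomorphic_on UNIV" and pw: "(\<lambda>x :: real ^ 'n. \<phi> (of_real (norm x))) \<in> paley_wiener 1 1"
    using assms by (auto simp: radial_extremal_def)
  have "continuous_on UNIV (\<lambda>x :: real ^ 'n. \<phi> (of_real (norm x)))"
    by (rule continuous_on_compose2[OF holomorphic_on_imp_continuous_on[OF hol]]) (auto intro!: continuous_intros)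
  then have "(\<lambda>x :: real ^ 'n. \<phi> (of_real (norm x))) \<in> borel_measurable lborel"
    by (simp add: borel_measurable_continuous_onI)
  moreover have "integrable lborel (\<lambda>x :: real ^ 'n. norm (\<phi> (of_real (norm x))))"
    using pw unfolding paley_wiener_def by simp
  ultimately show ?thesis by (simp add: integrable_norm_iff)
qed

lemma radial_extremal_weighted_integrable:
  assumes ex: "radial_extremal TYPE('n::finite) \<phi>" and even: "\<And>z. \<phi> (- z) = \<phi> z"
  shows "integrable lborel (\<lambda>x. complex_of_real x ^ (CARD('n) - 1) * \<phi> (of_real x))"
proof -
  have hol: "\<phi> holomorphic_on UNIV" using ex by (simp add: radial_extremal_def)
  have cont: "continuous_on UNIV (\<lambda>x. \<phi> (complex_of_real x))"
    by (rule continuous_on_compose2[OF holomorphic_on_imp_continuous_on[OF hol]]) (auto intro!: continuous_intros)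
  have meas: "(\<lambda>x. \<phi> (complex_of_real x)) \<in> borel_measurable borel"
    using cont by (rule borel_measurable_continuous_onI)
  have "set_integrable lborel {0..} (\<lambda>r. r ^ (CARD('n) - 1) *\<^sub>R \<phi> (of_real r))"
    using integrable_radial[OF meas radial_extremal_integrable[OF ex]] by simp
  then have "set_integrable lborel {0..} (\<lambda>r. \<bar>r\<bar> ^ (CARD('n) - 1) *\<^sub>R \<phi> (of_real r))"
    by (rule set_integrable_cong[THEN iffD1, rotated -1]) auto
  then have int: "integrable lborel (\<lambda>r. \<bar>r\<bar> ^ (CARD('n) - 1) *\<^sub>R \<phi> (of_real r))"
    by (rule integrable_even) (simp add: even)
  show ?thesis
    by (rule Bochner_Integration.integrable_bound[OF int])
       (use meas in \<open>auto simp: norm_mult norm_power\<close>)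
qed

text \<open>The extremal function is continuous with value \<open>1\<close> at the origin, so its \<open>L\<^sup>1\<close> norm, the reciprocal of the
constant, is not \<open>0\<close>.\<close>

lemma nikolskii_const_nonzero:
  assumes ex: "radial_extremal TYPE('n::finite) \<phi>"
  shows "nikolskii_const TYPE('n) \<noteq> 0"
proof
  let ?f = "\<lambda>x :: real ^ 'n. \<phi> (of_real (norm x))"
  assume "nikolskii_const TYPE('n) = 0"
  then have int0: "(LINT x|lborel. norm (?f x)) = 0" using ex by (simp add: radial_extremal_def)
  have hol: "\<phi> holomorphic_on UNIV" and phi0: "\<phi> 0 = 1" using ex by (auto simp: radial_extremal_def)
  have cont: "continuous_on UNIV ?f"
    by (rule continuous_on_compose2[OF holomorphic_on_imp_continuous_on[OF hol]]) (auto intro!: continuous_intros)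
  have op: "open {x. ?f x \<noteq> 0}" using cont by (rule open_Collect_neq) (intro continuous_intros)
  have "AE x in lborel. norm (?f x) = 0"
    using int0 integrable_norm[OF radial_extremal_integrable[OF ex]] by (subst (asm) integral_nonneg_eq_0_iff_AE) auto
  then have "{x. ?f x \<noteq> 0} \<in> null_sets lborel"
    by (subst AE_iff_null_sets) (use op in auto)
  then have "negligible {x. ?f x \<noteq> 0}"
    unfolding negligible_iff_null_sets by (rule null_sets_completionI)
  moreover have "{x. ?f x \<noteq> 0} \<noteq> {}" using phi0 by (auto intro!: exI[of _ 0])
  ultimately show False using open_not_negligible[OF op] by blast
qed

lemma ball_vol_pos: "ball_vol TYPE('n::finite) > 0"
  unfolding ball_vol_def by (rule content_ball_pos) simp

theorem theorem1:
  fixes d :: nat and \<phi> :: "complex \<Rightarrow> complex" and \<tau> p :: "nat \<Rightarrow> real"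
  assumes dim: "d = CARD('n::finite)"
    and extremal: "radial_extremal TYPE('n) \<phi>"
    and even: "\<And>z. \<phi> (- z) = \<phi> z"
    and exp_type: "exact_exp_type 1 \<phi>"
    and bounded: "\<And>x :: real. norm (\<phi> (of_real x)) \<le> 1"
    and zeros_mono: "strict_mono_on {1..} \<tau>"
    and zeros: "\<tau> ` {1..} = {x :: real. 0 < x \<and> \<phi> (of_real x) = 0}"
    and zeros_asymp: "\<tau> \<sim>[sequentially] (\<lambda>k. pi * real k)"
    and product: "\<And>z. (\<lambda>k. 1 - z\<^sup>2 / of_real (\<tau> (Suc k)) ^ 2) has_prod \<phi> z"
    and extremality: "extremality_condition TYPE('n) \<phi>"
    and coeffs: "signature_coeffs TYPE('n) \<phi> p"
  defines "a \<equiv> complex_of_real (a_const TYPE('n))"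
    and "\<Phi>\<^sub>1 \<equiv> Phi1 d \<tau>" and "\<Phi>\<^sub>2 \<equiv> Phi2 d \<tau>"
    and "\<Psi>\<^sub>1 \<equiv> Phi1_tilde d \<tau> p" and "\<Psi>\<^sub>2 \<equiv> Phi2_tilde d \<tau> p"
    and "R \<equiv> poly (R_poly d p)" and "R' \<equiv> poly (pderiv (R_poly d p))"
    and "K \<equiv> poly (K_poly d \<tau> p)"
  shows
    "\<Phi>\<^sub>1 holomorphic_on UNIV \<and> \<Phi>\<^sub>2 holomorphic_on UNIV \<and>
     (\<forall>z. z ^ (d + 1) * (deriv \<Phi>\<^sub>1 z * \<Phi>\<^sub>2 z - \<Phi>\<^sub>1 z * deriv \<Phi>\<^sub>2 z)
            - 2 * R z * \<Phi>\<^sub>1 z * \<Phi>\<^sub>2 z = - 2 * a) \<and>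
     (\<forall>y \<in> {\<Psi>\<^sub>1, \<Psi>\<^sub>2}. solves_ode2_on (- \<real>\<^sub>\<le>\<^sub>0) (\<lambda>z. of_nat (d + 1) / z)
        (\<lambda>z. K z / z ^ (d + 1) - (R z)\<^sup>2 / z ^ (2 * d + 2)) y) \<and>
     lin_indep2_on (- \<real>\<^sub>\<le>\<^sub>0) \<Psi>\<^sub>1 \<Psi>\<^sub>2 \<and>
     (\<forall>z \<in> - \<real>\<^sub>\<le>\<^sub>0. wronskian \<Psi>\<^sub>1 \<Psi>\<^sub>2 z = 2 * a / z ^ (d + 1)) \<and>
     (\<forall>z. z ^ (d + 1) * deriv (deriv \<Phi>\<^sub>1) z
            + (of_nat (d + 1) * z ^ d - 2 * R z) * deriv \<Phi>\<^sub>1 z + (K z - R' z) * \<Phi>\<^sub>1 z = 0) \<and>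
     (\<forall>z. z ^ (d + 1) * deriv (deriv \<Phi>\<^sub>2) z
            + (of_nat (d + 1) * z ^ d + 2 * R z) * deriv \<Phi>\<^sub>2 z + (K z + R' z) * \<Phi>\<^sub>2 z = 0)"
proof -
  obtain \<rho> :: "nat \<Rightarrow> real \<Rightarrow> real" where \<rho>:
    "\<And>k t. (\<rho> k has_real_derivative \<rho> (Suc k) t) (at t)"
    "\<And>k t. \<bar>t\<bar> \<ge> 1 / 2 \<Longrightarrow> \<rho> k t = 0"
    "\<And>t. \<rho> 0 (- t) = \<rho> 0 t" "\<And>t. \<rho> 0 t \<ge> 0"
    "integral\<^sup>L lborel (\<rho> 0) = 1"
    using bump_exists by blast
  have v: "ball_vol TYPE('n) \<noteq> 0" using ball_vol_pos[where 'n = 'n] by simp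
  have C: "nikolskii_const TYPE('n) \<noteq> 0" by (rule nikolskii_const_nonzero[OF extremal])
  (* Both sides are d v C / 2, with v the volume of the unit ball and C the Nikolskii constant. *)
  have const: "nikolskii_const TYPE('n) * sphere_area TYPE('n) / 2 = real d / (4 * a_const TYPE('n))"
    unfolding a_const_def sphere_area_def dim using v C by (simp add: field_simps)
  interpret sp: signature_polynomial \<phi> \<tau> d "a_const TYPE('n)" \<rho> p
  proof unfold_locales
    show "d \<ge> 1" unfolding dim using zero_less_card_finite[where 'a = 'n] by linarith
    show "\<phi> 0 = 1" using extremal by (simp add: radial_extremal_def)
    show "exp_type_at_most 1 \<phi>" using exp_type by (simp add: exact_exp_type_def)
    show "integrable lborel (\<lambda>x. of_real x ^ (d - 1) * \<phi> (of_real x))"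
      unfolding dim by (rule radial_extremal_weighted_integrable[OF extremal even])
    show "a_const TYPE('n) \<noteq> 0" unfolding a_const_def using v C by simp
    show "g 0 = of_real (real d / (4 * a_const TYPE('n))) *
        (LINT x :: real|lborel. of_real (signature \<phi> x) * g (of_real x) * of_real (\<bar>x\<bar> ^ (d - 1)))"
      if "g holomorphic_on UNIV" "\<And>z. g (- z) = g z" "exp_type_at_most 1 g"
        "integrable lborel (\<lambda>x :: real. of_real (\<bar>x\<bar> ^ (d - 1)) * g (of_real x))" for g
      using extremality that unfolding extremality_condition_def const dim by blast
    show "p (half_deg d) = (-1) ^ half_deg d * (2 / 2 ^ par d) * (4 * a_const TYPE('n) / fact d)"
      using coeffs unfolding signature_coeffs_def Let_def dim by blast
    show "2 / 2 ^ par d * \<i> ^ par d * fourier_distr (\<lambda>x. of_real (signature_tilde d \<phi> x)) \<psi>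
        = (LINT t|lborel. of_real (P_fun d p t) * \<psi> t)" if "test_function_on {-1<..<1} \<psi>" for \<psi>
      using coeffs that unfolding signature_coeffs_def Let_def dim distr_eq_on_def by blast
  qed (fact even zeros_mono zeros zeros_asymp product \<rho>)+
  show ?thesis
    unfolding a_def \<Phi>\<^sub>1_def \<Phi>\<^sub>2_def \<Psi>\<^sub>1_def \<Psi>\<^sub>2_def R_def R'_def K_def
    using sp.Phi1_holomorphic sp.Phi2_holomorphic sp.wronskian_identity sp.tilde_solves_ode
      sp.tilde_lin_indep sp.tilde_wronskian sp.ode1_eq_0 sp.ode2_eq_0
    unfolding sp.ode1_def sp.ode2_def by blast
qed

end
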